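(* Let $\mathcal{S}$ be a polytopal cut and project scheme (possibly with a polytopal labelling partition of its window), with associated cut and project set $\Lambda$. The following are equivalent: (1) $\Lambda$ is linearly repetitive (LR); (2) $\Lambda$ has positivity of weights (PW); (3) property C holds and, for each pair of flags $f,f'\in\mathscr{F}$ and each $i=1,\dots,\ell$, the group $\Gamma_i[f,f']_<$ is Diophantine in $X_i$ with respect to the singleton $\{v(f')_i-v(f)_i\}$. Here the $X_i$, $\Gamma_i[f,f']$ and $X_i$-components $v(f)_i$ are taken relative to a fixed CSR decomposition (see context).
   Context: SCHEMES. A ($k$-to-$d$) polytopal cut and project scheme $\mathcal{S}$ consists of a $k$-dimensional real vector space $\mathbb{E}$ (total space), complementary subspaces $\mathbb{E}_\vee$ (physical space, dimension $d\ge 1$) and $\mathbb{E}_<$ (internal space, dimension $n=k-d\ge 1$) with $\mathbb{E}=\mathbb{E}_\vee\oplus\mathbb{E}_<$, a lattice $\Gamma<\mathbb{E}$ and a (non-empty) polytopal window $W\subset\mathbb{E}_<$. The projections to $\mathbb{E}_\vee,\mathbb{E}_<$ are written $x\mapsto x_\vee$, $x\mapsto x_<$ (also for subsets). A set $W$ is polytopal if it is compact, the closure of its interior, and $\partial W$ is contained in the union of a finite set $\mathscr{H}$ of properly supporting hyperplanes (affine, codimension 1); $H$ is properly supporting if there are $w_H\in H$, an open neighbourhood $U_H$ of $w_H$ and a closed half-space $H^+$ of $H$ with $W\cap U_H=H^+\cap U_H$. (Equivalently $W$ is a finite union of convex polytopes with non-empty interior; $\mathscr H$ is then exactly the set of properly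 supporting hyperplanes.) The window may carry a labelling $W=\bigcup_i W_i$ with each $W_i$ polytopal and distinct $W_i$ meeting at most on their boundaries; then $\mathscr{H}$ denotes the union of the sets of supporting hyperplanes of the $W_i$. For $H\in\mathscr H$, $V(H)=H-H$; $\mathscr{H}_0=\{V(H): H\in\mathscr{H}\}$. Standing assumptions: both projections are injective on $\Gamma$; $\Gamma_<$ is dense in $\mathbb{E}_<$; the scheme is non-singular, i.e. $\gamma_<\notin\partial W$ (resp. $\notin\partial W_i$ for all $i$) for all $\gamma\in\Gamma$. For $x=\gamma_\vee\in\Gamma_\vee$ put $x^\star=\gamma_<$. The cut and project set is $\Lambda=\{x\in\Gamma_\vee: x^\star\in W\}$, where $x$ has label $i$ if $x^\star\in W_i$ in the labelled case. PATCHES. Fix norms on $\mathbb{E}_\vee,\mathbb{E}_<$. For $x\in\Lambda$ the $r$-patch $P_r(x)$ is $\Lambda\cap B_r(x)$ (closed ball, with labels) with marked centre $x$; $r$-patches are identified if they agree up to a translation taking centre to centre. $p(r)$ is the number of $r$-patches. Property C: there is $C>0$ with $p(r)\le Cr^d$ for all sufficiently large $r$. LR: there is $C>0$ such that for all sufficiently large $r$, every $Cr$-patch of $\Lambda$ contains every $r$-patch (up to translation). PW: there is $c>0$ such that for all sufficiently large $r$ every $r$-patch $P$ has frequency at least $cr^{-d}$, where the frequency is $\lim_{R\to\infty}\#\{x\in\Lambda\cap B_R: P_r(x)=P\}/\#(\Lambda\cap B_R)$. FLAGS. A flag in $\mathscr{H}$ is a set $f\subseteq\mathscr{H}$ of exactly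 $n$ hyperplanes intersecting in a single point, denoted $v(f)$; $\mathscr{F}$ is the set of flags in $\mathscr H$. Put $\mathrm{Ver}(f)=\{v\in\mathbb{E}_<: \{v\}=\bigcap_{H\in f}(H+(\gamma_H)_<)\text{ for some }\gamma_H\in\Gamma\}$. Then $\mathrm{Ver}(f)-v(f)=\bigcap_{H\in f}(V(H)+\Gamma_<)$ is a group containing $\Gamma_<$, and when C holds it is contained in $\frac1N\Gamma_<$ for some $N\in\mathbb{N}$; then $\Gamma[f]$ denotes the subgroup of $\frac1N\Gamma$ with $\Gamma[f]_<=\mathrm{Ver}(f)-v(f)$ (unique, by injectivity of $x\mapsto x_<$ on $\frac1N\Gamma$). For $f,f'\in\mathscr{F}$, $\Gamma[f,f']=\Gamma[f]-\Gamma[f']$, a group containing $\Gamma$ with finite index. STABILISERS AND DECOMPOSITIONS. For $V\in\mathscr{H}_0$, $\Gamma^V=\{\gamma\in\Gamma:\gamma_<\in V\}$; for $S\subseteq\mathscr{H}_0$, $\Gamma^S=\bigcap_{V\in S}\Gamma^V$ and $X_S=\bigcap_{V\in S}V$ (with $\Gamma^\emptyset=\Gamma$, $X_\emptyset=\mathbb{E}_<$). A decomposition is a collection $Q=\{S_1,\dots,S_\ell\}$ of strict subsets of $\mathscr{H}_0$ such that each $V\in\mathscr{H}_0$ fails to lie in exactly one $S_i$, and $\mathbb{E}_<=X_1+\cdots+X_\ell$ with $X_i=X_{S_i}$ (the sum is then direct). Put $\Gamma_i=\Gamma^{S_i}$, $k_i=\mathrm{rk}(\Gamma_i)$, $n_i=\dim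 X_i$, $d_i=k_i-n_i$, $\delta_i=d_i/n_i$. Call $Q$ a CSR decomposition if $\Gamma_1+\cdots+\Gamma_\ell$ has finite index in $\Gamma$ and, for all $i$ and all $V\in\mathscr{H}_0\setminus S_i$, $\mathrm{rk}(\Gamma^V\cap\Gamma_i)=k_i-\delta_i-1$. If C holds then a CSR decomposition exists. Given C and such a decomposition, $\Gamma_i[f,f']=\{\gamma\in\Gamma[f,f']:\gamma_<\in X_i\}$, and $v_i$ denotes the $X_i$-component of $v\in\mathbb{E}_<=X_1\oplus\cdots\oplus X_\ell$. DIOPHANTINE. Let $G\cong\mathbb{Z}^{k}$ be a subgroup of an $n$-dimensional real vector space $X$ with norm $\|\cdot\|$, let $\eta(g)=\max_i|g_i|$ be the norm on $G$ from an isomorphism $G\cong\mathbb{Z}^k$, and let $A\subset X$ be finite and non-empty. $G$ is Diophantine in $X$ with respect to $A$ if there is $c>0$ with $\|g-a\|\ge c\,\eta(g)^{-\delta}$ for all $a\in A$ and all $0\neq g\in G$ with $g\ne a$, where $\delta=(k-n)/n$. (Independent of the choices of norms.) Here it is applied to the rank $k_i$ group $\Gamma_i[f,f']_<$ in the $n_i$-dimensional space $X_i$. *)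

theory Defs
  imports "HOL-Analysis.Analysis"
begin

section \<open>Subgroups of a real vector space as integer modules\<close>

text \<open>
  Subgroups, generated subgroups and linear independence over the integers are the notions of
  the library's locale for modules, over the ring of integers.
\<close>

global_interpretation zmod: module "\<lambda>(m::int) (x::'a::real_vector). of_int m *\<^sub>R x"
  defines zsubgroup = zmod.subspace
    and zspan = zmod.span
    and zdependent = zmod.dependent
    and zrepresentation = zmod.representation
  by unfold_locales (simp_all add: algebra_simps)

definition zbasis :: "'a::real_vector set \<Rightarrow> 'a set \<Rightarrow> bool" where
  "zbasis B G \<longleftrightarrow> finite B \<and> \<not> zdependent B \<and> zspan B = G"

text \<open>The rank of a free abelian group of finite rank (unspecified for other groups).\<close>

definition zrank :: "'a::real_vector set \<Rightarrow> nat" where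
  "zrank G = (THE k. \<exists>B. zbasis B G \<and> card B = k)"

definition is_lattice :: "'a::euclidean_space set \<Rightarrow> bool" where
  "is_lattice G \<longleftrightarrow> (\<exists>B. independent B \<and> span B = UNIV \<and> zspan B = G)"

definition finite_index :: "'a::real_vector set \<Rightarrow> 'a set \<Rightarrow> bool" where
  "finite_index G' G \<longleftrightarrow> G' \<subseteq> G \<and> finite ((\<lambda>g. g +o G') ` G)"

definition differences :: "'a::ab_group_add set \<Rightarrow> 'a set \<Rightarrow> 'a set" where
  "differences A B = {a - b | a b. a \<in> A \<and> b \<in> B}"

section \<open>Norms, projections, Diophantine groups\<close>

text \<open>
  The ambient Euclidean structure only serves to provide the topology of a finite-dimensional
  space and to write linear functionals as inner products; the norms that measure patches and
  Diophantine approximation are arbitrary.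
\<close>

definition norm_on :: "'a::real_vector set \<Rightarrow> ('a \<Rightarrow> real) \<Rightarrow> bool" where
  "norm_on X N \<longleftrightarrow>
     (\<forall>x\<in>X. 0 \<le> N x \<and> (N x = 0 \<longleftrightarrow> x = 0)) \<and>
     (\<forall>x\<in>X. \<forall>a. N (a *\<^sub>R x) = \<bar>a\<bar> * N x) \<and>
     (\<forall>x\<in>X. \<forall>y\<in>X. N (x + y) \<le> N x + N y)"

text \<open>The projection onto \<open>A\<close> along \<open>B\<close>, meant for points of a direct sum of \<open>A\<close> and \<open>B\<close>.\<close>

definition proj :: "'a::ab_group_add set \<Rightarrow> 'a set \<Rightarrow> 'a \<Rightarrow> 'a" where
  "proj A B x = (THE u. u \<in> A \<and> x - u \<in> B)"

definition eta :: "'a::real_vector set \<Rightarrow> 'a \<Rightarrow> int" where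
  "eta B g = Max ((\<lambda>b. \<bar>zrepresentation B g b\<bar>) ` B)"

definition diophantine ::
    "('a::euclidean_space \<Rightarrow> real) \<Rightarrow> 'a set \<Rightarrow> 'a set \<Rightarrow> 'a set \<Rightarrow> bool" where
  "diophantine N X G A \<longleftrightarrow>
     (\<exists>B. zbasis B G \<and>
       (\<exists>c>0. \<forall>a\<in>A. \<forall>g\<in>G. g \<noteq> 0 \<and> g \<noteq> a \<longrightarrow>
          N (g - a) \<ge> c * real_of_int (eta B g) powr
            (- ((real (card B) - real (dim X)) / real (dim X)))))"

section \<open>Polytopal cut and project schemes\<close>

text \<open>
  The window is the union of the pieces \<open>piece S i\<close> for \<open>i \<in> labels S\<close>.
  The unlabelled case is the one in which \<open>labels S\<close> is a singleton.
\<close>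

record ('e, 'l) cp_scheme =
  physical :: "'e set"
  internal :: "'e set"
  lattice :: "'e set"
  labels :: "'l set"
  piece :: "'l \<Rightarrow> 'e set"

definition properly_supporting :: "'a::euclidean_space set \<Rightarrow> 'a set \<Rightarrow> 'a set \<Rightarrow> bool" where
  "properly_supporting E W H \<longleftrightarrow>
     (\<exists>a b. a \<in> E \<and> a \<noteq> 0 \<and> H = {x \<in> E. a \<bullet> x = b} \<and>
       (\<exists>w\<in>H. \<exists>U. openin (top_of_set E) U \<and> w \<in> U \<and>
          W \<inter> U = {x \<in> E. a \<bullet> x \<le> b} \<inter> U))"

definition polytopal :: "'a::euclidean_space set \<Rightarrow> 'a set \<Rightarrow> bool" where
  "polytopal E W \<longleftrightarrow>
     W \<subseteq> E \<and> compact W \<and> W = closure (top_of_set E interior_of W) \<and>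
     (\<exists>\<H>. finite \<H> \<and> (\<forall>H\<in>\<H>. properly_supporting E W H) \<and>
       top_of_set E frontier_of W \<subseteq> \<Union>\<H>)"

definition window :: "('e::euclidean_space, 'l) cp_scheme \<Rightarrow> 'e set" where
  "window S = (\<Union>i\<in>labels S. piece S i)"

definition to_phys :: "('e::euclidean_space, 'l) cp_scheme \<Rightarrow> 'e \<Rightarrow> 'e" where
  "to_phys S = proj (physical S) (internal S)"

definition to_int :: "('e::euclidean_space, 'l) cp_scheme \<Rightarrow> 'e \<Rightarrow> 'e" where
  "to_int S = proj (internal S) (physical S)"

definition polytopal_scheme :: "('e::euclidean_space, 'l) cp_scheme \<Rightarrow> bool" where
  "polytopal_scheme S \<longleftrightarrow>
     subspace (physical S) \<and> subspace (internal S) \<and>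
     physical S \<inter> internal S = {0} \<and> physical S + internal S = UNIV \<and>
     1 \<le> dim (physical S) \<and> 1 \<le> dim (internal S) \<and>
     is_lattice (lattice S) \<and>
     finite (labels S) \<and>
     window S \<noteq> {} \<and> polytopal (internal S) (window S) \<and>
     (\<forall>i\<in>labels S. polytopal (internal S) (piece S i)) \<and>
     (\<forall>i\<in>labels S. \<forall>j\<in>labels S. i \<noteq> j \<longrightarrow>
        piece S i \<inter> piece S j \<subseteq>
          (top_of_set (internal S) frontier_of piece S i) \<inter>
          (top_of_set (internal S) frontier_of piece S j)) \<and>
     inj_on (to_phys S) (lattice S) \<and> inj_on (to_int S) (lattice S) \<and>
     closure (to_int S ` lattice S) = internal S \<and>
     (\<forall>\<gamma>\<in>lattice S. \<forall>i\<in>labels S.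
        to_int S \<gamma> \<notin> top_of_set (internal S) frontier_of piece S i)"

section \<open>Patches of the cut and project set\<close>

definition star :: "('e::euclidean_space, 'l) cp_scheme \<Rightarrow> 'e \<Rightarrow> 'e" where
  "star S x = to_int S (the_inv_into (lattice S) (to_phys S) x)"

definition cps :: "('e::euclidean_space, 'l) cp_scheme \<Rightarrow> 'e set" where
  "cps S = {x \<in> to_phys S ` lattice S. star S x \<in> window S}"

definition cps_ball ::
    "('e::euclidean_space, 'l) cp_scheme \<Rightarrow> ('e \<Rightarrow> real) \<Rightarrow> real \<Rightarrow> 'e \<Rightarrow> 'e set" where
  "cps_ball S N r x = {y \<in> cps S. N (y - x) \<le> r}"

text \<open>
  The labelled \<open>r\<close>-patch at \<open>x\<close>, translated so that its centre is the origin: two patches agree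
  up to a translation taking centre to centre iff these sets are equal.
\<close>

definition patch :: "('e::euclidean_space, 'l) cp_scheme \<Rightarrow> ('e \<Rightarrow> real) \<Rightarrow> real \<Rightarrow> 'e \<Rightarrow>
    ('e \<times> 'l) set" where
  "patch S N r x =
     {(y - x, i) | y i. y \<in> cps_ball S N r x \<and> i \<in> labels S \<and> star S y \<in> piece S i}"

definition complexity :: "('e::euclidean_space, 'l) cp_scheme \<Rightarrow> ('e \<Rightarrow> real) \<Rightarrow> real \<Rightarrow> nat" where
  "complexity S N r = card (patch S N r ` cps S)"

definition property_C :: "('e::euclidean_space, 'l) cp_scheme \<Rightarrow> ('e \<Rightarrow> real) \<Rightarrow> bool" where
  "property_C S N \<longleftrightarrow>
     (\<exists>C>0. \<forall>\<^sub>F r in at_top. real (complexity S N r) \<le> C * r ^ dim (physical S))"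

text \<open>Here \<open>x\<close> is the centre of the \<open>C r\<close>-patch and \<open>y\<close> that of the \<open>r\<close>-patch; the latter
  occurs inside the former at \<open>z\<close>.\<close>

definition linearly_repetitive ::
    "('e::euclidean_space, 'l) cp_scheme \<Rightarrow> ('e \<Rightarrow> real) \<Rightarrow> bool" where
  "linearly_repetitive S N \<longleftrightarrow>
     (\<exists>C>0. \<forall>\<^sub>F r in at_top. \<forall>x\<in>cps S. \<forall>y\<in>cps S.
        \<exists>z\<in>cps S. patch S N r z = patch S N r y \<and> cps_ball S N r z \<subseteq> cps_ball S N (C * r) x)"

definition has_frequency :: "('e::euclidean_space, 'l) cp_scheme \<Rightarrow> ('e \<Rightarrow> real) \<Rightarrow> real \<Rightarrow>
    ('e \<times> 'l) set \<Rightarrow> real \<Rightarrow> bool" where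
  "has_frequency S N r P \<nu> \<longleftrightarrow>
     ((\<lambda>R. real (card {x \<in> cps_ball S N R 0. patch S N r x = P}) /
           real (card (cps_ball S N R 0))) \<longlongrightarrow> \<nu>) at_top"

definition positivity_of_weights ::
    "('e::euclidean_space, 'l) cp_scheme \<Rightarrow> ('e \<Rightarrow> real) \<Rightarrow> bool" where
  "positivity_of_weights S N \<longleftrightarrow>
     (\<exists>c>0. \<forall>\<^sub>F r in at_top. \<forall>P \<in> patch S N r ` cps S.
        \<exists>\<nu>. has_frequency S N r P \<nu> \<and> c / r ^ dim (physical S) \<le> \<nu>)"

section \<open>Flags\<close>

definition hyperplanes :: "('e::euclidean_space, 'l) cp_scheme \<Rightarrow> 'e set set" where
  "hyperplanes S = (\<Union>i\<in>labels S. {H. properly_supporting (internal S) (piece S i) H})"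

definition flags :: "('e::euclidean_space, 'l) cp_scheme \<Rightarrow> 'e set set set" where
  "flags S = {f. f \<subseteq> hyperplanes S \<and> card f = dim (internal S) \<and> (\<exists>v. \<Inter>f = {v})}"

definition flag_vertex :: "'e::euclidean_space set set \<Rightarrow> 'e" where
  "flag_vertex f = (THE v. \<Inter>f = {v})"

definition Ver :: "('e::euclidean_space, 'l) cp_scheme \<Rightarrow> 'e set set \<Rightarrow> 'e set" where
  "Ver S f = {v \<in> internal S.
     \<exists>\<gamma>. (\<forall>H\<in>f. \<gamma> H \<in> lattice S) \<and> {v} = (\<Inter>H\<in>f. to_int S (\<gamma> H) +o H)}"

text \<open>The subgroup of \<open>(1/N) \<Gamma>\<close>, for some \<open>N \<ge> 1\<close>, projecting to \<open>Ver S f\<close> minus the vertex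
  of \<open>f\<close>. It does not depend on \<open>N\<close>; such an \<open>N\<close> exists when \<open>property_C\<close> holds.\<close>

definition flag_group :: "('e::euclidean_space, 'l) cp_scheme \<Rightarrow> 'e set set \<Rightarrow> 'e set" where
  "flag_group S f = (THE G. zsubgroup G \<and>
     (\<exists>N::nat. 1 \<le> N \<and> G \<subseteq> (\<lambda>\<gamma>. (1 / real N) *\<^sub>R \<gamma>) ` lattice S) \<and>
     to_int S ` G = (\<lambda>v. v - flag_vertex f) ` Ver S f)"

definition flag_group2 ::
    "('e::euclidean_space, 'l) cp_scheme \<Rightarrow> 'e set set \<Rightarrow> 'e set set \<Rightarrow> 'e set" where
  "flag_group2 S f f' = differences (flag_group S f) (flag_group S f')"

section \<open>Stabilisers and decompositions\<close>

definition hyperplanes0 :: "('e::euclidean_space, 'l) cp_scheme \<Rightarrow> 'e set set" where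
  "hyperplanes0 S = (\<lambda>H. differences H H) ` hyperplanes S"

definition stabiliser :: "('e::euclidean_space, 'l) cp_scheme \<Rightarrow> 'e set set \<Rightarrow> 'e set" where
  "stabiliser S T = {\<gamma> \<in> lattice S. \<forall>V\<in>T. to_int S \<gamma> \<in> V}"

definition X_space :: "('e::euclidean_space, 'l) cp_scheme \<Rightarrow> 'e set set \<Rightarrow> 'e set" where
  "X_space S T = {x \<in> internal S. \<forall>V\<in>T. x \<in> V}"

text \<open>The members of \<open>Q\<close> are automatically distinct as an indexed family, so that a
  decomposition is indexed by itself. Sums of sets are Minkowski sums.\<close>

definition decomposition :: "('e::euclidean_space, 'l) cp_scheme \<Rightarrow> 'e set set set \<Rightarrow> bool" where
  "decomposition S Q \<longleftrightarrow>
     (\<forall>T\<in>Q. T \<subset> hyperplanes0 S) \<and>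
     (\<forall>V\<in>hyperplanes0 S. \<exists>!T. T \<in> Q \<and> V \<notin> T) \<and>
     internal S = (\<Sum>T\<in>Q. X_space S T)"

definition delta :: "('e::euclidean_space, 'l) cp_scheme \<Rightarrow> 'e set set \<Rightarrow> real" where
  "delta S T = (real (zrank (stabiliser S T)) - real (dim (X_space S T))) / real (dim (X_space S T))"

definition CSR_decomposition ::
    "('e::euclidean_space, 'l) cp_scheme \<Rightarrow> 'e set set set \<Rightarrow> bool" where
  "CSR_decomposition S Q \<longleftrightarrow>
     decomposition S Q \<and>
     finite_index (\<Sum>T\<in>Q. stabiliser S T) (lattice S) \<and>
     (\<forall>T\<in>Q. \<forall>V\<in>hyperplanes0 S - T.
        real (zrank (stabiliser S {V} \<inter> stabiliser S T)) =
          real (zrank (stabiliser S T)) - delta S T - 1)"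

definition component ::
    "('e::euclidean_space, 'l) cp_scheme \<Rightarrow> 'e set set set \<Rightarrow> 'e set set \<Rightarrow> 'e \<Rightarrow> 'e" where
  "component S Q T = proj (X_space S T) (\<Sum>T'\<in>Q - {T}. X_space S T')"

definition flag_group2_in :: "('e::euclidean_space, 'l) cp_scheme \<Rightarrow> 'e set set \<Rightarrow>
    'e set set \<Rightarrow> 'e set set \<Rightarrow> 'e set" where
  "flag_group2_in S T f f' = {\<gamma> \<in> flag_group2 S f f'. to_int S \<gamma> \<in> X_space S T}"

definition flags_diophantine :: "('e::euclidean_space, 'l) cp_scheme \<Rightarrow> ('e \<Rightarrow> real) \<Rightarrow>
    'e set set set \<Rightarrow> bool" where
  "flags_diophantine S N Q \<longleftrightarrow>
     (\<forall>f\<in>flags S. \<forall>f'\<in>flags S. \<forall>T\<in>Q.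
        diophantine N (X_space S T) (to_int S ` flag_group2_in S T f f')
          {component S Q T (flag_vertex f') - component S Q T (flag_vertex f)})"

end

theory Submission
  imports Defs
begin

text \<open>
 Patches of radius \<open>r\<close> correspond to the cells cut out of the window by the translates of the
 supporting hyperplanes by lattice vectors of norm about \<open>r\<close>. Counting those cells near an interior
 point shows that at most \<open>C r\<^sup>d\<close> patches forces the rank condition: for each flag the
 coranks of the stabilisers of its hyperplanes add up to the rank of the lattice. Then the lattice splits, up to
 finite index, along the axes of each flag. Under the rank condition, positivity of weights says that a
 flag vertex is either on a wall or at distance at least \<open>c / r ^ \<delta>\<close> from it (a closer wall cuts off a
 simplex of too small frequency). Conversely such gaps make every cell contain a box whose sides match the
 covering radii of the axis groups, obtained by greedy expansion at dyadic scales, whence linear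
 repetitivity. A CSR decomposition yields the rank condition with \<open>\<delta>\<close> the exponent of its parts, and the difference
 of two flag vertices, projected to a part, lies in the coset whose distance to \<open>0\<close> the Diophantine
 condition bounds.
\<close>

section \<open>Linear algebra, packing and norms\<close>

text \<open>Everything hinges on one exponent per wall, \<open>dlt h\<close>, the corank of its
  stabiliser minus one. Under the rank condition the lattice has rank \<open>dlt h + 1\<close> on
  the axis of \<open>h\<close> in a flag and is mapped to a line, so Dirichlet's principle yields
  heights as small as \<open>1 / r ^ dlt h\<close>; over a flag the exponents add up to
  \<open>d\<close>, so a box with such sides has the order \<open>1 / r ^ d\<close> demanded of
  frequencies. Walls that can be exchanged in a flag have equal exponents. The obstacle is that a
  patch sees a wall only near its supporting point, where it bounds a piece of the window, whereas
  cells are cut by whole hyperplanes. The rank condition removes it: the other axes of a flag carry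
  a point to the supporting point at a cost linear in \<open>r\<close> and leave its height over the
  wall unchanged. No measure on the internal space is used; its role is played by the number of
  lattice points over a set with physical norm at most \<open>R\<close>, so that the existence of
  frequencies has to be proved by comparing cubes.\<close>

lemma orthonormal_frame:
 fixes K :: "'a::euclidean_space set"
 assumes "subspace K"
 obtains B1 B2 where "finite B1" "finite B2" "B1 \<subseteq> K" "card B1 = dim K"
  "\<And>x. x \<in> K ==> (\<Sum>b\<in>B1. (x \<bullet> b) *\<^sub>R b) = x"
  "\<And>x. (\<Sum>b\<in>B1 \<union> B2. (x \<bullet> b) *\<^sub>R b) = x"
  "\<And>x b. x \<in> K ==> b \<in> B2 ==> x \<bullet> b = 0"
  "\<And>b. b \<in> B1 \<union> B2 ==> norm b = 1"
  "\<And>b c. b \<in> B1 \<union> B2 ==> c \<in> B1 \<union> B2 ==> b ~= c ==> b \<bullet> c = 0"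
proof -
 obtain B1 where B1: "B1 \<subseteq> K" "pairwise orthogonal B1" "\<And>x. x \<in> B1 ==> norm x = 1"
  "independent B1" "card B1 = dim K" "span B1 = K"
  using orthonormal_basis_subspace[OF assms] by metis
 define Q where "Q = {y. \<forall>x\<in>K. orthogonal x y}"
 have sO: "subspace Q" unfolding Q_def by (rule subspace_orthogonal_to_vectors)
 obtain B2 where B2: "B2 \<subseteq> Q" "pairwise orthogonal B2" "\<And>x. x \<in> B2 ==> norm x = 1"
  "independent B2" "card B2 = dim Q" "span B2 = Q"
  using orthonormal_basis_subspace[OF sO] by metis
 have f: "finite B1" "finite B2" using finiteI_independent B1(4) B2(4) by blast+
 have o: "b \<bullet> c = 0" if bc: "b \<in> B1 \<union> B2" "c \<in> B1 \<union> B2" "b ~= c" for b c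
 proof -
  consider "b \<in> B1" "c \<in> B1" | "b \<in> B2" "c \<in> B2" | "b \<in> B1" "c \<in> B2" | "b \<in> B2" "c \<in> B1"
   using bc by blast
  then show ?thesis
  proof cases
   case 1 then show ?thesis using B1(2) that(3) by (simp add: pairwise_def orthogonal_def)
  next
   case 2 then show ?thesis using B2(2) that(3) by (simp add: pairwise_def orthogonal_def)
  next
   case 3 then show ?thesis using B1(1) B2(1) Q_def by (auto simp: orthogonal_def)
  next
   case 4 then have "c \<bullet> b = 0" using B1(1) B2(1) Q_def by (auto simp: orthogonal_def)
   then show ?thesis by (simp add: inner_commute)
  qed
 qed
 have n: "norm b = 1" if "b \<in> B1 \<union> B2" for b using that B1(3) B2(3) by blast
 have sp: "x \<in> span (B1 \<union> B2)" for x
 proof -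
  obtain y z where yz: "y \<in> span K" "\<And>w. w \<in> span K ==> orthogonal z w" "x = y + z"
   using orthogonal_subspace_decomp_exists by metis
  have "y \<in> span (B1 \<union> B2)" using yz(1) B1(6) assms
   by (metis span_eq_iff span_mono subsetD sup_ge1)
  moreover have "z \<in> span B2" using yz(2) B2(6) assms by (auto simp: Q_def orthogonal_commute span_base)
  ultimately show ?thesis using yz(3) by (metis span_add span_mono subsetD sup_ge2)
 qed
 show ?thesis
 proof (rule that[of B1 B2])
  show "(\<Sum>b\<in>B1. (x \<bullet> b) *\<^sub>R b) = x" if "x \<in> K" for x
   by (rule orthonormal_basis_expand) (use B1 f that in auto)
  show "(\<Sum>b\<in>B1 \<union> B2. (x \<bullet> b) *\<^sub>R b) = x" for x
   by (rule orthonormal_basis_expand) (use o n f sp in \<open>simp_all add: pairwise_def orthogonal_def\<close>)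
  show "x \<bullet> b = 0" if "x \<in> K" "b \<in> B2" for x b using that B2(1) Q_def by (auto simp: orthogonal_def)
 qed (fact f B1(1,5) n o)+
qed

text \<open>Rounding coordinates to a grid of mesh \<open>1 / M\<close> is injective on a separated
  set. Only the \<open>dim K\<close> coordinates along \<open>K\<close> can take on the order of
  \<open>r\<close> values; the transversal ones are bounded by \<open>rh\<close>, which costs a
  constant factor.\<close>

lemma packing_upper:
 fixes K :: "'a::euclidean_space set"
 assumes K: "subspace K" and si: "si > 0"
 shows "\<exists>C>0. \<forall>r\<ge>1. \<forall>X. (\<forall>x\<in>X. norm x <= r \<and> (\<exists>y\<in>K. norm (x - y) <= rh)) \<and>
  (\<forall>x\<in>X. \<forall>y\<in>X. x ~= y --> si <= norm (x - y)) --> finite X \<and> real (card X) <= C * r ^ dim K"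
proof -
 obtain B1 B2 where B: "finite B1" "finite B2" "B1 \<subseteq> K" "card B1 = dim K"
  "\<And>x. x \<in> K ==> (\<Sum>b\<in>B1. (x \<bullet> b) *\<^sub>R b) = x"
  "\<And>x. (\<Sum>b\<in>B1 \<union> B2. (x \<bullet> b) *\<^sub>R b) = x"
  "\<And>x b. x \<in> K ==> b \<in> B2 ==> x \<bullet> b = 0"
  "\<And>b. b \<in> B1 \<union> B2 ==> norm b = 1"
  "\<And>b c. b \<in> B1 \<union> B2 ==> c \<in> B1 \<union> B2 ==> b ~= c ==> b \<bullet> c = 0"
  by (rule orthonormal_frame[OF K]) rule
 let ?B = "B1 \<union> B2"
 \<comment> \<open>Two points in one grid cell differ by at most \<open>1 / M\<close> in each
   coordinate, hence by at most \<open>card ?B / M\<close>, which this choice makes smaller than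
   \<open>si\<close>.\<close>
 define M where "M = (real (card ?B) + 1) / si"
 have M: "M > 0" using si by (simp add: M_def add_nonneg_pos)
 define f where "f x = (\<lambda>b\<in>?B. \<lfloor>(x \<bullet> b) * M\<rfloor>)" for x :: 'a
 have inj: "x = y" if sep: "\<forall>x\<in>X. \<forall>y\<in>X. x ~= y --> si <= norm (x - y)" "x \<in> X" "y \<in> X" "f x = f y" for X x y
 proof (rule ccontr)
  assume "x ~= y"
  have d: "\<bar>(x - y) \<bullet> b\<bar> <= 1 / M" if "b \<in> ?B" for b
  proof -
   have "\<lfloor>(x \<bullet> b) * M\<rfloor> = \<lfloor>(y \<bullet> b) * M\<rfloor>"
    using fun_cong[OF \<open>f x = f y\<close>, of b] that by (simp add: f_def)
   then have "\<bar>(x \<bullet> b) * M - (y \<bullet> b) * M\<bar> <= 1" by linarith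
   then have "\<bar>(x - y) \<bullet> b\<bar> * M <= 1"
    using M by (metis abs_mult abs_of_pos inner_diff_left left_diff_distrib)
   then show ?thesis using M by (simp add: field_simps)
  qed
  have "norm (x - y) = norm (\<Sum>b\<in>?B. ((x - y) \<bullet> b) *\<^sub>R b)" by (simp only: B(6))
  also have "\<dots> <= (\<Sum>b\<in>?B. 1 / M)"
  proof (rule sum_norm_le)
   fix b assume b: "b \<in> ?B"
   show "norm (((x - y) \<bullet> b) *\<^sub>R b) <= 1 / M" using d[OF b] B(8)[OF b] by simp
  qed
  also have "\<dots> = real (card ?B) / M" by simp
  also have "\<dots> < si" using si M unfolding M_def by (simp add: field_simps add_nonneg_pos)
  finally show False using sep \<open>x ~= y\<close> by force
 qed
 define L2 where "L2 = \<lceil>\<bar>rh\<bar> * M\<rceil> + 1"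
 define C where "C = (2 * M + 5) ^ card B1 * (2 * real_of_int L2 + 1) ^ card B2"
 have "\<bar>rh\<bar> * M >= 0" using M by simp
 then have L2: "L2 >= 1" unfolding L2_def by linarith
 have "C > 0" using M L2 unfolding C_def by (intro mult_pos_pos zero_less_power) auto
 moreover have "finite X \<and> real (card X) <= C * r ^ dim K"
  if r: "r >= 1" and X: "\<forall>x\<in>X. norm x <= r \<and> (\<exists>y\<in>K. norm (x - y) <= rh)"
   and sep: "\<forall>x\<in>X. \<forall>y\<in>X. x ~= y --> si <= norm (x - y)" for r X
 proof -
  define L1 where "L1 = \<lceil>r * M\<rceil> + 1"
  have "r * M >= 0" using M r by simp
  then have L1: "L1 >= 1" unfolding L1_def by linarith
  define S where "S b = (if b \<in> B1 then {-L1..L1} else {-L2..L2})" for b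
  have fl: "\<lfloor>(x \<bullet> b) * M\<rfloor> \<in> S b" if x: "x \<in> X" and b: "b \<in> ?B" for x b
  proof (cases "b \<in> B1")
   case True
   have "\<bar>x \<bullet> b\<bar> <= r" using X x B(8)[OF b] Cauchy_Schwarz_ineq2[of x b] by fastforce
   then have "\<bar>(x \<bullet> b) * M\<bar> <= r * M" using M by (simp add: abs_mult)
   then have "\<lfloor>(x \<bullet> b) * M\<rfloor> \<in> {-L1..L1}" unfolding L1_def by (auto; linarith)
   then show ?thesis using True by (simp add: S_def)
  next
   case False
   then have b2: "b \<in> B2" using b by auto
   obtain y where y: "y \<in> K" "norm (x - y) <= rh" using X x by auto
   have "x \<bullet> b = (x - y) \<bullet> b" using B(7)[OF y(1) b2] by (simp add: inner_diff_left)
   then have "\<bar>x \<bullet> b\<bar> <= \<bar>rh\<bar>" using y(2) B(8)[OF b] Cauchy_Schwarz_ineq2[of "x - y" b] by fastforce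
   then have "\<bar>(x \<bullet> b) * M\<bar> <= \<bar>rh\<bar> * M" using M by (simp add: abs_mult)
   then have "\<lfloor>(x \<bullet> b) * M\<rfloor> \<in> {-L2..L2}" unfolding L2_def by (auto; linarith)
   then show ?thesis using False by (simp add: S_def)
  qed
  have sub: "f ` X \<subseteq> PiE ?B S" unfolding f_def by (intro image_subsetI restrict_PiE_iff[THEN iffD2] ballI fl)
  have finS: "finite (PiE ?B S)" by (rule finite_PiE) (use B(1,2) in \<open>auto simp: S_def\<close>)
  have ij: "inj_on f X" using inj[OF sep] by (auto simp: inj_on_def)
  have "finite X" using sub finS ij by (metis finite_imageD finite_subset)
  have "B1 \<inter> B2 = {}"
  proof (rule ccontr)
   assume "B1 \<inter> B2 ~= {}"
   then obtain b where "b \<in> B1" "b \<in> B2" by auto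
   then have "b = 0" using B(3,7) by force
   then show False using B(8)[of b] \<open>b \<in> B1\<close> by auto
  qed
  have "card X <= card (PiE ?B S)" using sub finS ij by (metis card_image card_mono)
  also have "\<dots> = (\<Prod>b\<in>?B. card (S b))" by (rule card_PiE) (use B in auto)
  also have "\<dots> = (\<Prod>b\<in>B1. card (S b)) * (\<Prod>b\<in>B2. card (S b))"
   by (rule prod.union_disjoint) (use B \<open>B1 \<inter> B2 = {}\<close> in auto)
  also have "(\<Prod>b\<in>B1. card (S b)) = (\<Prod>b\<in>B1. nat (2 * L1 + 1))"
   by (rule prod.cong) (auto simp: S_def)
  also have "(\<Prod>b\<in>B2. card (S b)) = (\<Prod>b\<in>B2. nat (2 * L2 + 1))"
   by (rule prod.cong) (use \<open>B1 \<inter> B2 = {}\<close> in \<open>auto simp: S_def\<close>)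
  finally have "real (card X) <= real (nat (2 * L1 + 1)) ^ card B1 * real (nat (2 * L2 + 1)) ^ card B2"
   by (simp flip: of_nat_power of_nat_mult)
  also have "real (nat (2 * L1 + 1)) = 2 * real_of_int L1 + 1" using L1 by simp
  also have "real (nat (2 * L2 + 1)) = 2 * real_of_int L2 + 1" using L2 by simp
  also have "(2 * real_of_int L1 + 1) ^ card B1 <= ((2 * M + 5) * r) ^ card B1"
  proof (rule power_mono)
   have "real_of_int L1 <= r * M + 2" unfolding L1_def by (simp; linarith)
   then have "2 * real_of_int L1 + 1 <= 2 * M * r + 5" by (simp add: algebra_simps)
   also have "\<dots> <= (2 * M + 5) * r" using r by (simp add: algebra_simps)
   finally show "2 * real_of_int L1 + 1 <= (2 * M + 5) * r" .
  qed (use L1 in simp)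
  finally have "real (card X) <= ((2 * M + 5) * r) ^ card B1 * (2 * real_of_int L2 + 1) ^ card B2"
   using L2 by (simp add: mult_right_mono)
  also have "\<dots> = C * r ^ dim K" by (simp add: C_def power_mult_distrib B(4))
  finally show ?thesis using \<open>finite X\<close> by simp
 qed
 ultimately show ?thesis by blast
qed

text \<open>A cubic grid of spacing \<open>s\<close> in \<open>K\<close>. Since
  \<open>2 L + 1\<close> exceeds the real number whose floor is \<open>L\<close>, the lower bound
  holds down to \<open>r = 0\<close>, where the grid is a single point.\<close>

lemma packing_lower:
 fixes K :: "'a::euclidean_space set"
 assumes K: "subspace K" and s: "s > 0"
 shows "\<exists>c>0. \<forall>r\<ge>0. \<exists>X. finite X \<and> X \<subseteq> K \<and> (\<forall>x\<in>X. norm x <= r) \<and>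
  (\<forall>x\<in>X. \<forall>y\<in>X. x ~= y --> s <= norm (x - y)) \<and> c * r ^ dim K <= real (card X)"
proof -
 obtain B1 B2 where B0: "finite B1" "finite B2" "B1 \<subseteq> K" "card B1 = dim K"
  "\<And>x. x \<in> K ==> (\<Sum>b\<in>B1. (x \<bullet> b) *\<^sub>R b) = x"
  "\<And>x. (\<Sum>b\<in>B1 \<union> B2. (x \<bullet> b) *\<^sub>R b) = x"
  "\<And>x b. x \<in> K ==> b \<in> B2 ==> x \<bullet> b = 0"
  "\<And>b. b \<in> B1 \<union> B2 ==> norm b = 1"
  "\<And>b c. b \<in> B1 \<union> B2 ==> c \<in> B1 \<union> B2 ==> b ~= c ==> b \<bullet> c = 0"
  by (rule orthonormal_frame[OF K]) rule
 note B = B0(1,3,4,8,9)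
 let ?m = "dim K"
 define c where "c = (1 / (s * (real ?m + 1))) ^ ?m"
 have den: "s * (real ?m + 1) > 0" using s by (simp add: add_nonneg_pos)
 have "c > 0" unfolding c_def using den by simp
 moreover have "\<exists>X. finite X \<and> X \<subseteq> K \<and> (\<forall>x\<in>X. norm x <= r) \<and>
  (\<forall>x\<in>X. \<forall>y\<in>X. x ~= y --> s <= norm (x - y)) \<and> c * r ^ dim K <= real (card X)" if r: "r >= 0" for r
 proof -
  define L where "L = \<lfloor>r / (s * (real ?m + 1))\<rfloor>"
  have L: "L >= 0" unfolding L_def using r den by simp
  let ?Z = "PiE B1 (\<lambda>_. {-L..L})"
  define g where "g z = (\<Sum>b\<in>B1. (s * real_of_int (z b)) *\<^sub>R b)" for z
  have gb: "g z \<bullet> b = s * z b" if "b \<in> B1" for z b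
  proof -
   have "g z \<bullet> b = (\<Sum>c\<in>B1. s * real_of_int (z c) * (c \<bullet> b))" by (simp add: g_def inner_sum_left)
   also have "\<dots> = (\<Sum>c\<in>B1. if c = b then s * z b else 0)"
    by (rule sum.cong) (use B that in \<open>auto simp: norm_eq_1\<close>)
   finally show ?thesis using that B(1) by simp
  qed
  have sep: "s <= norm (g z - g z')" if z: "z \<in> ?Z" "z' \<in> ?Z" "z ~= z'" for z z'
  proof -
   obtain b where b: "b \<in> B1" "z b ~= z' b" using z(3) PiE_ext[OF z(1) z(2)] by auto
   have "s * 1 <= s * \<bar>real_of_int (z b - z' b)\<bar>"
    by (intro mult_left_mono) (use b s in auto)
   also have "\<dots> = \<bar>(g z - g z') \<bullet> b\<bar>" using gb[OF b(1)] s
    by (simp add: inner_diff_left abs_mult flip: right_diff_distrib)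
   also have "\<dots> <= norm (g z - g z')" using Cauchy_Schwarz_ineq2[of "g z - g z'" b] B(4) b by simp
   finally show ?thesis by simp
  qed
  have nm: "norm (g z) <= r" if z: "z \<in> ?Z" for z
  proof -
   have "norm (g z) <= (\<Sum>b\<in>B1. s * L)" unfolding g_def
   proof (rule sum_norm_le)
    fix b assume b: "b \<in> B1"
    have "z b \<in> {-L..L}" using z b by (rule PiE_mem)
    then have "\<bar>real_of_int (z b)\<bar> <= L" by (simp; linarith)
    then show "norm ((s * real_of_int (z b)) *\<^sub>R b) <= s * L" using B(4) b s by (simp add: abs_mult)
   qed
   also have "\<dots> = (?m * s) * L" by (simp add: B)
   also have "\<dots> <= (s * (real ?m + 1)) * L" using L s by (intro mult_right_mono) (auto simp: algebra_simps)
   also have "\<dots> <= (s * (real ?m + 1)) * (r / (s * (real ?m + 1)))"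
    using den unfolding L_def by (intro mult_left_mono) auto
   also have "\<dots> = r" using den s by simp
   finally show ?thesis .
  qed
  have ij: "inj_on g ?Z" using sep s by (auto simp: inj_on_def) (metis diff_self leD norm_zero)
  have finZ: "finite ?Z" using B(1) by (simp add: finite_PiE)
  have "card (g ` ?Z) = nat (2 * L + 1) ^ ?m"
   using ij B by (simp add: card_image card_PiE)
  then have "real (card (g ` ?Z)) = (2 * real_of_int L + 1) ^ ?m" using L by simp
  also have "\<dots> >= (r / (s * (real ?m + 1))) ^ ?m"
  proof (rule power_mono)
   have "r / (s * (real ?m + 1)) <= real_of_int L + 1" unfolding L_def by linarith
   then show "r / (s * (real ?m + 1)) <= 2 * real_of_int L + 1" using L by linarith
  qed (use r den in auto)
  finally have "c * r ^ ?m <= real (card (g ` ?Z))" unfolding c_def by (simp add: power_divide)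
  moreover have "g ` ?Z \<subseteq> K"
  proof
   fix x assume "x \<in> g ` ?Z"
   then obtain z where x: "x = g z" by auto
   show "x \<in> K" unfolding x g_def
    by (rule subspace_sum[OF K], rule subspace_scale[OF K]) (use B(2) in blast)
  qed
  moreover have "\<forall>x\<in>g ` ?Z. \<forall>y\<in>g ` ?Z. x ~= y --> s <= norm (x - y)"
  proof (intro ballI impI)
   fix x y assume "x \<in> g ` ?Z" "y \<in> g ` ?Z" "x ~= y"
   then obtain z z' where "x = g z" "y = g z'" "z \<in> ?Z" "z' \<in> ?Z" "z ~= z'" by blast
   then show "s <= norm (x - y)" using sep by simp
  qed
  moreover have "\<forall>x\<in>g ` ?Z. norm x <= r" using nm by blast
  ultimately show ?thesis using finZ by blast
 qed
 ultimately show ?thesis by blast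
qed

text \<open>\<open>N\<close> is a norm on \<open>X\<close> only and arbitrary elsewhere. The upper
  bound from coordinates makes \<open>N\<close> continuous on \<open>X\<close>; its minimum on the
  unit sphere of \<open>X\<close> then gives the lower bound.\<close>

lemma norm_on_equiv:
 fixes X :: "'a::euclidean_space set"
 assumes X: "subspace X" and N: "norm_on X N"
 shows "\<exists>c>0. \<exists>C>0. \<forall>x\<in>X. c * norm x <= N x \<and> N x <= C * norm x"
proof -
 obtain B1 B2 where B0: "finite B1" "finite B2" "B1 \<subseteq> X" "card B1 = dim X"
  "\<And>x. x \<in> X ==> (\<Sum>b\<in>B1. (x \<bullet> b) *\<^sub>R b) = x"
  "\<And>x. (\<Sum>b\<in>B1 \<union> B2. (x \<bullet> b) *\<^sub>R b) = x"
  "\<And>x b. x \<in> X ==> b \<in> B2 ==> x \<bullet> b = 0"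
  "\<And>b. b \<in> B1 \<union> B2 ==> norm b = 1"
  "\<And>b c. b \<in> B1 \<union> B2 ==> c \<in> B1 \<union> B2 ==> b ~= c ==> b \<bullet> c = 0"
  by (rule orthonormal_frame[OF X]) rule
 note B = B0(1,4,4,3,5,8)
 have Nn: "0 <= N x" "N x = 0 \<longleftrightarrow> x = 0" if "x \<in> X" for x using N that by (auto simp: norm_on_def)
 have Ns: "N (a *\<^sub>R x) = \<bar>a\<bar> * N x" if "x \<in> X" for a x using N that by (auto simp: norm_on_def)
 have Nt: "N (x + y) <= N x + N y" if "x \<in> X" "y \<in> X" for x y using N that by (auto simp: norm_on_def)
 define C where "C = (\<Sum>b\<in>B1. N b) + 1"
 have "(\<Sum>b\<in>B1. N b) >= 0" by (rule sum_nonneg) (use Nn B in auto)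
 then have C: "C > 0" by (simp add: C_def)
 have Nsum: "N (\<Sum>b\<in>F. g b) <= (\<Sum>b\<in>F. N (g b))" if "finite F" "\<And>b. b \<in> F ==> g b \<in> X" for F and g :: "'a \<Rightarrow> 'a"
  using that
 proof (induction F)
  case empty show ?case using Nn(2)[of 0] subspace_0[OF X] by simp
 next
  case (insert x F)
  have "N (g x + sum g F) <= N (g x) + N (sum g F)"
   by (rule Nt) (use insert in \<open>auto intro: subspace_sum[OF X]\<close>)
  then show ?case using insert by (auto intro: order_trans)
 qed
 have up: "N x <= C * norm x" if x: "x \<in> X" for x
 proof -
  have "N x = N (\<Sum>b\<in>B1. (x \<bullet> b) *\<^sub>R b)" using B(5)[OF x] by simp
  also have "\<dots> <= (\<Sum>b\<in>B1. N ((x \<bullet> b) *\<^sub>R b))"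
   by (rule Nsum) (use B X in \<open>auto intro: subspace_scale\<close>)
  also have "\<dots> <= (\<Sum>b\<in>B1. norm x * N b)"
  proof (rule sum_mono)
   fix b assume b: "b \<in> B1"
   then have "\<bar>x \<bullet> b\<bar> <= norm x" using Cauchy_Schwarz_ineq2[of x b] B(6)[of b] by simp
   moreover have "b \<in> X" using b B(4) by blast
   ultimately show "N ((x \<bullet> b) *\<^sub>R b) <= norm x * N b" using Nn(1) Ns by (simp add: mult_right_mono)
  qed
  also have "\<dots> = (C - 1) * norm x" by (simp add: C_def sum_distrib_left mult.commute)
  also have "\<dots> <= C * norm x" by (simp add: mult_right_mono)
  finally show ?thesis .
 qed
 let ?S = "X \<inter> sphere 0 1"
 have comp: "compact ?S" using closed_subspace[OF X] by (simp add: closed_Int_compact)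
 have cont: "continuous_on X N"
 proof (rule continuous_onI)
  fix x e :: real and z assume e: "(0::real) < e" and z: "z \<in> X"
  show "\<exists>d>0. \<forall>x'\<in>X. dist x' z < d --> dist (N x') (N z) <= e"
  proof (intro exI conjI ballI impI)
   show "e / C > 0" using e C by simp
   fix y assume y: "y \<in> X" and d: "dist y z < e / C"
   have "N (y - z) <= C * norm (y - z)" "N (z - y) <= C * norm (z - y)" using y z up X by (auto simp: subspace_diff)
   moreover have "C * norm (y - z) <= e" using d C by (simp add: dist_norm field_simps)
   moreover have "N (z + (y - z)) <= N z + N (y - z)" "N (y + (z - y)) <= N y + N (z - y)"
    by (intro Nt y z subspace_diff[OF X])+
   ultimately show "dist (N y) (N z) <= e" by (simp add: dist_real_def abs_le_iff norm_minus_commute)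
  qed
 qed
 have "\<exists>c>0. \<forall>x\<in>X. c * norm x <= N x"
 proof (cases "?S = {}")
  case True
  have "x = 0" if "x \<in> X" for x
  proof (rule ccontr)
   assume "x ~= 0"
   then have "(1 / norm x) *\<^sub>R x \<in> ?S" using that X by (simp add: subspace_scale)
   then show False using True by blast
  qed
  then show ?thesis using Nn by (intro exI[of _ 1]) force
 next
  case False
  obtain z where z: "z \<in> ?S" "\<And>y. y \<in> ?S ==> N z <= N y"
   using continuous_attains_inf[OF comp False] cont by (meson continuous_on_subset inf_le1)
  have "N z > 0" using z(1) Nn[of z] by (metis IntD1 IntD2 dist_0_norm less_eq_real_def mem_sphere norm_zero zero_neq_one)
  moreover have "N z * norm x <= N x" if x: "x \<in> X" for x
  proof (cases "x = 0")
   case True then show ?thesis using Nn(2)[OF x] by simp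
  next
   case F: False
   then have "(1 / norm x) *\<^sub>R x \<in> ?S" using x X by (simp add: subspace_scale)
   then have "N z <= N ((1 / norm x) *\<^sub>R x)" by (rule z(2))
   also have "\<dots> = N x / norm x" using Ns[OF x] by simp
   finally show ?thesis using F by (simp add: field_simps)
  qed
  ultimately show ?thesis by blast
 qed
 then show ?thesis using up C by blast
qed

section \<open>Subgroups of lattices\<close>

lemma zspan_sub_span: "zspan B \<subseteq> span (B :: 'a::real_vector set)"
proof
 fix x assume "x \<in> zspan B"
 then show "x \<in> span B"
  by (induction rule: zmod.span_induct_alt) (auto intro: span_add span_scale span_base span_zero)
qed

lemma zsubgroup_iff: "zsubgroup G \<longleftrightarrow> 0 \<in> G \<and> (\<forall>x\<in>G. \<forall>y\<in>G. x + y \<in> G) \<and> (\<forall>m. \<forall>x\<in>G. real_of_int m *\<^sub>R x \<in> G)"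
 by (auto simp: zmod.subspace_def)

lemma zsubgroup_diff: "zsubgroup G ==> x \<in> G ==> y \<in> G ==> x - y \<in> G"
 by (rule zmod.subspace_diff)

text \<open>Induction on the ambient basis. The \<open>b\<close>-coefficients of \<open>G\<close>
  form a subgroup of the integers; an element \<open>g0\<close> with least positive coefficient,
  joined to a basis of \<open>G \<inter> zspan B\<close>, gives a basis of \<open>G\<close>. What is
  obtained is even independent over the reals.\<close>

lemma zsubgroup_basis:
 fixes B :: "'a::real_vector set"
 assumes "finite B" "independent B" "zsubgroup G" "G \<subseteq> zspan B"
 shows "\<exists>B'. finite B' \<and> independent B' \<and> zspan B' = G"
 using assms
proof (induction B arbitrary: G)
 case empty
 then have "G = {0}" using zmod.subspace_0 by auto
 then show ?case by (intro exI[of _ "{}"]) (auto simp: independent_empty)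
next
 case (insert b B)
 have nb: "b \<notin> span B" using insert by (simp add: independent_insert)
 have indB: "independent B" using insert.prems(1) insert.hyps(2) by (simp add: independent_insert)
 let ?G0 = "G \<inter> zspan B"
 have "zsubgroup ?G0" using insert.prems zmod.subspace_span zmod.subspace_inter by blast
 then obtain B0 where B0: "finite B0" "independent B0" "zspan B0 = ?G0"
  using insert.IH[of ?G0] indB by auto
 define M where "M = {m::int. \<exists>g\<in>G. g - real_of_int m *\<^sub>R b \<in> zspan B}"
 have ex: "\<exists>m. g - real_of_int m *\<^sub>R b \<in> zspan B" if "g \<in> G" for g
  using subsetD[OF insert.prems(3) that] by (simp add: zmod.span_insert)
 show ?case
 proof (cases "\<exists>m\<in>M. m > 0")
  case False
  have "m = 0" if m: "m \<in> M" for m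
  proof -
   obtain g where g: "g \<in> G" "g - real_of_int m *\<^sub>R b \<in> zspan B" using m M_def by auto
   have "- g \<in> G" using g insert.prems zmod.subspace_neg by blast
   moreover have "- g - real_of_int (- m) *\<^sub>R b \<in> zspan B"
    using zmod.span_neg[OF g(2)] by (simp add: algebra_simps)
   ultimately have "- m \<in> M" unfolding M_def by blast
   then show ?thesis using False m by (metis linorder_neqE_linordered_idom neg_0_less_iff_less)
  qed
  then have "G \<subseteq> zspan B" using ex M_def by (auto, metis (mono_tags, lifting) diff_0_right mem_Collect_eq of_int_0 scaleR_zero_left)
  then show ?thesis using B0 by (intro exI[of _ B0]) auto
 next
  case True
  define p where "p = (LEAST k. int k \<in> M \<and> k > 0)"
  have exk: "\<exists>k. int k \<in> M \<and> k > 0" using True by (metis zero_less_imp_eq_int)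
  have p: "int p \<in> M" "p > 0" using LeastI_ex[OF exk] by (auto simp: p_def)
  obtain g0 where g0: "g0 \<in> G" "g0 - real_of_int (int p) *\<^sub>R b \<in> zspan B" using p M_def by auto
  have ng0: "g0 \<notin> span B0"
  proof
   assume "g0 \<in> span B0"
   also have "span B0 \<subseteq> span B" using B0(3) zspan_sub_span
    by (metis inf.bounded_iff span_minimal subset_refl subspace_span zmod.span_superset order_trans)
   finally have "g0 - (g0 - real_of_int (int p) *\<^sub>R b) \<in> span B"
    using subsetD[OF zspan_sub_span g0(2)] by (rule span_diff)
   then have "real p *\<^sub>R b \<in> span B" by simp
   then have "(1 / real p) *\<^sub>R real p *\<^sub>R b \<in> span B" by (rule span_scale)
   then show False using nb p by simp
  qed
  have "zspan (insert g0 B0) = G"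
  proof
   show "zspan (insert g0 B0) \<subseteq> G"
    using g0 B0 insert.prems by (intro zmod.span_minimal) (auto intro: zmod.span_base)
   show "G \<subseteq> zspan (insert g0 B0)"
   proof
    fix g assume g: "g \<in> G"
    then obtain m where m: "g - real_of_int m *\<^sub>R b \<in> zspan B" using ex by auto
    define q where "q = m div int p"
    let ?g' = "g - real_of_int q *\<^sub>R g0"
    have g': "?g' \<in> G" using g g0 insert.prems by (meson zmod.subspace_diff zmod.subspace_scale)
    have "(g - real_of_int m *\<^sub>R b) - real_of_int q *\<^sub>R (g0 - real_of_int (int p) *\<^sub>R b) \<in> zspan B"
     by (rule zmod.span_diff[OF m zmod.span_scale[OF g0(2)]])
    moreover have "(g - real_of_int m *\<^sub>R b) - real_of_int q *\<^sub>R (g0 - real_of_int (int p) *\<^sub>R b)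
     = ?g' - real_of_int (m - q * int p) *\<^sub>R b" by (simp add: algebra_simps)
    moreover have mm: "m - q * int p = m mod int p" by (simp add: q_def minus_div_mult_eq_mod)
    ultimately have z: "?g' - real_of_int (m mod int p) *\<^sub>R b \<in> zspan B" by metis
    have "m mod int p = 0"
    proof (rule ccontr)
     assume nz: "m mod int p ~= 0"
     have pos: "m mod int p > 0" "m mod int p < int p" using nz p pos_mod_sign[of "int p" m] by (auto simp: le_less)
     have "m mod int p \<in> M" using z g' M_def by auto
     then have "int (nat (m mod int p)) \<in> M \<and> nat (m mod int p) > 0" using pos by simp
     then have "p <= nat (m mod int p)" unfolding p_def by (rule Least_le)
     then show False using pos by linarith
    qed
    then have "?g' \<in> ?G0" using z g' by simp
    then show "g \<in> zspan (insert g0 B0)" using B0(3) zmod.span_insert by blast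
   qed
  qed
  moreover have "independent (insert g0 B0)" using ng0 B0 by (simp add: independent_insertI)
  ultimately show ?thesis using B0(1) by (intro exI[of _ "insert g0 B0"]) auto
 qed
qed

text \<open>Inside a lattice, integer and real relations agree. \<open>zspan B\<close> has a basis
  \<open>B'\<close> that is independent over the reals; a pigeonhole count of integer combinations
  shows \<open>card B \<le> card B'\<close>, so \<open>B\<close> spans a space of dimension at least
  its own cardinality.\<close>

lemma zindependent_imp_independent:
 fixes B0 B :: "'a::euclidean_space set"
 assumes B0: "independent B0" and BB: "B \<subseteq> zspan B0" and fB: "finite B" and ind: "\<not> zdependent B"
 shows "independent B"
proof -
 have "zspan B \<subseteq> zspan B0" using BB by (simp add: zmod.span_minimal)
 then obtain B' where B': "finite B'" "independent B'" "zspan B' = zspan B"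
  using zsubgroup_basis[OF finiteI_independent[OF B0] B0, of "zspan B"] by auto
 have sp: "span B' = span B"
 proof
  show "span B' \<subseteq> span B" using B'(3) zspan_sub_span[of B] zmod.span_superset[of B']
   by (intro span_minimal) auto
  show "span B \<subseteq> span B'" using B'(3) zspan_sub_span[of B'] zmod.span_superset[of B]
   by (intro span_minimal) auto
 qed
 have "card B <= card B'"
 proof (rule ccontr)
  assume lt: "\<not> card B <= card B'"
  let ?m = "card B'"
  have "\<exists>c. b = (\<Sum>b'\<in>B'. real_of_int (c b') *\<^sub>R b')" if "b \<in> B" for b
  proof -
   have "b \<in> zspan B'" using that B'(3) zmod.span_base by auto
   then show ?thesis using zmod.span_finite[OF B'(1)] by auto
  qed
  then obtain c where c: "\<And>b. b \<in> B ==> b = (\<Sum>b'\<in>B'. real_of_int (c b b') *\<^sub>R b')" by metis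
  define M where "M = (\<Sum>b\<in>B. \<Sum>b'\<in>B'. \<bar>c b b'\<bar>)"
  have M0: "M >= 0" unfolding M_def by (intro sum_nonneg) auto
  \<comment> \<open>With this \<open>N\<close> the at most \<open>(2 N M + 1) ^ ?m\<close> possible
    images are fewer than the \<open>(N + 1) ^ card B\<close> coefficient vectors as soon as
    \<open>card B > ?m\<close>.\<close>
  define N where "N = nat ((2 * M + 1) ^ ?m)"
  have N1: "int N = (2 * M + 1) ^ ?m" using M0 by (simp add: N_def)
  define kp where "kp z = (\<lambda>b'\<in>B'. \<Sum>b\<in>B. z b * c b b')" for z
  let ?Z = "PiE B (\<lambda>_. {0..int N})"
  have "kp ` ?Z \<subseteq> PiE B' (\<lambda>_. {- (int N * M)..int N * M})"
   unfolding kp_def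
  proof (intro image_subsetI restrict_PiE_iff[THEN iffD2] ballI)
   fix z b' assume z: "z \<in> ?Z" and b': "b' \<in> B'"
   have "\<bar>\<Sum>b\<in>B. z b * c b b'\<bar> <= (\<Sum>b\<in>B. int N * (\<Sum>b'\<in>B'. \<bar>c b b'\<bar>))"
   proof (rule order_trans[OF sum_abs sum_mono])
    fix b assume b: "b \<in> B"
    have "z b \<in> {0..int N}" using z b by (rule PiE_mem)
    moreover have "\<bar>c b b'\<bar> <= (\<Sum>b'\<in>B'. \<bar>c b b'\<bar>)" by (rule member_le_sum) (use b' B' in auto)
    ultimately show "\<bar>z b * c b b'\<bar> <= int N * (\<Sum>b'\<in>B'. \<bar>c b b'\<bar>)"
     by (simp add: abs_mult mult_mono)
   qed
   then show "(\<Sum>b\<in>B. z b * c b b') \<in> {- (int N * M)..int N * M}"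
    unfolding M_def sum_distrib_left[symmetric] by (simp add: abs_le_iff)
  qed
  moreover have fin: "finite (PiE B' (\<lambda>_. {- (int N * M)..int N * M}))" using B'(1) by (simp add: finite_PiE)
  ultimately have "card (kp ` ?Z) <= card (PiE B' (\<lambda>_. {- (int N * M)..int N * M}))" by (simp add: card_mono)
  also have "\<dots> = nat (2 * (int N * M) + 1) ^ ?m" using B'(1) by (simp add: card_PiE mult.commute)
  finally have "int (card (kp ` ?Z)) <= (2 * (int N * M) + 1) ^ ?m" using M0
   by (metis (mono_tags, lifting) add_nonneg_nonneg int_nat_eq mult_nonneg_nonneg of_nat_0_le_iff of_nat_le_iff of_nat_power zero_le_numeral zero_le_one)
  also have "\<dots> <= ((2 * M + 1) * (int N + 1)) ^ ?m"
   using M0 by (intro power_mono) (auto simp: algebra_simps)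
  also have "\<dots> = int N * (int N + 1) ^ ?m" by (simp add: power_mult_distrib N1)
  also have "\<dots> < (int N + 1) * (int N + 1) ^ ?m" by (intro mult_strict_right_mono) auto
  also have "\<dots> = (int N + 1) ^ Suc ?m" by simp
  also have "\<dots> <= (int N + 1) ^ card B" using lt by (intro power_increasing) auto
  also have "\<dots> = int (card ?Z)" using fB by (simp add: card_PiE nat_add_distrib add.commute)
  finally have "card (kp ` ?Z) ~= card ?Z" by simp
  then have "\<not> inj_on kp ?Z" using card_image by blast
  then obtain z z' where z: "z \<in> ?Z" "z' \<in> ?Z" "kp z = kp z'" "z ~= z'" by (auto simp: inj_on_def)
  obtain b where b: "b \<in> B" "z b ~= z' b" using z(4) PiE_ext[OF z(1) z(2)] by auto
  have ev: "(\<Sum>b\<in>B. real_of_int (w b) *\<^sub>R b) = (\<Sum>b'\<in>B'. real_of_int (kp w b') *\<^sub>R b')" for w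
  proof -
   have "(\<Sum>b\<in>B. real_of_int (w b) *\<^sub>R b) = (\<Sum>b\<in>B. \<Sum>b'\<in>B'. real_of_int (w b * c b b') *\<^sub>R b')"
   proof (rule sum.cong[OF refl])
    fix b assume "b \<in> B"
    then have "real_of_int (w b) *\<^sub>R b = real_of_int (w b) *\<^sub>R (\<Sum>b'\<in>B'. real_of_int (c b b') *\<^sub>R b')" using c by metis
    then show "real_of_int (w b) *\<^sub>R b = (\<Sum>b'\<in>B'. real_of_int (w b * c b b') *\<^sub>R b')"
     by (simp add: scaleR_right.sum)
   qed
   also have "\<dots> = (\<Sum>b'\<in>B'. \<Sum>b\<in>B. real_of_int (w b * c b b') *\<^sub>R b')" by (rule sum.swap)
   also have "\<dots> = (\<Sum>b'\<in>B'. real_of_int (kp w b') *\<^sub>R b')"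
    by (rule sum.cong) (auto simp: kp_def scaleR_left.sum)
   finally show ?thesis .
  qed
  have "(\<Sum>b\<in>B. real_of_int (z b - z' b) *\<^sub>R b) = 0"
   using ev[of z] ev[of z'] z(3) by (simp add: algebra_simps sum_subtractf)
  then have "zdependent B" using zmod.dependent_finite[OF fB] b by (auto intro!: exI[of _ "\<lambda>b. z b - z' b"])
  then show False using ind by simp
 qed
 also have "card B' = dim (span B)" using B' sp by (metis dim_eq_card_independent dim_span)
 finally show ?thesis using fB by (intro card_le_dim_spanning[of B "span B"]) (auto simp: span_superset)
qed

text \<open>The ambient lattice is left open because the flag groups lie in \<open>(1/N) Ga\<close>
  and not in \<open>Ga\<close>.\<close>

definition sublattice :: "'a::euclidean_space set \<Rightarrow> bool" where
 "sublattice G \<longleftrightarrow> zsubgroup G \<and> (\<exists>B. independent B \<and> G \<subseteq> zspan B)"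

lemma sublattice_zbasis_independent:
 assumes "sublattice G" "zbasis B G" shows "independent B"
 using assms zindependent_imp_independent unfolding sublattice_def zbasis_def
 by (metis order_trans zmod.span_superset)

lemma span_zspan: "span (zspan B) = span (B :: 'a::real_vector set)"
 by (metis span_eq subset_trans zmod.span_superset zspan_sub_span span_superset)

lemma zbasis_card:
 assumes "sublattice G" "zbasis B G" shows "card B = dim G"
 using sublattice_zbasis_independent[OF assms] assms(2) unfolding zbasis_def
 by (metis dim_eq_card_independent dim_span span_zspan)

lemma independent_zindependent:
 assumes "independent (B::'a::real_vector set)" "finite B" shows "\<not> zdependent B"
proof
 assume "zdependent B"
 then obtain u v where "v \<in> B" "u v ~= (0::int)" "(\<Sum>v\<in>B. real_of_int (u v) *\<^sub>R v) = 0"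
  using assms(2) by (auto simp: zmod.dependent_finite)
 then have "\<exists>u'. (\<exists>v\<in>B. u' v ~= 0) \<and> (\<Sum>v\<in>B. u' v *\<^sub>R v) = 0"
  by (intro exI[of _ "\<lambda>v. real_of_int (u v)"]) auto
 then have "dependent B" by (simp add: dependent_finite[OF assms(2)])
 then show False using assms(1) by simp
qed

lemma sublattice_zbasis_exists:
 assumes "sublattice G" shows "\<exists>B. zbasis B G \<and> independent B"
proof -
 obtain B where "independent B" "G \<subseteq> zspan B" "zsubgroup G" using assms sublattice_def by auto
 then obtain B' where "finite B'" "independent B'" "zspan B' = G"
  using zsubgroup_basis finiteI_independent by metis
 then show ?thesis using independent_zindependent zbasis_def by blast
qed

lemma zrank_sublattice:
 assumes "sublattice G" shows "zrank G = dim G"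
 unfolding zrank_def
 using sublattice_zbasis_exists[OF assms] zbasis_card[OF assms] by (intro the_equality) blast+

text \<open>Each coordinate is a linear functional, hence bounded. The estimate serves both to
  separate lattice points and to compare \<open>eta\<close> with a norm.\<close>

lemma coordinate_bound:
 fixes B :: "'a::euclidean_space set"
 assumes B: "independent B"
 shows "\<exists>C>0. \<forall>u. \<forall>b\<in>B. \<bar>u b\<bar> <= C * norm (\<Sum>v\<in>B. u v *\<^sub>R v)"
proof -
 have fB: "finite B" using B by (rule finiteI_independent)
 have "\<forall>b. \<exists>fi::'a \<Rightarrow> real. linear fi \<and> (\<forall>c\<in>B. fi c = (if c = b then 1 else 0))"
  by (rule allI, rule linear_independent_extend[OF B])
 from choice[OF this] obtain fi :: "'a \<Rightarrow> 'a \<Rightarrow> real"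
  where fi: "\<And>b. linear (fi b)" "\<And>b c. c \<in> B ==> fi b c = (if c = b then 1 else 0)" by blast
 have "\<forall>b. \<exists>K>0. \<forall>x. norm (fi b x) <= K * norm x" using linear_bounded_pos[OF fi(1)] by blast
 from choice[OF this] obtain K where K: "\<And>b. K b > 0" "\<And>b x. norm (fi b x) <= K b * norm x" by blast
 have "\<bar>u b\<bar> <= ((\<Sum>b\<in>B. K b) + 1) * norm (\<Sum>v\<in>B. u v *\<^sub>R v)" if b: "b \<in> B" for u b
 proof -
  have "fi b (\<Sum>v\<in>B. u v *\<^sub>R v) = (\<Sum>v\<in>B. if v = b then u b else 0)"
   unfolding linear_sum[OF fi(1)] by (rule sum.cong) (auto simp: linear_scale[OF fi(1)] fi(2))
  then have "\<bar>u b\<bar> = norm (fi b (\<Sum>v\<in>B. u v *\<^sub>R v))" using b fB by simp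
  also have "\<dots> <= K b * norm (\<Sum>v\<in>B. u v *\<^sub>R v)" by (rule K(2))
  also have "\<dots> <= ((\<Sum>b\<in>B. K b) + 1) * norm (\<Sum>v\<in>B. u v *\<^sub>R v)"
   using member_le_sum[OF b, of K] fB K(1) by (intro mult_right_mono) (simp_all add: less_imp_le)
  finally show ?thesis .
 qed
 moreover have "(\<Sum>b\<in>B. K b) + 1 > 0" using K(1) by (simp add: add_nonneg_pos sum_nonneg less_imp_le)
 ultimately show ?thesis by blast
qed

section \<open>Cut and project lattices\<close>

locale cut_lattice =
 fixes Ga :: "'e::euclidean_space set" and P I :: "'e \<Rightarrow> 'e" and N :: "'e \<Rightarrow> real"
 assumes linP: "linear P" and linI: "linear I"
  and PI: "P x + I x = x" and PP [simp]: "P (P x) = P x" and II [simp]: "I (I x) = I x"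
  and lattice: "is_lattice Ga"
  and injP: "ga \<in> Ga ==> P ga = 0 ==> ga = 0"
  and injI: "ga \<in> Ga ==> I ga = 0 ==> ga = 0"
  and dense: "x \<in> range I ==> e > 0 ==> \<exists>ga\<in>Ga. norm (I ga - x) < e"
  and norm_N: "norm_on (range P) N"
begin

abbreviation d :: nat where "d \<equiv> dim (range P)"
abbreviation n :: nat where "n \<equiv> dim (range I)"

lemmas I_add = linear_add[OF linI] and I_diff = linear_diff[OF linI]
 and I_scale = linear_scale[OF linI] and I_0 = linear_0[OF linI] and I_sum = linear_sum[OF linI]
lemmas P_add = linear_add[OF linP] and P_diff = linear_diff[OF linP]
 and P_scale = linear_scale[OF linP] and P_0 = linear_0[OF linP] and P_sum = linear_sum[OF linP]

lemma subspace_P: "subspace (range P)" and subspace_I: "subspace (range I)"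
 using linP linI by (auto intro: linear_subspace_image)

lemma I_id: "x \<in> range I ==> I x = x" by auto

lemma PI0 [simp]: "P (I x) = 0" and IP0 [simp]: "I (P x) = 0"
 using PI[of "I x"] PI[of "P x"] by auto

lemma I_eq_0_iff: "I x = 0 \<longleftrightarrow> x \<in> range P"
 using PI[of x] by (metis IP0 add.right_neutral imageE rangeI)

lemma bounds: "\<exists>KP>0. \<exists>KI>0. \<forall>x. norm (P x) <= KP * norm x \<and> norm (I x) <= KI * norm x"
 using linear_bounded_pos[OF linP] linear_bounded_pos[OF linI] by (metis mult.commute)

lemma zsubgroup_lattice: "zsubgroup Ga"
 using lattice unfolding is_lattice_def by (metis zmod.subspace_span)

lemmas lat_add = zmod.subspace_add[OF zsubgroup_lattice]
 and lat_diff = zmod.subspace_diff[OF zsubgroup_lattice]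
 and lat_neg = zmod.subspace_neg[OF zsubgroup_lattice]
 and lat_scale = zmod.subspace_scale[OF zsubgroup_lattice]
 and lat_0 = zmod.subspace_0[OF zsubgroup_lattice]
 and lat_sum = zmod.subspace_sum[OF zsubgroup_lattice]

lemma sublatticeI: "zsubgroup A ==> A \<subseteq> Ga ==> sublattice A"
 using lattice unfolding sublattice_def is_lattice_def by auto

lemma lattice_span: "span Ga = UNIV"
proof -
 obtain B where "span B = UNIV" "zspan B = Ga" using lattice is_lattice_def by metis
 then show ?thesis by (metis span_zspan)
qed

lemma lattice_separated: "\<exists>si>0. \<forall>ga\<in>Ga. ga ~= 0 --> si <= norm ga"
proof -
 obtain B where B: "independent B" "span B = UNIV" "zspan B = Ga"
  using lattice is_lattice_def by metis
 have fB: "finite B" using B(1) by (rule finiteI_independent)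
 obtain C where C: "C > 0" "\<And>u b. b \<in> B ==> \<bar>u b\<bar> <= C * norm (\<Sum>v\<in>B. u v *\<^sub>R v)" using coordinate_bound[OF B(1)] by blast
 have "1 / C <= norm ga" if g: "ga \<in> Ga" "ga ~= 0" for ga
 proof -
  obtain u where u: "ga = (\<Sum>v\<in>B. real_of_int (u v) *\<^sub>R v)" using g(1) B(3) zmod.span_finite[OF fB] by auto
  obtain b where b: "b \<in> B" "u b ~= 0" using g(2) unfolding u by (metis (mono_tags, lifting) of_int_0 scale_eq_0_iff sum.neutral)
  have "1 <= \<bar>real_of_int (u b)\<bar>" using b(2) by (simp; linarith)
  also have "\<dots> <= C * norm ga" unfolding u by (rule C(2)[OF b(1)])
  finally show ?thesis using C(1) by (simp add: field_simps)
 qed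
 then show ?thesis using C(1) by (intro exI[of _ "1 / C"]) auto
qed

lemma lattice_finite: "finite {ga\<in>Ga. norm ga <= r}"
proof -
 obtain si where s: "si > 0" "\<forall>ga\<in>Ga. ga ~= 0 --> si <= norm ga" using lattice_separated by auto
 obtain C where C: "\<forall>r\<ge>1. \<forall>X. (\<forall>x\<in>X. norm x <= r \<and> (\<exists>y\<in>UNIV::'e set. norm (x - y) <= 0)) \<and>
  (\<forall>x\<in>X. \<forall>y\<in>X. x ~= y --> si <= norm (x - y)) --> finite X \<and> real (card X) <= C * r ^ dim (UNIV :: 'e set)"
  using packing_upper[OF subspace_UNIV s(1), of 0] by metis
 have "(\<forall>x\<in>{ga\<in>Ga. norm ga <= r}. norm x <= max r 1 \<and> (\<exists>y\<in>UNIV. norm (x - y) <= 0))" by auto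
 moreover have "\<forall>x\<in>{ga\<in>Ga. norm ga <= r}. \<forall>y\<in>{ga\<in>Ga. norm ga <= r}. x ~= y --> si <= norm (x - y)"
  using s(2) lat_diff by auto
 ultimately show ?thesis using C[rule_format, of "max r 1" "{ga\<in>Ga. norm ga <= r}"] by auto
qed

lemma bounded_image_finite:
 assumes "\<And>ga. ga \<in> X ==> ga \<in> Ga \<and> norm ga <= r"
 shows "finite X"
 by (rule finite_subset[OF _ lattice_finite[of r]]) (use assms in auto)

text \<open>Real coordinates are rounded down with respect to a real basis chosen inside
  \<open>A\<close>; it spans the same space as \<open>A\<close> but need not generate the
  group.\<close>

lemma cocompact:
 fixes A :: "'e set"
 assumes "zsubgroup A"
 shows "\<exists>C>0. \<forall>x\<in>span A. \<exists>a\<in>A. norm (x - a) <= C"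
proof -
 obtain B where B: "B \<subseteq> A" "independent B" "A \<subseteq> span B" using basis_exists by metis
 have fB: "finite B" using B(2) by (rule finiteI_independent)
 define C where "C = (\<Sum>b\<in>B. norm b) + 1"
 have "\<exists>a\<in>A. norm (x - a) <= C" if x: "x \<in> span A" for x
 proof -
  have "x \<in> span B" using x B by (metis span_minimal subspace_span subsetD)
  then obtain u where u: "x = (\<Sum>v\<in>B. u v *\<^sub>R v)" using span_finite[OF fB] by auto
  let ?a = "\<Sum>v\<in>B. real_of_int \<lfloor>u v\<rfloor> *\<^sub>R v"
  have "?a \<in> A" by (rule zmod.subspace_sum[OF assms], rule zmod.subspace_scale[OF assms]) (use B in auto)
  moreover have "norm (x - ?a) <= (\<Sum>v\<in>B. norm v)"
  proof -
   have "x - ?a = (\<Sum>v\<in>B. (u v - \<lfloor>u v\<rfloor>) *\<^sub>R v)" by (simp add: u sum_subtractf algebra_simps)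
   also have "norm \<dots> <= (\<Sum>v\<in>B. norm v)"
   proof (rule sum_norm_le)
    fix v assume "v \<in> B"
    have "\<bar>u v - \<lfloor>u v\<rfloor>\<bar> <= 1" by linarith
    then show "norm ((u v - \<lfloor>u v\<rfloor>) *\<^sub>R v) <= norm v" by (simp add: mult_left_le_one_le)
   qed
   finally show ?thesis .
  qed
  ultimately show ?thesis unfolding C_def by (intro bexI[of _ ?a]) linarith+
 qed
 moreover have "C > 0" unfolding C_def by (simp add: add_nonneg_pos sum_nonneg)
 ultimately show ?thesis by blast
qed

text \<open>Subspaces spanned by lattice vectors behave under intersection like rational subspaces.\<close>

lemma span_Int_sublattice:
 assumes A: "zsubgroup A" "A \<subseteq> Ga" and B: "zsubgroup B" "B \<subseteq> Ga"
 shows "span A \<inter> span B = span (A \<inter> B)"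
proof
 show "span (A \<inter> B) \<subseteq> span A \<inter> span B" by (simp add: span_mono)
 show "span A \<inter> span B \<subseteq> span (A \<inter> B)"
 proof
  fix x assume x: "x \<in> span A \<inter> span B"
  obtain C1 where C1: "C1 > 0" "\<And>x. x \<in> span A ==> \<exists>a\<in>A. norm (x - a) <= C1" using cocompact[OF A(1)] by auto
  obtain C2 where C2: "C2 > 0" "\<And>x. x \<in> span B ==> \<exists>a\<in>B. norm (x - a) <= C2" using cocompact[OF B(1)] by auto
  have "\<exists>a\<in>A. norm (real m *\<^sub>R x - a) <= C1" for m using x by (intro C1(2) span_scale) auto
  then obtain a where a: "\<And>m. a m \<in> A" "\<And>m. norm (real m *\<^sub>R x - a m) <= C1" by metis
  have "\<exists>a\<in>B. norm (real m *\<^sub>R x - a) <= C2" for m using x by (intro C2(2) span_scale) auto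
  then obtain b where b: "\<And>m. b m \<in> B" "\<And>m. norm (real m *\<^sub>R x - b m) <= C2" by metis
  \<comment> \<open>The multiples \<open>m x\<close> are approximated from both groups. The
    differences \<open>a m - b m\<close> are bounded lattice vectors, so one value recurs for
    infinitely many \<open>m\<close>; then \<open>a m - a m0 = b m - b m0\<close> lies in both
    groups, and divided by \<open>m - m0\<close> it tends to \<open>x\<close>.\<close>
  have "finite (range (\<lambda>m. a m - b m))"
  proof (rule bounded_image_finite)
   fix ga assume "ga \<in> range (\<lambda>m. a m - b m)"
   then obtain m where m: "ga = a m - b m" by auto
   have "norm ((real m *\<^sub>R x - b m) - (real m *\<^sub>R x - a m)) <= C2 + C1"
    by (rule order_trans[OF norm_triangle_ineq4 add_mono[OF b(2) a(2)]])
   then show "ga \<in> Ga \<and> norm ga <= C2 + C1" using m a b A B by (auto intro!: lat_diff)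
  qed
  then obtain m0 where m0: "infinite {m \<in> UNIV. a m - b m = a m0 - b m0}"
   using pigeonhole_infinite[of UNIV "\<lambda>m. a m - b m"] by auto
  show "x \<in> span (A \<inter> B)"
  proof (rule closed_approachable[THEN iffD1, OF closed_subspace[OF subspace_span], rule_format])
   fix e :: real assume e: "e > 0"
   obtain m where m: "m > m0 + nat \<lceil>2 * C1 / e\<rceil> + 1" "a m - b m = a m0 - b m0"
    using m0 by (auto simp: infinite_nat_iff_unbounded)
   let ?t = "real m - real m0"
   have t: "?t > 2 * C1 / e" "?t > 0" using m(1) by linarith+
   let ?y = "(1 / ?t) *\<^sub>R (a m - a m0)"
   have eq: "a m - a m0 = b m - b m0" using m(2) by (simp add: algebra_simps)
   have "a m - a m0 \<in> A \<inter> B"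
    using zmod.subspace_diff[OF A(1) a(1) a(1)] zmod.subspace_diff[OF B(1) b(1) b(1)] by (metis IntI eq)
   then have "?y \<in> span (A \<inter> B)" by (intro span_scale span_base)
   moreover have "dist ?y x < e"
   proof -
    have "?t *\<^sub>R (?y - x) = (real m0 *\<^sub>R x - a m0) - (real m *\<^sub>R x - a m)"
     using t by (simp add: algebra_simps)
    then have "norm (?t *\<^sub>R (?y - x)) <= C1 + C1"
     using a(2) by (metis norm_triangle_ineq4 add_mono order_trans)
    then have "?t * norm (?y - x) <= 2 * C1" using t by simp
    also have "\<dots> < e * ?t" using t(1) e by (simp add: field_simps)
    finally show ?thesis using t by (simp add: dist_norm mult.commute)
   qed
   ultimately show "\<exists>y\<in>span (A \<inter> B). dist y x < e" by blast
  qed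
 qed
qed

text \<open>Cocompactness puts a lattice vector at bounded distance from \<open>p\<close>. Its
  internal error lies in a compact ball, which by density is covered by finitely many
  \<open>e\<close>-balls around projected lattice points. So \<open>C\<close> depends on
  \<open>e\<close> but not on \<open>p\<close>.\<close>

lemma lattice_near:
 assumes e: "e > 0"
 shows "\<exists>C>0. \<forall>p. \<exists>ga\<in>Ga. norm (I ga - I p) < e \<and> norm (ga - p) <= C"
proof -
 obtain C1 where C1: "C1 > 0" "\<And>x. \<exists>a\<in>Ga. norm (x - a) <= C1"
  using cocompact[OF zsubgroup_lattice] lattice_span by auto
 obtain KI where KI: "\<And>x. norm (I x) <= KI * norm x" "KI > 0" using bounds by metis
 let ?D = "cball 0 (KI * C1) \<inter> range I"
 have cpt: "compact ?D" using closed_subspace[OF subspace_I] by (simp add: compact_Int_closed)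
 have cov: "?D \<subseteq> (\<Union>g\<in>Ga. ball (I g) e)"
 proof
  fix y assume "y \<in> ?D"
  then obtain g where "g \<in> Ga" "norm (I g - y) < e" using dense[of y e] e by auto
  then show "y \<in> (\<Union>g\<in>Ga. ball (I g) e)" by (auto simp: dist_norm)
 qed
 obtain F where F: "F \<subseteq> Ga" "finite F" "?D \<subseteq> (\<Union>g\<in>F. ball (I g) e)"
  by (rule compactE_image[OF cpt _ cov]) auto
 define C where "C = C1 + (\<Sum>g\<in>F. norm g)"
 have "C > 0" unfolding C_def using C1 by (simp add: add_pos_nonneg sum_nonneg)
 moreover have "\<exists>ga\<in>Ga. norm (I ga - I p) < e \<and> norm (ga - p) <= C" for p
 proof -
  obtain a where a: "a \<in> Ga" "norm (p - a) <= C1" using C1(2) by blast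
  have "norm (I (p - a)) <= KI * norm (p - a)" by (rule KI)
  also have "\<dots> <= KI * C1" using KI a by simp
  finally have "I (p - a) \<in> ?D" by auto
  then obtain g where g: "g \<in> F" "norm (I g - I (p - a)) < e" using F(3) by (auto simp: dist_norm)
  have ng: "norm g <= (\<Sum>g\<in>F. norm g)" by (rule member_le_sum) (use g F in auto)
  have "norm ((a + g) - p) = norm (g - (p - a))" by (simp add: algebra_simps)
  also have "\<dots> <= norm g + norm (p - a)" by (rule norm_triangle_ineq4)
  finally have "norm ((a + g) - p) <= C" using ng a(2) unfolding C_def by linarith
  moreover have "norm (I (a + g) - I p) < e" using g(2) by (simp add: I_add I_diff algebra_simps)
  ultimately show ?thesis using a g F by (intro bexI[of _ "a + g"]) (auto intro: lat_add)
 qed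
 ultimately show ?thesis by blast
qed

text \<open>Uniform discreteness of cut and project sets: apart from vectors with physical part
  longer than 1 only finitely many candidates remain, and none of them has physical part 0.\<close>

lemma phys_separated: "\<exists>si>0. \<forall>ga\<in>Ga. ga ~= 0 \<and> norm (I ga) <= rh --> si <= norm (P ga)"
proof -
 let ?F = "{ga\<in>Ga. norm ga <= 1 + rh} - {0}"
 let ?S = "insert 1 ((\<lambda>ga. norm (P ga)) ` ?F)"
 have fin: "finite ?S" using lattice_finite by simp
 have "Min ?S > 0" using fin injP by (subst Min_gr_iff) auto
 moreover have "Min ?S <= norm (P ga)" if g: "ga \<in> Ga" "ga ~= 0" "norm (I ga) <= rh" for ga
 proof (cases "norm (P ga) <= 1")
  case True
  have "norm ga <= norm (P ga) + norm (I ga)" using PI[of ga] by (metis norm_triangle_ineq)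
  then have "ga \<in> ?F" using True g by auto
  then show ?thesis by (intro Min_le[OF fin]) auto
 next
  case False
  moreover have "Min ?S <= 1" by (intro Min_le[OF fin]) auto
  ultimately show ?thesis by linarith
 qed
 ultimately show ?thesis by blast
qed

subsection \<open>The physical norm\<close>

lemma N_nonneg: "0 <= N (P x)" and N_0: "N 0 = 0"
 and N_scale: "N (a *\<^sub>R P x) = \<bar>a\<bar> * N (P x)"
 and N_triangle: "N (P x + P y) <= N (P x) + N (P y)"
 using norm_N P_0 unfolding norm_on_def by (auto, metis rangeI)

lemma N_minus: "N (P (- x)) = N (P x)"
 using N_scale[of "-1" x] by (simp add: linear_neg[OF linP])

lemma N_triangle': "N (P (x + y)) <= N (P x) + N (P y)"
 using N_triangle by (simp add: P_add)

lemma N_equiv: "\<exists>c>0. \<exists>C>0. \<forall>x. c * norm (P x) <= N (P x) \<and> N (P x) <= C * norm (P x)"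
 using norm_on_equiv[OF subspace_P norm_N] by (metis rangeI)

lemma N_le: "\<exists>C>0. \<forall>x. N (P x) <= C * norm x"
proof -
 obtain KP where KP: "KP > 0" "\<And>x. norm (P x) <= KP * norm x" using bounds by metis
 obtain C where C: "C > 0" "\<And>x. N (P x) <= C * norm (P x)" using N_equiv by metis
 have "N (P x) <= (C * KP) * norm x" for x
 proof -
  have "C * norm (P x) <= C * (KP * norm x)" using KP(2) C(1) by simp
  then show ?thesis using C(2)[of x] by (simp add: mult.assoc)
 qed
 then show ?thesis using C KP by (intro exI[of _ "C * KP"]) auto
qed

lemma norm_le_N: "\<exists>C>0. \<forall>x. norm x <= C * N (P x) + norm (I x)"
proof -
 obtain c where c: "c > 0" "\<And>x. c * norm (P x) <= N (P x)" using N_equiv by metis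
 have "norm x <= (1 / c) * N (P x) + norm (I x)" for x
 proof -
  have "norm x <= norm (P x) + norm (I x)" using PI[of x] by (metis norm_triangle_ineq)
  moreover have "norm (P x) <= (1 / c) * N (P x)" using c(2)[of x] c(1) by (simp add: field_simps)
  ultimately show ?thesis by linarith
 qed
 then show ?thesis using c by (intro exI[of _ "1 / c"]) auto
qed

subsection \<open>Counting lattice points\<close>

definition pts :: "real \<Rightarrow> 'e set \<Rightarrow> 'e set" where
 "pts R A = {ga\<in>Ga. N (P ga) <= R \<and> I ga \<in> A}"

text \<open>Stands in for the volume of \<open>A\<close> times \<open>R ^ d\<close>.\<close>

definition cnt :: "real \<Rightarrow> 'e set \<Rightarrow> real" where
 "cnt R A = real (card (pts R A))"

lemma pts_finite: assumes "bounded A" shows "finite (pts R A)"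
proof -
 obtain rh where rh: "\<And>x. x \<in> A ==> norm x <= rh" using assms by (auto simp: bounded_iff)
 obtain C where C: "C > 0" "\<And>x. norm x <= C * N (P x) + norm (I x)" using norm_le_N by metis
 show ?thesis
 proof (rule bounded_image_finite)
  fix ga assume g: "ga \<in> pts R A"
  have "norm ga <= C * N (P ga) + norm (I ga)" by (rule C)
  also have "\<dots> <= C * R + rh" using g rh C(1) by (intro add_mono mult_left_mono) (auto simp: pts_def)
  finally show "ga \<in> Ga \<and> norm ga <= C * R + rh" using g by (auto simp: pts_def)
 qed
qed

lemma cnt_nonneg: "0 <= cnt R A" by (simp add: cnt_def)

lemma cnt_mono: "bounded B ==> A \<subseteq> B ==> R <= R' ==> cnt R A <= cnt R' B"
 unfolding cnt_def by (intro of_nat_mono card_mono pts_finite) (auto simp: pts_def)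

lemma cnt_Un: "bounded A ==> bounded B ==> cnt R (A \<union> B) <= cnt R A + cnt R B"
proof -
 have "pts R (A \<union> B) = pts R A \<union> pts R B" by (auto simp: pts_def)
 then show ?thesis unfolding cnt_def by (simp add: card_Un_le flip: of_nat_add)
qed

lemma cnt_UN: "finite F ==> (\<And>i. i \<in> F ==> bounded (A i)) ==> cnt R (\<Union>i\<in>F. A i) <= (\<Sum>i\<in>F. cnt R (A i))"
proof (induction F rule: finite_induct)
 case empty then show ?case by (simp add: cnt_def pts_def)
next
 case (insert x F)
 have "bounded (\<Union>i\<in>F. A i)" using insert by (intro bounded_UN) auto
 then have "cnt R (\<Union>i\<in>insert x F. A i) <= cnt R (A x) + cnt R (\<Union>i\<in>F. A i)"
  using cnt_Un insert by simp
 also have "\<dots> <= cnt R (A x) + (\<Sum>i\<in>F. cnt R (A i))" using insert by simp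
 finally show ?case using insert by simp
qed

lemma cnt_disjoint_UN:
 assumes "finite F" "\<And>i. i \<in> F ==> bounded (A i)"
  "\<And>i j. i \<in> F ==> j \<in> F ==> i ~= j ==> A i \<inter> A j = {}"
 shows "cnt R (\<Union>i\<in>F. A i) = (\<Sum>i\<in>F. cnt R (A i))"
proof -
 have "pts R (\<Union>i\<in>F. A i) = (\<Union>i\<in>F. pts R (A i))" by (auto simp: pts_def)
 moreover have "card (\<Union>i\<in>F. pts R (A i)) = (\<Sum>i\<in>F. card (pts R (A i)))"
 proof (rule card_UN_disjoint[OF assms(1)])
  show "\<forall>i\<in>F. finite (pts R (A i))" using assms(2) pts_finite by blast
  show "\<forall>i\<in>F. \<forall>j\<in>F. i ~= j --> pts R (A i) \<inter> pts R (A j) = {}" using assms(3) unfolding pts_def by blast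
 qed
 ultimately show ?thesis by (simp add: cnt_def)
qed

text \<open>The counterpart of translation invariance; the price is a shift of the radius, which
  \<open>cnt_annulus\<close> shows to be negligible.\<close>

lemma cnt_translate_le:
 assumes "g \<in> Ga" "bounded B" "\<And>y. y \<in> A ==> y + I g \<in> B"
 shows "cnt R A <= cnt (R + N (P g)) B"
proof -
 have "(\<lambda>ga. ga + g) ` pts R A \<subseteq> pts (R + N (P g)) B"
 proof
  fix z assume "z \<in> (\<lambda>ga. ga + g) ` pts R A"
  then obtain ga where "z = ga + g" "ga \<in> Ga" "N (P ga) <= R" "I ga \<in> A" by (auto simp: pts_def)
  then show "z \<in> pts (R + N (P g)) B"
   using assms N_triangle'[of ga g] by (auto simp: pts_def I_add intro: lat_add)
 qed
 then have "card ((\<lambda>ga. ga + g) ` pts R A) <= card (pts (R + N (P g)) B)"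
  using pts_finite[OF assms(2)] by (rule card_mono[rotated])
 then show ?thesis by (simp add: cnt_def card_image)
qed

lemma cnt_upper:
 assumes "bounded A" shows "\<exists>C>0. \<forall>R\<ge>1. cnt R A <= C * R ^ d"
proof -
 obtain rh where rh: "rh >= 0" "\<And>x. x \<in> A ==> norm x <= rh" using assms by (metis bounded_pos less_imp_le)
 obtain si where s: "si > 0" "\<forall>ga\<in>Ga. ga ~= 0 --> si <= norm ga" using lattice_separated by auto
 obtain k where k: "k > 0" "\<And>x. norm x <= k * N (P x) + norm (I x)" using norm_le_N by metis
 obtain C where C: "C > 0" and Cb: "\<forall>r\<ge>1. \<forall>X. (\<forall>x\<in>X. norm x <= r \<and> (\<exists>y\<in>range P. norm (x - y) <= rh)) \<and>
  (\<forall>x\<in>X. \<forall>y\<in>X. x ~= y --> si <= norm (x - y)) --> finite X \<and> real (card X) <= C * r ^ d"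
  using packing_upper[OF subspace_P s(1), of rh] by metis
 have "cnt R A <= (C * (k + rh + 1) ^ d) * R ^ d" if R: "R >= 1" for R
 proof -
  have 1: "norm x <= (k + rh + 1) * R \<and> (\<exists>y\<in>range P. norm (x - y) <= rh)" if x: "x \<in> pts R A" for x
  proof
   have "norm x <= k * N (P x) + norm (I x)" by (rule k)
   also have "\<dots> <= k * R + rh * R"
   proof (rule add_mono)
    show "k * N (P x) <= k * R" using x k by (auto simp: pts_def)
    have "norm (I x) <= rh" using x rh by (auto simp: pts_def)
    also have "\<dots> <= rh * R" using rh R by (simp add: mult_le_cancel_left1)
    finally show "norm (I x) <= rh * R" .
   qed
   finally show "norm x <= (k + rh + 1) * R" using R by (simp add: algebra_simps)
   have "x - P x = I x" using PI[of x] by (simp add: algebra_simps)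
   then show "\<exists>y\<in>range P. norm (x - y) <= rh" using x rh by (intro bexI[of _ "P x"]) (auto simp: pts_def)
  qed
  have 2: "\<forall>x\<in>pts R A. \<forall>y\<in>pts R A. x ~= y --> si <= norm (x - y)"
   using s(2) lat_diff unfolding pts_def by auto
  have "1 * 1 <= (k + rh + 1) * R" using R k rh by (intro mult_mono) auto
  then have "real (card (pts R A)) <= C * ((k + rh + 1) * R) ^ d" using Cb[rule_format, of "(k + rh + 1) * R" "pts R A"] 1 2 by auto
  then show ?thesis by (simp add: cnt_def power_mult_distrib mult.assoc)
 qed
 moreover have "C * (k + rh + 1) ^ d > 0" using C k rh by (intro mult_pos_pos zero_less_power) auto
 ultimately show ?thesis by blast
qed

text \<open>The points of a packing in the physical space are displaced to lattice vectors whose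
  internal part is close to \<open>a\<close>.\<close>

lemma cnt_lower:
 assumes A: "bounded A" and a: "a \<in> range I" "e > 0" "\<And>y. y \<in> range I ==> norm (y - a) < e ==> y \<in> A"
 shows "\<exists>c>0. \<exists>R0\<ge>1. \<forall>R\<ge>R0. c * R ^ d <= cnt R A"
proof -
 obtain C where C: "C > 0" "\<And>p. \<exists>ga\<in>Ga. norm (I ga - I p) < e \<and> norm (ga - p) <= C" using lattice_near[OF a(2)] by metis
 \<comment> \<open>The displacement is at most \<open>C\<close>, so packing points more than
   \<open>2 C\<close> apart yield different lattice vectors.\<close>
 define s where "s = 2 * C + 1"
 have s: "s > 0" using C by (simp add: s_def)
 obtain c where c: "c > 0" "\<And>r. r >= 0 ==> \<exists>X. finite X \<and> X \<subseteq> range P \<and> (\<forall>x\<in>X. norm x <= r) \<and>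
  (\<forall>x\<in>X. \<forall>y\<in>X. x ~= y --> s <= norm (x - y)) \<and> c * r ^ d <= real (card X)"
  using packing_lower[OF subspace_P s] by metis
 obtain k where k: "k > 0" "\<And>x. N (P x) <= k * norm x" using N_le by metis
 define R0 where "R0 = 2 * k * (norm a + C) + 1"
 have R0: "R0 >= 1" using k C by (simp add: R0_def)
 have "(c * (1 / (2 * k)) ^ d) * R ^ d <= cnt R A" if R: "R >= R0" for R
 proof -
  have "R / (2 * k) >= 0" using R R0 k by simp
  from c(2)[OF this] obtain X where X: "finite X" "X \<subseteq> range P" "\<forall>x\<in>X. norm x <= R / (2 * k)"
   "\<forall>x\<in>X. \<forall>y\<in>X. x ~= y --> s <= norm (x - y)" "c * (R / (2 * k)) ^ d <= real (card X)" by blast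
  obtain f where f: "\<And>x. f x \<in> Ga" "\<And>x. norm (I (f x) - I (x + a)) < e" "\<And>x. norm (f x - (x + a)) <= C"
  proof -
   have "\<forall>x. \<exists>ga. ga \<in> Ga \<and> norm (I ga - I (x + a)) < e \<and> norm (ga - (x + a)) <= C" using C(2) by blast
   then show ?thesis using that by metis
  qed
  have ij: "inj_on f X"
  proof (rule inj_onI, rule ccontr)
   fix x y assume xy: "x \<in> X" "y \<in> X" "f x = f y" "x ~= y"
   have "norm ((f y - (y + a)) - (f x - (x + a))) <= C + C"
    by (rule order_trans[OF norm_triangle_ineq4 add_mono[OF f(3) f(3)]])
   then have "norm (x - y) <= 2 * C" using xy(3) by (simp add: algebra_simps)
   moreover have "s <= norm (x - y)" using X(4) xy by blast
   ultimately show False by (simp add: s_def)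
  qed
  have "f ` X \<subseteq> pts R A"
  proof
   fix z assume "z \<in> f ` X"
   then obtain x where x: "x \<in> X" "z = f x" by auto
   have "I x = 0" using X(2) x(1) I_eq_0_iff by blast
   then have "norm (I (f x) - a) < e" using f(2)[of x] I_id[OF a(1)] by (simp add: I_add)
   then have "I (f x) \<in> A" by (rule a(3)[OF rangeI])
   moreover have "N (P (f x)) <= R"
   proof -
    have "norm (f x) <= norm (f x - (x + a)) + norm (x + a)" by norm
    also have "\<dots> <= C + (norm x + norm a)"
     by (intro add_mono f(3) norm_triangle_ineq)
    also have "\<dots> <= C + (R / (2 * k) + norm a)" using X(3) x by simp
    finally have "norm (f x) <= C + (R / (2 * k) + norm a)" .
    then have "N (P (f x)) <= k * (C + (R / (2 * k) + norm a))"
     using k(2)[of "f x"] k(1) by (meson mult_left_mono less_imp_le order_trans)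
    also have "\<dots> = R / 2 + k * (norm a + C)" using k by (simp add: field_simps)
    also have "\<dots> <= R" using R unfolding R0_def by linarith
    finally show ?thesis .
   qed
   ultimately show "z \<in> pts R A" using f(1) x by (simp add: pts_def)
  qed
  then have "card (f ` X) <= card (pts R A)" using pts_finite[OF A] by (rule card_mono[rotated])
  then have "real (card X) <= cnt R A" using ij by (simp add: card_image cnt_def)
  then show ?thesis using X(5) by (simp add: power_divide)
 qed
 moreover have "c * (1 / (2 * k)) ^ d > 0" using c k by simp
 ultimately show ?thesis using R0 by blast
qed

text \<open>The shell of physical norms between \<open>R\<close> and \<open>R + s\<close> holds only
  \<open>O(R ^ (d - 1))\<close> points. To see this without volumes, about
  \<open>R / (2 (s + 1))\<close> shrunken copies of the shell are placed in the ball; together they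
  are still uniformly separated, so the packing bound applies to their union.\<close>

lemma cnt_annulus:
 assumes A: "bounded A" and s: "s >= 0" and e: "e > 0" and d: "d >= 1"
 shows "\<forall>\<^sub>F R in at_top. cnt (R + s) A <= cnt R A + e * R ^ d"
proof -
 obtain rh where rh: "\<And>x. x \<in> A ==> norm x <= rh" using A by (metis bounded_pos)
 obtain si where si: "si > 0" "\<forall>ga\<in>Ga. ga ~= 0 \<and> norm (I ga) <= 2 * rh --> si <= norm (P ga)" using phys_separated by metis
 obtain c k where ck: "c > 0" "k > 0" "\<And>x. c * norm (P x) <= N (P x)" "\<And>x. N (P x) <= k * norm (P x)" using N_equiv by metis
 \<comment> \<open>Scaling factors are at least 1/2, which leaves \<open>si / 2\<close> inside one
   copy; points of different copies are at least 1 apart in \<open>N\<close>, which gives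
   \<open>1 / k\<close>.\<close>
 define ta where "ta = min (si / 2) (1 / k)"
 have ta: "ta > 0" using si ck by (simp add: ta_def)
 obtain C where C: "C > 0" and Cb: "\<forall>r\<ge>1. \<forall>X. (\<forall>x\<in>X. norm x <= r \<and> (\<exists>y\<in>range P. norm (x - y) <= 0)) \<and>
  (\<forall>x\<in>X. \<forall>y\<in>X. x ~= y --> ta <= norm (x - y)) --> finite X \<and> real (card X) <= C * r ^ d"
  using packing_upper[OF subspace_P ta, of 0] by metis
 define D where "D = C * (2 / c + 1) ^ d * (4 * (s + 1))"
 have main: "cnt (R + s) A <= cnt R A + e * R ^ d" if R: "R >= 4 * (s + 1)" "R >= D / e" "R >= 1" for R
 proof -
  let ?X = "pts (R + s) A - pts R A"
  have fin: "finite ?X" using pts_finite[OF A] by simp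
  have XI: "ga \<in> Ga" "R < N (P ga)" "N (P ga) <= R + s" "I ga \<in> A" if "ga \<in> ?X" for ga using that by (auto simp: pts_def)
  define M where "M = nat \<lfloor>R / (2 * (s + 1))\<rfloor>"
  have M: "real M <= R / (2 * (s + 1))" "real M >= R / (4 * (s + 1))"
  proof -
   define q where "q = R / (2 * (s + 1))"
   have q: "q >= 2" "R / (4 * (s + 1)) = q / 2" unfolding q_def using R s by (simp_all add: field_simps)
   then have "real M = real_of_int \<lfloor>q\<rfloor>" unfolding M_def q_def by simp
   then have "real M <= q" "q / 2 <= real M" using q(1) by linarith+
   then show "real M <= R / (2 * (s + 1))" "real M >= R / (4 * (s + 1))" unfolding q(2) q_def by simp_all
  qed
  \<comment> \<open>Copy \<open>m\<close> lies within the norms from \<open>R - m (s + 1)\<close> to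
    \<open>R - m (s + 1) + s\<close>, so a gap of 1 remains between consecutive copies.\<close>
  define t where "t m = 1 - real m * (s + 1) / R" for m :: nat
  have tR: "t m * R = R - real m * (s + 1)" for m using R by (simp add: t_def field_simps)
  have t: "1 / 2 <= t m" "t m <= 1" if "m < M" for m
  proof -
   have "real m <= R / (2 * (s + 1))" using that M by linarith
   then have "real m * (s + 1) <= R / 2" using s by (simp add: field_simps)
   then show "1 / 2 <= t m" using R unfolding t_def by (simp add: field_simps)
   show "t m <= 1" unfolding t_def using s R by simp
  qed
  define g where "g = (\<lambda>(m, ga). t m *\<^sub>R P ga)"
  have sep: "ta <= norm (g (m, ga) - g (m', ga'))" if q: "m < M" "m' < M" "ga \<in> ?X" "ga' \<in> ?X" "(m, ga) ~= (m', ga')" "m <= m'" for m m' ga ga'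
  proof (cases "m = m'")
   case True
   then have "ga - ga' ~= 0" using q by auto
   moreover have "norm (I (ga - ga')) <= 2 * rh"
    using rh[OF XI(4)[OF q(3)]] rh[OF XI(4)[OF q(4)]] norm_triangle_ineq4[of "I ga" "I ga'"] by (simp add: I_diff)
   ultimately have "si <= norm (P (ga - ga'))" using si(2) lat_diff XI(1) q by blast
   then have "1 / 2 * si <= t m * norm (P (ga - ga'))" using t(1)[OF q(1)] si by (intro mult_mono) auto
   also have "\<dots> = norm (g (m, ga) - g (m', ga'))"
    using True t(1)[OF q(1)] by (simp add: g_def P_diff flip: scaleR_diff_right)
   finally show ?thesis unfolding ta_def by auto
  next
   case False
   then have mm: "real m + 1 <= real m'" using q by linarith
   have a: "N (t m *\<^sub>R P ga) >= R - real m * (s + 1)"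
   proof -
    have "t m * R <= t m * N (P ga)" using XI(2)[OF q(3)] t(1)[OF q(1)] by (intro mult_left_mono) auto
    moreover have "N (t m *\<^sub>R P ga) = t m * N (P ga)" using t(1)[OF q(1)] by (simp add: N_scale)
    ultimately show ?thesis using tR[of m] by linarith
   qed
   have "N (t m' *\<^sub>R P ga') <= t m' * (R + s)"
    using XI(3)[OF q(4)] t(1)[OF q(2)] by (simp add: N_scale)
   also have "\<dots> <= R - real m' * (s + 1) + s" using t(2)[OF q(2)] s tR[of m'] mult_left_le_one_le[of s "t m'"] t(1)[OF q(2)]
    by (simp add: distrib_left)
   also have "\<dots> <= R - (real m + 1) * (s + 1) + s" using mm s by (simp add: mult_right_mono)
   finally have b: "N (t m' *\<^sub>R P ga') <= R - real m * (s + 1) - 1" by (simp add: algebra_simps)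
   have "N (t m *\<^sub>R P ga) <= N (t m *\<^sub>R P ga - t m' *\<^sub>R P ga') + N (t m' *\<^sub>R P ga')"
    using N_triangle'[of "t m *\<^sub>R ga - t m' *\<^sub>R ga'" "t m' *\<^sub>R ga'"] by (simp add: P_diff P_scale)
   then have "1 <= N (t m *\<^sub>R P ga - t m' *\<^sub>R P ga')" using a b by linarith
   also have "\<dots> <= k * norm (t m *\<^sub>R P ga - t m' *\<^sub>R P ga')"
    using ck(4)[of "t m *\<^sub>R ga - t m' *\<^sub>R ga'"] by (simp add: P_diff P_scale)
   finally have "1 / k <= norm (t m *\<^sub>R P ga - t m' *\<^sub>R P ga')" using ck by (simp add: field_simps)
   then show ?thesis unfolding ta_def g_def by auto
  qed
  have sep2: "ta <= norm (g u - g v)" if "u \<in> {..<M} \<times> ?X" "v \<in> {..<M} \<times> ?X" "u ~= v" for u v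
  proof (cases "fst u <= fst v")
   case True then show ?thesis using sep[of "fst u" "fst v" "snd u" "snd v"] that by auto
  next
   case False then show ?thesis using sep[of "fst v" "fst u" "snd v" "snd u"] that
    by (auto simp: norm_minus_commute)
  qed
  have ij: "inj_on g ({..<M} \<times> ?X)"
   using sep2 ta by (auto intro!: inj_onI) (metis SigmaI diff_self fst_conv lessThan_iff not_le norm_zero snd_conv)+
  have "norm x <= (2 / c + 1) * R \<and> (\<exists>y\<in>range P. norm (x - y) <= 0)" if gx: "x \<in> g ` ({..<M} \<times> ?X)" for x
  proof -
   obtain m ga where x: "x = t m *\<^sub>R P ga" "m < M" "ga \<in> ?X" using gx by (auto simp: g_def)
   have "norm x <= 1 * norm (P ga)" using t[OF x(2)] mult_right_mono[of "t m" 1 "norm (P ga)"] by (simp add: x(1))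
   also have "\<dots> <= (R + s) / c" using ck(1,3) XI(3)[OF x(3)] order_trans by (fastforce simp: field_simps)
   also have "\<dots> <= (2 * R) / c" using R s ck by (intro divide_right_mono) auto
   also have "\<dots> <= (2 / c + 1) * R" using R by (simp add: algebra_simps)
   finally show ?thesis using x(1) by (auto intro!: bexI[of _ x] simp: image_iff) (metis P_scale)
  qed
  moreover have "\<forall>x\<in>g ` ({..<M} \<times> ?X). \<forall>y\<in>g ` ({..<M} \<times> ?X). x ~= y --> ta <= norm (x - y)"
  proof (intro ballI impI)
   fix x y assume xy: "x \<in> g ` ({..<M} \<times> ?X)" "y \<in> g ` ({..<M} \<times> ?X)" "x ~= y"
   obtain u v where "x = g u" "y = g v" "u \<in> {..<M} \<times> ?X" "v \<in> {..<M} \<times> ?X" using xy(1,2) by blast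
   then show "ta <= norm (x - y)" using sep2[of u v] xy(3) by blast
  qed
  moreover have "(2 / c + 1) * R >= 1" using R ck mult_mono[of 1 "2 / c + 1" 1 R] by simp
  ultimately have "real (card (g ` ({..<M} \<times> ?X))) <= C * ((2 / c + 1) * R) ^ d"
   using Cb[rule_format, of "(2 / c + 1) * R" "g ` ({..<M} \<times> ?X)"] by blast
  then have "real M * real (card ?X) <= C * (2 / c + 1) ^ d * R ^ d"
   using ij by (simp add: card_image card_cartesian_product power_mult_distrib mult.assoc)
  moreover have "R / (4 * (s + 1)) * real (card ?X) <= real M * real (card ?X)" using M by (intro mult_right_mono) auto
  ultimately have "R / (4 * (s + 1)) * real (card ?X) <= C * (2 / c + 1) ^ d * R ^ d" by linarith
  then have "R * real (card ?X) <= D * R ^ d" using s unfolding D_def by (simp add: field_simps)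
  also have "\<dots> <= (e * R) * R ^ d" using R e by (intro mult_right_mono) (auto simp: field_simps)
  finally have "R * real (card ?X) <= R * (e * R ^ d)" by (simp add: mult_ac)
  then have X: "real (card ?X) <= e * R ^ d" using R by simp
  have "pts R A \<subseteq> pts (R + s) A" using s by (auto simp: pts_def)
  then have "card (pts (R + s) A) = card (pts R A) + card ?X"
   using pts_finite[OF A] by (metis add.commute card_Diff_subset card_mono le_add_diff_inverse)
  then show ?thesis using X by (simp add: cnt_def)
 qed
 show ?thesis
  using eventually_ge_at_top[of "4 * (s + 1)"] eventually_ge_at_top[of "D / e"] eventually_ge_at_top[of 1]
  by eventually_elim (rule main)
qed

text \<open>Replaces the volume of a box: at least as many translates of \<open>A\<close> by lattice
  vectors as the product of the \<open>1 / et j\<close> are disjoint and stay in a fixed ball, and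
  each has at least the count of \<open>A\<close> after enlarging the radius. \<open>C\<close> is
  uniform in the box; only \<open>R0\<close> depends on it.\<close>

lemma cnt_box:
 assumes J: "finite J" and d: "d >= 1"
  and u: "\<And>j. j \<in> J ==> u j \<in> range I"
  and dual: "\<And>i j. i \<in> J ==> j \<in> J ==> a i \<bullet> u j = (if i = j then 1 else 0)"
 shows "\<exists>C>0. \<forall>be et A. (\<forall>j\<in>J. 0 < et j \<and> et j <= 1) \<and>
  (\<forall>y\<in>A. norm y <= rh \<and> (\<forall>j\<in>J. \<bar>a j \<bullet> y - be j\<bar> <= et j)) -->
  (\<exists>R0\<ge>1. \<forall>R\<ge>R0. cnt R A <= C * (\<Prod>j\<in>J. et j) * R ^ d)"
proof -
 define rh' where "rh' = \<bar>rh\<bar> + 6 * (\<Sum>j\<in>J. norm (u j)) + 1"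
 obtain C0 where C0: "C0 > 0" "\<And>R. R >= 1 ==> cnt R (cball 0 rh') <= C0 * R ^ d"
  using cnt_upper[OF bounded_cball[of 0 rh']] by auto
 have "\<exists>R0\<ge>1. \<forall>R\<ge>R0. cnt R A <= (C0 * 2 ^ d) * (\<Prod>j\<in>J. et j) * R ^ d"
  if et: "\<forall>j\<in>J. 0 < et j \<and> et j <= 1" and A: "\<forall>y\<in>A. norm y <= rh \<and> (\<forall>j\<in>J. \<bar>a j \<bullet> y - be j\<bar> <= et j)" for be et A
 proof -
  define M where "M j = nat \<lceil>1 / et j\<rceil>" for j
  have M: "1 / et j <= real (M j)" "real (M j) * et j <= 2" if "j \<in> J" for j
  proof -
   have e: "0 < et j" "et j <= 1" using et that by auto
   have "1 / et j > 0" using e by simp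
   then have "\<lceil>1 / et j\<rceil> >= 0" by linarith
   then have "real (M j) = real_of_int \<lceil>1 / et j\<rceil>" unfolding M_def by simp
   then have m: "1 / et j <= real (M j)" "real (M j) <= 1 / et j + 1" by linarith+
   show "1 / et j <= real (M j)" by (rule m)
   have "real (M j) * et j <= (1 / et j + 1) * et j" using m(2) e by (intro mult_right_mono) auto
   also have "\<dots> = 1 + et j" using e by (simp add: distrib_right)
   finally show "real (M j) * et j <= 2" using e by simp
  qed
  let ?Z = "PiE J (\<lambda>j. {..<M j})"
  \<comment> \<open>Spacing \<open>3 et j\<close> leaves room: a box extends \<open>et j\<close> to
    either side of its centre, and approximating \<open>p z\<close> by a lattice vector costs at
    most \<open>et j / 4\<close>.\<close>
  define p where "p z = (\<Sum>j\<in>J. (3 * et j * real (z j)) *\<^sub>R u j)" for z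
  have ap: "a i \<bullet> p z = 3 * et i * real (z i)" if "i \<in> J" for i z
  proof -
   have "a i \<bullet> p z = (\<Sum>j\<in>J. 3 * et j * real (z j) * (a i \<bullet> u j))" by (simp add: p_def inner_sum_right)
   also have "\<dots> = (\<Sum>j\<in>J. if j = i then 3 * et i * real (z i) else 0)"
    by (rule sum.cong) (use that dual in auto)
   finally show ?thesis using that J by simp
  qed
  have np: "norm (p z) <= 6 * (\<Sum>j\<in>J. norm (u j))" if z: "z \<in> ?Z" for z
   unfolding p_def sum_distrib_left
  proof (rule sum_norm_le)
   fix j assume j: "j \<in> J"
   have "z j < M j" using PiE_mem[OF z j] by simp
   then have "et j * real (z j) <= et j * real (M j)" using et j by (intro mult_left_mono) auto
   also have "\<dots> <= 2" using M(2)[OF j] by (simp add: mult.commute)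
   finally have "3 * et j * real (z j) <= 6" by simp
   then show "norm ((3 * et j * real (z j)) *\<^sub>R u j) <= 6 * norm (u j)"
    using et j by (auto intro!: mult_right_mono)
  qed
  have pI: "p z \<in> range I" for z unfolding p_def
   by (intro subspace_sum[OF subspace_I] subspace_scale[OF subspace_I] u)
  have "\<exists>e>0. e <= 1 \<and> (\<forall>j\<in>J. norm (a j) * e <= et j / 4)"
  proof -
   have "\<forall>\<^sub>F e in at_right 0. norm (a j) * e <= et j / 4" if "j \<in> J" for j
   proof -
    have "((\<lambda>e. norm (a j) * e) \<longlongrightarrow> norm (a j) * 0) (at_right 0)" by (intro tendsto_intros)
    then have "\<forall>\<^sub>F e in at_right 0. norm (a j) * e < et j / 4" by (rule order_tendstoD) (use et that in auto)
    then show ?thesis by eventually_elim simp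
   qed
   then have "\<forall>\<^sub>F e in at_right 0. \<forall>j\<in>J. norm (a j) * e <= et j / 4" using J by (simp add: eventually_ball_finite)
   moreover have "\<forall>\<^sub>F e in at_right (0::real). e \<in> {0<..<1}" by (rule eventually_at_right_real) simp
   ultimately have "\<forall>\<^sub>F e in at_right (0::real). e > 0 \<and> e <= 1 \<and> (\<forall>j\<in>J. norm (a j) * e <= et j / 4)"
    by eventually_elim auto
   then show ?thesis using eventually_happens trivial_limit_at_right_real by blast
  qed
  then obtain e where e: "e > 0" "e <= 1" "\<And>j. j \<in> J ==> norm (a j) * e <= et j / 4" by blast
  have "\<forall>z. \<exists>g\<in>Ga. norm (I g - p z) < e" using dense[OF pI e(1)] by blast
  then obtain g where g: "\<And>z. g z \<in> Ga" "\<And>z. norm (I (g z) - p z) < e" by metis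
  define s where "s = (\<Sum>z\<in>?Z. N (P (g z)))"
  have finZ: "finite ?Z" using J by (simp add: finite_PiE)
  have s: "N (P (g z)) <= s" if "z \<in> ?Z" for z unfolding s_def
   by (rule member_le_sum[OF that]) (use finZ N_nonneg in auto)
  have s0: "s >= 0" unfolding s_def by (simp add: sum_nonneg N_nonneg)
  define T where "T z = (\<lambda>y. y + I (g z)) ` A" for z
  have Tsub: "T z \<subseteq> cball 0 rh'" if z: "z \<in> ?Z" for z
  proof
   fix x assume "x \<in> T z"
   then obtain y where y: "y \<in> A" "x = y + I (g z)" by (auto simp: T_def)
   have "norm x <= norm y + norm (I (g z) - p z) + norm (p z)" unfolding y(2) by norm
   moreover have "norm y <= \<bar>rh\<bar>" using A y(1) by fastforce
   ultimately show "x \<in> cball 0 rh'" using np[OF z] g(2)[of z] e(2) unfolding rh'_def by simp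
  qed
  have disj: "T z \<inter> T z' = {}" if z: "z \<in> ?Z" "z' \<in> ?Z" "z ~= z'" for z z'
  proof (rule ccontr)
   assume "T z \<inter> T z' ~= {}"
   then obtain x where x: "x \<in> T z" "x \<in> T z'" by blast
   obtain y where y: "y \<in> A" "x = y + I (g z)" using x(1) unfolding T_def by blast
   obtain y' where y': "y' \<in> A" "x = y' + I (g z')" using x(2) unfolding T_def by blast
   obtain j where j: "j \<in> J" "z j ~= z' j" using z(3) PiE_ext[OF z(1) z(2)] by auto
   have ej: "et j > 0" using et j by auto
   have b: "\<bar>a j \<bullet> (I (g w) - p w)\<bar> <= et j / 4" for w
   proof -
    have "\<bar>a j \<bullet> (I (g w) - p w)\<bar> <= norm (a j) * norm (I (g w) - p w)" by (rule Cauchy_Schwarz_ineq2)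
    also have "\<dots> <= norm (a j) * e" using g(2)[of w] by (intro mult_left_mono) auto
    finally show ?thesis using e(3)[OF j(1)] by linarith
   qed
   have "1 <= \<bar>real (z j) - real (z' j)\<bar>" using j(2) by linarith
   then have "3 * et j * 1 <= 3 * et j * \<bar>real (z j) - real (z' j)\<bar>" using ej by (intro mult_left_mono) auto
   also have "\<dots> = \<bar>a j \<bullet> p z - a j \<bullet> p z'\<bar>" using ej by (simp add: ap[OF j(1)] abs_mult flip: right_diff_distrib)
   finally have c: "3 * et j <= \<bar>a j \<bullet> p z - a j \<bullet> p z'\<bar>" by simp
   have "a j \<bullet> y + a j \<bullet> I (g z) = a j \<bullet> y' + a j \<bullet> I (g z')"
    using y(2) y'(2) by (metis inner_add_right)
   moreover have "\<bar>a j \<bullet> y - be j\<bar> <= et j" "\<bar>a j \<bullet> y' - be j\<bar> <= et j" using A y(1) y'(1) j(1) by auto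
   ultimately show False using b[of z] b[of z'] c ej unfolding inner_diff_right by linarith
  qed
  have bA: "bounded (T z)" if "z \<in> ?Z" for z using Tsub[OF that] bounded_cball bounded_subset by blast
  have "cnt R A <= (C0 * 2 ^ d) * (\<Prod>j\<in>J. et j) * R ^ d" if R: "R >= s + 1" for R
  proof -
   have "(\<Prod>j\<in>J. 1 / et j) <= (\<Prod>j\<in>J. real (M j))"
    by (intro prod_mono) (use M(1) et in \<open>auto simp: less_imp_le\<close>)
   then have "(\<Prod>j\<in>J. 1 / et j) * cnt R A <= (\<Prod>j\<in>J. real (M j)) * cnt R A"
    by (rule mult_right_mono) (rule cnt_nonneg)
   also have "(\<Prod>j\<in>J. real (M j)) * cnt R A = (\<Sum>z\<in>?Z. cnt R A)" using J by (simp add: card_PiE)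
   also have "\<dots> <= (\<Sum>z\<in>?Z. cnt (R + s) (T z))"
   proof (rule sum_mono)
    fix z assume z: "z \<in> ?Z"
    have "cnt R A <= cnt (R + N (P (g z))) (T z)"
     by (rule cnt_translate_le[OF g(1) bA[OF z]]) (auto simp: T_def)
    also have "\<dots> <= cnt (R + s) (T z)" by (rule cnt_mono[OF bA[OF z]]) (use s[OF z] in auto)
    finally show "cnt R A <= cnt (R + s) (T z)" .
   qed
   also have "\<dots> = cnt (R + s) (\<Union>z\<in>?Z. T z)"
    by (rule cnt_disjoint_UN[symmetric, OF finZ bA disj])
   also have "\<dots> <= cnt (R + s) (cball 0 rh')" using Tsub by (intro cnt_mono) auto
   also have "\<dots> <= C0 * (R + s) ^ d" using R s0 by (intro C0(2)) auto
   also have "\<dots> <= C0 * (2 * R) ^ d" using C0(1) R s0 by (intro mult_left_mono power_mono) auto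
   finally have "(\<Prod>j\<in>J. 1 / et j) * cnt R A <= C0 * 2 ^ d * R ^ d" by (simp add: power_mult_distrib)
   moreover have pos: "(\<Prod>j\<in>J. et j) > 0" by (rule prod_pos) (use et in auto)
   moreover have "(\<Prod>j\<in>J. 1 / et j) = 1 / (\<Prod>j\<in>J. et j)" by (simp add: prod_dividef)
   ultimately show ?thesis by (simp add: field_simps)
  qed
  then show ?thesis using s0 by (intro exI[of _ "s + 1"]) auto
 qed
 moreover have "C0 * 2 ^ d > 0" using C0 by simp
 ultimately show ?thesis by blast
qed

lemma cnt_slab:
 assumes d: "d >= 1" and a: "a \<in> range I" "a ~= 0"
 shows "\<exists>C>0. \<forall>be et A. 0 < et \<and> et <= 1 \<and> (\<forall>y\<in>A. norm y <= rh \<and> \<bar>a \<bullet> y - be\<bar> <= et) -->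
  (\<exists>R0\<ge>1. \<forall>R\<ge>R0. cnt R A <= C * et * R ^ d)"
proof -
 have u: "(1 / (a \<bullet> a)) *\<^sub>R a \<in> range I" using a subspace_I by (simp add: subspace_scale)
 obtain C where "C > 0" and C: "\<forall>be et A. (\<forall>j\<in>{0::nat}. 0 < et j \<and> et j <= 1) \<and>
  (\<forall>y\<in>A. norm y <= rh \<and> (\<forall>j\<in>{0}. \<bar>a \<bullet> y - be j\<bar> <= et j)) -->
  (\<exists>R0\<ge>1. \<forall>R\<ge>R0. cnt R A <= C * (\<Prod>j\<in>{0}. et j) * R ^ d)"
  using cnt_box[of "{0::nat}" "\<lambda>_. (1 / (a \<bullet> a)) *\<^sub>R a" "\<lambda>_. a" rh] u d a by auto
 show ?thesis
 proof (rule exI[of _ C], intro conjI allI impI)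
  fix be et A assume "0 < et \<and> et <= 1 \<and> (\<forall>y\<in>A. norm y <= rh \<and> \<bar>a \<bullet> y - be\<bar> <= et)"
  then show "\<exists>R0\<ge>1. \<forall>R\<ge>R0. cnt R A <= C * et * R ^ d"
   using C[rule_format, of "\<lambda>_. et" A "\<lambda>_. be"] by simp
 qed fact
qed

subsection \<open>Existence of frequencies\<close>

text \<open>\<open>K\<close> lists affine hyperplanes, and some member weakly separates any point of
  \<open>A\<close> from any internal point outside. So the boundary of \<open>A\<close> is carried
  by finitely many hyperplanes, expressed without topology.\<close>

definition cuts :: "('e \<times> real) set \<Rightarrow> 'e set \<Rightarrow> bool" where
 "cuts K A \<longleftrightarrow> (\<forall>y\<in>A. \<forall>y'\<in>range I - A. \<exists>(a, be)\<in>K. (a \<bullet> y - be) * (a \<bullet> y' - be) <= 0)"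

section \<open>Counting lattice points over cubes of side \<open>1 / M\<close>\<close>

context
 fixes B :: "'e set"
 assumes finB: "finite B" and BI: "B \<subseteq> range I" and B_norm: "\<And>b. b \<in> B ==> norm b = 1"
  and B_orth: "\<And>b c. b \<in> B ==> c \<in> B ==> b ~= c ==> b \<bullet> c = 0"
  and B_expand: "\<And>x. x \<in> range I ==> (\<Sum>b\<in>B. (x \<bullet> b) *\<^sub>R b) = x"
  and d1: "d >= 1"
begin

text \<open>Half-open, so that the cubes of one mesh partition the internal space.\<close>

definition cube :: "nat \<Rightarrow> ('e \<Rightarrow> int) \<Rightarrow> 'e set" where
 "cube M z = {y\<in>range I. \<forall>b\<in>B. real_of_int (z b) <= real M * (y \<bullet> b) \<and> real M * (y \<bullet> b) < real_of_int (z b) + 1}"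

lemma norm_le_coords:
 assumes "x \<in> range I" "\<And>b. b \<in> B ==> \<bar>x \<bullet> b\<bar> <= f b" shows "norm x <= (\<Sum>b\<in>B. f b)"
proof -
 have "norm x = norm (\<Sum>b\<in>B. (x \<bullet> b) *\<^sub>R b)" using B_expand[OF assms(1)] by simp
 also have "\<dots> <= (\<Sum>b\<in>B. f b)" by (rule sum_norm_le) (use assms B_norm in auto)
 finally show ?thesis .
qed

lemma cube_norm:
 assumes "M >= 1" "y \<in> cube M z" shows "norm y <= (\<Sum>b\<in>B. \<bar>real_of_int (z b)\<bar> + 1)"
proof (rule norm_le_coords)
 show "y \<in> range I" using assms by (simp add: cube_def)
 fix b assume b: "b \<in> B"
 have "\<bar>real M * (y \<bullet> b)\<bar> <= \<bar>real_of_int (z b)\<bar> + 1" using assms b by (force simp: cube_def)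
 moreover have "1 * \<bar>y \<bullet> b\<bar> <= real M * \<bar>y \<bullet> b\<bar>" using assms by (intro mult_right_mono) auto
 ultimately show "\<bar>y \<bullet> b\<bar> <= \<bar>real_of_int (z b)\<bar> + 1" by (simp add: abs_mult)
qed

lemma cube_bounded: "M >= 1 ==> bounded (cube M z)"
 using cube_norm by (auto simp: bounded_iff)

lemma cube_diam:
 assumes "M >= 1" "y \<in> cube M z" "y' \<in> cube M z" shows "norm (y - y') <= real (card B) / real M"
proof -
 have "norm (y - y') <= (\<Sum>b\<in>B. 1 / real M)"
 proof (rule norm_le_coords)
  show "y - y' \<in> range I" using assms subspace_I by (auto simp: cube_def intro: subspace_diff)
  fix b assume b: "b \<in> B"
  have "\<bar>real M * (y \<bullet> b) - real M * (y' \<bullet> b)\<bar> <= 1" using assms b by (force simp: cube_def)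
  then have "real M * \<bar>(y - y') \<bullet> b\<bar> <= 1" by (simp add: inner_diff_left abs_mult flip: right_diff_distrib)
  then show "\<bar>(y - y') \<bullet> b\<bar> <= 1 / real M" using assms by (simp add: field_simps)
 qed
 then show ?thesis by simp
qed

lemma cube_disjoint:
 assumes "z \<in> PiE B S" "z' \<in> PiE B S'" "z ~= z'" shows "cube M z \<inter> cube M z' = {}"
proof (rule ccontr)
 assume "cube M z \<inter> cube M z' ~= {}"
 then obtain y where y: "y \<in> cube M z" "y \<in> cube M z'" by blast
 have "z b = z' b" if b: "b \<in> B" for b
 proof -
  have "real_of_int (z b) < real_of_int (z' b) + 1" "real_of_int (z' b) < real_of_int (z b) + 1"
   using y b by (force simp: cube_def)+
  then show ?thesis by linarith
 qed
 then have "z = z'" using assms(1,2) by (intro extensionalityI[of z B z']) (auto simp: PiE_iff)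
 then show False using assms(3) by simp
qed

lemma mem_cube_floor: "y \<in> range I ==> y \<in> cube M (\<lambda>b\<in>B. \<lfloor>real M * (y \<bullet> b)\<rfloor>)"
 by (auto simp: cube_def)

text \<open>A lattice vector whose internal part nearly equals the difference of the cubes carries
  one into the other up to thin slabs around the faces of the target. The slabs are controlled by
  \<open>cnt_slab\<close>, the change of radius by \<open>cnt_annulus\<close>.\<close>

lemma cube_cmp:
 assumes M: "M >= 1" and e: "e > 0"
 shows "\<forall>\<^sub>F R in at_top. cnt R (cube M z) <= cnt R (cube M z') + e * R ^ d"
proof -
 define t where "t = (\<Sum>b\<in>B. (real_of_int (z' b - z b) / real M) *\<^sub>R b)"
 have tI: "t \<in> range I" unfolding t_def
  by (intro subspace_sum[OF subspace_I] subspace_scale[OF subspace_I]) (use BI in auto)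
 have tb: "t \<bullet> b = real_of_int (z' b - z b) / real M" if b: "b \<in> B" for b
 proof -
  have "t \<bullet> b = (\<Sum>c\<in>B. real_of_int (z' c - z c) / real M * (c \<bullet> b))" by (simp add: t_def inner_sum_left)
  also have "\<dots> = (\<Sum>c\<in>B. if c = b then real_of_int (z' b - z b) / real M else 0)"
   by (rule sum.cong) (use B_orth B_norm b in \<open>auto simp: norm_eq_1\<close>)
  finally show ?thesis using b finB by simp
 qed
 define rh where "rh = (\<Sum>b\<in>B. \<bar>real_of_int (z b)\<bar> + 1) + norm t + 1"
 have "\<forall>b\<in>B. \<exists>C>0. \<forall>be et A. 0 < et \<and> et <= 1 \<and> (\<forall>y\<in>A. norm y <= rh \<and> \<bar>b \<bullet> y - be\<bar> <= et) -->
  (\<exists>R0\<ge>1. \<forall>R\<ge>R0. cnt R A <= C * et * R ^ d)"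
 proof
  fix b assume "b \<in> B"
  then have "b \<in> range I" "b ~= 0" using BI B_norm[of b] by auto
  then show "\<exists>C>0. \<forall>be et A. 0 < et \<and> et <= 1 \<and> (\<forall>y\<in>A. norm y <= rh \<and> \<bar>b \<bullet> y - be\<bar> <= et) -->
   (\<exists>R0\<ge>1. \<forall>R\<ge>R0. cnt R A <= C * et * R ^ d)"
   by (rule cnt_slab[OF d1])
 qed
 from bchoice[OF this] obtain C where C: "\<And>b. b \<in> B ==> C b > 0"
  "\<And>b be et A. b \<in> B ==> 0 < et \<and> et <= 1 \<and> (\<forall>y\<in>A. norm y <= rh \<and> \<bar>b \<bullet> y - be\<bar> <= et) ==>
  (\<exists>R0\<ge>1. \<forall>R\<ge>R0. cnt R A <= C b * et * R ^ d)" by metis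
 define Cs where "Cs = (\<Sum>b\<in>B. C b) + 1"
 have "(\<Sum>b\<in>B. C b) >= 0" by (rule sum_nonneg) (use C(1) less_imp_le in blast)
 then have Cs: "Cs > 0" by (simp add: Cs_def)
 \<comment> \<open>Slab thickness: half of \<open>e\<close> pays for all slabs around the two faces
   in each direction, counted up to radius \<open>2 R\<close>, and the other half for the
   shell.\<close>
 define et where "et = min 1 (e / (2 ^ (d + 2) * Cs))"
 have et: "0 < et" "et <= 1" using e Cs by (auto simp: et_def)
 have etC: "2 * Cs * et * 2 ^ d <= e / 2"
 proof -
  have "2 * Cs * et * 2 ^ d <= 2 * Cs * (e / (2 ^ (d + 2) * Cs)) * 2 ^ d"
   using Cs by (intro mult_right_mono mult_left_mono) (auto simp: et_def)
  also have "\<dots> = e / 2" using Cs by (simp add: field_simps)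
  finally show ?thesis .
 qed
 obtain g where g: "g \<in> Ga" "norm (I g - t) < et" using dense[OF tI et(1)] by blast
 define s where "s = N (P g)"
 have s: "s >= 0" using N_nonneg by (simp add: s_def)
 define S where "S b be = {y\<in>range I. norm y <= rh \<and> \<bar>b \<bullet> y - be\<bar> <= et}" for b be
 have bS: "bounded (S b be)" for b be by (auto simp: S_def bounded_iff)
 let ?S1 = "\<Union>b\<in>B. S b (real_of_int (z' b) / real M)"
 let ?S2 = "\<Union>b\<in>B. S b ((real_of_int (z' b) + 1) / real M)"
 have bS12: "bounded ?S1" "bounded ?S2" using finB bS by (auto intro!: bounded_UN)
 have sub: "y + I g \<in> cube M z' \<union> (?S1 \<union> ?S2)" if y: "y \<in> cube M z" for y
 proof (rule ccontr)
  assume nin: "y + I g \<notin> cube M z' \<union> (?S1 \<union> ?S2)"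
  have yI: "y + I g \<in> range I" using y subspace_I by (auto simp: cube_def intro: subspace_add)
  then obtain b where b: "b \<in> B" "\<not> (real_of_int (z' b) <= real M * ((y + I g) \<bullet> b) \<and> real M * ((y + I g) \<bullet> b) < real_of_int (z' b) + 1)"
   using nin by (auto simp: cube_def)
  have ny: "norm (y + I g) <= rh"
  proof -
   have "norm (y + I g) <= norm y + norm (I g - t) + norm t" by norm
   then show ?thesis using cube_norm[OF M y] g(2) et(2) unfolding rh_def by linarith
  qed
  define x where "x = (y + I g) \<bullet> b"
  have c: "\<bar>(I g - t) \<bullet> b\<bar> <= et"
   using Cauchy_Schwarz_ineq2[of "I g - t" b] B_norm[OF b(1)] g(2) by simp
  have x: "x = y \<bullet> b + real_of_int (z' b - z b) / real M + (I g - t) \<bullet> b"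
   unfolding x_def tb[OF b(1), symmetric] by (simp add: inner_add_left inner_diff_left)
  have yb: "real_of_int (z b) / real M <= y \<bullet> b" "y \<bullet> b < (real_of_int (z b) + 1) / real M"
   using y b(1) M by (auto simp: cube_def field_simps)
  have x1: "real_of_int (z' b) / real M - et <= x" "x <= (real_of_int (z' b) + 1) / real M + et"
   using x yb c by (simp_all add: diff_divide_distrib add_divide_distrib abs_le_iff)
  have "x < real_of_int (z' b) / real M \<or> (real_of_int (z' b) + 1) / real M <= x"
   using b(2) M unfolding x_def[symmetric] by (auto simp: field_simps not_le not_less)
  then have "\<bar>b \<bullet> (y + I g) - real_of_int (z' b) / real M\<bar> <= et \<or> \<bar>b \<bullet> (y + I g) - (real_of_int (z' b) + 1) / real M\<bar> <= et"
   using x1 unfolding inner_commute[of b] x_def[symmetric] by linarith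
  then show False using nin b(1) yI ny by (auto simp: S_def)
 qed
 have "\<forall>b\<in>B. \<exists>R0\<ge>1. \<forall>R\<ge>R0. cnt R (S b (real_of_int (z' b) / real M)) <= C b * et * R ^ d"
  by (intro ballI C(2) conjI et) (auto simp: S_def)
 then obtain R1 where R1: "\<And>b R. b \<in> B ==> R >= R1 b ==> cnt R (S b (real_of_int (z' b) / real M)) <= C b * et * R ^ d" by metis
 have "\<forall>b\<in>B. \<exists>R0\<ge>1. \<forall>R\<ge>R0. cnt R (S b ((real_of_int (z' b) + 1) / real M)) <= C b * et * R ^ d"
  by (intro ballI C(2) conjI et) (auto simp: S_def)
 then obtain R2 where R2: "\<And>b R. b \<in> B ==> R >= R2 b ==> cnt R (S b ((real_of_int (z' b) + 1) / real M)) <= C b * et * R ^ d" by metis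
 have "\<forall>\<^sub>F R in at_top. \<forall>b\<in>B. R >= R1 b" "\<forall>\<^sub>F R in at_top. \<forall>b\<in>B. R >= R2 b"
  using finB by (simp_all add: eventually_ball_finite eventually_ge_at_top)
 moreover have "\<forall>\<^sub>F R in at_top. cnt (R + s) (cube M z') <= cnt R (cube M z') + (e / 2) * R ^ d"
  by (rule cnt_annulus[OF cube_bounded[OF M] s _ d1]) (use e in simp)
 moreover have "\<forall>\<^sub>F R in at_top. R >= s + 1" by (rule eventually_ge_at_top)
 ultimately show ?thesis
 proof eventually_elim
  case (elim R)
  have "cnt R (cube M z) <= cnt (R + s) (cube M z' \<union> (?S1 \<union> ?S2))" unfolding s_def
   by (rule cnt_translate_le[OF g(1)]) (use cube_bounded[OF M] bS12 sub in auto)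
  also have "\<dots> <= cnt (R + s) (cube M z') + cnt (R + s) (?S1 \<union> ?S2)" using cube_bounded[OF M] bS12 by (intro cnt_Un) auto
  also have "cnt (R + s) (?S1 \<union> ?S2) <= cnt (R + s) ?S1 + cnt (R + s) ?S2" using bS12 by (rule cnt_Un)
  also have "cnt (R + s) ?S1 <= (\<Sum>b\<in>B. cnt (R + s) (S b (real_of_int (z' b) / real M)))" using finB bS by (rule cnt_UN)
  also have "\<dots> <= (\<Sum>b\<in>B. C b * et * (R + s) ^ d)" by (rule sum_mono) (use R1 elim s in force)
  also have "cnt (R + s) ?S2 <= (\<Sum>b\<in>B. cnt (R + s) (S b ((real_of_int (z' b) + 1) / real M)))" using finB bS by (rule cnt_UN)
  also have "\<dots> <= (\<Sum>b\<in>B. C b * et * (R + s) ^ d)" by (rule sum_mono) (use R2 elim s in force)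
  also have "(\<Sum>b\<in>B. C b * et * (R + s) ^ d) = (Cs - 1) * et * (R + s) ^ d" by (simp add: Cs_def sum_distrib_right)
  also have "(Cs - 1) * et * (R + s) ^ d <= Cs * et * (2 * R) ^ d"
   using elim s et Cs \<open>(\<Sum>b\<in>B. C b) >= 0\<close> by (intro mult_mono power_mono mult_nonneg_nonneg) (auto simp: Cs_def)
  finally have "cnt R (cube M z) <= cnt (R + s) (cube M z') + 2 * Cs * et * 2 ^ d * R ^ d"
   by (simp add: power_mult_distrib mult_ac)
  then have "cnt R (cube M z) <= cnt R (cube M z') + e / 2 * R ^ d + 2 * Cs * et * 2 ^ d * R ^ d"
   using elim by linarith
  also have "2 * Cs * et * 2 ^ d * R ^ d <= e / 2 * R ^ d" using etC elim s by (intro mult_right_mono) auto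
  finally show ?case by simp
 qed
qed

lemma cube_cmp_sum:
 assumes M: "M >= 1" and e: "e > 0" and Z: "finite Z" "Z \<subseteq> PiE B S"
 shows "\<forall>\<^sub>F R in at_top. \<bar>cnt R (\<Union>z\<in>Z. cube M z) - real (card Z) * cnt R (cube M z0)\<bar> <= e * R ^ d"
proof -
 define e' where "e' = e / (real (card Z) + 1)"
 have e': "e' > 0" using e by (simp add: e'_def add_nonneg_pos)
 have "\<forall>\<^sub>F R in at_top. \<forall>z\<in>Z. cnt R (cube M z) <= cnt R (cube M z0) + e' * R ^ d"
  using Z(1) cube_cmp[OF M e'] by (simp add: eventually_ball_finite)
 moreover have "\<forall>\<^sub>F R in at_top. \<forall>z\<in>Z. cnt R (cube M z0) <= cnt R (cube M z) + e' * R ^ d"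
  using Z(1) cube_cmp[OF M e'] by (simp add: eventually_ball_finite)
 moreover have "\<forall>\<^sub>F R in at_top. R >= (0::real)" by (rule eventually_ge_at_top)
 ultimately show ?thesis
 proof eventually_elim
  case (elim R)
  have "cnt R (\<Union>z\<in>Z. cube M z) = (\<Sum>z\<in>Z. cnt R (cube M z))"
   by (rule cnt_disjoint_UN[OF Z(1) cube_bounded[OF M] cube_disjoint]) (use Z(2) in auto)
  then have "\<bar>cnt R (\<Union>z\<in>Z. cube M z) - real (card Z) * cnt R (cube M z0)\<bar> = \<bar>\<Sum>z\<in>Z. cnt R (cube M z) - cnt R (cube M z0)\<bar>"
   by (simp add: sum_subtractf)
  also have "\<dots> <= (\<Sum>z\<in>Z. e' * R ^ d)"
   by (rule order_trans[OF sum_abs sum_mono]) (use elim in \<open>auto simp: abs_le_iff algebra_simps\<close>)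
  also have "\<dots> = (real (card Z) * e') * R ^ d" by simp
  also have "\<dots> <= e * R ^ d"
  proof (rule mult_right_mono)
   have "real (card Z) * e' <= (real (card Z) + 1) * e'" using e' by (simp add: distrib_right)
   then show "real (card Z) * e' <= e" using e by (simp add: e'_def add_nonneg_pos)
  qed (use elim in simp)
  finally show ?case .
 qed
qed

lemma unit_cube_split:
 assumes M: "M >= 1"
 shows "cube 1 (\<lambda>_. 0) = (\<Union>z\<in>PiE B (\<lambda>_. {0..<int M}). cube M z)"
proof
 show "cube 1 (\<lambda>_. 0) \<subseteq> (\<Union>z\<in>PiE B (\<lambda>_. {0..<int M}). cube M z)"
 proof
  fix y assume y: "y \<in> cube 1 (\<lambda>_. 0)"
  have "\<lfloor>real M * (y \<bullet> b)\<rfloor> \<in> {0..<int M}" if "b \<in> B" for b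
  proof -
   have "0 <= y \<bullet> b" "y \<bullet> b < 1" using y that by (auto simp: cube_def)
   then have "0 <= real M * (y \<bullet> b)" "real M * (y \<bullet> b) < real M * 1" using M by (auto intro!: mult_strict_left_mono)
   then show ?thesis by (simp add: floor_less_iff)
  qed
  then have "(\<lambda>b\<in>B. \<lfloor>real M * (y \<bullet> b)\<rfloor>) \<in> PiE B (\<lambda>_. {0..<int M})" by (simp only: restrict_PiE_iff) blast
  moreover have "y \<in> cube M (\<lambda>b\<in>B. \<lfloor>real M * (y \<bullet> b)\<rfloor>)" using y by (intro mem_cube_floor) (simp add: cube_def)
  ultimately show "y \<in> (\<Union>z\<in>PiE B (\<lambda>_. {0..<int M}). cube M z)" by blast
 qed
 show "(\<Union>z\<in>PiE B (\<lambda>_. {0..<int M}). cube M z) \<subseteq> cube 1 (\<lambda>_. 0)"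
 proof
  fix y assume "y \<in> (\<Union>z\<in>PiE B (\<lambda>_. {0..<int M}). cube M z)"
  then obtain z where z: "z \<in> PiE B (\<lambda>_. {0..<int M})" "y \<in> cube M z" by blast
  have "0 <= y \<bullet> b \<and> y \<bullet> b < 1" if b: "b \<in> B" for b
  proof -
   have zb: "0 <= z b" "z b + 1 <= int M" using PiE_mem[OF z(1) b] by auto
   then have "real_of_int (z b) + 1 <= real M" by linarith
   moreover have "real_of_int (z b) <= real M * (y \<bullet> b)" "real M * (y \<bullet> b) < real_of_int (z b) + 1"
    using z(2) b by (auto simp: cube_def)
   ultimately have "0 <= real M * (y \<bullet> b)" "real M * (y \<bullet> b) < real M * 1" using zb by linarith+
   moreover have "real M > 0" using M by simp
   ultimately show ?thesis using mult_less_cancel_left_pos[of "real M" "y \<bullet> b" 1] by (metis zero_le_mult_iff not_le)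
  qed
  then show "y \<in> cube 1 (\<lambda>_. 0)" using z(2) by (auto simp: cube_def)
 qed
qed

text \<open>A Riemann sum. \<open>A\<close> is exhausted by the cubes it contains, the remaining
  cubes that meet it lie in slabs of width of order \<open>1 / M\<close> around the hyperplanes of
  \<open>K\<close>, and all cubes of one mesh count equally up to a small error.\<close>

lemma cnt_cube_approx:
 assumes A: "bounded A" "A \<subseteq> range I" and K: "finite K" "\<And>a be. (a, be) \<in> K ==> a \<in> range I \<and> a ~= 0" "cuts K A"
 shows "\<exists>C>0. \<forall>M\<ge>1. \<exists>q. \<forall>\<^sub>F R in at_top. \<bar>cnt R A - q * cnt R (cube 1 (\<lambda>_. 0))\<bar> <= C / real M * R ^ d"
proof -
 obtain rh where rh: "rh > 0" "\<And>x. x \<in> A ==> norm x <= rh" using A(1) by (metis bounded_pos)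
 define rh' where "rh' = rh + real (card B)"
 have "\<forall>kp\<in>K. \<exists>C>0. \<forall>be et A. 0 < et \<and> et <= 1 \<and> (\<forall>y\<in>A. norm y <= rh' \<and> \<bar>fst kp \<bullet> y - be\<bar> <= et) -->
  (\<exists>R0\<ge>1. \<forall>R\<ge>R0. cnt R A <= C * et * R ^ d)"
 proof
  fix kp assume "kp \<in> K"
  then have "fst kp \<in> range I" "fst kp ~= 0" using K(2)[of "fst kp" "snd kp"] by auto
  then show "\<exists>C>0. \<forall>be et A. 0 < et \<and> et <= 1 \<and> (\<forall>y\<in>A. norm y <= rh' \<and> \<bar>fst kp \<bullet> y - be\<bar> <= et) -->
   (\<exists>R0\<ge>1. \<forall>R\<ge>R0. cnt R A <= C * et * R ^ d)"
   by (rule cnt_slab[OF d1])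
 qed
 from bchoice[OF this] obtain C where C: "\<And>kp. kp \<in> K ==> C kp > 0"
  "\<And>kp be et A. kp \<in> K ==> 0 < et \<and> et <= 1 \<and> (\<forall>y\<in>A. norm y <= rh' \<and> \<bar>fst kp \<bullet> y - be\<bar> <= et) ==>
  (\<exists>R0\<ge>1. \<forall>R\<ge>R0. cnt R A <= C kp * et * R ^ d)" by metis
 obtain C0 where C0: "C0 > 0" "\<And>R. R >= 1 ==> cnt R A <= C0 * R ^ d" using cnt_upper[OF A(1)] by auto
 \<comment> \<open>A cube that meets \<open>A\<close> and its complement lies within
   \<open>norm a * card B / M\<close> of a hyperplane of \<open>K\<close>; the summand 1 makes
   \<open>L\<close> positive.\<close>
 define L where "L kp = norm (fst kp) * real (card B) + 1" for kp :: "'e \<times> real"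
 have L: "L kp > 0" for kp unfolding L_def by (simp add: add_nonneg_pos)
 \<comment> \<open>The summand 3 leaves room for the two errors \<open>1 / M\<close> from the cube
   comparisons.\<close>
 define D where "D = (\<Sum>kp\<in>K. (C kp + C0) * L kp) + 3"
 have DK: "(\<Sum>kp\<in>K. (C kp + C0) * L kp) >= 0" by (rule sum_nonneg) (use C(1) C0 L in \<open>simp add: less_imp_le\<close>)
 have "\<exists>q. \<forall>\<^sub>F R in at_top. \<bar>cnt R A - q * cnt R (cube 1 (\<lambda>_. 0))\<bar> <= D / real M * R ^ d" if M: "M >= 1" for M
 proof -
  define Lz where "Lz = \<lceil>real M * rh\<rceil> + 1"
  let ?Z = "PiE B (\<lambda>_. {-Lz..Lz})"
  have finZ: "finite ?Z" using finB by (simp add: finite_PiE)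
  define In where "In = {z\<in>?Z. cube M z \<subseteq> A}"
  define Bd where "Bd = {z\<in>?Z. cube M z \<inter> A ~= {} \<and> \<not> cube M z \<subseteq> A}"
  have finI: "finite In" "finite Bd" using finZ by (auto simp: In_def Bd_def)
  have cover: "A \<subseteq> (\<Union>z\<in>In. cube M z) \<union> ((\<Union>z\<in>Bd. cube M z) \<inter> A)"
  proof
   fix y assume y: "y \<in> A"
   let ?z = "\<lambda>b\<in>B. \<lfloor>real M * (y \<bullet> b)\<rfloor>"
   have "\<lfloor>real M * (y \<bullet> b)\<rfloor> \<in> {-Lz..Lz}" if "b \<in> B" for b
   proof -
    have "\<bar>y \<bullet> b\<bar> <= rh" using Cauchy_Schwarz_ineq2[of y b] B_norm[OF that] rh(2)[OF y] by simp
    then have "\<bar>real M * (y \<bullet> b)\<bar> <= real M * rh" by (simp add: abs_mult mult_left_mono)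
    then show ?thesis unfolding Lz_def by (simp; linarith)
   qed
   then have z: "?z \<in> ?Z" by (simp only: restrict_PiE_iff) blast
   have yz: "y \<in> cube M ?z" using y A by (intro mem_cube_floor) auto
   show "y \<in> (\<Union>z\<in>In. cube M z) \<union> ((\<Union>z\<in>Bd. cube M z) \<inter> A)"
   proof (cases "cube M ?z \<subseteq> A")
    case True then show ?thesis using z yz unfolding In_def by blast
   next
    case False
    then have "?z \<in> Bd" unfolding Bd_def using z yz y by blast
    then show ?thesis using yz y by blast
   qed
  qed
  let ?E = "(\<Union>z\<in>Bd. cube M z) \<inter> A"
  define T where "T kp = {y\<in>?E. \<bar>fst kp \<bullet> y - snd kp\<bar> <= L kp / real M}" for kp
  have ET: "?E \<subseteq> (\<Union>kp\<in>K. T kp)"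
  proof
   fix y assume yE: "y \<in> ?E"
   then obtain z where z: "z \<in> Bd" "y \<in> cube M z" by blast
   then obtain y' where y': "y' \<in> cube M z" "y' \<notin> A" by (auto simp: Bd_def)
   then have "y' \<in> range I - A" by (auto simp: cube_def)
   then have "\<exists>(a, be)\<in>K. (a \<bullet> y - be) * (a \<bullet> y' - be) <= 0"
    using yE K(3) unfolding cuts_def by blast
   then obtain a be where kp: "(a, be) \<in> K" "(a \<bullet> y - be) * (a \<bullet> y' - be) <= 0" by blast
   have "\<bar>a \<bullet> y - be\<bar> <= \<bar>(a \<bullet> y - be) - (a \<bullet> y' - be)\<bar>"
    using kp(2) by (auto simp: mult_le_0_iff)
   also have "\<dots> = \<bar>a \<bullet> (y - y')\<bar>" by (simp add: inner_diff_right)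
   also have "\<dots> <= norm a * norm (y - y')" by (rule Cauchy_Schwarz_ineq2)
   also have "\<dots> <= norm a * (real (card B) / real M)" using cube_diam[OF M z(2) y'(1)] by (intro mult_left_mono) auto
   also have "\<dots> <= L (a, be) / real M" unfolding L_def by (simp add: divide_right_mono)
   finally show "y \<in> (\<Union>kp\<in>K. T kp)" using kp(1) yE unfolding T_def by force
  qed
  have bT: "bounded (T kp)" for kp by (rule bounded_subset[OF A(1)]) (auto simp: T_def)
  have Tn: "norm y <= rh'" if "y \<in> T kp" for y kp
   using that rh(2)[of y] by (auto simp: T_def rh'_def)
  have evT: "\<forall>\<^sub>F R in at_top. cnt R (T kp) <= ((C kp + C0) * L kp / real M) * R ^ d" if kp: "kp \<in> K" for kp
  proof (cases "L kp / real M <= 1")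
   case True
   have "\<exists>R0\<ge>1. \<forall>R\<ge>R0. cnt R (T kp) <= C kp * (L kp / real M) * R ^ d"
   proof (rule C(2)[OF kp], intro conjI ballI)
    show "0 < L kp / real M" using L M by simp
    fix y assume y: "y \<in> T kp"
    show "norm y <= rh'" using y by (rule Tn)
    show "\<bar>fst kp \<bullet> y - snd kp\<bar> <= L kp / real M" using y by (simp add: T_def)
   qed (rule True)
   then obtain R0 where R0: "R0 >= 1" "\<And>R. R >= R0 ==> cnt R (T kp) <= C kp * (L kp / real M) * R ^ d" by blast
   show ?thesis using eventually_ge_at_top[of R0]
   proof eventually_elim
    case (elim R)
    have "cnt R (T kp) <= C kp * (L kp / real M) * R ^ d" using R0 elim by blast
    also have "\<dots> <= (C kp + C0) * (L kp / real M) * R ^ d"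
     using C0(1) L M elim R0(1) by (intro mult_right_mono) (auto simp: less_imp_le)
    finally show ?case by simp
   qed
  next
   \<comment> \<open>The slab estimate is restricted to widths up to 1. For wider slabs the bound
     for all of \<open>A\<close> suffices, which is why \<open>C0\<close> enters
     \<open>D\<close>.\<close>
   case False
   show ?thesis using eventually_ge_at_top[of 1]
   proof eventually_elim
    case (elim R)
    have "cnt R (T kp) <= cnt R A" by (rule cnt_mono[OF A(1)]) (auto simp: T_def)
    also have "\<dots> <= C0 * R ^ d" by (rule C0(2)) (use elim in simp)
    also have "C0 * 1 <= (C kp + C0) * (L kp / real M)"
     using False C(1)[OF kp] C0(1) by (intro mult_mono) auto
    then have "C0 * R ^ d <= ((C kp + C0) * L kp / real M) * R ^ d" using elim by (intro mult_right_mono) auto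
    finally show ?case .
   qed
  qed
  have "\<forall>\<^sub>F R in at_top. \<forall>kp\<in>K. cnt R (T kp) <= ((C kp + C0) * L kp / real M) * R ^ d"
   using K(1) evT by (simp add: eventually_ball_finite)
  define cc where "cc = card (PiE B (\<lambda>_. {0..<int M}))"
  have "cc = M ^ card B" unfolding cc_def using finB by (simp add: card_PiE)
  then have cc: "cc > 0" using M by simp
  \<comment> \<open>Cubes inside \<open>A\<close> relative to the cubes of the same mesh in the unit
    cube; the point is that \<open>q\<close> does not depend on \<open>R\<close>.\<close>
  define q where "q = real (card In) / real cc"
  have q0: "q >= 0" by (simp add: q_def)
  have e2: "1 / (real M * (q + 1)) > 0" using M q0 by (simp add: add_nonneg_pos)
  have ev1: "\<forall>\<^sub>F R in at_top. \<bar>cnt R (\<Union>z\<in>In. cube M z) - real (card In) * cnt R (cube M (\<lambda>_. 0))\<bar> <= 1 / real M * R ^ d"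
   by (rule cube_cmp_sum[OF M _ finI(1)]) (use M in \<open>auto simp: In_def\<close>)
  have ev2: "\<forall>\<^sub>F R in at_top. \<bar>cnt R (cube 1 (\<lambda>_. 0)) - real cc * cnt R (cube M (\<lambda>_. 0))\<bar> <= 1 / (real M * (q + 1)) * R ^ d"
   unfolding unit_cube_split[OF M] cc_def
   by (rule cube_cmp_sum[OF M e2 _ subset_refl]) (use finB in \<open>auto simp: finite_PiE\<close>)
  have "\<forall>\<^sub>F R in at_top. \<bar>cnt R A - q * cnt R (cube 1 (\<lambda>_. 0))\<bar> <= D / real M * R ^ d"
   using \<open>\<forall>\<^sub>F R in at_top. \<forall>kp\<in>K. _ kp R\<close> ev1 ev2 eventually_ge_at_top[of 1]
  proof eventually_elim
   case (elim R)
   have bI: "bounded (\<Union>z\<in>In. cube M z)" by (rule bounded_subset[OF A(1)]) (auto simp: In_def)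
   have bE: "bounded ?E" by (rule bounded_subset[OF A(1)]) auto
   have E: "cnt R ?E <= (D - 3) / real M * R ^ d"
   proof -
    have "cnt R ?E <= cnt R (\<Union>kp\<in>K. T kp)" using ET bT K(1) by (intro cnt_mono) auto
    also have "\<dots> <= (\<Sum>kp\<in>K. cnt R (T kp))" using K(1) bT by (rule cnt_UN)
    also have "\<dots> <= (\<Sum>kp\<in>K. ((C kp + C0) * L kp / real M) * R ^ d)" by (rule sum_mono) (use elim in blast)
    also have "\<dots> = (D - 3) / real M * R ^ d" by (simp add: D_def sum_distrib_right sum_divide_distrib)
    finally show ?thesis .
   qed
   have "cnt R A <= cnt R ((\<Union>z\<in>In. cube M z) \<union> ?E)" using cover bI bE by (intro cnt_mono) auto
   also have "\<dots> <= cnt R (\<Union>z\<in>In. cube M z) + cnt R ?E" using bI bE by (rule cnt_Un)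
   finally have up: "cnt R A <= cnt R (\<Union>z\<in>In. cube M z) + (D - 3) / real M * R ^ d" using E by simp
   have lo: "cnt R (\<Union>z\<in>In. cube M z) <= cnt R A" by (rule cnt_mono[OF A(1)]) (auto simp: In_def)
   have Rd: "R ^ d / real M >= 0" using elim by simp
   have "\<bar>q * cnt R (cube 1 (\<lambda>_. 0)) - real (card In) * cnt R (cube M (\<lambda>_. 0))\<bar>
    = q * \<bar>cnt R (cube 1 (\<lambda>_. 0)) - real cc * cnt R (cube M (\<lambda>_. 0))\<bar>"
   proof -
    have "q * cnt R (cube 1 (\<lambda>_. 0)) - real (card In) * cnt R (cube M (\<lambda>_. 0))
     = q * (cnt R (cube 1 (\<lambda>_. 0)) - real cc * cnt R (cube M (\<lambda>_. 0)))"
     using cc by (simp add: q_def right_diff_distrib)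
    then show ?thesis using q0 by (simp add: abs_mult)
   qed
   also have "\<dots> <= q * (1 / (real M * (q + 1)) * R ^ d)" using elim q0 by (intro mult_left_mono) auto
   also have "\<dots> = q / (q + 1) * (R ^ d / real M)" by simp
   also have "\<dots> <= 1 * (R ^ d / real M)" using q0 Rd by (intro mult_right_mono) (auto simp: divide_simps)
   finally have "\<bar>q * cnt R (cube 1 (\<lambda>_. 0)) - real (card In) * cnt R (cube M (\<lambda>_. 0))\<bar> <= R ^ d / real M" by simp
   moreover have "\<bar>cnt R A - cnt R (\<Union>z\<in>In. cube M z)\<bar> <= (D - 3) / real M * R ^ d" using up lo by linarith
   moreover have "\<bar>cnt R (\<Union>z\<in>In. cube M z) - real (card In) * cnt R (cube M (\<lambda>_. 0))\<bar> <= R ^ d / real M" using elim by simp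
   ultimately have "\<bar>cnt R A - q * cnt R (cube 1 (\<lambda>_. 0))\<bar> <= (D - 3) / real M * R ^ d + 2 * (R ^ d / real M)" by linarith
   also have "\<dots> = D / real M * R ^ d - R ^ d / real M"
   proof -
    have "(D - 3) / real M = D / real M - 3 * (1 / real M)" "R ^ d / real M = 1 / real M * R ^ d"
     by (simp_all add: diff_divide_distrib)
    then show ?thesis by (simp only: left_diff_distrib)
   qed
   finally show ?case using Rd by linarith
  qed
  then show ?thesis by blast
 qed
 moreover have "D > 0" using DK by (simp add: D_def)
 ultimately show ?thesis by blast
qed

end

lemma approx_convergent:
 fixes f :: "real \<Rightarrow> real"
 assumes "\<And>e. e > 0 ==> \<exists>q. \<forall>\<^sub>F R in at_top. \<bar>f R - q\<bar> <= e"
 shows "\<exists>mu. (f \<longlongrightarrow> mu) at_top"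
proof -
 have "cauchy_filter (filtermap f at_top)"
  unfolding cauchy_filter_metric_filtermap
 proof (intro allI impI)
  fix e :: real assume "e > 0"
  then obtain q where q: "\<forall>\<^sub>F R in at_top. \<bar>f R - q\<bar> <= e / 3" using assms[of "e / 3"] by auto
  show "\<exists>Q. eventually Q at_top \<and> (\<forall>x y. Q x \<and> Q y --> dist (f x) (f y) < e)"
  proof (intro exI conjI allI impI)
   show "\<forall>\<^sub>F R in at_top. \<bar>f R - q\<bar> <= e / 3" by (rule q)
   fix x y assume "\<bar>f x - q\<bar> <= e / 3 \<and> \<bar>f y - q\<bar> <= e / 3"
   then show "dist (f x) (f y) < e" using \<open>e > 0\<close> unfolding dist_real_def by linarith
  qed
 qed
 then obtain mu where "filtermap f at_top <= nhds mu"
  using complete_uniform[where S="UNIV::real set"] complete_UNIV by (force simp: trivial_limit_at_top_linorder filtermap_bot_iff)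
 then show ?thesis by (auto simp: filterlim_def)
qed

text \<open>Normalising by the count of a unit cube instead of \<open>R ^ d\<close> makes the limit
  accessible: the cube comparisons are relative, and the count of the unit cube divided by
  \<open>R ^ d\<close> need not be known to converge.\<close>

theorem frequency_exists:
 assumes d: "d >= 1"
 shows "\<exists>K0. bounded K0 \<and> K0 \<subseteq> range I \<and> (\<exists>c>0. \<exists>R0\<ge>1. \<forall>R\<ge>R0. c * R ^ d <= cnt R K0) \<and>
  (\<forall>A K. bounded A \<and> A \<subseteq> range I \<and> finite K \<and> (\<forall>(a, be)\<in>K. a \<in> range I \<and> a ~= 0) \<and> cuts K A -->
   (\<exists>mu. ((\<lambda>R. cnt R A / cnt R K0) \<longlongrightarrow> mu) at_top))"
proof -
 obtain B B2 where B0: "finite B" "finite B2" "B \<subseteq> range I" "card B = n"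
  "\<And>x. x \<in> range I ==> (\<Sum>b\<in>B. (x \<bullet> b) *\<^sub>R b) = x"
  "\<And>x. (\<Sum>b\<in>B \<union> B2. (x \<bullet> b) *\<^sub>R b) = x"
  "\<And>x b. x \<in> range I ==> b \<in> B2 ==> x \<bullet> b = 0"
  "\<And>b. b \<in> B \<union> B2 ==> norm b = 1"
  "\<And>b c. b \<in> B \<union> B2 ==> c \<in> B \<union> B2 ==> b ~= c ==> b \<bullet> c = 0"
  by (rule orthonormal_frame[OF subspace_I]) rule
 have B: "finite B" "B \<subseteq> range I" "\<And>b. b \<in> B ==> norm b = 1"
  "\<And>b c. b \<in> B ==> c \<in> B ==> b ~= c ==> b \<bullet> c = 0"
  "\<And>x. x \<in> range I ==> (\<Sum>b\<in>B. (x \<bullet> b) *\<^sub>R b) = x"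
  using B0 by auto
 note BB = B d
 let ?K0 = "cube B 1 (\<lambda>_. 0)"
 have bK: "bounded ?K0" by (rule cube_bounded[OF BB order.refl])
 have "\<exists>c>0. \<exists>R0\<ge>1. \<forall>R\<ge>R0. c * R ^ d <= cnt R ?K0"
 proof (rule cnt_lower[OF bK])
  let ?a = "\<Sum>b\<in>B. (1 / 2) *\<^sub>R b"
  show "?a \<in> range I"
   by (intro subspace_sum[OF subspace_I] subspace_scale[OF subspace_I]) (use B in auto)
  show "0 < (1 / 2 :: real)" by simp
  fix y assume y: "y \<in> range I" "norm (y - ?a) < 1 / 2"
  have "0 <= y \<bullet> b \<and> y \<bullet> b < 1" if b: "b \<in> B" for b
  proof -
   have "?a \<bullet> b = (\<Sum>c\<in>B. (c \<bullet> b) / 2)" by (simp add: inner_sum_left)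
   also have "\<dots> = (\<Sum>c\<in>B. if c = b then 1 / 2 else 0)"
    by (rule sum.cong) (use B b in \<open>auto simp: norm_eq_1\<close>)
   finally have "?a \<bullet> b = 1 / 2" using b B(1) by simp
   moreover have "\<bar>(y - ?a) \<bullet> b\<bar> <= norm (y - ?a)" using Cauchy_Schwarz_ineq2[of "y - ?a" b] B(3)[OF b] by simp
   ultimately have "\<bar>y \<bullet> b - 1 / 2\<bar> < 1 / 2" using y(2) by (simp only: inner_diff_left)
   then show ?thesis by linarith
  qed
  then show "y \<in> ?K0" using y(1) by (auto simp: cube_def[OF BB])
 qed
 then obtain c R0 where c: "c > 0" "R0 >= 1" "\<And>R. R >= R0 ==> c * R ^ d <= cnt R ?K0" by blast
 have "\<exists>mu. ((\<lambda>R. cnt R A / cnt R ?K0) \<longlongrightarrow> mu) at_top"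
  if A: "bounded A" "A \<subseteq> range I" and K: "finite K" "\<forall>(a, be)\<in>K. a \<in> range I \<and> a ~= 0" "cuts K A" for A K
 proof (rule approx_convergent)
  fix e :: real assume e: "e > 0"
  obtain C where C: "C > 0" "\<And>M. M >= 1 ==> \<exists>q. \<forall>\<^sub>F R in at_top. \<bar>cnt R A - q * cnt R ?K0\<bar> <= C / real M * R ^ d"
   using cnt_cube_approx[OF BB A K(1) _ K(3)] K(2) by blast
  define M where "M = nat \<lceil>C / (c * e)\<rceil> + 1"
  have M: "M >= 1" "C / real M <= c * e"
  proof -
   have "C / (c * e) <= real M" unfolding M_def by linarith
   then have "C <= real M * (c * e)" using c(1) e by (simp only: pos_divide_le_eq mult_pos_pos)
   moreover have "real M > 0" by (simp add: M_def)
   ultimately show "C / real M <= c * e" by (simp only: pos_divide_le_eq mult.commute)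
  qed (simp add: M_def)
  obtain q where q: "\<forall>\<^sub>F R in at_top. \<bar>cnt R A - q * cnt R ?K0\<bar> <= C / real M * R ^ d" using C(2)[OF M(1)] by blast
  have "\<forall>\<^sub>F R in at_top. \<bar>cnt R A / cnt R ?K0 - q\<bar> <= e"
   using q eventually_ge_at_top[of R0]
  proof eventually_elim
   case (elim R)
   have k: "c * R ^ d <= cnt R ?K0" by (rule c(3)) (use elim in simp)
   have "R ^ d > 0" using elim c(2) by simp
   then have k0: "cnt R ?K0 > 0" using k c(1) by (smt (verit) mult_pos_pos)
   have "\<bar>cnt R A - q * cnt R ?K0\<bar> <= (c * e) * R ^ d"
    using elim M(2) \<open>R ^ d > 0\<close> by (meson less_imp_le mult_right_mono order_trans)
   also have "\<dots> <= e * cnt R ?K0" using k e by (simp add: mult_ac mult_left_mono)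
   finally have "\<bar>cnt R A - q * cnt R ?K0\<bar> / cnt R ?K0 <= e" using k0 by (simp add: field_simps)
   moreover have "cnt R A / cnt R ?K0 - q = (cnt R A - q * cnt R ?K0) / cnt R ?K0" using k0 by (simp add: field_simps)
   ultimately show ?case using k0 by simp
  qed
  then show "\<exists>q. \<forall>\<^sub>F R in at_top. \<bar>cnt R A / cnt R ?K0 - q\<bar> <= e" by blast
 qed
 moreover have "?K0 \<subseteq> range I" by (auto simp: cube_def[OF BB])
 ultimately show ?thesis using bK c by (intro exI[of _ ?K0]) blast
qed

end

section \<open>Windows and patches\<close>

text \<open>Walls are abstract indices with a normal \<open>a h\<close>, an offset
  \<open>b h\<close> and a supporting point \<open>w h\<close>. \<open>W_cut\<close> expresses that
  boundaries lie on walls, \<open>W_loc\<close> that each wall properly supports some piece at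
  \<open>w h\<close>, with the piece on the lower side, and \<open>nonsing\<close> that pieces are
  locally constant at projected lattice points. \<open>spanning\<close> makes the normals rich
  enough to contain flags.\<close>

locale cut_window = cut_lattice Ga P I N
 for Ga :: "'e::euclidean_space set" and P I :: "'e \<Rightarrow> 'e" and N :: "'e \<Rightarrow> real" +
 fixes L :: "'l set" and W :: "'l \<Rightarrow> 'e set"
  and Hs :: "'h set" and a :: "'h \<Rightarrow> 'e" and b :: "'h \<Rightarrow> real" and w :: "'h \<Rightarrow> 'e"
 assumes d_pos: "1 <= dim (range P)"
  and finL: "finite L" and finH: "finite Hs"
  and a_I: "h \<in> Hs ==> a h \<in> range I" and a_nz: "h \<in> Hs ==> a h ~= 0"
  and W_I: "i \<in> L ==> W i \<subseteq> range I" and W_bdd: "i \<in> L ==> bounded (W i)"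
  and W_cut: "i \<in> L ==> y \<in> W i ==> y' \<in> range I ==> y' \<notin> W i ==>
   \<exists>h\<in>Hs. (a h \<bullet> y - b h) * (a h \<bullet> y' - b h) <= 0"
  and w_I: "h \<in> Hs ==> w h \<in> range I" and w_wall: "h \<in> Hs ==> a h \<bullet> w h = b h"
  and W_loc: "h \<in> Hs ==> \<exists>i\<in>L. \<exists>e>0. \<forall>y\<in>range I. norm (y - w h) < e --> (y \<in> W i \<longleftrightarrow> a h \<bullet> y <= b h)"
  and nonsing: "ga \<in> Ga ==> i \<in> L ==> \<exists>e>0. \<forall>y\<in>range I. norm (y - I ga) < e --> (y \<in> W i \<longleftrightarrow> I ga \<in> W i)"
  and W_reg: "z \<in> (\<Union>i\<in>L. W i) ==> e > 0 ==>
   \<exists>c\<in>range I. norm (c - z) < e \<and> (\<exists>r>0. \<forall>y\<in>range I. norm (y - c) < r --> y \<in> (\<Union>i\<in>L. W i))"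
  and W_ne: "(\<Union>i\<in>L. W i) ~= {}"
  and spanning: "y \<in> range I ==> (\<And>h. h \<in> Hs ==> a h \<bullet> y = 0) ==> y = 0"
begin

definition Win :: "'e set" where "Win = (\<Union>i\<in>L. W i)"

definition Gw :: "'e set" where "Gw = {ga\<in>Ga. I ga \<in> Win}"

text \<open>A patch is recorded by lattice vectors instead of physical differences and depends only
  on the internal point. It is defined at every internal point, so points may be perturbed off the
  projected lattice.\<close>

definition pat :: "real \<Rightarrow> 'e \<Rightarrow> ('e \<times> 'l) set" where
 "pat r y = {(g, i). g \<in> Ga \<and> N (P g) <= r \<and> i \<in> L \<and> y + I g \<in> W i}"

text \<open>The acceptance domain of the patch at \<open>y\<close>.\<close>

definition acc :: "real \<Rightarrow> 'e \<Rightarrow> 'e set" where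
 "acc r y = {u\<in>Win. pat r u = pat r y}"

definition LR :: bool where
 "LR \<longleftrightarrow> (\<exists>C>0. \<forall>\<^sub>F r in at_top. \<forall>x\<in>Gw. \<forall>y\<in>Gw. \<exists>z\<in>Gw. pat r (I z) = pat r (I y) \<and> N (P (z - x)) <= C * r)"

definition PW :: bool where
 "PW \<longleftrightarrow> (\<exists>c>0. \<forall>\<^sub>F r in at_top. \<forall>y\<in>Gw.
  \<exists>vn. ((\<lambda>R. cnt R (acc r (I y)) / cnt R Win) \<longlongrightarrow> vn) at_top \<and> c / r ^ d <= vn)"

text \<open>The height over the wall \<open>h\<close> without its offset, extended by 0 in the
  physical directions so that it is a linear functional on the total space.\<close>

definition lam :: "'h \<Rightarrow> 'e \<Rightarrow> real" where "lam h x = a h \<bullet> I x"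

lemma lam_linear: "linear (lam h)"
 by (rule linearI) (auto simp: lam_def I_add I_scale inner_add_right)

lemmas lam_add = linear_add[OF lam_linear] and lam_diff = linear_diff[OF lam_linear]
 and lam_scale = linear_scale[OF lam_linear] and lam_sum = linear_sum[OF lam_linear]
 and lam_0 = linear_0[OF lam_linear] and lam_neg = linear_neg[OF lam_linear]

lemma lam_P [simp]: "lam h (P x) = 0" and lam_I [simp]: "lam h (I x) = lam h x"
 by (simp_all add: lam_def)

lemma lam_bound: "\<exists>K>0. \<forall>h\<in>Hs. \<forall>x. \<bar>lam h x\<bar> <= K * norm x"
proof -
 have "\<forall>h. \<exists>K>0. \<forall>x. norm (lam h x) <= K * norm x" using linear_bounded_pos[OF lam_linear] by blast
 from choice[OF this] obtain K where K: "\<And>h. K h > 0" "\<And>h x. norm (lam h x) <= K h * norm x" by blast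
 have "\<bar>lam h x\<bar> <= ((\<Sum>h\<in>Hs. K h) + 1) * norm x" if h: "h \<in> Hs" for h x
 proof -
  have "K h <= (\<Sum>h\<in>Hs. K h)" by (rule member_le_sum[OF h]) (use K finH in \<open>auto simp: less_imp_le\<close>)
  then have "K h * norm x <= ((\<Sum>h\<in>Hs. K h) + 1) * norm x" by (intro mult_right_mono) auto
  then show ?thesis using K(2)[of h x] by simp
 qed
 moreover have "(\<Sum>h\<in>Hs. K h) + 1 > 0" by (simp add: K(1) add_nonneg_pos sum_nonneg less_imp_le)
 ultimately show ?thesis by blast
qed

lemma Win_bdd: "bounded Win" unfolding Win_def using finL W_bdd by (intro bounded_UN) auto

lemma Win_I: "Win \<subseteq> range I" unfolding Win_def using W_I by auto

lemma Win_bound: "\<exists>rh>0. \<forall>x\<in>Win. norm x <= rh" using Win_bdd by (simp add: bounded_pos)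

lemma Win_ball: "\<exists>c\<in>range I. \<exists>r>0. \<forall>y\<in>range I. norm (y - c) < r --> y \<in> Win"
proof -
 obtain z where "z \<in> (\<Union>i\<in>L. W i)" using W_ne by blast
 from W_reg[OF this, of 1] show ?thesis unfolding Win_def by auto
qed

lemma cnt_Win_lower: "\<exists>c>0. \<exists>R0\<ge>1. \<forall>R\<ge>R0. c * R ^ d <= cnt R Win"
proof -
 obtain c r where "c \<in> range I" "r > 0" "\<And>y. y \<in> range I ==> norm (y - c) < r ==> y \<in> Win" using Win_ball by blast
 then show ?thesis by (rule cnt_lower[OF Win_bdd])
qed

lemma cut_transl:
 assumes "i \<in> L" "y \<in> range I" "y' \<in> range I" "g \<in> Ga" "y + I g \<in> W i" "y' + I g \<notin> W i"
 shows "\<exists>h\<in>Hs. (a h \<bullet> y - (b h - lam h g)) * (a h \<bullet> y' - (b h - lam h g)) <= 0"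
proof -
 have "y' + I g \<in> range I" using assms subspace_I by (auto intro: subspace_add)
 from W_cut[OF assms(1,5) this assms(6)] show ?thesis
  by (auto simp: lam_def inner_add_right algebra_simps)
qed

lemma pat_range:
 assumes "y \<in> Win" "(g, i) \<in> pat r y" "\<forall>x\<in>Win. norm x <= rh"
 shows "g \<in> Ga" "N (P g) <= r" "i \<in> L" "y + I g \<in> W i" "norm (I g) <= 2 * rh"
proof -
 show *: "g \<in> Ga" "N (P g) <= r" "i \<in> L" "y + I g \<in> W i" using assms(2) by (auto simp: pat_def)
 have "norm (y + I g) <= rh" "norm y <= rh" using assms(1,3) * by (auto simp: Win_def)
 moreover have "norm (I g) <= norm (y + I g) + norm y" by norm
 ultimately show "norm (I g) <= 2 * rh" by linarith
qed

text \<open>Membership in the window and equality of patches change only across finitely many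
  translated walls, so both the window and the acceptance domain satisfy
  \<open>cuts\<close>.\<close>

lemma acc_frequency: "\<exists>vn. ((\<lambda>R. cnt R (acc r y) / cnt R Win) \<longlongrightarrow> vn) at_top"
proof -
 obtain rh where rh: "rh > 0" "\<forall>x\<in>Win. norm x <= rh" using Win_bound by blast
 \<comment> \<open>If \<open>y\<close> and \<open>y + I g\<close> both lie in the window, then
   \<open>I g\<close> has norm at most \<open>2 rh\<close>, so these are all relevant translations;
   0 accounts for the window itself.\<close>
 define F where "F = insert 0 (pts r (cball 0 (2 * rh)))"
 define K where "K = (\<lambda>(h, g). (a h, b h - lam h g)) ` (Hs \<times> F)"
 have finK: "finite K" unfolding K_def F_def using finH pts_finite by auto
 have Ka: "\<forall>(a, be)\<in>K. a \<in> range I \<and> a ~= 0" using a_I a_nz by (auto simp: K_def)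
 have sep: "\<exists>(a, be)\<in>K. (a \<bullet> y - be) * (a \<bullet> y' - be) <= 0"
  if "i \<in> L" "y \<in> range I" "y' \<in> range I" "g \<in> F" "y + I g \<in> W i" "y' + I g \<notin> W i" for y y' g i
 proof -
  have "g \<in> Ga" using that lat_0 by (auto simp: F_def pts_def)
  from cut_transl[OF that(1,2,3) this that(5,6)] obtain h where
   "h \<in> Hs" "(a h \<bullet> y - (b h - lam h g)) * (a h \<bullet> y' - (b h - lam h g)) <= 0" by blast
  moreover have "(a h, b h - lam h g) \<in> K" using \<open>h \<in> Hs\<close> that(4) by (force simp: K_def)
  ultimately show ?thesis by blast
 qed
 have cW: "cuts K Win" unfolding cuts_def
 proof (intro ballI)
  fix u u' assume u: "u \<in> Win" "u' \<in> range I - Win"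
  then obtain i where "i \<in> L" "u \<in> W i" by (auto simp: Win_def)
  then show "\<exists>(a, be)\<in>K. (a \<bullet> u - be) * (a \<bullet> u' - be) <= 0"
   using u Win_I by (intro sep[of i _ _ 0]) (auto simp: Win_def F_def I_0)
 qed
 have cA: "cuts K (acc r y)" unfolding cuts_def
 proof (intro ballI)
  fix u u' assume u: "u \<in> acc r y" "u' \<in> range I - acc r y"
  show "\<exists>(a, be)\<in>K. (a \<bullet> u - be) * (a \<bullet> u' - be) <= 0"
  proof (cases "u' \<in> Win")
   case False
   then show ?thesis using cW u unfolding cuts_def by (auto simp: acc_def)
  next
   case True
   have uW: "u \<in> Win" using u by (simp add: acc_def)
   have "pat r u ~= pat r u'" using u True by (auto simp: acc_def)
   then obtain g i where gi: "((g, i) \<in> pat r u \<and> (g, i) \<notin> pat r u') \<or> ((g, i) \<in> pat r u' \<and> (g, i) \<notin> pat r u)" by auto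
   then have g: "g \<in> Ga" "N (P g) <= r" "i \<in> L" "norm (I g) <= 2 * rh"
    using pat_range[OF uW _ rh(2), of g i r] pat_range[OF True _ rh(2), of g i r] by blast+
   then have gF: "g \<in> F" by (auto simp: F_def pts_def)
   have "(u + I g \<in> W i \<and> u' + I g \<notin> W i) \<or> (u' + I g \<in> W i \<and> u + I g \<notin> W i)" using gi g by (auto simp: pat_def)
   then show ?thesis
   proof
    assume "u + I g \<in> W i \<and> u' + I g \<notin> W i"
    then show ?thesis using uW True Win_I g gF by (intro sep[of i u u' g]) auto
   next
    assume "u' + I g \<in> W i \<and> u + I g \<notin> W i"
    then have "\<exists>(a, be)\<in>K. (a \<bullet> u' - be) * (a \<bullet> u - be) <= 0" using uW True Win_I g gF by (intro sep[of i u' u g]) auto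
    then show ?thesis by (simp add: mult.commute)
   qed
  qed
 qed
 obtain K0 where K0': "bounded K0 \<and> K0 \<subseteq> range I \<and> (\<exists>c>0. \<exists>R0\<ge>1. \<forall>R\<ge>R0. c * R ^ d <= cnt R K0) \<and>
  (\<forall>A K. bounded A \<and> A \<subseteq> range I \<and> finite K \<and> (\<forall>(a, be)\<in>K. a \<in> range I \<and> a ~= 0) \<and> cuts K A -->
   (\<exists>mu. ((\<lambda>R. cnt R A / cnt R K0) \<longlongrightarrow> mu) at_top))"
  by (rule exE[OF frequency_exists[OF d_pos]])
 then have K0: "bounded K0" "\<exists>c>0. \<exists>R0\<ge>1. \<forall>R\<ge>R0. c * R ^ d <= cnt R K0"
  "\<And>A K. bounded A ==> A \<subseteq> range I ==> finite K ==> (\<forall>(a, be)\<in>K. a \<in> range I \<and> a ~= 0) ==> cuts K A ==>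
   (\<exists>mu. ((\<lambda>R. cnt R A / cnt R K0) \<longlongrightarrow> mu) at_top)"
  by blast+
 have acc_sub: "acc r y \<subseteq> Win" by (auto simp: acc_def)
 obtain mu where mu: "((\<lambda>R. cnt R (acc r y) / cnt R K0) \<longlongrightarrow> mu) at_top"
  using K0(3)[OF bounded_subset[OF Win_bdd acc_sub] order_trans[OF acc_sub Win_I] finK Ka cA] by blast
 obtain om where om: "((\<lambda>R. cnt R Win / cnt R K0) \<longlongrightarrow> om) at_top"
  using K0(3)[OF Win_bdd Win_I finK Ka cW] by blast
 obtain c R0 where c: "c > 0" "R0 >= 1" "\<And>R. R >= R0 ==> c * R ^ d <= cnt R Win" using cnt_Win_lower by metis
 obtain c' R0' where c': "c' > 0" "R0' >= 1" "\<And>R. R >= R0' ==> c' * R ^ d <= cnt R K0" using K0(2) by metis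
 obtain C where C: "C > 0" "\<And>R. R >= 1 ==> cnt R K0 <= C * R ^ d" using cnt_upper[OF K0(1)] by metis
 \<comment> \<open>A positive lower bound for this ratio keeps its limit \<open>om\<close> away from
   0, so that \<open>K0\<close> can be replaced by the window in the denominator.\<close>
 have ev: "\<forall>\<^sub>F R in at_top. c / C <= cnt R Win / cnt R K0 \<and> cnt R K0 > 0"
  using eventually_ge_at_top[of R0] eventually_ge_at_top[of R0']
 proof eventually_elim
  case (elim R)
  have Rd: "R ^ d > 0" using elim c by simp
  have 1: "cnt R K0 > 0" using c'(3)[OF elim(2)] c'(1) Rd by (meson less_le_trans mult_pos_pos)
  have "c * cnt R K0 <= c * (C * R ^ d)" using C(2)[of R] elim c by (intro mult_left_mono) auto
  also have "\<dots> = C * (c * R ^ d)" by simp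
  also have "\<dots> <= C * cnt R Win" using C(1) c(3)[OF elim(1)] by simp
  finally have "c / C <= cnt R Win / cnt R K0" using 1 C(1) by (simp add: field_simps)
  then show ?case using 1 by simp
 qed
 have "c / C <= om"
  by (rule tendsto_lowerbound[OF om]) (use ev in \<open>auto elim: eventually_mono\<close>)
 then have "om ~= 0" using c C by (metis divide_pos_pos not_le)
 have "((\<lambda>R. (cnt R (acc r y) / cnt R K0) / (cnt R Win / cnt R K0)) \<longlongrightarrow> mu / om) at_top"
  by (rule tendsto_divide[OF mu om \<open>om ~= 0\<close>])
 moreover have "\<forall>\<^sub>F R in at_top. (cnt R (acc r y) / cnt R K0) / (cnt R Win / cnt R K0) = cnt R (acc r y) / cnt R Win"
  using ev by eventually_elim simp
 ultimately have "((\<lambda>R. cnt R (acc r y) / cnt R Win) \<longlongrightarrow> mu / om) at_top" by (rule Lim_transform_eventually)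
 then show ?thesis by blast
qed

subsection \<open>Linear repetitivity implies positivity of weights\<close>

text \<open>A packing of the ball of radius of order \<open>R / r\<close>, dilated by
  \<open>r\<close>, gives of the order of \<open>(R / r) ^ d\<close> places; near each of them
  repetitivity supplies an occurrence of the patch, and different places supply different
  occurrences.\<close>

lemma LR_imp_PW: assumes LR shows PW
proof -
 obtain C r0 where C: "C > 0" and r0: "\<And>r x y. r >= r0 ==> x \<in> Gw ==> y \<in> Gw ==>
  \<exists>z\<in>Gw. pat r (I z) = pat r (I y) \<and> N (P (z - x)) <= C * r"
  using assms unfolding LR_def eventually_at_top_linorder by metis
 obtain c0 e where c0: "c0 \<in> range I" "e > 0" "\<And>y. y \<in> range I ==> norm (y - c0) < e ==> y \<in> Win" using Win_ball by blast
 obtain C1 where C1: "C1 > 0" "\<And>p. \<exists>ga\<in>Ga. norm (I ga - I p) < e \<and> norm (ga - p) <= C1" using lattice_near[OF c0(2)] by metis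
 obtain cN CN where N: "cN > 0" "CN > 0" "\<And>x. cN * norm (P x) <= N (P x)" "\<And>x. N (P x) <= CN * norm (P x)"
  using N_equiv by metis
 obtain KP where KP: "KP > 0" "\<And>x. norm (P x) <= KP * norm x" using bounds by metis
 \<comment> \<open>Bounds the distance, divided by \<open>r\<close>, from a dilated packing point to
   its occurrence: \<open>C / cN\<close> from repetitivity, the rest from finding a point of the set
   near the packing point.\<close>
 define k1 where "k1 = C / cN + KP * C1"
 have k1: "k1 > 0" unfolding k1_def using C N KP C1 by (simp add: add_pos_pos)
 define s where "s = 2 * k1 + 1"
 have s: "s > 0" using k1 by (simp add: s_def)
 obtain c where c: "c > 0" "\<And>r. r >= 0 ==> \<exists>X. finite X \<and> X \<subseteq> range P \<and> (\<forall>x\<in>X. norm x <= r) \<and>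
  (\<forall>x\<in>X. \<forall>y\<in>X. x ~= y --> s <= norm (x - y)) \<and> c * r ^ d <= real (card X)"
  using packing_lower[OF subspace_P s] by metis
 define c' where "c' = c * (1 / (2 * CN)) ^ d"
 have c': "c' > 0" unfolding c'_def using c N by simp
 have count: "c' / r ^ d * R ^ d <= cnt R (acc r (I y))"
  if r: "r >= r0" "r >= 1" and y: "y \<in> Gw" and R: "R >= 2 * CN * k1 * r" for r y R
 proof -
  have "0 <= 2 * CN * k1 * r" using N k1 r by simp
  then have R0: "R >= 0" using R by linarith
  then have "R / (2 * CN * r) >= 0" using N r by simp
  from c(2)[OF this] obtain X where X: "finite X" "X \<subseteq> range P" "\<forall>x\<in>X. norm x <= R / (2 * CN * r)"
   "\<forall>x\<in>X. \<forall>y\<in>X. x ~= y --> s <= norm (x - y)" "c * (R / (2 * CN * r)) ^ d <= real (card X)" by blast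
  have "\<exists>z\<in>Gw. pat r (I z) = pat r (I y) \<and> norm (P z - r *\<^sub>R p) <= k1 * r" if p: "p \<in> X" for p
  proof -
   obtain ga where g: "ga \<in> Ga" "norm (I ga - I (r *\<^sub>R p + c0)) < e" "norm (ga - (r *\<^sub>R p + c0)) <= C1" using C1(2) by blast
   have Ip: "I (r *\<^sub>R p + c0) = c0" using p X(2) I_eq_0_iff[of p] I_id[OF c0(1)] by (auto simp: I_add I_scale)
   have Pp: "P (r *\<^sub>R p + c0) = r *\<^sub>R p" using Ip PI[of "r *\<^sub>R p + c0"] by (metis add_right_cancel)
   have "ga \<in> Gw" using g c0(3)[of "I ga"] Ip by (simp add: Gw_def)
   then obtain z where z: "z \<in> Gw" "pat r (I z) = pat r (I y)" "N (P (z - ga)) <= C * r" using r0[OF r(1) _ y] by blast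
   have "norm (P z - r *\<^sub>R p) = norm (P (z - ga) + P (ga - (r *\<^sub>R p + c0)))" using Pp by (simp add: P_diff P_add)
   also have "\<dots> <= norm (P (z - ga)) + norm (P (ga - (r *\<^sub>R p + c0)))" by (rule norm_triangle_ineq)
   also have "norm (P (z - ga)) <= C * r / cN" using N(1) N(3)[of "z - ga"] z(3) by (simp add: field_simps)
   also have "norm (P (ga - (r *\<^sub>R p + c0))) <= KP * C1" using KP(2) g(3) KP(1) by (meson less_imp_le mult_left_mono order_trans)
   also have "KP * C1 <= KP * C1 * r" using KP C1 r by simp
   finally have "norm (P z - r *\<^sub>R p) <= k1 * r" by (simp add: k1_def algebra_simps)
   then show ?thesis using z by blast
  qed
  then obtain f where f: "\<And>p. p \<in> X ==> f p \<in> Gw" "\<And>p. p \<in> X ==> pat r (I (f p)) = pat r (I y)"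
   "\<And>p. p \<in> X ==> norm (P (f p) - r *\<^sub>R p) <= k1 * r" by metis
  have ij: "inj_on f X"
  proof (rule inj_onI, rule ccontr)
   fix p q assume pq: "p \<in> X" "q \<in> X" "f p = f q" "p ~= q"
   have "norm (r *\<^sub>R p - r *\<^sub>R q) <= norm (P (f q) - r *\<^sub>R q) + norm (P (f p) - r *\<^sub>R p)"
    using norm_triangle_ineq4[of "P (f q) - r *\<^sub>R q" "P (f p) - r *\<^sub>R p"] unfolding pq(3) by simp
   also have "\<dots> <= k1 * r + k1 * r" using f(3)[OF pq(1)] f(3)[OF pq(2)] unfolding pq(3) by (intro add_mono)
   finally have "r * norm (p - q) <= r * (2 * k1)" using r by (simp add: algebra_simps flip: scaleR_diff_right)
   then have "norm (p - q) <= 2 * k1" using r by simp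
   then show False using X(4) pq unfolding s_def by fastforce
  qed
  have "f ` X \<subseteq> pts R (acc r (I y))"
  proof
   fix z assume "z \<in> f ` X"
   then obtain p where p: "p \<in> X" "z = f p" by blast
   have "norm (P z) <= norm (P z - r *\<^sub>R p) + norm (r *\<^sub>R p)"
    using norm_triangle_ineq[of "P z - r *\<^sub>R p" "r *\<^sub>R p"] by simp
   also have "\<dots> <= k1 * r + r * (R / (2 * CN * r))"
    unfolding p(2)
   proof (rule add_mono[OF f(3)[OF p(1)]])
    have "r * norm p <= r * (R / (2 * CN * r))" using X(3) p(1) r by (intro mult_left_mono) auto
    then show "norm (r *\<^sub>R p) <= r * (R / (2 * CN * r))" using r by simp
   qed
   also have "r * (R / (2 * CN * r)) = R / (2 * CN)" using r N by simp
   finally have "CN * norm (P z) <= CN * (k1 * r + R / (2 * CN))" using N by (intro mult_left_mono) auto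
   also have "\<dots> = CN * k1 * r + R / 2" using N by (simp add: distrib_left)
   also have "\<dots> <= R" using R by (simp add: mult.assoc)
   finally have "N (P z) <= R" using N(4)[of z] by linarith
   then show "z \<in> pts R (acc r (I y))" using f[OF p(1)] p(2) by (auto simp: pts_def acc_def Gw_def)
  qed
  moreover have "bounded (acc r (I y))" by (rule bounded_subset[OF Win_bdd]) (auto simp: acc_def)
  ultimately have "card (f ` X) <= card (pts R (acc r (I y)))" by (intro card_mono pts_finite)
  then have "real (card X) <= cnt R (acc r (I y))" using ij by (simp add: card_image cnt_def)
  moreover have "c * (R / (2 * CN * r)) ^ d = c' / r ^ d * R ^ d" by (simp add: c'_def power_divide power_mult_distrib)
  ultimately show ?thesis using X(5) by linarith
 qed
 obtain CW where CW: "CW > 0" "\<And>R. R >= 1 ==> cnt R Win <= CW * R ^ d" using cnt_upper[OF Win_bdd] by metis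
 obtain cW RW where cW: "cW > 0" "RW >= 1" "\<And>R. R >= RW ==> cW * R ^ d <= cnt R Win" using cnt_Win_lower by metis
 have "\<exists>vn. ((\<lambda>R. cnt R (acc r (I y)) / cnt R Win) \<longlongrightarrow> vn) at_top \<and> c' / CW / r ^ d <= vn"
  if r: "r >= max r0 1" and y: "y \<in> Gw" for r y
 proof -
  obtain vn where vn: "((\<lambda>R. cnt R (acc r (I y)) / cnt R Win) \<longlongrightarrow> vn) at_top" using acc_frequency by blast
  have "c' / CW / r ^ d <= vn"
  proof (rule tendsto_lowerbound[OF vn])
   show "\<forall>\<^sub>F R in at_top. c' / CW / r ^ d <= cnt R (acc r (I y)) / cnt R Win"
    using eventually_ge_at_top[of "2 * CN * k1 * r"] eventually_ge_at_top[of RW]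
   proof eventually_elim
    case (elim R)
    have Rd: "R ^ d > 0" using elim cW by simp
    then have pos: "cnt R Win > 0" using cW(3)[OF elim(2)] cW(1) by (meson less_le_trans mult_pos_pos)
    have rd: "r ^ d > 0" using r by simp
    have "c' / CW / r ^ d * cnt R Win <= c' / CW / r ^ d * (CW * R ^ d)"
     using CW(2)[of R] elim cW c' CW(1) rd by (intro mult_left_mono) auto
    also have "\<dots> = c' / r ^ d * R ^ d" using CW by simp
    also have "\<dots> <= cnt R (acc r (I y))" using count[of r y R] r y elim by simp
    finally show ?case using pos by (simp add: pos_le_divide_eq)
   qed
  qed simp
  then show ?thesis using vn by blast
 qed
 then have "\<forall>\<^sub>F r in at_top. \<forall>y\<in>Gw. \<exists>vn. ((\<lambda>R. cnt R (acc r (I y)) / cnt R Win) \<longlongrightarrow> vn) at_top \<and> c' / CW / r ^ d <= vn"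
  unfolding eventually_at_top_linorder by blast
 moreover have "c' / CW > 0" using c' CW by simp
 ultimately show ?thesis unfolding PW_def by blast
qed

subsection \<open>Positivity of weights bounds the complexity\<close>

text \<open>Acceptance domains of different patches are disjoint, so their frequencies add up to at
  most 1, while each is at least \<open>c / r ^ d\<close>.\<close>

lemma PW_patches:
 assumes PW
 shows "\<exists>C>0. \<forall>\<^sub>F r in at_top. finite ((\<lambda>y. pat r (I y)) ` Gw) \<and> real (card ((\<lambda>y. pat r (I y)) ` Gw)) <= C * r ^ d"
proof -
 obtain c where c: "c > 0" and ev: "\<forall>\<^sub>F r in at_top. \<forall>y\<in>Gw.
  \<exists>vn. ((\<lambda>R. cnt R (acc r (I y)) / cnt R Win) \<longlongrightarrow> vn) at_top \<and> c / r ^ d <= vn"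
  using assms PW_def by blast
 have "\<forall>\<^sub>F r in at_top. finite ((\<lambda>y. pat r (I y)) ` Gw) \<and> real (card ((\<lambda>y. pat r (I y)) ` Gw)) <= 1 / c * r ^ d"
  using ev eventually_ge_at_top[of 1]
 proof eventually_elim
  case (elim r)
  have rd: "r ^ d > 0" using elim by simp
  have fin: "real (card F) <= 1 / c * r ^ d" if F: "finite F" "F \<subseteq> (\<lambda>y. pat r (I y)) ` Gw" for F
  proof -
   have "\<forall>p\<in>F. \<exists>y. y \<in> Gw \<and> pat r (I y) = p" using F by auto
   from bchoice[OF this] obtain f where f: "\<And>p. p \<in> F ==> f p \<in> Gw" "\<And>p. p \<in> F ==> pat r (I (f p)) = p" by blast
   have "\<forall>p\<in>F. \<exists>vn. ((\<lambda>R. cnt R (acc r (I (f p))) / cnt R Win) \<longlongrightarrow> vn) at_top \<and> c / r ^ d <= vn" using elim(1) f by blast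
   from bchoice[OF this] obtain vn where vn: "\<And>p. p \<in> F ==> ((\<lambda>R. cnt R (acc r (I (f p))) / cnt R Win) \<longlongrightarrow> vn p) at_top"
    "\<And>p. p \<in> F ==> c / r ^ d <= vn p" by blast
   have bA: "bounded (acc r (I (f p)))" for p by (rule bounded_subset[OF Win_bdd]) (auto simp: acc_def)
   have lim: "((\<lambda>R. \<Sum>p\<in>F. cnt R (acc r (I (f p))) / cnt R Win) \<longlongrightarrow> (\<Sum>p\<in>F. vn p)) at_top"
    by (rule tendsto_sum) (rule vn(1))
   have "(\<Sum>p\<in>F. cnt R (acc r (I (f p))) / cnt R Win) <= 1" for R
   proof -
    have "(\<Sum>p\<in>F. cnt R (acc r (I (f p)))) = cnt R (\<Union>p\<in>F. acc r (I (f p)))"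
     by (rule cnt_disjoint_UN[symmetric, OF F(1) bA]) (use f(2) in \<open>auto simp: acc_def\<close>)
    also have "\<dots> <= cnt R Win" by (rule cnt_mono[OF Win_bdd]) (auto simp: acc_def)
    finally show ?thesis using cnt_nonneg[of R Win]
     by (auto simp: divide_le_eq_1 less_le simp flip: sum_divide_distrib)
   qed
   then have "(\<Sum>p\<in>F. vn p) <= 1" by (intro tendsto_upperbound[OF lim]) auto
   moreover have "(\<Sum>p\<in>F. c / r ^ d) <= (\<Sum>p\<in>F. vn p)" by (rule sum_mono) (rule vn(2))
   ultimately have "real (card F) * (c / r ^ d) <= 1" by simp
   then show ?thesis using c rd by (simp add: field_simps)
  qed
  \<comment> \<open>An infinite set has \<open>card\<close> equal to 0, so finiteness has to be
    secured separately; the bound for finite subsets does it.\<close>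
  have "finite ((\<lambda>y. pat r (I y)) ` Gw)"
  proof (rule ccontr)
   assume "infinite ((\<lambda>y. pat r (I y)) ` Gw)"
   then obtain F where F: "finite F" "card F = nat \<lceil>1 / c * r ^ d\<rceil> + 1" "F \<subseteq> (\<lambda>y. pat r (I y)) ` Gw"
    using infinite_arbitrarily_large by blast
   have "real (card F) <= 1 / c * r ^ d" using fin F by blast
   then show False using F(2) by linarith
  qed
  then show ?case using fin by blast
 qed
 then show ?thesis using c by (intro exI[of _ "1 / c"]) auto
qed

subsection \<open>Flags, stabilisers and ranks\<close>

text \<open>Independence of the \<open>n\<close> normals is used in place of the intersection in a
  single point; \<open>flags_eq\<close> shows the equivalence.\<close>

definition flag :: "'h set \<Rightarrow> bool" where
 "flag f \<longleftrightarrow> f \<subseteq> Hs \<and> card f = n \<and> (\<forall>y\<in>range I. (\<forall>h\<in>f. a h \<bullet> y = 0) --> y = 0)"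

definition stab :: "'h \<Rightarrow> 'e set" where "stab h = {ga\<in>Ga. lam h ga = 0}"

definition U :: "'h \<Rightarrow> 'e set" where "U h = span (stab h)"

text \<open>The rank of the group of heights that lattice vectors take over the wall
  \<open>h\<close>.\<close>

definition cdim :: "'h \<Rightarrow> nat" where "cdim h = DIM('e) - dim (U h)"

text \<open>The axis of \<open>h\<close> in the flag: lattice translations that move only the wall
  \<open>h\<close> of \<open>f\<close>.\<close>

definition axg :: "'h set \<Rightarrow> 'h \<Rightarrow> 'e set" where
 "axg f h = {ga\<in>Ga. \<forall>l\<in>f - {h}. lam l ga = 0}"

text \<open>The rank condition equivalent to property C.\<close>

definition RC :: bool where "RC \<longleftrightarrow> (\<forall>f. flag f --> (\<Sum>h\<in>f. cdim h) = DIM('e))"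

lemma flag_finite: "flag f ==> finite f" using finH finite_subset by (auto simp: flag_def)

lemma flag_Hs: "flag f ==> h \<in> f ==> h \<in> Hs" by (auto simp: flag_def)

lemma flag_lam_0: assumes "flag f" "ga \<in> Ga" "\<And>h. h \<in> f ==> lam h ga = 0" shows "ga = 0"
proof -
 have "I ga = 0" using assms(1,3) unfolding flag_def lam_def by blast
 then show ?thesis by (rule injI[OF assms(2)])
qed

lemma dim_k: "d + n = DIM('e)"
proof -
 have "{x + y |x y. x \<in> range P \<and> y \<in> range I} = UNIV" using PI by (auto, metis rangeI)
 moreover have "range P \<inter> range I = {0}"
 proof
  show "range P \<inter> range I \<subseteq> {0}"
  proof
   fix x assume "x \<in> range P \<inter> range I"
   then show "x \<in> {0}" using I_eq_0_iff[of x] by auto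
  qed
  show "{0} \<subseteq> range P \<inter> range I" using subspace_0[OF subspace_P] subspace_0[OF subspace_I] by blast
 qed
 ultimately show ?thesis using dim_sums_Int[OF subspace_P subspace_I] by simp
qed

section \<open>Dual bases of flags\<close>

definition dual :: "'h set \<Rightarrow> ('h \<Rightarrow> 'e) \<Rightarrow> bool" where
 "dual f u \<longleftrightarrow> (\<forall>h\<in>f. u h \<in> range I) \<and> (\<forall>h\<in>f. \<forall>l\<in>f. a l \<bullet> u h = (if l = h then 1 else 0))"

lemma dualD:
 assumes "dual f u"
 shows "h \<in> f ==> u h \<in> range I" "h \<in> f ==> l \<in> f ==> a l \<bullet> u h = (if l = h then 1 else 0)"
 using assms by (simp_all add: dual_def)

lemma flag_dual:
 assumes f: "flag f"
 shows "\<exists>u. dual f u"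
proof -
 have ff: "finite f" by (rule flag_finite[OF f])
 have aI: "a ` f \<subseteq> range I" using f a_I by (auto simp: flag_def)
 have sp: "range I \<subseteq> span (a ` f)"
 proof
  fix y assume y: "y \<in> range I"
  obtain p q where pq: "p \<in> span (a ` f)" "\<And>v. v \<in> span (a ` f) ==> orthogonal q v" "y = p + q"
   using orthogonal_subspace_decomp_exists by metis
  have "p \<in> range I" using pq(1) aI subspace_I by (metis span_minimal subsetD)
  then have "y - p \<in> range I" using y subspace_I by (intro subspace_diff)
  then have qI: "q \<in> range I" using pq(3) by simp
  have "a h \<bullet> q = 0" if "h \<in> f" for h
   using pq(2)[OF span_base, of "a h"] that by (simp add: orthogonal_def inner_commute)
  then have "q = 0" using f qI unfolding flag_def by blast
  then show "y \<in> span (a ` f)" using pq by simp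
 qed
 have "n <= dim (a ` f)" using dim_subset[OF sp] by (simp add: dim_span)
 then have nn: "n <= card (a ` f)" using dim_le_card'[of "a ` f"] ff by simp
 moreover have "card (a ` f) <= card f" using ff by (rule card_image_le)
 ultimately have "card (a ` f) = card f" using f by (simp add: flag_def)
 then have inj: "inj_on a f" using ff by (simp add: eq_card_imp_inj_on)
 have ind: "independent (a ` f)"
  by (rule card_le_dim_spanning[OF aI sp]) (use ff f \<open>card (a ` f) = card f\<close> in \<open>auto simp: flag_def\<close>)
 have "\<exists>v. v \<in> range I \<and> (\<forall>l\<in>f. a l \<bullet> v = (if l = h then 1 else 0))" if h: "h \<in> f" for h
 proof -
  obtain g :: "'e \<Rightarrow> real" where g: "linear g" "\<forall>x\<in>a ` f. g x = (if x = a h then 1 else 0)"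
   using linear_independent_extend[OF ind, of "\<lambda>x. if x = a h then 1 else (0::real)"] by (rule exE) (elim conjE, rule that)
  \<comment> \<open>\<open>adjoint g 1\<close> represents \<open>g\<close> as an inner product; its
    component in the internal space has the same products with the normals.\<close>
  obtain p q where pq: "p \<in> span (range I)" "\<And>v. v \<in> span (range I) ==> orthogonal q v" "adjoint g 1 = p + q"
   using orthogonal_subspace_decomp_exists by metis
  have "a l \<bullet> p = (if l = h then 1 else 0)" if l: "l \<in> f" for l
  proof -
   have "a l \<bullet> q = 0" using pq(2)[OF span_base, of "a l"] aI l by (auto simp: orthogonal_def inner_commute)
   then have "a l \<bullet> p = a l \<bullet> adjoint g 1" by (simp add: pq(3) inner_add_right)
   also have "\<dots> = g (a l)" by (simp add: adjoint_works[OF g(1)])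
   also have "\<dots> = (if l = h then 1 else 0)" using g(2) l h inj by (auto simp: inj_on_def)
   finally show ?thesis .
  qed
  moreover have "p \<in> range I" using pq(1) subspace_I span_eq_iff by blast
  ultimately show ?thesis by blast
 qed
 then have "\<forall>h\<in>f. \<exists>v. v \<in> range I \<and> (\<forall>l\<in>f. a l \<bullet> v = (if l = h then 1 else 0))" by blast
 from bchoice[OF this] show ?thesis unfolding dual_def by blast
qed

lemma flag_expand:
 assumes f: "flag f" and u: "\<And>h. h \<in> f ==> u h \<in> range I"
  "\<And>h l. h \<in> f ==> l \<in> f ==> a l \<bullet> u h = (if l = h then 1 else 0)" and y: "y \<in> range I"
 shows "y = (\<Sum>h\<in>f. (a h \<bullet> y) *\<^sub>R u h)"
proof -
 have "y - (\<Sum>h\<in>f. (a h \<bullet> y) *\<^sub>R u h) \<in> range I"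
  by (intro subspace_diff[OF subspace_I] subspace_sum[OF subspace_I] subspace_scale[OF subspace_I] u y)
 moreover have "a l \<bullet> (y - (\<Sum>h\<in>f. (a h \<bullet> y) *\<^sub>R u h)) = 0" if l: "l \<in> f" for l
 proof -
  have "(\<Sum>h\<in>f. (a h \<bullet> y) * (a l \<bullet> u h)) = (\<Sum>h\<in>f. if h = l then a l \<bullet> y else 0)"
   by (rule sum.cong) (use u(2) l in auto)
  then show ?thesis using l flag_finite[OF f] by (simp add: inner_diff_right inner_sum_right)
 qed
 ultimately have "y - (\<Sum>h\<in>f. (a h \<bullet> y) *\<^sub>R u h) = 0" using f unfolding flag_def by blast
 then show ?thesis by simp
qed

lemma dual_coord:
 assumes f: "flag f" and u: "\<And>h l. h \<in> f ==> l \<in> f ==> a l \<bullet> u h = (if l = h then 1 else 0)" and l: "l \<in> f"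
 shows "a l \<bullet> (\<Sum>h\<in>f. t h *\<^sub>R u h) = t l"
proof -
 have "a l \<bullet> (\<Sum>h\<in>f. t h *\<^sub>R u h) = (\<Sum>h\<in>f. t h * (a l \<bullet> u h))" by (simp add: inner_sum_right)
 also have "\<dots> = (\<Sum>h\<in>f. if h = l then t l else 0)" by (rule sum.cong) (use u l in auto)
 finally show ?thesis using l flag_finite[OF f] by simp
qed

section \<open>Stabilisers and axis groups: dimension counts\<close>

lemma stab_sub: "zsubgroup (stab h)" "stab h \<subseteq> Ga"
 unfolding zsubgroup_iff stab_def by (auto simp: lat_0 lat_add lat_scale lam_add lam_scale lam_0)

lemma axg_sub: "zsubgroup (axg f h)" "axg f h \<subseteq> Ga"
 unfolding zsubgroup_iff axg_def by (auto simp: lat_0 lat_add lat_scale lam_add lam_scale lam_0)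

lemma subspace_U: "subspace (U h)" by (simp add: U_def)

lemma U_lam: "x \<in> U h ==> lam h x = 0"
proof -
 have "subspace {x. lam h x = 0}" by (rule linear_subspace_kernel[OF lam_linear])
 moreover have "stab h \<subseteq> {x. lam h x = 0}" by (auto simp: stab_def)
 ultimately have "U h \<subseteq> {x. lam h x = 0}" unfolding U_def by (rule span_minimal[rotated])
 then show "x \<in> U h ==> lam h x = 0" by blast
qed

lemma INT_U: "finite g ==> (\<Inter>l\<in>g. U l) = span {ga\<in>Ga. \<forall>l\<in>g. lam l ga = 0}"
proof (induction g rule: finite_induct)
 case empty then show ?case using lattice_span by simp
next
 case (insert x g)
 let ?A = "{ga\<in>Ga. \<forall>l\<in>g. lam l ga = 0}"
 have "zsubgroup ?A" unfolding zsubgroup_iff by (auto simp: lat_0 lat_add lat_scale lam_add lam_scale lam_0)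
 then have "span (stab x) \<inter> span ?A = span (stab x \<inter> ?A)" by (intro span_Int_sublattice stab_sub) auto
 moreover have "stab x \<inter> ?A = {ga\<in>Ga. \<forall>l\<in>insert x g. lam l ga = 0}" by (auto simp: stab_def)
 ultimately show ?case using insert by (simp add: U_def)
qed

lemma axg_span: "finite f ==> span (axg f h) = (\<Inter>l\<in>f - {h}. U l)"
 using INT_U[of "f - {h}"] by (simp add: axg_def)

text \<open>Codimension inside \<open>V\<close> is subadditive under intersections. The natural
  number subtractions are exact, since \<open>V \<inter> X l\<close> has at most the dimension of
  \<open>V\<close>.\<close>

lemma codim_INT:
 fixes X :: "'b \<Rightarrow> 'e set"
 assumes V: "subspace V"
 shows "finite g ==> (\<And>l. l \<in> g ==> subspace (X l)) ==>
  dim V <= dim (V \<inter> (\<Inter>l\<in>g. X l)) + (\<Sum>l\<in>g. dim V - dim (V \<inter> X l))"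
proof (induction g rule: finite_induct)
 case empty then show ?case by simp
next
 case (insert x g)
 let ?Y = "V \<inter> (\<Inter>l\<in>g. X l)" and ?Z = "V \<inter> X x"
 have sY: "subspace ?Y" using V insert.prems by (intro subspace_inter subspace_Inter) auto
 have sZ: "subspace ?Z" using V insert.prems by (intro subspace_inter) auto
 have "dim {p + q |p q. p \<in> ?Y \<and> q \<in> ?Z} + dim (?Y \<inter> ?Z) = dim ?Y + dim ?Z" by (rule dim_sums_Int[OF sY sZ])
 moreover have "dim {p + q |p q. p \<in> ?Y \<and> q \<in> ?Z} <= dim V"
  by (rule dim_subset) (use V in \<open>auto intro: subspace_add\<close>)
 moreover have "?Y \<inter> ?Z = V \<inter> (\<Inter>l\<in>insert x g. X l)" by auto
 moreover have "dim ?Z <= dim V" by (rule dim_subset) auto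
 moreover have "dim V <= dim ?Y + (\<Sum>l\<in>g. dim V - dim (V \<inter> X l))" using insert by auto
 ultimately show ?case using insert.hyps by simp
qed

text \<open>Otherwise every lattice vector with small internal part could be reduced by the
  stabiliser into a fixed ball without changing its height over \<open>h\<close>; only finitely many
  heights would then occur near 0, against density.\<close>

lemma not_phys_le_U:
 assumes h: "h \<in> Hs" shows "\<not> range P \<subseteq> U h"
proof
 assume sub: "range P \<subseteq> U h"
 obtain C where C: "C > 0" "\<And>x. x \<in> U h ==> \<exists>a\<in>stab h. norm (x - a) <= C" using cocompact[OF stab_sub(1)] U_def by metis
 let ?F = "{ga\<in>Ga. norm ga <= C + 1}"
 have fin: "finite ((\<lambda>ga. \<bar>lam h ga\<bar>) ` ?F - {0})" using lattice_finite by simp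
 obtain ep where ep: "ep > 0" "\<And>ga. ga \<in> ?F ==> lam h ga ~= 0 ==> ep <= \<bar>lam h ga\<bar>"
 proof (cases "(\<lambda>ga. \<bar>lam h ga\<bar>) ` ?F - {0} = {}")
  case True
  have "lam h ga = 0" if "ga \<in> ?F" for ga using True that by (metis (no_types, lifting) Diff_eq_empty_iff abs_eq_0 image_subset_iff singletonD)
  then show ?thesis using that[of 1] by force
 next
  case False
  have "Min ((\<lambda>ga. \<bar>lam h ga\<bar>) ` ?F - {0}) > 0" using fin False by (subst Min_gr_iff) auto
  moreover have "Min ((\<lambda>ga. \<bar>lam h ga\<bar>) ` ?F - {0}) <= \<bar>lam h ga\<bar>" if "ga \<in> ?F" "lam h ga ~= 0" for ga
   using fin that by (intro Min_le) auto
  ultimately show ?thesis using that by blast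
 qed
 have na: "norm (a h) > 0" using a_nz[OF h] by simp
 \<comment> \<open>A lattice vector with internal part close to \<open>?x\<close> has positive
   height at most \<open>2 t norm (a h)\<close>, which is below \<open>ep\<close>.\<close>
 define t where "t = min (1 / 2) (ep / (4 * norm (a h)))"
 have t: "t > 0" "t <= 1 / 2" "t * norm (a h) <= ep / 4" using ep(1) na by (auto simp: t_def min_def field_simps)
 let ?x = "(t / norm (a h)) *\<^sub>R a h"
 have "?x \<in> range I" using a_I[OF h] subspace_I by (intro subspace_scale)
 then obtain ga where g: "ga \<in> Ga" "norm (I ga - ?x) < t / 2" using dense[of ?x "t / 2"] t by auto
 have nx: "norm ?x = t" using na t by simp
 have "norm (I ga) <= norm ?x + norm (I ga - ?x)" by (rule norm_triangle_sub)
 then have nI: "norm (I ga) <= 2 * t" using nx g(2) t by linarith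
 have "\<bar>a h \<bullet> (I ga - ?x)\<bar> <= norm (a h) * (t / 2)"
  using Cauchy_Schwarz_ineq2[of "a h" "I ga - ?x"] g(2) na by (meson less_imp_le mult_left_mono norm_ge_zero order_trans)
 moreover have "a h \<bullet> ?x = t * norm (a h)" using na by (simp add: power2_norm_eq_inner[symmetric] power2_eq_square)
 ultimately have nz: "lam h ga > 0" using t na unfolding lam_def inner_diff_right
  by (smt (verit) field_sum_of_halves mult.commute mult_pos_pos times_divide_eq_left)
 obtain s where s: "s \<in> stab h" "norm (P ga - s) <= C" using C(2) sub by blast
 have "ga - s \<in> ?F"
 proof -
  have "norm (ga - s) = norm ((P ga - s) + I ga)" using PI[of ga] by (metis add_diff_eq diff_add_eq)
  also have "norm ((P ga - s) + I ga) <= C + 1" using norm_triangle_ineq[of "P ga - s" "I ga"] s(2) nI t by linarith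
  finally have "norm (ga - s) <= C + 1" .
  then show ?thesis using g(1) s(1) stab_sub by (auto intro: lat_diff)
 qed
 moreover have ls: "lam h (ga - s) = lam h ga" using s(1) by (simp add: lam_diff stab_def)
 ultimately have "ep <= \<bar>lam h ga\<bar>" using ep(2)[of "ga - s"] nz by simp
 moreover have "\<bar>lam h ga\<bar> <= norm (a h) * (2 * t)" unfolding lam_def
  using Cauchy_Schwarz_ineq2[of "a h" "I ga"] nI na by (meson mult_left_mono norm_ge_zero order_trans)
 moreover have "norm (a h) * (2 * t) = 2 * (t * norm (a h))" by simp
 ultimately show False using t(3) ep(1) by linarith
qed

text \<open>\<open>U h\<close> lies in the kernel of \<open>lam h\<close>, a hyperplane containing
  the physical space; equality is excluded by \<open>not_phys_le_U\<close>. This makes the exponents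
  \<open>dlt\<close> at least 1.\<close>

lemma cdim_ge_2:
 assumes h: "h \<in> Hs" shows "cdim h >= 2"
proof (rule ccontr)
 assume "\<not> cdim h >= 2"
 then have ge: "dim (U h) + 1 >= DIM('e)" unfolding cdim_def by linarith
 let ?S = "{x. lam h x = 0}"
 have sS: "subspace ?S" by (rule linear_subspace_kernel[OF lam_linear])
 have US: "U h \<subseteq> ?S" using U_lam by auto
 have "a h \<notin> ?S"
 proof -
  have "lam h (a h) = a h \<bullet> a h" using I_id[OF a_I[OF h]] by (simp add: lam_def)
  then show ?thesis using a_nz[OF h] by simp
 qed
 then have nU: "?S ~= UNIV" by (metis UNIV_I)
 have sp: "span ?S = ?S" using sS by (rule span_eq_iff[THEN iffD2])
 have "dim ?S ~= DIM('e)" unfolding dim_eq_full sp by (rule nU)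
 then have "dim ?S < DIM('e)" by (rule le_neq_implies_less[OF dim_subset_UNIV])
 then have "dim ?S <= dim (U h)" using ge by linarith
 then have "U h = ?S" by (rule subspace_dim_equal[OF subspace_U sS US])
 moreover have "range P \<subseteq> ?S" by auto
 ultimately show False using not_phys_le_U[OF h] by blast
qed

lemma cdim_le: "cdim h <= DIM('e)" by (simp add: cdim_def)

lemma dim_U: "dim (U h) = DIM('e) - cdim h" "dim (U h) <= DIM('e)"
 unfolding cdim_def using dim_subset_UNIV[of "U h"] by auto

lemma flag_INT_U: "flag f ==> (\<Inter>h\<in>f. U h) = {0}"
proof -
 assume f: "flag f"
 have "{ga\<in>Ga. \<forall>l\<in>f. lam l ga = 0} = {0}" using flag_lam_0[OF f] lat_0 by (auto simp: lam_0)
 then show ?thesis using INT_U[OF flag_finite[OF f]] by simp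
qed

text \<open>Half of the rank condition, valid for every flag because its stabilisers intersect
  trivially.\<close>

lemma sum_cdim_ge: assumes f: "flag f" shows "DIM('e) <= (\<Sum>h\<in>f. cdim h)"
proof -
 have "dim (UNIV::'e set) <= dim (UNIV \<inter> (\<Inter>l\<in>f. U l)) + (\<Sum>l\<in>f. dim (UNIV::'e set) - dim (UNIV \<inter> U l))"
  by (rule codim_INT[OF subspace_UNIV flag_finite[OF f] subspace_U])
 then show ?thesis using flag_INT_U[OF f] by (simp add: cdim_def)
qed

text \<open>The axes are independent: all other axes lie in the stabiliser of \<open>x\<close>,
  which meets the axis of \<open>x\<close> only in 0.\<close>

lemma axg_dims:
 assumes f: "flag f"
 shows "g \<subseteq> f ==> (\<Sum>h\<in>g. dim (axg f h)) = dim (\<Union>h\<in>g. axg f h)"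
proof -
 have "finite g ==> g \<subseteq> f ==> (\<Sum>h\<in>g. dim (axg f h)) = dim (\<Union>h\<in>g. axg f h)"
 proof (induction g rule: finite_induct)
  case empty then show ?case by simp
 next
  case (insert x g)
  let ?Y = "span (\<Union>h\<in>g. axg f h)" and ?Z = "span (axg f x)"
  have "(\<Union>h\<in>g. axg f h) \<subseteq> stab x" using insert by (auto simp: axg_def stab_def)
  then have "?Y \<inter> ?Z \<subseteq> span (stab x) \<inter> ?Z" using span_mono by blast
  also have "\<dots> = span (stab x \<inter> axg f x)" by (rule span_Int_sublattice[OF stab_sub axg_sub])
  also have "stab x \<inter> axg f x \<subseteq> {0}" using flag_lam_0[OF f] by (fastforce simp: stab_def axg_def)
  then have "span (stab x \<inter> axg f x) \<subseteq> {0}" by (metis span_mono span_empty span_insert_0)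
  finally have e0: "dim (?Y \<inter> ?Z) = 0" by simp
  have "dim {p + q |p q. p \<in> ?Y \<and> q \<in> ?Z} + dim (?Y \<inter> ?Z) = dim ?Y + dim ?Z"
   by (rule dim_sums_Int) auto
  then have "dim ((\<Union>h\<in>g. axg f h) \<union> axg f x) = dim (\<Union>h\<in>g. axg f h) + dim (axg f x)"
   unfolding e0 span_Un[symmetric] dim_span by simp
  then show ?case using insert by (simp add: Un_commute)
 qed
 then show "g \<subseteq> f ==> ?thesis" using flag_finite[OF f] finite_subset by blast
qed

text \<open>Every axis has rank at least \<open>cdim h\<close>, since it is cut out by the other
  stabilisers. The axes are independent, so their ranks add up to at most the full dimension, which
  is the sum of the \<open>cdim\<close>; hence equality everywhere.\<close>

lemma axg_rank:
 assumes RC and f: "flag f"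
 shows "h \<in> f ==> dim (axg f h) = cdim h" and "span (\<Union>h\<in>f. axg f h) = UNIV"
proof -
 have ff: "finite f" by (rule flag_finite[OF f])
 have tot: "(\<Sum>h\<in>f. cdim h) = DIM('e)" using assms by (simp add: RC_def)
 have ge: "cdim h <= dim (axg f h)" if h: "h \<in> f" for h
 proof -
  have "dim (UNIV::'e set) <= dim (UNIV \<inter> (\<Inter>l\<in>f - {h}. U l)) + (\<Sum>l\<in>f - {h}. dim (UNIV::'e set) - dim (UNIV \<inter> U l))"
   by (rule codim_INT[OF subspace_UNIV _ subspace_U]) (use ff in simp)
  then have "DIM('e) <= dim (axg f h) + (\<Sum>l\<in>f - {h}. cdim l)" using axg_span[OF ff, of h] by (simp add: cdim_def) (metis dim_span)
  moreover have "(\<Sum>h\<in>f. cdim h) = cdim h + (\<Sum>l\<in>f - {h}. cdim l)" using ff h by (rule sum.remove)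
  ultimately show ?thesis using tot by linarith
 qed
 have le: "(\<Sum>h\<in>f. dim (axg f h)) = dim (\<Union>h\<in>f. axg f h)" by (rule axg_dims[OF f subset_refl])
 moreover have "dim (\<Union>h\<in>f. axg f h) <= DIM('e)" by (rule dim_subset_UNIV)
 moreover have "(\<Sum>h\<in>f. cdim h) <= (\<Sum>h\<in>f. dim (axg f h))" by (rule sum_mono) (rule ge)
 ultimately have eq: "(\<Sum>h\<in>f. dim (axg f h)) = DIM('e)" "dim (\<Union>h\<in>f. axg f h) = DIM('e)" using tot by linarith+
 show "span (\<Union>h\<in>f. axg f h) = UNIV" using eq(2) by (simp add: dim_eq_full)
 show "dim (axg f h) = cdim h" if h: "h \<in> f"
 proof (rule ccontr)
  assume "dim (axg f h) ~= cdim h"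
  then have "(\<Sum>h\<in>f. cdim h) < (\<Sum>h\<in>f. dim (axg f h))"
   using ge h by (intro sum_strict_mono_ex1[OF ff] ballI bexI[of _ h]) (auto simp: order.not_eq_order_implies_strict)
  then show False using tot eq by linarith
 qed
qed

text \<open>The rank condition in terms of the growth exponents of the families of parallel walls.\<close>

lemma RC_if_growth:
 assumes "\<And>f. flag f ==> (\<Sum>h\<in>f. d - dim (range P \<inter> U h)) <= d"
 shows RC
 unfolding RC_def
proof (intro allI impI)
 fix f assume f: "flag f"
 have ff: "finite f" by (rule flag_finite[OF f])
 let ?e = "\<lambda>h. dim (range P \<inter> U h)"
 have tot: "(\<Sum>h\<in>f. d - ?e h) <= d" by (rule assms[OF f])
 have "range P \<inter> {0} = {0}" using subspace_0[OF subspace_P] by blast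
 then have tot': "d <= (\<Sum>h\<in>f. d - ?e h)"
  using codim_INT[OF subspace_P ff subspace_U, of "\<lambda>h. h"] flag_INT_U[OF f] by simp
 have lt: "?e h < d" if h: "h \<in> f" for h
 proof -
  have "range P \<inter> U h ~= range P" using not_phys_le_U[OF flag_Hs[OF f h]] by blast
  moreover have "subspace (range P \<inter> U h)" by (intro subspace_inter subspace_P subspace_U)
  ultimately show ?thesis using subspace_dim_equal[of "range P \<inter> U h" "range P"] subspace_P
   by (metis dim_subset inf_le1 le_neq_implies_less nle_le)
 qed
 have ax: "d - ?e h + 1 <= dim (axg f h)" if h: "h \<in> f" for h
 proof -
  let ?K = "range P \<inter> (\<Inter>l\<in>f - {h}. U l)"
  have "d <= dim ?K + (\<Sum>l\<in>f - {h}. d - ?e l)" by (rule codim_INT[OF subspace_P _ subspace_U]) (use ff in simp)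
  moreover have "(\<Sum>h\<in>f. d - ?e h) = (d - ?e h) + (\<Sum>l\<in>f - {h}. d - ?e l)" using ff h by (rule sum.remove)
  ultimately have K: "d - ?e h <= dim ?K" using tot by linarith
  have KA: "?K \<subseteq> span (axg f h)" using axg_span[OF ff] by auto
  have sK: "subspace ?K" by (intro subspace_inter subspace_P subspace_Inter) (auto simp: subspace_U)
  \<comment> \<open>A lattice vector in the physical space is 0, so the span of a nonzero axis does
    not lie in the physical space. This is the extra 1 in the rank.\<close>
  have "?K ~= span (axg f h)"
  proof
   assume eq: "?K = span (axg f h)"
   have "ga = 0" if "ga \<in> axg f h" for ga
    using that span_base[OF that] axg_sub(2) I_eq_0_iff injI unfolding eq[symmetric] by blast
   then have "axg f h \<subseteq> {0}" by auto
   then have "dim (axg f h) = 0" by simp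
   then have "dim ?K = 0" by (simp add: eq dim_span)
   then show False using K lt[OF h] by linarith
  qed
  then have "dim ?K < dim (span (axg f h))" using subspace_dim_equal[OF sK subspace_span KA] dim_subset[OF KA] by linarith
  then show ?thesis using K by (simp add: dim_span)
 qed
 have cd: "cdim h <= dim (axg f h)" and cA: "(\<Sum>h\<in>f. dim (axg f h)) <= DIM('e)" if h: "h \<in> f" for h
 proof -
  have le: "(\<Sum>h\<in>f. dim (axg f h)) = dim (\<Union>h\<in>f. axg f h)" by (rule axg_dims[OF f subset_refl])
  then show cA: "(\<Sum>h\<in>f. dim (axg f h)) <= DIM('e)" using dim_subset_UNIV by metis
  \<comment> \<open>Summed over the \<open>n\<close> walls of the flag this gives at least
    \<open>d + n\<close>, the full rank, so the axes span everything. All axes but that of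
    \<open>h\<close> lie in \<open>U h\<close>, which bounds its codimension from above.\<close>
  have "(\<Sum>h\<in>f. d - ?e h + 1) <= (\<Sum>h\<in>f. dim (axg f h))" by (rule sum_mono) (rule ax)
  moreover have "(\<Sum>h\<in>f. d - ?e h + 1) = (\<Sum>h\<in>f. d - ?e h) + n" using f by (simp only: sum.distrib flag_def) simp
  ultimately have eq: "(\<Sum>h\<in>f. dim (axg f h)) = DIM('e)" using tot' cA dim_k by linarith
  have "(\<Union>l\<in>f - {h}. axg f l) \<subseteq> U h" using h by (auto simp: axg_def U_def stab_def intro!: span_base)
  then have "dim (\<Union>l\<in>f - {h}. axg f l) <= dim (U h)" by (rule dim_subset)
  moreover have "(\<Sum>h\<in>f - {h}. dim (axg f h)) = dim (\<Union>h\<in>f - {h}. axg f h)" by (rule axg_dims[OF f]) auto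
  moreover have "(\<Sum>l\<in>f. dim (axg f l)) = dim (axg f h) + (\<Sum>l\<in>f - {h}. dim (axg f l))" using ff h by (rule sum.remove)
  ultimately show "cdim h <= dim (axg f h)" unfolding cdim_def using eq by linarith
 qed
 have "(\<Sum>h\<in>f. cdim h) <= (\<Sum>h\<in>f. dim (axg f h))" by (rule sum_mono) (rule cd)
 moreover have "(\<Sum>h\<in>f. dim (axg f h)) <= DIM('e)"
  by (subst axg_dims[OF f subset_refl]) (rule dim_subset_UNIV)
 ultimately show "(\<Sum>h\<in>f. cdim h) = DIM('e)" using sum_cdim_ge[OF f] by linarith
qed

subsection \<open>Positivity of weights implies the rank condition\<close>

text \<open>On the orthogonal complement of \<open>range P \<inter> V\<close> in \<open>V\<close>
  the map \<open>I\<close> has trivial kernel, so the length of the internal part is a norm there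
  and controls the distance.\<close>

lemma near_kernel:
 assumes V: "subspace V"
 shows "\<exists>C>0. \<forall>x\<in>V. \<exists>y\<in>range P \<inter> V. norm (x - y) <= C * norm (I x)"
proof -
 let ?K = "range P \<inter> V"
 define T where "T = V \<inter> {z. \<forall>x\<in>?K. orthogonal x z}"
 have sT: "subspace T" unfolding T_def by (intro subspace_inter V subspace_orthogonal_to_vectors)
 have "norm_on T (\<lambda>z. norm (I z))"
  unfolding norm_on_def
 proof (intro conjI ballI allI)
  fix x assume x: "x \<in> T"
  show "(norm (I x) = 0) = (x = 0)"
  proof
   assume "norm (I x) = 0"
   then have "x \<in> ?K" using x I_eq_0_iff by (auto simp: T_def)
   then have "orthogonal x x" using x by (auto simp: T_def)
   then show "x = 0" by (simp add: orthogonal_self)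
  qed (simp add: I_0)
 next
  fix x y show "norm (I (x + y)) <= norm (I x) + norm (I y)" by (simp add: I_add norm_triangle_ineq)
 qed (simp_all add: I_scale)
 then obtain c where c: "c > 0" "\<And>z. z \<in> T ==> c * norm z <= norm (I z)" using norm_on_equiv[OF sT] by metis
 have "\<exists>y\<in>?K. norm (x - y) <= (1 / c) * norm (I x)" if x: "x \<in> V" for x
 proof -
  obtain y z where yz: "y \<in> span ?K" "\<And>u. u \<in> span ?K ==> orthogonal z u" "x = y + z"
   using orthogonal_subspace_decomp_exists by metis
  have sK: "subspace ?K" by (intro subspace_inter subspace_P V)
  have y: "y \<in> ?K" using yz(1) sK by (simp only: span_eq_iff[THEN iffD2])
  have "z = x - y" using yz(3) by simp
  then have "z \<in> V" using x y V by (auto intro: subspace_diff)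
  moreover have "orthogonal u z" if "u \<in> ?K" for u using yz(2)[OF span_base[OF that]] by (simp add: orthogonal_commute)
  ultimately have "z \<in> T" by (simp add: T_def)
  then have "c * norm z <= norm (I z)" by (rule c)
  moreover have "I z = I x" using y \<open>z = x - y\<close> I_eq_0_iff by (auto simp: I_diff)
  ultimately have "norm z <= (1 / c) * norm (I x)" using c(1) by (simp add: field_simps)
  then show ?thesis using y \<open>z = x - y\<close> by auto
 qed
 then show ?thesis using c(1) by (intro exI[of _ "1 / c"]) auto
qed

text \<open>By \<open>near_kernel\<close>, stabiliser vectors with bounded internal part stay near
  \<open>range P \<inter> U h\<close>, so the dimension of that space is their growth
  exponent.\<close>

lemma stab_count:
 "\<exists>C>0. \<forall>r\<ge>1. \<forall>X. X \<subseteq> {ga\<in>stab h. N (P ga) <= r \<and> norm (I ga) <= rh} -->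
  finite X \<and> real (card X) <= C * r ^ dim (range P \<inter> U h)"
proof -
 obtain si where s: "si > 0" "\<forall>ga\<in>Ga. ga ~= 0 --> si <= norm ga" using lattice_separated by auto
 obtain kp where k: "kp > 0" "\<And>x. norm x <= kp * N (P x) + norm (I x)" using norm_le_N by metis
 obtain c where c: "c > 0" "\<And>x. x \<in> U h ==> \<exists>y\<in>range P \<inter> U h. norm (x - y) <= c * norm (I x)" using near_kernel[OF subspace_U] by metis
 have sK: "subspace (range P \<inter> U h)" by (intro subspace_inter subspace_P subspace_U)
 obtain C where C: "C > 0" and Cb: "\<forall>r\<ge>1. \<forall>X. (\<forall>x\<in>X. norm x <= r \<and> (\<exists>y\<in>range P \<inter> U h. norm (x - y) <= c * rh)) \<and>
  (\<forall>x\<in>X. \<forall>y\<in>X. x ~= y --> si <= norm (x - y)) --> finite X \<and> real (card X) <= C * r ^ dim (range P \<inter> U h)"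
  using packing_upper[OF sK s(1), of "c * rh"] by metis
 have "finite X \<and> real (card X) <= (C * (kp + \<bar>rh\<bar> + 1) ^ dim (range P \<inter> U h)) * r ^ dim (range P \<inter> U h)"
  if r: "r >= 1" and X: "X \<subseteq> {ga\<in>stab h. N (P ga) <= r \<and> norm (I ga) <= rh}" for r X
 proof -
  have 1: "\<forall>x\<in>X. norm x <= (kp + \<bar>rh\<bar> + 1) * r \<and> (\<exists>y\<in>range P \<inter> U h. norm (x - y) <= c * rh)"
  proof (intro ballI conjI)
   fix x assume x: "x \<in> X"
   have "norm x <= kp * N (P x) + norm (I x)" by (rule k)
   also have "\<dots> <= kp * r + \<bar>rh\<bar> * r"
   proof (rule add_mono)
    show "kp * N (P x) <= kp * r" using x X k by auto
    have "norm (I x) <= \<bar>rh\<bar> * 1" using x X by auto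
    also have "\<dots> <= \<bar>rh\<bar> * r" using r by (intro mult_left_mono) auto
    finally show "norm (I x) <= \<bar>rh\<bar> * r" .
   qed
   finally show "norm x <= (kp + \<bar>rh\<bar> + 1) * r" using r by (simp add: algebra_simps)
   have "x \<in> U h" using x X by (auto simp: U_def intro: span_base)
   then obtain y where "y \<in> range P \<inter> U h" "norm (x - y) <= c * norm (I x)" using c by blast
   moreover have "c * norm (I x) <= c * rh" using x X c(1) by auto
   ultimately show "\<exists>y\<in>range P \<inter> U h. norm (x - y) <= c * rh" by force
  qed
  have 2: "\<forall>x\<in>X. \<forall>y\<in>X. x ~= y --> si <= norm (x - y)"
  proof (intro ballI impI)
   fix x y assume "x \<in> X" "y \<in> X" "x ~= y"
   then have "x - y \<in> Ga" "x - y ~= 0" using X stab_sub(2) by (auto intro!: lat_diff)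
   then show "si <= norm (x - y)" using s(2) by blast
  qed
  have "1 * 1 <= (kp + \<bar>rh\<bar> + 1) * r" using r k by (intro mult_mono) auto
  then have "finite X \<and> real (card X) <= C * ((kp + \<bar>rh\<bar> + 1) * r) ^ dim (range P \<inter> U h)"
   using Cb[rule_format, of "(kp + \<bar>rh\<bar> + 1) * r" X] 1 2 by auto
  then show ?thesis by (simp add: power_mult_distrib mult.assoc)
 qed
 moreover have "C * (kp + \<bar>rh\<bar> + 1) ^ dim (range P \<inter> U h) > 0" using C k by (intro mult_pos_pos zero_less_power) auto
 ultimately show ?thesis by blast
qed

text \<open>Translations of physical norm at most \<open>r\<close> that carry \<open>c\<close> to
  within \<open>e\<close> of the supporting point of \<open>h\<close>; equivalently, the wall
  shifted by \<open>- I dt\<close> is visible near \<open>c\<close>.\<close>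

definition near_walls :: "'e \<Rightarrow> real \<Rightarrow> 'h \<Rightarrow> real \<Rightarrow> 'e set" where
 "near_walls c e h r = {dt\<in>Ga. N (P dt) <= r \<and> norm (c + I dt - w h) < e}"

text \<open>There are of the order of \<open>r ^ d\<close> such translations, and those with a
  common height over \<open>h\<close> differ by stabiliser vectors. Dividing by
  \<open>stab_count\<close> leaves the number of distinct parallel walls near
  \<open>c0\<close>.\<close>

lemma near_walls_count:
 assumes h: "h \<in> Hs" and c0: "c0 \<in> range I" and e: "e > 0"
 shows "\<exists>c>0. \<exists>R0\<ge>1. \<forall>r\<ge>R0. finite (lam h ` near_walls c0 e h r) \<and>
  c * r ^ (d - dim (range P \<inter> U h)) <= real (card (lam h ` near_walls c0 e h r))"
proof -
 let ?m = "dim (range P \<inter> U h)"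
 let ?A = "{y\<in>range I. norm (c0 + y - w h) < e}"
 have bA: "bounded ?A"
 proof (rule boundedI)
  fix y assume "y \<in> ?A"
  then show "norm y <= e + norm (w h - c0)" using norm_triangle_ineq[of "c0 + y - w h" "w h - c0"] by auto
 qed
 have nw: "near_walls c0 e h r = pts r ?A" for r by (auto simp: near_walls_def pts_def)
 have wc: "w h - c0 \<in> range I" using w_I[OF h] c0 subspace_I by (intro subspace_diff)
 obtain c R0 where c: "c > 0" "R0 >= 1" "\<And>R. R >= R0 ==> c * R ^ d <= cnt R ?A"
  using cnt_lower[OF bA wc e] by (auto simp: algebra_simps)
 from stab_count[of h "2 * e"] obtain C where C0: "C > 0 \<and> (\<forall>r\<ge>1. \<forall>X. X \<subseteq> {ga\<in>stab h. N (P ga) <= r \<and> norm (I ga) <= 2 * e} -->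
  finite X \<and> real (card X) <= C * r ^ ?m)" by (rule exE)
 note C = C0[THEN conjunct1] C0[THEN conjunct2, rule_format]
 have md: "?m <= d" by (rule dim_subset) auto
 have "finite (lam h ` near_walls c0 e h r) \<and> c / (C * 2 ^ ?m) * r ^ (d - ?m) <= real (card (lam h ` near_walls c0 e h r))"
  if r: "r >= R0" for r
 proof -
  let ?S = "near_walls c0 e h r"
  have fS: "finite ?S" unfolding nw by (rule pts_finite[OF bA])
  have r1: "r >= 1" using r c by simp
  have fib: "real (card {dt\<in>?S. lam h dt = v}) <= C * (2 * r) ^ ?m" if v: "v \<in> lam h ` ?S" for v
  proof -
   obtain dt0 where d0: "dt0 \<in> ?S" "lam h dt0 = v" using v by auto
   let ?X = "(\<lambda>dt. dt - dt0) ` {dt\<in>?S. lam h dt = v}"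
   have "?X \<subseteq> {ga\<in>stab h. N (P ga) <= 2 * r \<and> norm (I ga) <= 2 * e}"
   proof
    fix x assume "x \<in> ?X"
    then obtain dt where x: "x = dt - dt0" "dt \<in> ?S" "lam h dt = v" by auto
    have "N (P x) <= N (P dt) + N (P dt0)"
     using N_triangle'[of dt "- dt0"] N_minus[of dt0] by (simp add: x(1))
    then have "N (P x) <= 2 * r" using x(2) d0(1) by (simp add: near_walls_def)
    moreover have "norm (I x) <= 2 * e"
    proof -
     have "norm (I x) = norm ((c0 + I dt - w h) - (c0 + I dt0 - w h))" by (simp add: x(1) I_diff)
     also have "\<dots> <= norm (c0 + I dt - w h) + norm (c0 + I dt0 - w h)" by (rule norm_triangle_ineq4)
     also have "\<dots> <= 2 * e" using x(2) d0(1) by (simp add: near_walls_def)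
     finally show ?thesis .
    qed
    moreover have "x \<in> stab h" using x d0 by (auto simp: stab_def near_walls_def lam_diff intro: lat_diff)
    ultimately show "x \<in> {ga\<in>stab h. N (P ga) <= 2 * r \<and> norm (I ga) <= 2 * e}" by simp
   qed
   then have "real (card ?X) <= C * (2 * r) ^ ?m" using C(2)[of "2 * r" ?X] r1 by linarith
   moreover have "card ?X = card {dt\<in>?S. lam h dt = v}" by (rule card_image) (simp add: inj_on_def)
   ultimately show ?thesis by simp
  qed
  have un: "(\<Union>v\<in>lam h ` ?S. {dt\<in>?S. lam h dt = v}) = ?S" by auto
  have "card (\<Union>v\<in>lam h ` ?S. {dt\<in>?S. lam h dt = v}) <= (\<Sum>v\<in>lam h ` ?S. card {dt\<in>?S. lam h dt = v})"
   by (rule card_UN_le[OF finite_imageI[OF fS]])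
  then have "card ?S <= (\<Sum>v\<in>lam h ` ?S. card {dt\<in>?S. lam h dt = v})" unfolding un .
  then have "real (card ?S) <= (\<Sum>v\<in>lam h ` ?S. real (card {dt\<in>?S. lam h dt = v}))" by (simp flip: of_nat_sum)
  also have "\<dots> <= (\<Sum>v\<in>lam h ` ?S. C * (2 * r) ^ ?m)" by (rule sum_mono) (rule fib)
  finally have "real (card ?S) <= real (card (lam h ` ?S)) * (C * (2 * r) ^ ?m)" by simp
  moreover have "c * r ^ d <= real (card ?S)" using c(3)[OF r] by (simp add: cnt_def nw)
  moreover have "r ^ d = r ^ (d - ?m) * r ^ ?m" using md by (simp flip: power_add)
  ultimately have "(c * r ^ (d - ?m)) * r ^ ?m <= (real (card (lam h ` ?S)) * (C * 2 ^ ?m)) * r ^ ?m"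
   by (simp add: power_mult_distrib mult_ac)
  moreover have "r ^ ?m > 0" using r1 by simp
  ultimately have "c * r ^ (d - ?m) <= real (card (lam h ` ?S)) * (C * 2 ^ ?m)" by (rule mult_right_le_imp_le)
  then show ?thesis using fS C(1) by (simp add: pos_divide_le_eq)
 qed
 moreover have "c / (C * 2 ^ ?m) > 0" using c C by simp
 ultimately show ?thesis using c(2) by blast
qed

lemma finite_pos_lower:
 fixes D :: "real set" assumes "finite D" "\<And>x. x \<in> D ==> x > 0" "q > 0"
 shows "\<exists>e>0. e <= q \<and> (\<forall>x\<in>D. e < x)"
proof -
 let ?M = "Min (insert q D)"
 have "?M > 0" using assms by (subst Min_gr_iff) auto
 moreover have "?M <= x" if "x \<in> insert q D" for x using assms(1) that by (intro Min_le) auto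
 ultimately show ?thesis by (intro exI[of _ "?M / 2"]) (auto, fastforce+)
qed

text \<open>Choosing one visible wall near \<open>c0\<close> from each of the \<open>n\<close>
  parallel families determines a corner of the arrangement. Lattice points placed at different
  corners have different patches, so the product of the numbers of walls is bounded by the number of
  patches.\<close>

lemma PW_growth:
 assumes PW and f: "flag f"
 shows "(\<Sum>h\<in>f. d - dim (range P \<inter> U h)) <= d"
proof -
 have ff: "finite f" by (rule flag_finite[OF f])
 obtain c0 r0 where c0: "c0 \<in> range I" "r0 > 0" "\<And>y. y \<in> range I ==> norm (y - c0) < r0 ==> y \<in> Win" using Win_ball by blast
 obtain u where "dual f u" using flag_dual[OF f] by blast
 note u = dualD[OF this]
 have "\<forall>h\<in>f. \<exists>ie. fst ie \<in> L \<and> snd ie > 0 \<and> (\<forall>y\<in>range I. norm (y - w h) < snd ie --> (y \<in> W (fst ie) \<longleftrightarrow> a h \<bullet> y <= b h))"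
  using W_loc flag_Hs[OF f] by (metis fst_conv snd_conv)
 from bchoice[OF this] obtain ie where ie: "\<And>h. h \<in> f ==> fst (ie h) \<in> L" "\<And>h. h \<in> f ==> snd (ie h) > 0"
  "\<And>h y. h \<in> f ==> y \<in> range I ==> norm (y - w h) < snd (ie h) ==> y \<in> W (fst (ie h)) \<longleftrightarrow> a h \<bullet> y <= b h" by blast
 obtain e0 where e0: "e0 > 0" "e0 <= r0" "\<And>h. h \<in> f ==> e0 < snd (ie h)"
  using finite_pos_lower[of "(\<lambda>h. snd (ie h)) ` f" r0] ff ie(2) c0(2) by auto
 define Su where "Su = (\<Sum>h\<in>f. norm (u h)) + 1"
 define Sa where "Sa = (\<Sum>h\<in>f. norm (a h)) + 1"
 have Su: "Su > 0" and Sa: "Sa > 0" by (auto simp: Su_def Sa_def add_nonneg_pos sum_nonneg)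
 have aSa: "norm (a h) <= Sa" if "h \<in> f" for h
 proof -
  have "norm (a h) <= (\<Sum>h\<in>f. norm (a h))" by (rule member_le_sum[OF that]) (use ff in auto)
  then show ?thesis by (simp add: Sa_def)
 qed
 define ep where "ep = e0 / (2 * Su)"
 have ep: "ep > 0" using e0 Su by (simp add: ep_def)
 define e' where "e' = min (e0 / 2) (ep / (2 * Sa))"
 have e': "e' > 0" "e' <= e0 / 2" "Sa * e' <= ep / 2"
  using e0 ep Sa by (auto simp: e'_def min_def field_simps)
 have close: "norm (y - c0) < e0 / 2" if y: "y \<in> range I" "\<And>h. h \<in> f ==> \<bar>a h \<bullet> (y - c0)\<bar> <= ep" for y
 proof -
  have yc: "y - c0 \<in> range I" using y c0 subspace_I by (intro subspace_diff)
  have "norm (y - c0) = norm (\<Sum>h\<in>f. (a h \<bullet> (y - c0)) *\<^sub>R u h)" using flag_expand[OF f u yc] by simp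
  also have "\<dots> <= (\<Sum>h\<in>f. ep * norm (u h))" by (rule sum_norm_le) (use y in \<open>auto intro: mult_right_mono\<close>)
  also have "\<dots> = ep * (Su - 1)" by (simp add: Su_def sum_distrib_left)
  also have "\<dots> < ep * Su" using ep by simp
  also have "\<dots> = e0 / 2" using Su by (simp add: ep_def)
  finally show ?thesis .
 qed
 let ?V = "\<lambda>h r. lam h ` near_walls c0 e' h r"
 let ?m = "\<lambda>h. d - dim (range P \<inter> U h)"
 let ?pats = "\<lambda>r. (\<lambda>y. pat r (I y)) ` Gw"
 have "\<forall>h\<in>f. \<exists>c>0. \<exists>R0\<ge>1. \<forall>r\<ge>R0. finite (?V h r) \<and> c * r ^ ?m h <= real (card (?V h r))"
  using near_walls_count[OF flag_Hs[OF f] c0(1) e'(1)] by blast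
 from bchoice[OF this] obtain cc where cc: "\<forall>h\<in>f. cc h > 0 \<and> (\<exists>R0\<ge>1. \<forall>r\<ge>R0. finite (?V h r) \<and> cc h * r ^ ?m h <= real (card (?V h r)))" by blast
 then have "\<forall>h\<in>f. \<exists>R0. R0 >= 1 \<and> (\<forall>r\<ge>R0. finite (?V h r) \<and> cc h * r ^ ?m h <= real (card (?V h r)))" by blast
 from bchoice[OF this] obtain RR where RR: "\<And>h. h \<in> f ==> RR h >= 1"
  "\<And>h r. h \<in> f ==> r >= RR h ==> finite (?V h r) \<and> cc h * r ^ ?m h <= real (card (?V h r))" by blast
 have emb: "real (card (PiE f (\<lambda>h. ?V h r))) <= real (card (?pats r))"
  if fV: "\<And>h. h \<in> f ==> finite (?V h r)" and fp: "finite (?pats r)" for r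
 proof -
  let ?D = "(\<Union>h\<in>f. (\<lambda>(v, v'). \<bar>v - v'\<bar>) ` (?V h r \<times> ?V h r)) - {0}"
  have "finite ?D" using ff fV by auto
  moreover have "\<And>x. x \<in> ?D ==> x > 0" by auto
  \<comment> \<open>Smaller than the distance of any two distinct heights of one family.\<close>
  ultimately obtain ta where ta: "ta > 0" "ta <= ep / 2" "\<forall>x\<in>?D. ta < x"
   using finite_pos_lower[of ?D "ep / 2"] ep by auto
  have taV: "ta < \<bar>v - v'\<bar>" if "h \<in> f" "v \<in> ?V h r" "v' \<in> ?V h r" "v ~= v'" for h v v'
   using ta(3) that by (intro ta(3)[rule_format]) force
  \<comment> \<open>The point at depth \<open>ta / 2\<close> below the chosen wall of every family;
    the other walls of a family are more than \<open>ta\<close> away from the chosen one.\<close>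
  define t where "t p = (\<Sum>h\<in>f. (b h - p h - ta / 2) *\<^sub>R u h)" for p
  have tI: "t p \<in> range I" for p unfolding t_def
   by (intro subspace_sum[OF subspace_I] subspace_scale[OF subspace_I] u)
  have "ta / (2 * Sa) > 0" using ta Sa by simp
  then have "\<forall>p. \<exists>g\<in>Ga. norm (I g - t p) < ta / (2 * Sa)" using dense[OF tI] by blast
  then obtain g where g: "\<And>p. g p \<in> Ga" "\<And>p. norm (I (g p) - t p) < ta / (2 * Sa)" by metis
  have lg: "b h - p h - ta < lam h (g p)" "lam h (g p) < b h - p h" if h: "h \<in> f" for h p
  proof -
   have "\<bar>a h \<bullet> (I (g p) - t p)\<bar> <= norm (a h) * norm (I (g p) - t p)" by (rule Cauchy_Schwarz_ineq2)
   also have "\<dots> <= Sa * norm (I (g p) - t p)" using aSa[OF h] by (rule mult_right_mono) simp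
   also have "\<dots> < Sa * (ta / (2 * Sa))" using g(2) Sa by (intro mult_strict_left_mono)
   also have "\<dots> = ta / 2" using Sa by simp
   finally have "\<bar>lam h (g p) - (b h - p h - ta / 2)\<bar> < ta / 2"
    using dual_coord[OF f u(2) h, of "\<lambda>h. b h - p h - ta / 2"] by (simp add: lam_def inner_diff_right t_def)
   then show "b h - p h - ta < lam h (g p)" "lam h (g p) < b h - p h" by linarith+
  qed
  have gc: "norm (I (g p) - c0) < e0 / 2" if p: "p \<in> PiE f (\<lambda>h. ?V h r)" for p
  proof (rule close)
   fix h assume h: "h \<in> f"
   obtain dt where dt: "p h = lam h dt" "dt \<in> near_walls c0 e' h r" using PiE_mem[OF p h] by auto
   have "\<bar>a h \<bullet> (c0 + I dt - w h)\<bar> <= norm (a h) * norm (c0 + I dt - w h)" by (rule Cauchy_Schwarz_ineq2)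
   also have "\<dots> <= Sa * e'" using aSa[OF h] dt(2) Sa by (intro mult_mono) (auto simp: near_walls_def)
   finally have "\<bar>a h \<bullet> c0 - (b h - p h)\<bar> <= ep / 2"
    using e'(3) w_wall[OF flag_Hs[OF f h]] dt(1) unfolding lam_def inner_add_right inner_diff_right by linarith
   then show "\<bar>a h \<bullet> (I (g p) - c0)\<bar> <= ep" using lg[OF h, of p] ta(1,2) unfolding inner_diff_right lam_def by linarith
  qed auto
  have gW: "g p \<in> Gw" if p: "p \<in> PiE f (\<lambda>h. ?V h r)" for p
   using gc[OF p] e0 c0(3)[of "I (g p)"] g(1) by (simp add: Gw_def)
  have neq: "pat r (I (g p)) ~= pat r (I (g p'))"
   if p: "p \<in> PiE f (\<lambda>h. ?V h r)" "p' \<in> PiE f (\<lambda>h. ?V h r)" and h: "h \<in> f" "p' h < p h" for p p' h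
  proof -
   obtain dt where dt: "p h = lam h dt" "dt \<in> near_walls c0 e' h r" using PiE_mem[OF p(1) h(1)] by auto
   have nn: "norm (I (g q) + I dt - w h) < snd (ie h)" if "q \<in> PiE f (\<lambda>h. ?V h r)" for q
   proof -
    have "norm (I (g q) + I dt - w h) <= norm (I (g q) - c0) + norm (c0 + I dt - w h)"
     using norm_triangle_ineq[of "I (g q) - c0" "c0 + I dt - w h"] by (simp add: algebra_simps)
    then show ?thesis using gc[OF that] dt(2) e'(2) e0(3)[OF h(1)] by (simp add: near_walls_def)
   qed
   have mem: "(dt, fst (ie h)) \<in> pat r (I (g q)) \<longleftrightarrow> lam h (g q) + p h <= b h" if q: "q \<in> PiE f (\<lambda>h. ?V h r)" for q
   proof -
    have "I (g q) + I dt \<in> range I" using subspace_I by (intro subspace_add) auto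
    then show ?thesis using ie(3)[OF h(1) _ nn[OF q]] ie(1)[OF h(1)] dt
     by (auto simp: pat_def near_walls_def lam_def inner_add_right)
   qed
   \<comment> \<open>\<open>g p'\<close> is less than \<open>ta\<close> below a wall which is more
     than \<open>ta\<close> higher, so it lies beyond the wall that \<open>dt\<close> tests.\<close>
   have "ta < p h - p' h" using taV[OF h(1) PiE_mem[OF p(1) h(1)] PiE_mem[OF p(2) h(1)]] h(2) by simp
   then have "\<not> lam h (g p') + p h <= b h" using lg(1)[OF h(1), of p'] by linarith
   moreover have "lam h (g p) + p h <= b h" using lg(2)[OF h(1), of p] by linarith
   ultimately show ?thesis using mem[OF p(1)] mem[OF p(2)] by blast
  qed
  have ij: "inj_on (\<lambda>p. pat r (I (g p))) (PiE f (\<lambda>h. ?V h r))"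
  proof (rule inj_onI, rule ccontr)
   fix p p' assume p: "p \<in> PiE f (\<lambda>h. ?V h r)" "p' \<in> PiE f (\<lambda>h. ?V h r)" "pat r (I (g p)) = pat r (I (g p'))" "p ~= p'"
   obtain h where h: "h \<in> f" "p h ~= p' h" using p(4) PiE_ext[OF p(1) p(2)] by auto
   then consider "p' h < p h" | "p h < p' h" by linarith
   then show False using neq[OF p(1,2) h(1)] neq[OF p(2,1) h(1)] p(3) by cases auto
  qed
  have "(\<lambda>p. pat r (I (g p))) ` PiE f (\<lambda>h. ?V h r) \<subseteq> ?pats r" using gW by blast
  then have "card ((\<lambda>p. pat r (I (g p))) ` PiE f (\<lambda>h. ?V h r)) <= card (?pats r)" using fp by (rule card_mono[rotated])
  then show ?thesis by (simp add: card_image[OF ij])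
 qed
 obtain C where C: "C > 0" and evC: "\<forall>\<^sub>F r in at_top. finite (?pats r) \<and> real (card (?pats r)) <= C * r ^ d"
  using PW_patches[OF assms(1)] by blast
 define c where "c = (\<Prod>h\<in>f. cc h)"
 have c: "c > 0" unfolding c_def by (rule prod_pos) (use cc in blast)
 define m where "m = (\<Sum>h\<in>f. ?m h)"
 have "\<forall>\<^sub>F r in at_top. \<forall>h\<in>f. r >= RR h" using ff by (simp add: eventually_ball_finite eventually_ge_at_top)
 then have ev: "\<forall>\<^sub>F r in at_top. c * r ^ m <= C * r ^ d"
  using evC eventually_ge_at_top[of "1::real"]
 proof eventually_elim
  case (elim r)
  have "c * r ^ m = (\<Prod>h\<in>f. cc h * r ^ ?m h)" by (simp add: c_def m_def prod.distrib power_sum)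
  also have "\<dots> <= (\<Prod>h\<in>f. real (card (?V h r)))"
  proof (rule prod_mono)
   fix h assume h: "h \<in> f"
   have "cc h > 0" using cc h by blast
   then show "0 <= cc h * r ^ ?m h \<and> cc h * r ^ ?m h <= real (card (?V h r))" using RR(2)[OF h] elim h by auto
  qed
  also have "\<dots> = real (card (PiE f (\<lambda>h. ?V h r)))" using ff by (simp add: card_PiE)
  also have "\<dots> <= real (card (?pats r))" using emb RR(2) elim by blast
  finally show ?case using elim by linarith
 qed
 have "m <= d"
 proof (rule ccontr)
  assume "\<not> m <= d"
  have "\<forall>\<^sub>F r in at_top. r <= C / c"
   using ev eventually_ge_at_top[of "1::real"]
  proof eventually_elim
   case (elim r)
   have 1: "c * (r * r ^ d) <= c * r ^ m" using c elim \<open>\<not> m <= d\<close>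
    by (intro mult_left_mono) (auto simp flip: power_Suc intro!: power_increasing)
   have "(c * r) * r ^ d <= C * r ^ d" using order_trans[OF 1 elim(1)] by (simp only: mult.assoc)
   moreover have "r ^ d > 0" using elim by simp
   ultimately have "c * r <= C" by (rule mult_right_le_imp_le)
   then show ?case using c by (simp add: field_simps)
  qed
  moreover have "\<forall>\<^sub>F r in at_top. r > C / c" by (rule eventually_gt_at_top)
  ultimately have "\<forall>\<^sub>F r::real in at_top. False" by eventually_elim simp
  then show False by simp
 qed
 then show ?thesis by (simp add: m_def)
qed

theorem PW_imp_RC: assumes PW shows RC
 using RC_if_growth PW_growth[OF assms] by blast

subsection \<open>Consequences of the rank condition\<close>

lemma span_range_I:
 assumes "S \<subseteq> range I" "\<And>y. y \<in> range I ==> (\<And>v. v \<in> S ==> v \<bullet> y = 0) ==> y = 0"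
 shows "range I \<subseteq> span S"
proof
 fix y assume y: "y \<in> range I"
 obtain p q where pq: "p \<in> span S" "\<And>v. v \<in> span S ==> orthogonal q v" "y = p + q"
  using orthogonal_subspace_decomp_exists by metis
 have "p \<in> range I" using subsetD[OF span_minimal[OF assms(1) subspace_I] pq(1)] .
 then have "y - p \<in> range I" using y subspace_I by (intro subspace_diff)
 then have qI: "q \<in> range I" using pq(3) by simp
 have "v \<bullet> q = 0" if "v \<in> S" for v
  using pq(2)[OF span_base[OF that]] by (simp add: orthogonal_def inner_commute)
 then have "q = 0" using assms(2) qI by blast
 then show "y \<in> span S" using pq by simp
qed

text \<open>A basis of normals containing \<open>a h\<close> is chosen among all normals and lifted
  to walls.\<close>

lemma flag_extend:
 assumes h: "h \<in> Hs" shows "\<exists>f. flag f \<and> h \<in> f"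
proof -
 have "independent {a h}" using a_nz[OF h] by simp
 then obtain B where B: "{a h} \<subseteq> B" "B \<subseteq> a ` Hs" "independent B" "a ` Hs \<subseteq> span B"
  using maximal_independent_subset_extend[of "{a h}" "a ` Hs"] h by auto
 have aI: "a ` Hs \<subseteq> range I" using a_I by auto
 have "range I \<subseteq> span (a ` Hs)" by (rule span_range_I[OF aI]) (use spanning in blast)
 also have "\<dots> \<subseteq> span B" using B(4) by (simp add: span_minimal)
 finally have sp: "range I \<subseteq> span B" .
 have "card B = n" by (rule dim_unique[symmetric, OF order_trans[OF B(2) aI] sp B(3) refl])
 \<comment> \<open>Parallel walls may share a normal; the last condition makes sure that
   \<open>a h\<close> is lifted to \<open>h\<close> itself.\<close>
 have "\<forall>v\<in>B. \<exists>l. l \<in> Hs \<and> a l = v \<and> (v = a h --> l = h)"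
 proof
  fix v assume "v \<in> B"
  then obtain l where "l \<in> Hs" "a l = v" using B(2) by blast
  then show "\<exists>l. l \<in> Hs \<and> a l = v \<and> (v = a h --> l = h)" using h by (cases "v = a h") auto
 qed
 from bchoice[OF this] obtain q where q: "\<And>v. v \<in> B ==> q v \<in> Hs" "\<And>v. v \<in> B ==> a (q v) = v" "q (a h) = h"
  using B(1) by blast
 have "inj_on q B" using q(2) by (metis inj_onI)
 then have "card (q ` B) = n" using \<open>card B = n\<close> by (simp add: card_image)
 moreover have "y = 0" if y: "y \<in> range I" "\<forall>h\<in>q ` B. a h \<bullet> y = 0" for y
 proof -
  have "orthogonal y v" if "v \<in> B" for v using y(2) q(2)[OF that] that by (auto simp: orthogonal_def inner_commute)
  then have "orthogonal y y" using orthogonal_to_span[of y B] sp y(1) by blast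
  then show ?thesis by (simp add: orthogonal_self)
 qed
 moreover have "h \<in> q ` B" using q(3) B(1) by (metis image_eqI insert_subset)
 ultimately show ?thesis unfolding flag_def using q(1) by (intro exI[of _ "q ` B"]) auto
qed

lemma flag_exchange:
 assumes f: "flag f" and u: "\<And>h. h \<in> f ==> u h \<in> range I"
  "\<And>h l. h \<in> f ==> l \<in> f ==> a l \<bullet> u h = (if l = h then 1 else 0)"
  and h: "h \<in> Hs" and j: "j \<in> f" "a h \<bullet> u j ~= 0"
 shows "flag (insert h (f - {j}))" and "h \<in> f ==> h = j"
proof -
 show hj: "h = j" if "h \<in> f" using u(2)[OF j(1) that] j(2) by (auto split: if_splits)
 have ff: "finite f" by (rule flag_finite[OF f])
 have "card (insert h (f - {j})) = card f"
 proof (cases "h \<in> f")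
  case True then show ?thesis using hj j by (simp add: insert_absorb)
 next
  case False
  then have "card (insert h (f - {j})) = Suc (card (f - {j}))" using ff by simp
  then show ?thesis using card_Suc_Diff1[OF ff j(1)] by simp
 qed
 moreover have "y = 0" if y: "y \<in> range I" "\<forall>l\<in>insert h (f - {j}). a l \<bullet> y = 0" for y
 proof -
  have "y = (\<Sum>l\<in>f. (a l \<bullet> y) *\<^sub>R u l)" by (rule flag_expand[OF f u y(1)])
  also have "\<dots> = (\<Sum>l\<in>f. if l = j then (a j \<bullet> y) *\<^sub>R u j else 0)" by (rule sum.cong) (use y(2) in auto)
  also have "\<dots> = (a j \<bullet> y) *\<^sub>R u j" using ff j(1) by simp
  finally have yj: "y = (a j \<bullet> y) *\<^sub>R u j" .
  then have "a h \<bullet> y = (a j \<bullet> y) * (a h \<bullet> u j)" by (metis inner_scaleR_right)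
  then have "a j \<bullet> y = 0" using y(2) j(2) by simp
  then show ?thesis using yj by simp
 qed
 ultimately show "flag (insert h (f - {j}))" using f h by (auto simp: flag_def)
qed

text \<open>The rank condition for a flag and for the exchanged flag differ in one summand only. So
  a wall has the same exponent as every axis along which its height varies, which lets a single
  power of \<open>r\<close> govern all axes that matter for it.\<close>

lemma cdim_exchange:
 assumes RC and f: "flag f" and u: "\<And>h. h \<in> f ==> u h \<in> range I"
  "\<And>h l. h \<in> f ==> l \<in> f ==> a l \<bullet> u h = (if l = h then 1 else 0)"
  and h: "h \<in> Hs" and j: "j \<in> f" "a h \<bullet> u j ~= 0"
 shows "cdim h = cdim j"
proof -
 have ff: "finite f" by (rule flag_finite[OF f])
 have hn: "h \<notin> f - {j}" using flag_exchange(2)[OF f u h j] by auto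
 have "(\<Sum>l\<in>insert h (f - {j}). cdim l) = DIM('e)" using assms(1) flag_exchange(1)[OF f u h j] by (simp add: RC_def)
 moreover have "(\<Sum>l\<in>insert h (f - {j}). cdim l) = cdim h + (\<Sum>l\<in>f - {j}. cdim l)" using ff hn by simp
 moreover have "(\<Sum>l\<in>f. cdim l) = cdim j + (\<Sum>l\<in>f - {j}. cdim l)" using ff j(1) by (rule sum.remove)
 moreover have "(\<Sum>l\<in>f. cdim l) = DIM('e)" using assms(1) f by (simp add: RC_def)
 ultimately show ?thesis by linarith
qed

text \<open>Under a CSR decomposition this is the \<open>delta\<close> of the part to which
  \<open>h\<close> belongs, see \<open>dlt_delta\<close>.\<close>

definition dlt :: "'h \<Rightarrow> nat" where "dlt h = cdim h - 1"

lemma dlt_ge_1: "h \<in> Hs ==> dlt h >= 1" using cdim_ge_2 by (force simp: dlt_def)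

lemma Suc_dlt: "h \<in> Hs ==> Suc (dlt h) = cdim h" using cdim_ge_2 by (force simp: dlt_def)

text \<open>Why the estimates are sharp: a box with side \<open>1 / r ^ dlt h\<close> on each axis
  of a flag has exactly the order \<open>1 / r ^ d\<close>.\<close>

lemma sum_dlt: assumes RC "flag f" shows "(\<Sum>h\<in>f. dlt h) = d"
proof -
 have "(\<Sum>h\<in>f. dlt h + 1) = (\<Sum>h\<in>f. cdim h)" by (rule sum.cong) (use Suc_dlt flag_Hs[OF assms(2)] in auto)
 moreover have "(\<Sum>h\<in>f. dlt h + 1) = (\<Sum>h\<in>f. dlt h) + n" using assms(2) by (simp only: sum.distrib flag_def) simp
 ultimately show ?thesis using assms dim_k by (simp add: RC_def)
qed

lemma axg_lam_nz:
 assumes "flag f" "j \<in> f" "g \<in> axg f j" "g ~= 0" shows "lam j g ~= 0"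
 using flag_lam_0[OF assms(1), of g] assms by (auto simp: axg_def)

text \<open>Dirichlet's theorem on an axis of a flag, by the pigeonhole principle.\<close>

lemma axg_dirichlet:
 assumes RC and f: "flag f" and j: "j \<in> f"
 shows "\<exists>C>0. \<exists>r0\<ge>1. \<forall>r\<ge>r0. \<exists>g\<in>axg f j. norm g <= r \<and> 0 < lam j g \<and> lam j g <= C / r ^ dlt j"
proof -
 define m where "m = dim (axg f j)"
 have m: "m = Suc (dlt j)" using axg_rank(1)[OF assms(1) f j] Suc_dlt[OF flag_Hs[OF f j]] by (simp add: m_def)
 obtain C1 where C1: "C1 > 0" "\<And>x. x \<in> span (axg f j) ==> \<exists>a\<in>axg f j. norm (x - a) <= C1"
  using cocompact[OF axg_sub(1)] by metis
 have "2 * C1 + 1 > 0" using C1 by simp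
 from packing_lower[OF subspace_span this, of "axg f j"] obtain c where c: "c > 0"
  "\<And>r. r >= 0 ==> \<exists>X. finite X \<and> X \<subseteq> span (axg f j) \<and> (\<forall>x\<in>X. norm x <= r) \<and>
  (\<forall>x\<in>X. \<forall>y\<in>X. x ~= y --> 2 * C1 + 1 <= norm (x - y)) \<and> c * r ^ m <= real (card X)"
  by (auto simp: m_def dim_span)
 obtain K where K: "K > 0" "\<And>x. \<bar>lam j x\<bar> <= K * norm x" using lam_bound flag_Hs[OF f j] by metis
 \<comment> \<open>With bins of width \<open>C / r ^ dlt j\<close> and
   \<open>X = c r ^ m / 4 ^ (m + 2)\<close> there are at most \<open>2 X + 3\<close> bins against
   \<open>16 X\<close> points; \<open>r0\<close> ensures \<open>X \<ge> 1\<close>, so two points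
   share a bin.\<close>
 define C where "C = 4 ^ (m + 2) * K / c"
 have C: "C > 0" using K c by (simp add: C_def)
 define r0 where "r0 = max (4 * C1) (max 1 (4 ^ (m + 2) / c))"
 have "\<exists>g\<in>axg f j. norm g <= r \<and> 0 < lam j g \<and> lam j g <= C / r ^ dlt j" if r: "r >= r0" for r
 proof -
  have r': "r >= 4 * C1" "r >= 1" "r >= 4 ^ (m + 2) / c" using r by (auto simp: r0_def)
  have "r / 4 >= 0" using r' by simp
  from c(2)[OF this] obtain X where X: "finite X" "X \<subseteq> span (axg f j)" "\<forall>x\<in>X. norm x <= r / 4"
   "\<forall>x\<in>X. \<forall>y\<in>X. x ~= y --> 2 * C1 + 1 <= norm (x - y)" "c * (r / 4) ^ m <= real (card X)" by blast
  have "\<forall>x\<in>X. \<exists>g. g \<in> axg f j \<and> norm (x - g) <= C1" using C1(2) X(2) by blast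
  from bchoice[OF this] obtain q where q: "\<And>x. x \<in> X ==> q x \<in> axg f j" "\<And>x. x \<in> X ==> norm (x - q x) <= C1" by blast
  have qn: "norm (q x) <= r / 2" if "x \<in> X" for x
  proof -
   have "norm (q x) <= norm x + norm (x - q x)" by norm
   then show ?thesis using X(3) that q(2)[OF that] r'(1) by fastforce
  qed
  define ta where "ta = C / r ^ dlt j"
  have rd: "r ^ dlt j > 0" using r' by simp
  have ta: "ta > 0" using C rd by (simp add: ta_def)
  define fi where "fi x = \<lfloor>lam j (q x) / ta\<rfloor>" for x
  define M where "M = \<lfloor>K * r / ta\<rfloor> + 1"
  have M0: "M >= 0" unfolding M_def using K r' ta by (simp add: add_nonneg_nonneg)
  have "fi ` X \<subseteq> {-M..M}"
  proof
   fix z assume "z \<in> fi ` X"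
   then obtain x where x: "x \<in> X" "z = fi x" by auto
   have "\<bar>lam j (q x)\<bar> <= K * norm (q x)" by (rule K)
   also have "\<dots> <= K * r" using qn[OF x(1)] r' K by (intro mult_left_mono) auto
   finally have "\<bar>lam j (q x) / ta\<bar> <= K * r / ta" using ta by (simp add: abs_divide divide_right_mono)
   then show "z \<in> {-M..M}" unfolding x(2) fi_def M_def by (simp; linarith)
  qed
  then have "card (fi ` X) <= nat (2 * M + 1)" using card_mono[of "{-M..M}" "fi ` X"] by simp
  then have "real (card (fi ` X)) <= 2 * real_of_int M + 1" using M0 by linarith
  also have "real_of_int M <= K * r / ta + 1" unfolding M_def by (simp; linarith)
  also have "K * r / ta = K * r ^ m / C" using rd by (simp add: ta_def m)
  also have "\<dots> = c * r ^ m / 4 ^ (m + 2)" using K c by (simp add: C_def)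
  finally have up: "real (card (fi ` X)) <= 2 * (c * r ^ m / 4 ^ (m + 2)) + 3" by simp
  have "4 ^ (m + 2) / c * 1 <= r * r ^ dlt j" using r' c by (intro mult_mono) auto
  then have "4 ^ (m + 2) <= c * r ^ m" using c by (simp add: m field_simps)
  then have "1 <= c * r ^ m / 4 ^ (m + 2)" by simp
  then have "2 * (c * r ^ m / 4 ^ (m + 2)) + 3 < 16 * (c * r ^ m / 4 ^ (m + 2))" by linarith
  also have "\<dots> = c * (r / 4) ^ m" by (simp add: power_divide)
  finally have "card (fi ` X) ~= card X" using up X(5) by linarith
  then have "\<not> inj_on fi X" using card_image by blast
  then obtain x y where xy: "x \<in> X" "y \<in> X" "x ~= y" "fi x = fi y" by (auto simp: inj_on_def)
  have qq: "q x ~= q y"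
  proof
   assume "q x = q y"
   then have "norm (x - y) <= norm (x - q x) + norm (y - q y)"
    using norm_triangle_ineq4[of "x - q x" "y - q y"] by simp
   then have "norm (x - y) <= 2 * C1" using q(2)[OF xy(1)] q(2)[OF xy(2)] by linarith
   then show False using X(4) xy by fastforce
  qed
  let ?g = "q x - q y"
  have g: "?g \<in> axg f j" by (rule zmod.subspace_diff[OF axg_sub(1) q(1)[OF xy(1)] q(1)[OF xy(2)]])
  have gn: "norm ?g <= r" using norm_triangle_ineq4[of "q x" "q y"] qn[OF xy(1)] qn[OF xy(2)] by linarith
  have "\<bar>lam j (q x) / ta - lam j (q y) / ta\<bar> <= 1" using xy(4) unfolding fi_def by linarith
  then have "\<bar>lam j ?g\<bar> / ta <= 1" using ta by (simp add: lam_diff flip: diff_divide_distrib)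
  then have lg: "\<bar>lam j ?g\<bar> <= ta" using ta by (simp add: field_simps)
  have nz: "lam j ?g ~= 0" using axg_lam_nz[OF f j g] qq by simp
  show ?thesis
  proof (cases "lam j ?g > 0")
   case True then show ?thesis using g gn lg unfolding ta_def by (intro bexI[of _ ?g]) auto
  next
   case False
   have "- ?g \<in> axg f j" using zmod.subspace_neg[OF axg_sub(1) g] .
   moreover have "lam j (- ?g) = - lam j ?g" by (rule lam_neg)
   moreover have "norm (- ?g) = norm ?g" by (rule norm_minus_cancel)
   ultimately show ?thesis using False nz gn lg unfolding ta_def by (intro bexI[of _ "- ?g"]) linarith+
  qed
 qed
 then show ?thesis using C by (intro exI[of _ C] conjI exI[of _ r0]) (auto simp: r0_def)
qed

text \<open>Multiples of one axis vector with height at most \<open>et\<close>; the number of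
  multiples needed grows linearly with the target height.\<close>

lemma axg_approx:
 assumes RC and f: "flag f" and j: "j \<in> f" and et: "et > 0"
 shows "\<exists>C>0. \<forall>s. \<exists>g\<in>axg f j. \<bar>lam j g - s\<bar> <= et \<and> norm g <= C * (1 + \<bar>s\<bar>)"
proof -
 obtain C r0 where C: "C > 0" "r0 >= 1" "\<And>r. r >= r0 ==> \<exists>g\<in>axg f j. norm g <= r \<and> 0 < lam j g \<and> lam j g <= C / r ^ dlt j"
  using axg_dirichlet[OF assms(1) f j] by metis
 define r where "r = max r0 (C / et)"
 have r: "r >= r0" "r >= C / et" "r >= 1" using C(2) by (auto simp: r_def)
 obtain g where g: "g \<in> axg f j" "0 < lam j g" "lam j g <= C / r ^ dlt j" using C(3)[OF r(1)] by blast
 have "C <= et * r" using r(2) et by (simp add: field_simps)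
 also have "\<dots> <= et * r ^ dlt j" using dlt_ge_1[OF flag_Hs[OF f j]] r(3) et self_le_power[of r "dlt j"] by (intro mult_left_mono) auto
 finally have "C / r ^ dlt j <= et" using r(3) by (simp add: divide_le_eq)
 then have lg: "lam j g <= et" using g by linarith
 define D where "D = norm g * (1 + 1 / lam j g) + 1"
 have D: "D > 0" unfolding D_def using g by (simp add: add_nonneg_pos)
 have "\<exists>g'\<in>axg f j. \<bar>lam j g' - s\<bar> <= et \<and> norm g' <= D * (1 + \<bar>s\<bar>)" for s
 proof
  define q where "q = \<lfloor>s / lam j g\<rfloor>"
  let ?g' = "real_of_int q *\<^sub>R g"
  show "?g' \<in> axg f j" by (rule zmod.subspace_scale[OF axg_sub(1) g(1)])
  have q: "real_of_int q <= s / lam j g" "s / lam j g < real_of_int q + 1" unfolding q_def by linarith+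
  then have "real_of_int q * lam j g <= s" "s < (real_of_int q + 1) * lam j g" using g(2) by (simp_all add: field_simps)
  then have "\<bar>lam j ?g' - s\<bar> <= et" using lg by (simp add: lam_scale abs_le_iff algebra_simps)
  moreover have "norm ?g' <= D * (1 + \<bar>s\<bar>)"
  proof -
   have "\<bar>real_of_int q\<bar> <= \<bar>s / lam j g\<bar> + 1" using q by linarith
   then have "\<bar>real_of_int q\<bar> <= \<bar>s\<bar> * (1 / lam j g) + 1" using g(2) by simp
   also have "\<dots> <= (1 + 1 / lam j g) * (1 + \<bar>s\<bar>)"
   proof -
    have "\<bar>s\<bar> * x + 1 <= (1 + x) * (1 + \<bar>s\<bar>)" if "x >= 0" for x using that by (simp add: algebra_simps)
    from this[of "1 / lam j g"] show ?thesis using g(2) by simp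
   qed
   finally have "\<bar>real_of_int q\<bar> * norm g <= (1 + 1 / lam j g) * (1 + \<bar>s\<bar>) * norm g" by (intro mult_right_mono) auto
   also have "\<dots> = (D - 1) * (1 + \<bar>s\<bar>)" by (simp add: D_def)
   also have "\<dots> <= D * (1 + \<bar>s\<bar>)" by (intro mult_right_mono) auto
   finally show ?thesis by simp
  qed
  ultimately show "\<bar>lam j ?g' - s\<bar> <= et \<and> norm ?g' <= D * (1 + \<bar>s\<bar>)" ..
 qed
 then show ?thesis using D by blast
qed

subsection \<open>Patches separate points across walls\<close>

text \<open>Near the supporting point a lattice point on the wall would lie in the piece, while
  arbitrarily small steps along the normal leave the piece. This contradicts
  \<open>nonsing\<close>.\<close>

lemma no_wall:
 assumes h: "h \<in> Hs" and i: "i \<in> L" and e: "e > 0"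
  and loc: "\<And>y. y \<in> range I ==> norm (y - w h) < e ==> y \<in> W i \<longleftrightarrow> a h \<bullet> y <= b h"
  and z: "z \<in> Ga" "norm (I z - w h) < e"
 shows "a h \<bullet> I z ~= b h"
proof
 assume eq: "a h \<bullet> I z = b h"
 then have zW: "I z \<in> W i" using loc[OF rangeI z(2)] by simp
 obtain e2 where e2: "e2 > 0" "\<And>y. y \<in> range I ==> norm (y - I z) < e2 ==> y \<in> W i \<longleftrightarrow> I z \<in> W i"
  using nonsing[OF z(1) i] by blast
 have na: "norm (a h) > 0" using a_nz[OF h] by simp
 define q where "q = min e2 (e - norm (I z - w h)) / (2 * norm (a h))"
 have q: "q > 0" using e2 z(2) na by (simp add: q_def)
 have qn: "q * norm (a h) < e2" "q * norm (a h) < e - norm (I z - w h)"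
  using e2 z(2) na by (auto simp: q_def min_def)
 let ?y = "I z + q *\<^sub>R a h"
 have yI: "?y \<in> range I" using a_I[OF h] subspace_I by (intro subspace_add subspace_scale) auto
 have "norm (?y - I z) < e2" using qn(1) q by simp
 then have "?y \<in> W i" using e2(2)[OF yI] zW by simp
 moreover have "norm (?y - w h) <= norm (I z - w h) + norm (q *\<^sub>R a h)"
  using norm_triangle_ineq[of "I z - w h" "q *\<^sub>R a h"] by (simp add: algebra_simps)
 then have "norm (?y - w h) < e" using qn(2) q by simp
 ultimately have "a h \<bullet> ?y <= b h" using loc[OF yI] by simp
 then have "q * (a h \<bullet> a h) <= 0" using eq by (simp add: inner_add_right)
 moreover have "a h \<bullet> a h > 0" using a_nz[OF h] by simp
 ultimately show False using q by (simp add: mult_le_0_iff)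
qed

lemma pat_mono: "pat R y = pat R y' ==> r <= R ==> pat r y = pat r y'"
proof -
 have "pat r y = pat R y \<inter> {(g, i). N (P g) <= r}" if "r <= R" for y using that by (auto simp: pat_def)
 then show "pat R y = pat R y' ==> r <= R ==> pat r y = pat r y'" by simp
qed

text \<open>Suppose a shifted wall passes between two close points. A lattice vector composed of the
  other axes of a flag through \<open>h\<close>, combined with \<open>- ga\<close>, brings both
  points close to the supporting point of \<open>h\<close> without disturbing their heights over the
  shifted wall. There the piece decides on which side they lie, so their patches of radius
  \<open>C r\<close> differ.\<close>

lemma wall_separation_local:
 assumes RC and h: "h \<in> Hs"
 shows "\<exists>C>0. \<exists>et>0. \<forall>r\<ge>1. \<forall>ga\<in>Ga. \<forall>y\<in>Gw. \<forall>y'\<in>Gw. norm ga <= r --> norm (I y - I y') < et -->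
  pat (C * r) (I y) = pat (C * r) (I y') --> (lam h y - (b h + lam h ga)) * (lam h y' - (b h + lam h ga)) > 0"
proof -
 obtain f where f: "flag f" "h \<in> f" using flag_extend[OF h] by blast
 have ff: "finite f" by (rule flag_finite[OF f(1)])
 obtain u where "dual f u" using flag_dual[OF f(1)] by blast
 note u = dualD[OF this]
 obtain i e where ie: "i \<in> L" "e > 0" "\<And>y. y \<in> range I ==> norm (y - w h) < e ==> y \<in> W i \<longleftrightarrow> a h \<bullet> y <= b h"
  using W_loc[OF h] by blast
 define Su where "Su = (\<Sum>h\<in>f. norm (u h)) + 1"
 have Su: "Su > 0" by (simp add: Su_def add_nonneg_pos sum_nonneg)
 define et1 where "et1 = e / (2 * Su)"
 have et1: "et1 > 0" using ie Su by (simp add: et1_def)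
 have "\<forall>l\<in>f. \<exists>C>0. \<forall>s. \<exists>g\<in>axg f l. \<bar>lam l g - s\<bar> <= et1 \<and> norm g <= C * (1 + \<bar>s\<bar>)"
  using axg_approx[OF assms(1) f(1) _ et1] by blast
 from bchoice[OF this] obtain Cl where Cl: "\<And>l. l \<in> f ==> Cl l > 0"
  "\<And>l s. l \<in> f ==> \<exists>g\<in>axg f l. \<bar>lam l g - s\<bar> <= et1 \<and> norm g <= Cl l * (1 + \<bar>s\<bar>)" by blast
 obtain rh where rh: "rh > 0" "\<forall>x\<in>Win. norm x <= rh" using Win_bound by blast
 obtain KI where KI: "KI > 0" "\<And>x. norm (I x) <= KI * norm x" using bounds by metis
 obtain KN where KN: "KN > 0" "\<And>x. N (P x) <= KN * norm x" using N_le by metis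
 define Sa where "Sa = (\<Sum>h\<in>f. norm (a h)) + 1"
 have Sa: "Sa > 0" by (simp add: Sa_def add_nonneg_pos sum_nonneg)
 have aSa: "norm (a l) <= Sa" if "l \<in> f" for l
 proof -
  have "norm (a l) <= (\<Sum>h\<in>f. norm (a h))" by (rule member_le_sum[OF that]) (use ff in auto)
  then show ?thesis by (simp add: Sa_def)
 qed
 define Q where "Q = norm (w h) + rh + KI"
 have Q: "Q > 0" using rh KI by (simp add: Q_def add_nonneg_pos)
 define D where "D = (\<Sum>l\<in>f. Cl l * (1 + Sa * Q)) + 1"
 define C where "C = KN * D"
 have D: "D > 0" unfolding D_def using Cl(1) Sa Q by (intro add_nonneg_pos sum_nonneg mult_nonneg_nonneg) (auto simp: less_imp_le)
 \<comment> \<open>\<open>e / 2\<close> keeps the second point in the region where the piece is a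
   half-space; \<open>et1 / Sa\<close> forces the height of \<open>y\<close> over the shifted wall
   to be at most \<open>et1\<close>, an error that the axes cannot correct.\<close>
 define et where "et = min (e / 2) (et1 / Sa)"
 have et: "et > 0" using ie et1 Sa by (simp add: et_def)
 have "(lam h y - (b h + lam h ga)) * (lam h y' - (b h + lam h ga)) > 0"
  if r: "r >= 1" and g: "ga \<in> Ga" "norm ga <= r" and y: "y \<in> Gw" "y' \<in> Gw" "norm (I y - I y') < et"
   and p: "pat (C * r) (I y) = pat (C * r) (I y')" for r ga y y'
 proof (rule ccontr)
  assume "\<not> ?thesis"
  then have np: "(lam h y - (b h + lam h ga)) * (lam h y' - (b h + lam h ga)) <= 0" by simp
  have "\<bar>lam h y - (b h + lam h ga)\<bar> <= \<bar>lam h y - lam h y'\<bar>" using np by (auto simp: mult_le_0_iff)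
  also have "\<dots> = \<bar>a h \<bullet> (I y - I y')\<bar>" by (simp add: lam_def inner_diff_right)
  also have "\<dots> <= norm (a h) * norm (I y - I y')" by (rule Cauchy_Schwarz_ineq2)
  also have "\<dots> <= Sa * (et1 / Sa)" using aSa[OF f(2)] y(3) Sa by (intro mult_mono) (auto simp: et_def)
  finally have close: "\<bar>lam h y - (b h + lam h ga)\<bar> <= et1" using Sa by simp
  \<comment> \<open>The displacement still missing after the shift by \<open>- ga\<close>.\<close>
  define q where "q = w h - (I y - I ga)"
  have qI: "q \<in> range I" unfolding q_def using w_I[OF h] subspace_I by (intro subspace_diff) auto
  have qn: "norm q <= Q * r"
  proof -
   have "norm q <= norm (w h) + norm (I y) + norm (I ga)" unfolding q_def by norm
   also have "norm (I y) <= rh" using rh y(1) by (auto simp: Gw_def)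
   also have "norm (I ga) <= KI * r" using KI(2)[of ga] g(2) KI(1) by (meson mult_left_mono less_imp_le order_trans)
   also have "norm (w h) + rh + KI * r <= (norm (w h) + rh) * r + KI * r"
    using mult_left_mono[OF r, of "norm (w h) + rh"] rh(1) by simp
   finally show ?thesis by (simp add: Q_def algebra_simps)
  qed
  have "\<forall>l\<in>f. \<exists>g. g \<in> axg f l \<and> \<bar>lam l g - a l \<bullet> q\<bar> <= et1 \<and> norm g <= Cl l * (1 + \<bar>a l \<bullet> q\<bar>)" using Cl(2) by blast
  from bchoice[OF this] obtain s where s: "\<And>l. l \<in> f ==> s l \<in> axg f l" "\<And>l. l \<in> f ==> \<bar>lam l (s l) - a l \<bullet> q\<bar> <= et1"
   "\<And>l. l \<in> f ==> norm (s l) <= Cl l * (1 + \<bar>a l \<bullet> q\<bar>)" by blast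
  \<comment> \<open>The axis of \<open>h\<close> is left out, so \<open>lam h si = 0\<close> and the
    heights over \<open>h\<close> are kept.\<close>
  define si where "si = (\<Sum>l\<in>f - {h}. s l)"
  have siG: "si \<in> Ga" unfolding si_def by (rule lat_sum) (use s(1) axg_sub(2) in blast)
  have ls: "lam l si = (if l = h then 0 else lam l (s l))" if l: "l \<in> f" for l
  proof -
   have "lam l si = (\<Sum>j\<in>f - {h}. lam l (s j))" by (simp add: si_def lam_sum)
   also have "\<dots> = (\<Sum>j\<in>f - {h}. if j = l then lam l (s l) else 0)"
    by (rule sum.cong) (use s(1) l in \<open>auto simp: axg_def\<close>)
   finally show ?thesis using l ff by simp
  qed
  have sin: "norm si <= (D - 1) * r"
  proof -
   have "norm si <= (\<Sum>l\<in>f - {h}. Cl l * (1 + Sa * Q) * r)" unfolding si_def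
   proof (rule sum_norm_le)
    fix l assume l: "l \<in> f - {h}"
    have "\<bar>a l \<bullet> q\<bar> <= norm (a l) * norm q" by (rule Cauchy_Schwarz_ineq2)
    also have "\<dots> <= Sa * (Q * r)" using aSa l qn Sa by (intro mult_mono) auto
    finally have "1 + \<bar>a l \<bullet> q\<bar> <= (1 + Sa * Q) * r" using r by (simp add: algebra_simps)
    then have "Cl l * (1 + \<bar>a l \<bullet> q\<bar>) <= Cl l * ((1 + Sa * Q) * r)" using Cl(1)[of l] l by (intro mult_left_mono) auto
    then show "norm (s l) <= Cl l * (1 + Sa * Q) * r" using s(3)[of l] l by (simp add: mult.assoc)
   qed
   also have "\<dots> <= (\<Sum>l\<in>f. Cl l * (1 + Sa * Q) * r)"
    using ff Cl(1) Sa Q r by (intro sum_mono2) (auto intro!: mult_nonneg_nonneg simp: less_imp_le)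
   finally show ?thesis by (simp add: D_def sum_distrib_right)
  qed
  define dt where "dt = si - ga"
  have dtG: "dt \<in> Ga" unfolding dt_def using siG g by (intro lat_diff)
  have "norm dt <= norm si + norm ga" unfolding dt_def by (rule norm_triangle_ineq4)
  also have "\<dots> <= (D - 1) * r + r" using sin g(2) by linarith
  also have "\<dots> = D * r" by (simp add: algebra_simps)
  finally have "KN * norm dt <= C * r" using KN(1) by (simp add: C_def mult.assoc)
  then have dtN: "N (P dt) <= C * r" using KN(2)[of dt] by linarith
  have al: "\<bar>a l \<bullet> (I si - q)\<bar> <= et1" if l: "l \<in> f" for l
  proof (cases "l = h")
   case True
   have "a h \<bullet> q = b h - lam h y + lam h ga" using w_wall[OF h] by (simp add: q_def lam_def inner_diff_right)
   then show ?thesis using ls[OF l] close True by (simp add: inner_diff_right flip: lam_def)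
  next
   case False then show ?thesis using ls[OF l] s(2)[OF l] by (simp add: inner_diff_right flip: lam_def)
  qed
  have siq: "norm (I si - q) < e / 2"
  proof -
   have "I si - q \<in> range I" using qI subspace_I by (intro subspace_diff) auto
   then have "norm (I si - q) = norm (\<Sum>l\<in>f. (a l \<bullet> (I si - q)) *\<^sub>R u l)" using flag_expand[OF f(1) u] by simp
   also have "\<dots> <= (\<Sum>l\<in>f. et1 * norm (u l))" by (rule sum_norm_le) (use al in \<open>auto intro: mult_right_mono\<close>)
   also have "\<dots> = et1 * (Su - 1)" by (simp add: Su_def sum_distrib_left)
   also have "\<dots> < et1 * Su" using et1 by simp
   also have "\<dots> = e / 2" using Su by (simp add: et1_def)
   finally show ?thesis .
  qed
  have yw: "I (y + dt) - w h = I si - q" by (simp add: dt_def q_def I_add I_diff)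
  have n1: "norm (I (y + dt) - w h) < e" using siq ie(2) by (simp add: yw)
  have n2: "norm (I (y' + dt) - w h) < e"
  proof -
   have "I (y' + dt) - w h = (I (y + dt) - w h) - (I y - I y')" by (simp add: I_add)
   also have "norm \<dots> <= norm (I (y + dt) - w h) + norm (I y - I y')" by (rule norm_triangle_ineq4)
   finally show ?thesis using siq y(3) yw by (simp add: et_def)
  qed
  have val: "a h \<bullet> I (z + dt) = lam h z - lam h ga" for z
   using ls[OF f(2)] by (simp add: dt_def lam_add lam_diff flip: lam_def)
  have mem: "(dt, i) \<in> pat (C * r) (I z) \<longleftrightarrow> lam h z <= b h + lam h ga" if "norm (I (z + dt) - w h) < e" for z
   using ie(3)[OF rangeI that] val[of z] dtG dtN ie(1) by (auto simp: pat_def I_add)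
  have iff: "lam h y <= b h + lam h ga \<longleftrightarrow> lam h y' <= b h + lam h ga" using mem[OF n1] mem[OF n2] p by simp
  have "y + dt \<in> Ga" "y' + dt \<in> Ga" using y dtG by (auto simp: Gw_def intro: lat_add)
  then have "a h \<bullet> I (y + dt) ~= b h" "a h \<bullet> I (y' + dt) ~= b h"
   using no_wall[OF h ie(1,2,3)] n1 n2 by auto
  then have "lam h y ~= b h + lam h ga" "lam h y' ~= b h + lam h ga" using val by auto
  then show False using np iff by (auto simp: mult_le_0_iff)
 qed
 moreover have "C > 0" using KN D by (simp add: C_def)
 ultimately show ?thesis using et by blast
qed

text \<open>Points of the window at a given distance are told apart by translating one of them
 to an interior point of the window that is almost extremal in a coordinate direction.\<close>

lemma far_separation:
 assumes et: "et > 0"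
 shows "\<exists>R. \<forall>y\<in>Gw. \<forall>y'\<in>Gw. pat R (I y) = pat R (I y') --> norm (I y - I y') < et"
proof -
 obtain rh where rh: "rh > 0" "\<And>x. x \<in> Win ==> norm x <= rh" using Win_bound by blast
 obtain KN where KN: "KN > 0" "\<And>x. N (P x) <= KN * norm x" using N_le by metis
 define ta where "ta = et / real DIM('e)"
 have ta: "ta > 0" using et by (simp add: ta_def)
 let ?V = "Basis \<union> uminus ` Basis :: 'e set"
 have Vn: "norm v = 1" if "v \<in> ?V" for v using that by auto
 have "\<exists>R. \<forall>y\<in>Gw. \<forall>y'\<in>Gw. pat R (I y) = pat R (I y') --> v \<bullet> (I y' - I y) < ta" if v: "v \<in> ?V" for v
 proof -
  have bd: "v \<bullet> z <= rh" if "z \<in> Win" for z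
   using norm_cauchy_schwarz[of v z] Vn[OF v] rh(2)[OF that] by simp
  let ?S = "(\<lambda>z. v \<bullet> z) ` Win"
  have bS: "bdd_above ?S" using bd by (auto intro!: bdd_aboveI)
  have neS: "?S ~= {}" using W_ne by (simp add: Win_def)
  have "Sup ?S - ta / 3 < Sup ?S" using ta by simp
  then obtain z where z: "z \<in> Win" "Sup ?S - ta / 3 < v \<bullet> z" using less_cSup_iff[OF neS bS] by auto
  have "ta / 3 > 0" using ta by simp
  then obtain c r where c: "c \<in> range I" "norm (c - z) < ta / 3" "r > 0" "\<And>y. y \<in> range I ==> norm (y - c) < r ==> y \<in> Win"
   using W_reg[of z "ta / 3"] z(1) unfolding Win_def by blast
  \<comment> \<open>Three errors below \<open>ta / 3\<close> add up: \<open>z\<close> misses the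
    supremum, \<open>c\<close> misses \<open>z\<close>, and the translate of \<open>y\<close> misses
    \<open>c\<close>. A point that exceeds \<open>y\<close> by \<open>ta\<close> in direction
    \<open>v\<close> would be carried beyond the supremum.\<close>
  define r' where "r' = min r (ta / 3)"
  have r': "r' > 0" using c(3) ta by (simp add: r'_def)
  obtain C where C: "C > 0" "\<And>p. \<exists>ga\<in>Ga. norm (I ga - I p) < r' \<and> norm (ga - p) <= C" using lattice_near[OF r'] by metis
  define R where "R = KN * (C + norm c + rh)"
  have "v \<bullet> (I y' - I y) < ta" if y: "y \<in> Gw" "y' \<in> Gw" and p: "pat R (I y) = pat R (I y')" for y y'
  proof (rule ccontr)
   assume far: "\<not> ?thesis"
   obtain ga where g: "ga \<in> Ga" "norm (I ga - I (c - I y)) < r'" "norm (ga - (c - I y)) <= C" using C(2) by blast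
   have Ic: "I (c - I y) = c - I y" using I_id[OF c(1)] by (simp add: I_diff)
   have "norm ga <= norm (ga - (c - I y)) + norm c + norm (I y)" by norm
   then have "norm ga <= C + norm c + rh" using g(3) rh(2)[of "I y"] y(1) by (simp add: Gw_def)
   then have "KN * norm ga <= R" using KN(1) by (simp add: R_def)
   then have NR: "N (P ga) <= R" using KN(2)[of ga] by linarith
   have near: "norm ((I y + I ga) - c) < r'" using g(2) unfolding Ic by (simp add: algebra_simps)
   have "I y + I ga \<in> range I" using subspace_I by (intro subspace_add) auto
   then have "I y + I ga \<in> Win" using c(4) near by (simp add: r'_def)
   then obtain i where i: "i \<in> L" "I y + I ga \<in> W i" by (auto simp: Win_def)
   then have "(ga, i) \<in> pat R (I y)" using g(1) NR by (simp add: pat_def)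
   then have "(ga, i) \<in> pat R (I y')" using p by simp
   then have "I y' + I ga \<in> Win" by (auto simp: pat_def Win_def)
   then have "v \<bullet> (I y' + I ga) <= Sup ?S" using bS by (intro cSup_upper) auto
   moreover have "v \<bullet> (I y' + I ga) = v \<bullet> z + v \<bullet> (c - z) + v \<bullet> ((I y + I ga) - c) + v \<bullet> (I y' - I y)"
    by (simp add: inner_add_right inner_diff_right)
   moreover have "\<bar>v \<bullet> (c - z)\<bar> < ta / 3" using Cauchy_Schwarz_ineq2[of v "c - z"] c(2) Vn[OF v] by simp
   moreover have "\<bar>v \<bullet> ((I y + I ga) - c)\<bar> < ta / 3"
    using Cauchy_Schwarz_ineq2[of v "(I y + I ga) - c"] near Vn[OF v] by (simp add: r'_def)
   ultimately show False using z(2) far by linarith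
  qed
  then show ?thesis by blast
 qed
 then have "\<forall>v\<in>?V. \<exists>R. \<forall>y\<in>Gw. \<forall>y'\<in>Gw. pat R (I y) = pat R (I y') --> v \<bullet> (I y' - I y) < ta" by blast
 from bchoice[OF this] obtain R where R: "\<And>v y y'. v \<in> ?V ==> y \<in> Gw ==> y' \<in> Gw ==> pat (R v) (I y) = pat (R v) (I y') ==> v \<bullet> (I y' - I y) < ta" by blast
 define RM where "RM = Max (R ` ?V)"
 have RM: "R v <= RM" if "v \<in> ?V" for v unfolding RM_def using that by (intro Max_ge) auto
 have "norm (I y - I y') < et" if y: "y \<in> Gw" "y' \<in> Gw" and p: "pat RM (I y) = pat RM (I y')" for y y'
 proof -
  have "\<bar>(I y' - I y) \<bullet> v\<bar> < ta" if v: "v \<in> Basis" for v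
  proof -
   have "v \<bullet> (I y' - I y) < ta" by (rule R[OF _ y pat_mono[OF p RM]]) (use v in auto)
   moreover have "(- v) \<bullet> (I y' - I y) < ta" by (rule R[OF _ y pat_mono[OF p RM]]) (use v in auto)
   ultimately show ?thesis by (simp add: inner_commute)
  qed
  then have "(\<Sum>v\<in>Basis. \<bar>(I y' - I y) \<bullet> v\<bar>) < (\<Sum>v\<in>(Basis :: 'e set). ta)" by (intro sum_strict_mono) auto
  then have "norm (I y' - I y) < et" using norm_le_l1[of "I y' - I y"] by (simp add: ta_def)
  then show ?thesis by (simp add: norm_minus_commute)
 qed
 then show ?thesis by blast
qed

text \<open>Equal patches of some fixed radius already force the points to be as close as the local
  statement demands, and a patch of large radius determines that of the fixed radius.\<close>

lemma wall_separation:
 assumes RC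
 shows "\<exists>C>0. \<exists>r0\<ge>1. \<forall>r\<ge>r0. \<forall>h\<in>Hs. \<forall>ga\<in>Ga. \<forall>y\<in>Gw. \<forall>y'\<in>Gw. norm ga <= r -->
  pat (C * r) (I y) = pat (C * r) (I y') --> (lam h y - (b h + lam h ga)) * (lam h y' - (b h + lam h ga)) > 0"
proof -
 have "\<forall>h\<in>Hs. \<exists>Cet. fst Cet > 0 \<and> snd Cet > 0 \<and> (\<forall>r\<ge>1. \<forall>ga\<in>Ga. \<forall>y\<in>Gw. \<forall>y'\<in>Gw. norm ga <= r --> norm (I y - I y') < snd Cet -->
  pat (fst Cet * r) (I y) = pat (fst Cet * r) (I y') --> (lam h y - (b h + lam h ga)) * (lam h y' - (b h + lam h ga)) > 0)"
  using wall_separation_local[OF assms] by (metis fst_conv snd_conv)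
 from bchoice[OF this] obtain q where q: "\<And>h. h \<in> Hs ==> fst (q h) > 0" "\<And>h. h \<in> Hs ==> snd (q h) > 0"
  "\<And>h r ga y y'. h \<in> Hs ==> r >= 1 ==> ga \<in> Ga ==> y \<in> Gw ==> y' \<in> Gw ==> norm ga <= r ==> norm (I y - I y') < snd (q h) ==>
  pat (fst (q h) * r) (I y) = pat (fst (q h) * r) (I y') ==> (lam h y - (b h + lam h ga)) * (lam h y' - (b h + lam h ga)) > 0" by blast
 obtain et where et: "et > 0" "\<And>h. h \<in> Hs ==> et < snd (q h)"
  using finite_pos_lower[of "(\<lambda>h. snd (q h)) ` Hs" 1] finH q(2) by auto
 define C where "C = (\<Sum>h\<in>Hs. fst (q h)) + 1"
 have C: "fst (q h) <= C" if "h \<in> Hs" for h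
 proof -
  have "fst (q h) <= (\<Sum>h\<in>Hs. fst (q h))" by (rule member_le_sum[OF that]) (use finH q(1) in \<open>auto simp: less_imp_le\<close>)
  then show ?thesis by (simp add: C_def)
 qed
 have C0: "C >= 1" unfolding C_def using q(1) by (simp add: sum_nonneg less_imp_le)
 obtain R where R: "\<And>y y'. y \<in> Gw ==> y' \<in> Gw ==> pat R (I y) = pat R (I y') ==> norm (I y - I y') < et"
  using far_separation[OF et(1)] by blast
 have "(lam h y - (b h + lam h ga)) * (lam h y' - (b h + lam h ga)) > 0"
  if "r >= max 1 R" "h \<in> Hs" "ga \<in> Ga" "y \<in> Gw" "y' \<in> Gw" "norm ga <= r" "pat (C * r) (I y) = pat (C * r) (I y')" for r h ga y y'
 proof -
  have "1 * r <= C * r" using C0 that(1) by (intro mult_right_mono) auto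
  then have "R <= C * r" using that(1) by linarith
  then have "norm (I y - I y') < et" using R[OF that(4,5) pat_mono[OF that(7)]] by blast
  moreover have "fst (q h) * r <= C * r" using C[OF that(2)] that(1) by (intro mult_right_mono) auto
  ultimately show ?thesis using q(3)[OF that(2) _ that(3,4,5,6) _ pat_mono[OF that(7)]] et(2)[OF that(2)] that(1) by force
 qed
 then show ?thesis using C0 by (intro exI[of _ C] conjI exI[of _ "max 1 R"]) auto
qed

subsection \<open>Vertices stay away from walls\<close>

text \<open>Each wall of the flag is shifted by its own lattice vector, so \<open>v\<close> runs
  through the vertices of the shifted walls. A vertex may lie on a shifted wall of \<open>h\<close>,
  but otherwise it keeps the distance that Dirichlet's exponent allows.\<close>

definition gap :: "'h set \<Rightarrow> 'h \<Rightarrow> real \<Rightarrow> bool" where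
 "gap f h c \<longleftrightarrow> (\<forall>r\<ge>1. \<forall>ga ga' v. (\<forall>l\<in>f. ga l \<in> Ga \<and> norm (ga l) <= r) -->
  ga' \<in> Ga --> norm ga' <= r --> v \<in> range I --> (\<forall>l\<in>f. a l \<bullet> v = b l + lam l (ga l)) -->
  a h \<bullet> v - (b h + lam h ga') ~= 0 --> c / r ^ dlt h <= \<bar>a h \<bullet> v - (b h + lam h ga')\<bar>)"

lemma gapD:
 assumes "gap f h c" "r >= 1" "\<And>l. l \<in> f ==> ga l \<in> Ga \<and> norm (ga l) <= r" "ga' \<in> Ga" "norm ga' <= r" "v \<in> range I"
  "\<And>l. l \<in> f ==> a l \<bullet> v = b l + lam l (ga l)" "a h \<bullet> v - (b h + lam h ga') ~= 0"
 shows "c / r ^ dlt h <= \<bar>a h \<bullet> v - (b h + lam h ga')\<bar>"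
 using assms unfolding gap_def by blast

lemma gap_mono: "gap f h c ==> e <= c ==> gap f h e"
 unfolding gap_def by (intro allI impI, rule order_trans[OF divide_right_mono]) auto

text \<open>The Diophantine condition on the level of walls; as there are finitely many flags and
  walls, one constant serves all of them, see \<open>DS_uniform\<close>.\<close>

definition DS :: bool where
 "DS \<longleftrightarrow> (\<forall>f h. flag f --> h \<in> Hs --> (\<exists>c>0. gap f h c))"

text \<open>The box around the cut-off simplex has sides of order \<open>|th|\<close> on the axes in
  \<open>J\<close> and of order \<open>1 / r ^ dlt l\<close> on the others. Comparing its frequency
  with \<open>1 / r ^ d\<close>, where \<open>d\<close> is the sum of all exponents of the flag,
  leaves \<open>(|th| r ^ dlt h) ^ card J\<close> bounded below, because the axes in
  \<open>J\<close> all share the exponent of \<open>h\<close>.\<close>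

theorem PW_imp_DS:
 assumes PW and RC
 shows DS
 unfolding DS_def
proof (intro allI impI)
 fix f h assume f: "flag f" and h: "h \<in> Hs"
 have ff: "finite f" by (rule flag_finite[OF f])
 obtain u where "dual f u" using flag_dual[OF f] by blast
 note u = dualD[OF this]
 define t where "t j = a h \<bullet> u j" for j
 \<comment> \<open>The axes along which the height over \<open>h\<close> varies; the simplex
   degenerates in the others.\<close>
 define J where "J = {j\<in>f. t j ~= 0}"
 have fJ: "finite J" "J \<subseteq> f" using ff by (auto simp: J_def)
 have expand: "a h \<bullet> y = (\<Sum>j\<in>J. t j * (a j \<bullet> y))" if y: "y \<in> range I" for y
 proof -
  have "a h \<bullet> y = a h \<bullet> (\<Sum>j\<in>f. (a j \<bullet> y) *\<^sub>R u j)" using flag_expand[OF f u y] by simp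
  also have "\<dots> = (\<Sum>j\<in>f. t j * (a j \<bullet> y))" by (simp add: inner_sum_right t_def mult.commute)
  also have "\<dots> = (\<Sum>j\<in>J. t j * (a j \<bullet> y))" by (rule sum.mono_neutral_right) (use ff in \<open>auto simp: J_def\<close>)
  finally show ?thesis .
 qed
 have Jne: "J ~= {}"
 proof
  assume "J = {}"
  then have "a h \<bullet> a h = 0" using expand[OF a_I[OF h]] by simp
  then show False using a_nz[OF h] by simp
 qed
 have dJ: "dlt j = dlt h" if "j \<in> J" for j
  using cdim_exchange[OF assms(2) f u h] that by (auto simp: J_def t_def dlt_def)
 obtain cP where cP: "cP > 0" "\<forall>\<^sub>F r in at_top. \<forall>y\<in>Gw. \<exists>vn. ((\<lambda>R. cnt R (acc r (I y)) / cnt R Win) \<longlongrightarrow> vn) at_top \<and> cP / r ^ d <= vn"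
  using assms(1) PW_def by blast
 then obtain rP where rP: "\<And>r y. r >= rP ==> y \<in> Gw ==> \<exists>vn. ((\<lambda>R. cnt R (acc r (I y)) / cnt R Win) \<longlongrightarrow> vn) at_top \<and> cP / r ^ d <= vn"
  unfolding eventually_at_top_linorder by blast
 obtain CS rS where CS: "CS > 0" "rS >= 1" "\<And>r h ga y y'. r >= rS ==> h \<in> Hs ==> ga \<in> Ga ==> y \<in> Gw ==> y' \<in> Gw ==> norm ga <= r ==>
  pat (CS * r) (I y) = pat (CS * r) (I y') ==> (lam h y - (b h + lam h ga)) * (lam h y' - (b h + lam h ga)) > 0"
  using wall_separation[OF assms(2)] by blast
 have "\<forall>l\<in>f. \<exists>Cr. fst Cr > 0 \<and> snd Cr >= 1 \<and> (\<forall>r\<ge>snd Cr. \<exists>g\<in>axg f l. norm g <= r \<and> 0 < lam l g \<and> lam l g <= fst Cr / r ^ dlt l)"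
  using axg_dirichlet[OF assms(2) f] by (metis fst_conv snd_conv)
 from bchoice[OF this] obtain CD where CD: "\<And>l. l \<in> f ==> fst (CD l) > 0" "\<And>l. l \<in> f ==> snd (CD l) >= 1"
  "\<And>l r. l \<in> f ==> r >= snd (CD l) ==> \<exists>g\<in>axg f l. norm g <= r \<and> 0 < lam l g \<and> lam l g <= fst (CD l) / r ^ dlt l" by blast
 obtain rh where rh: "rh > 0" "\<forall>x\<in>Win. norm x <= rh" using Win_bound by blast
 obtain CB where CB: "CB > 0" "\<And>be et A. (\<forall>j\<in>f. 0 < et j \<and> et j <= 1) \<and>
  (\<forall>y\<in>A. norm y <= rh \<and> (\<forall>j\<in>f. \<bar>a j \<bullet> y - be j\<bar> <= et j)) ==>
  (\<exists>R0\<ge>1. \<forall>R\<ge>R0. cnt R A <= CB * (\<Prod>j\<in>f. et j) * R ^ d)"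
 proof -
  have "\<exists>C>0. \<forall>be et A. (\<forall>j\<in>f. 0 < et j \<and> et j <= 1) \<and>
   (\<forall>y\<in>A. norm y <= rh \<and> (\<forall>j\<in>f. \<bar>a j \<bullet> y - be j\<bar> <= et j)) -->
   (\<exists>R0\<ge>1. \<forall>R\<ge>R0. cnt R A <= C * (\<Prod>j\<in>f. et j) * R ^ d)"
   by (rule cnt_box[OF ff d_pos u(1)]) (use u(2) in auto)
  then show ?thesis using that by blast
 qed
 obtain cW RW where cW: "cW > 0" "RW >= 1" "\<And>R. R >= RW ==> cW * R ^ d <= cnt R Win" using cnt_Win_lower by metis
 obtain c0 r0 where c0: "c0 \<in> range I" "r0 > 0" "\<And>y. y \<in> range I ==> norm (y - c0) < r0 ==> y \<in> Win" using Win_ball by blast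
 have "r0 / 2 > 0" using c0 by simp
 then obtain C1 where C1: "C1 > 0" "\<And>p. \<exists>ga\<in>Ga. norm (I ga - I p) < r0 / 2 \<and> norm (ga - p) <= C1" using lattice_near by metis
 obtain Kl where Kl: "Kl > 0" "\<And>h x. h \<in> Hs ==> \<bar>lam h x\<bar> <= Kl * norm x" using lam_bound by metis
 obtain T where T: "T > 0" "T <= 1" "\<And>j. j \<in> J ==> T < \<bar>t j\<bar>"
 proof -
  have "finite ((\<lambda>j. \<bar>t j\<bar>) ` J)" "\<And>x. x \<in> (\<lambda>j. \<bar>t j\<bar>) ` J ==> x > 0" using fJ by (auto simp: J_def)
  from finite_pos_lower[OF this zero_less_one] show ?thesis using that by blast
 qed
 define Sb where "Sb = (\<Sum>l\<in>f. \<bar>b l\<bar>)"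
 define Su where "Su = (\<Sum>l\<in>f. norm (u l)) + 1"
 have Su: "Su > 0" by (simp add: Su_def add_nonneg_pos sum_nonneg)
 have Sb: "\<bar>b l\<bar> <= Sb" if "l \<in> f" for l unfolding Sb_def by (rule member_le_sum[OF that]) (use ff in auto)
 have Sb0: "Sb >= 0" by (simp add: Sb_def sum_nonneg)
 \<comment> \<open>Bounds, relative to \<open>r\<close>, the lattice translation that moves the
   simplex to the interior point \<open>c0\<close> of the window.\<close>
 define K where "K = C1 + norm c0 + (Sb + Kl + 1) * Su + 1"
 have K: "K >= 1" using C1 Sb0 Kl Su unfolding K_def by (simp add: add_nonneg_nonneg)
 define r2 where "r2 = Max (insert 1 (insert rS (insert (rP / CS) ((\<lambda>l. snd (CD l)) ` f \<union> (\<lambda>l. fst (CD l)) ` f))))"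
 have r2f: "finite (insert 1 (insert rS (insert (rP / CS) ((\<lambda>l. snd (CD l)) ` f \<union> (\<lambda>l. fst (CD l)) ` f))))" using ff by simp
 have r2: "1 <= r2" "rS <= r2" "rP / CS <= r2" "\<And>l. l \<in> f ==> snd (CD l) <= r2" "\<And>l. l \<in> f ==> fst (CD l) <= r2"
  unfolding r2_def by (rule Max_ge[OF r2f], simp)+
 \<comment> \<open>The threshold for \<open>(|th| r ^ dlt h) ^ card J\<close> obtained by solving
   the final comparison of frequencies for this quantity.\<close>
 define c6 where "c6 = cP * cW / (CB * (CS * (K + 1)) ^ d * (\<Prod>j\<in>J. 1 / \<bar>t j\<bar>) * (\<Prod>l\<in>f - J. fst (CD l)))"
 have prodt: "(\<Prod>j\<in>J. 1 / \<bar>t j\<bar>) > 0" by (rule prod_pos) (auto simp: J_def)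
 have prodC: "(\<Prod>l\<in>f - J. fst (CD l)) > 0" by (rule prod_pos) (use CD(1) in auto)
 have c6: "c6 > 0" unfolding c6_def using cP cW CB CS K prodt prodC by (intro divide_pos_pos mult_pos_pos zero_less_power) auto
 \<comment> \<open>\<open>T\<close> keeps the sides of the box at most 1, and the bound 1 allows
   passing from the power \<open>card J\<close> to the first power.\<close>
 define c7 where "c7 = min T (min 1 c6)"
 have c7: "c7 > 0" using T c6 by (simp add: c7_def)
 have main: "c7 / r ^ dlt h <= \<bar>th\<bar>"
  if r: "r >= r2" and g: "\<forall>l\<in>f. ga l \<in> Ga \<and> norm (ga l) <= r" and g': "ga' \<in> Ga" "norm ga' <= r"
   and v: "v \<in> range I" "\<forall>l\<in>f. a l \<bullet> v = b l + lam l (ga l)" and th: "th = a h \<bullet> v - (b h + lam h ga')" "th ~= 0"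
  for r ga ga' v th
 proof (rule ccontr)
  assume "\<not> ?thesis"
  then have small: "\<bar>th\<bar> < c7 / r ^ dlt h" by simp
  have r1: "r >= 1" using r r2(1) by simp
  have rd: "r ^ dlt h >= 1" using r1 by (rule one_le_power)
  have "c7 / r ^ dlt h <= c7 / 1" using rd c7 by (intro divide_left_mono) auto
  then have thT: "\<bar>th\<bar> < T" "\<bar>th\<bar> < 1" using small by (auto simp: c7_def)
  have "\<forall>l\<in>f. \<exists>g. g \<in> axg f l \<and> norm g <= r \<and> 0 < lam l g \<and> lam l g <= fst (CD l) / r ^ dlt l" using CD(3) r2(4) r by (meson order_trans)
  from bchoice[OF this] obtain q where q: "\<And>l. l \<in> f ==> q l \<in> axg f l" "\<And>l. l \<in> f ==> norm (q l) <= r"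
   "\<And>l. l \<in> f ==> 0 < lam l (q l)" "\<And>l. l \<in> f ==> lam l (q l) <= fst (CD l) / r ^ dlt l" by blast
  have qG: "q l \<in> Ga" if "l \<in> f" for l using q(1)[OF that] axg_sub(2) by blast
  define s where "s = sgn th"
  have s: "s * th = \<bar>th\<bar>" "\<bar>s\<bar> = 1" "s * s = 1" using th(2) by (auto simp: s_def sgn_if)
  \<comment> \<open>A small simplex cut off the flag at \<open>v\<close> by the wall of \<open>h\<close>, times short gaps in the other axes.\<close>
  define Om where "Om = {y. (\<forall>j\<in>J. s * t j * (a j \<bullet> y - a j \<bullet> v) < 0) \<and> s * (a h \<bullet> y - (b h + lam h ga')) > 0 \<and>
   (\<forall>l\<in>f - J. b l < a l \<bullet> y \<and> a l \<bullet> y < b l + lam l (q l))}"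
  have op: "open Om"
  proof -
   have "Om = (\<Inter>j\<in>J. {y. s * t j * (a j \<bullet> y - a j \<bullet> v) < 0}) \<inter> {y. s * (a h \<bullet> y - (b h + lam h ga')) > 0} \<inter>
    (\<Inter>l\<in>f - J. {y. b l < a l \<bullet> y} \<inter> {y. a l \<bullet> y < b l + lam l (q l)})" by (auto simp: Om_def)
   also have "open \<dots>"
    by (intro open_Int open_INT ballI open_Collect_less continuous_intros) (use ff fJ in auto)
   finally show ?thesis .
  qed
  \<comment> \<open>On each axis in \<open>J\<close> the point moves off \<open>v\<close> so that
    the height over \<open>h\<close> changes by \<open>|th| / (2 card J)\<close>; together the
    changes use up half of \<open>th\<close>, so \<open>y0\<close> lies strictly between the vertex
    and the wall.\<close>
  define y0 where "y0 = (\<Sum>l\<in>f. (if l \<in> J then a l \<bullet> v - s * \<bar>th\<bar> / (2 * real (card J) * t l) else b l + lam l (q l) / 2) *\<^sub>R u l)"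
  have y0I: "y0 \<in> range I" unfolding y0_def
   by (intro subspace_sum[OF subspace_I] subspace_scale[OF subspace_I] u)
  have y0c: "a l \<bullet> y0 = (if l \<in> J then a l \<bullet> v - s * \<bar>th\<bar> / (2 * real (card J) * t l) else b l + lam l (q l) / 2)" if "l \<in> f" for l
   unfolding y0_def by (rule dual_coord[OF f u(2) that])
  have cJ: "real (card J) >= 1" using Jne fJ by (simp add: Suc_le_eq card_gt_0_iff)
  have y0Om: "y0 \<in> Om"
  proof -
   have 1: "s * t j * (a j \<bullet> y0 - a j \<bullet> v) < 0" if j: "j \<in> J" for j
   proof -
    have "s * t j * (a j \<bullet> y0 - a j \<bullet> v) = - (s * s) * (\<bar>th\<bar> / (2 * real (card J)))"
     using y0c[of j] j fJ by (auto simp: J_def)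
    then show ?thesis using s(3) th(2) cJ by simp
   qed
   have "a h \<bullet> y0 = (\<Sum>j\<in>J. t j * (a j \<bullet> v) - s * \<bar>th\<bar> / (2 * real (card J)))"
    unfolding expand[OF y0I] by (rule sum.cong) (use y0c fJ in \<open>auto simp: J_def right_diff_distrib\<close>)
   also have "\<dots> = a h \<bullet> v - s * \<bar>th\<bar> / 2" using cJ by (simp add: sum_subtractf expand[OF v(1)])
   finally have "a h \<bullet> y0 - (b h + lam h ga') = th - s * \<bar>th\<bar> / 2" unfolding th(1) by linarith
   then have "s * (a h \<bullet> y0 - (b h + lam h ga')) = s * (th - s * \<bar>th\<bar> / 2)" by (rule arg_cong)
   also have "\<dots> = s * th - (s * s) * (\<bar>th\<bar> / 2)" by (simp add: right_diff_distrib)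
   finally have "s * (a h \<bullet> y0 - (b h + lam h ga')) = s * th - (s * s) * (\<bar>th\<bar> / 2)" .
   then have 2: "s * (a h \<bullet> y0 - (b h + lam h ga')) > 0" using s th(2) by simp
   have 3: "b l < a l \<bullet> y0 \<and> a l \<bullet> y0 < b l + lam l (q l)" if l: "l \<in> f - J" for l
    using y0c[of l] q(3)[of l] l by simp
   show ?thesis using 1 2 3 by (simp add: Om_def)
  qed
  have y0n: "norm y0 <= (Sb + Kl + 1) * Su * r"
  proof -
   have "norm y0 = norm (\<Sum>l\<in>f. (a l \<bullet> y0) *\<^sub>R u l)" using flag_expand[OF f u y0I] by simp
   also have "\<dots> <= (\<Sum>l\<in>f. (Sb + Kl + 1) * r * norm (u l))"
   proof (rule sum_norm_le)
    fix l assume l: "l \<in> f"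
    have SK: "Sb + Kl * r + 1 <= (Sb + Kl + 1) * r" using r1 Sb0 mult_left_mono[OF r1, of Sb] by (simp add: algebra_simps)
    have "\<bar>a l \<bullet> y0\<bar> <= Sb + Kl * r + 1"
    proof (cases "l \<in> J")
     case True
     have "\<bar>lam l (ga l)\<bar> <= Kl * norm (ga l)" by (rule Kl(2)[OF flag_Hs[OF f l]])
     also have "\<dots> <= Kl * r" using g l Kl by (intro mult_left_mono) auto
     finally have av: "\<bar>a l \<bullet> v\<bar> <= Sb + Kl * r" using v(2) l Sb[OF l] by fastforce
     have "1 * T <= (2 * real (card J)) * \<bar>t l\<bar>" using T(3)[OF True] T(1) cJ by (intro mult_mono) auto
     then have "\<bar>th\<bar> <= 2 * real (card J) * \<bar>t l\<bar>" using thT by linarith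
     then have "\<bar>s * \<bar>th\<bar> / (2 * real (card J) * t l)\<bar> <= 1" using s(2) cJ True by (simp add: abs_mult J_def divide_le_eq)
     moreover have "a l \<bullet> y0 = a l \<bullet> v - s * \<bar>th\<bar> / (2 * real (card J) * t l)" using y0c[OF l] True by simp
     ultimately show ?thesis using av by linarith
    next
     case False
     have "\<bar>lam l (q l)\<bar> <= Kl * norm (q l)" by (rule Kl(2)[OF flag_Hs[OF f l]])
     also have "\<dots> <= Kl * r" using q(2)[OF l] Kl by (intro mult_left_mono) auto
     finally show ?thesis using y0c[OF l] False Sb[OF l] by (simp add: abs_le_iff)
    qed
    then have "\<bar>a l \<bullet> y0\<bar> <= (Sb + Kl + 1) * r" using SK by linarith
    then show "norm ((a l \<bullet> y0) *\<^sub>R u l) <= (Sb + Kl + 1) * r * norm (u l)" by (simp add: mult_right_mono)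
   qed
   also have "\<dots> = (Sb + Kl + 1) * r * (Su - 1)" by (simp add: Su_def sum_distrib_left)
   also have "\<dots> <= (Sb + Kl + 1) * r * Su" using Sb0 Kl r1 by (intro mult_left_mono) auto
   finally show ?thesis by (simp add: mult_ac)
  qed
  \<comment> \<open>Patches are defined in the window, so the simplex is transported there; the
    walls are shifted along with it and stay within norm \<open>R = (K + 1) r\<close>.\<close>
  obtain p where p: "p \<in> Ga" "norm (I p - I (c0 - y0)) < r0 / 2" "norm (p - (c0 - y0)) <= C1" using C1(2) by blast
  have Ic: "I (c0 - y0) = c0 - y0" using I_id[OF c0(1)] I_id[OF y0I] by (simp add: I_diff)
  have pn: "norm p <= K * r"
  proof -
   have "norm p <= norm (p - (c0 - y0)) + norm c0 + norm y0" by norm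
   also have "\<dots> <= C1 * 1 + norm c0 * 1 + (Sb + Kl + 1) * Su * r" using p(3) y0n by simp
   also have "\<dots> <= C1 * r + norm c0 * r + (Sb + Kl + 1) * Su * r"
    using mult_left_mono[OF r1 less_imp_le[OF C1(1)]] mult_left_mono[OF r1 norm_ge_zero[of c0]] by linarith
   also have "\<dots> <= K * r" using r1 by (simp add: K_def algebra_simps)
   finally show ?thesis .
  qed
  have "open ((\<lambda>y. y - I p) -` Om)" by (intro open_vimage[OF op] continuous_intros)
  moreover have "y0 + I p \<in> (\<lambda>y. y - I p) -` Om" using y0Om by simp
  ultimately obtain e3 where e3: "e3 > 0" "\<And>y. dist y (y0 + I p) < e3 ==> y - I p \<in> Om"
   unfolding open_dist by (metis vimage_eq)
  have yp: "y0 + I p \<in> range I" using y0I subspace_I by (intro subspace_add) auto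
  have "min e3 (r0 / 2) > 0" using e3 c0 by simp
  then obtain z where z: "z \<in> Ga" "norm (I z - (y0 + I p)) < min e3 (r0 / 2)" using dense[OF yp] by blast
  have zOm: "I z - I p \<in> Om" by (rule e3(2)) (use z(2) in \<open>simp add: dist_norm\<close>)
  have "norm (I z - c0) <= norm (I z - (y0 + I p)) + norm (I p - (c0 - y0))"
   using norm_triangle_ineq[of "I z - (y0 + I p)" "I p - (c0 - y0)"] by (simp add: algebra_simps)
  then have "norm (I z - c0) < r0" using z(2) p(2) unfolding Ic by simp
  then have zG: "z \<in> Gw" using z(1) c0(3) by (simp add: Gw_def)
  define R where "R = (K + 1) * r"
  have RrS: "R >= rS"
  proof -
   have "1 * r <= R" unfolding R_def using K r1 by (intro mult_right_mono) auto
   then show ?thesis using r r2(2) by linarith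
  qed
  have RrP: "CS * R >= rP"
  proof -
   have "rP <= CS * r2" using r2(3) CS(1) by (simp add: pos_divide_le_eq mult.commute)
   also have "\<dots> <= CS * r" using r CS(1) by simp
   also have "\<dots> <= CS * R" unfolding R_def using K r1 CS(1) by (intro mult_left_mono) (auto simp: mult_le_cancel_right1)
   finally show ?thesis .
  qed
  have wn: "norm (ga + p) <= R" if "norm ga <= r" for ga
   using norm_triangle_ineq[of ga p] that pn by (simp add: R_def algebra_simps)
  have same: "(a l \<bullet> (I z - I p) - (b l + lam l ga)) * (a l \<bullet> (I x - I p) - (b l + lam l ga)) > 0"
   if x: "x \<in> Gw" "pat (CS * R) (I x) = pat (CS * R) (I z)" and l: "l \<in> Hs" and ga: "ga \<in> Ga" "norm ga <= r" for x l ga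
  proof -
   have "(lam l z - (b l + lam l (ga + p))) * (lam l x - (b l + lam l (ga + p))) > 0"
    by (rule CS(3)[OF RrS l lat_add[OF ga(1) p(1)] zG x(1) wn[OF ga(2)] x(2)[symmetric]])
   then show ?thesis by (simp add: lam_def inner_diff_right inner_add_right I_add algebra_simps)
  qed
  define et where "et l = (if l \<in> J then \<bar>th\<bar> / \<bar>t l\<bar> else lam l (q l))" for l
  define be where "be l = (if l \<in> J then a l \<bullet> v else b l) + lam l p" for l
  have et: "\<forall>l\<in>f. 0 < et l \<and> et l <= 1"
  proof
   fix l assume l: "l \<in> f"
   show "0 < et l \<and> et l <= 1"
   proof (cases "l \<in> J")
    case True then show ?thesis using T(3)[OF True] thT th(2) T(1) by (simp add: et_def divide_le_eq)
   next
    case False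
    have "fst (CD l) <= r" using r2(5)[OF l] r by linarith
    also have "\<dots> <= r ^ dlt l" using dlt_ge_1[OF flag_Hs[OF f l]] r1 by (simp add: self_le_power)
    finally have "fst (CD l) / r ^ dlt l <= 1" using r1 by (simp add: divide_le_eq)
    then show ?thesis using q(3,4)[OF l] False by (simp add: et_def)
   qed
  qed
  define Box where "Box = {y\<in>Win. \<forall>l\<in>f. \<bar>a l \<bullet> y - be l\<bar> <= et l}"
  have box: "I x \<in> Box" if x: "x \<in> Gw" "pat (CS * R) (I x) = pat (CS * R) (I z)" for x
  proof -
   let ?y = "I x - I p"
   have yI: "?y \<in> range I" using subspace_I by (intro subspace_diff) auto
   have 1: "s * t j * (a j \<bullet> ?y - a j \<bullet> v) < 0" if j: "j \<in> J" for j
   proof -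
    have jf: "j \<in> f" using j fJ by auto
    have "(a j \<bullet> (I z - I p) - a j \<bullet> v) * (a j \<bullet> ?y - a j \<bullet> v) > 0"
     using same[OF x flag_Hs[OF f jf], of "ga j"] g v(2) jf by simp
    moreover have "s * t j * (a j \<bullet> (I z - I p) - a j \<bullet> v) < 0" using zOm j by (simp add: Om_def)
    ultimately show ?thesis by (auto simp: zero_less_mult_iff mult_less_0_iff)
   qed
   have 2: "s * (a h \<bullet> ?y - (b h + lam h ga')) > 0"
   proof -
    have "(a h \<bullet> (I z - I p) - (b h + lam h ga')) * (a h \<bullet> ?y - (b h + lam h ga')) > 0" by (rule same[OF x h g'])
    moreover have "s * (a h \<bullet> (I z - I p) - (b h + lam h ga')) > 0" using zOm by (simp add: Om_def)
    ultimately show ?thesis by (auto simp: zero_less_mult_iff)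
   qed
   have "\<bar>a l \<bullet> I x - be l\<bar> <= et l" if l: "l \<in> f" for l
   proof (cases "l \<in> J")
    case True
    \<comment> \<open>The signed height over \<open>h\<close> is \<open>|th|\<close> plus one
      negative term for each axis in \<open>J\<close>, and it stays positive. Hence every single
      term is at most \<open>|th|\<close> in size.\<close>
    have "s * (a h \<bullet> ?y - (b h + lam h ga')) = \<bar>th\<bar> + (\<Sum>j\<in>J. s * t j * (a j \<bullet> ?y - a j \<bullet> v))"
    proof -
     have "(\<Sum>j\<in>J. s * t j * (a j \<bullet> ?y - a j \<bullet> v)) = s * (a h \<bullet> ?y - a h \<bullet> v)"
      unfolding expand[OF yI] expand[OF v(1)]
      by (simp add: sum_distrib_left sum_subtractf right_diff_distrib mult.assoc)
     moreover have "s * (a h \<bullet> ?y - (b h + lam h ga')) = s * th + s * (a h \<bullet> ?y - a h \<bullet> v)"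
      unfolding th(1) by (simp add: right_diff_distrib)
     ultimately show ?thesis using s(1) by simp
    qed
    also have "(\<Sum>j\<in>J. s * t j * (a j \<bullet> ?y - a j \<bullet> v)) = s * t l * (a l \<bullet> ?y - a l \<bullet> v) + (\<Sum>j\<in>J - {l}. s * t j * (a j \<bullet> ?y - a j \<bullet> v))"
     using fJ True by (simp add: sum.remove)
    also have "(\<Sum>j\<in>J - {l}. s * t j * (a j \<bullet> ?y - a j \<bullet> v)) <= 0" by (rule sum_nonpos) (use 1 less_imp_le in blast)
    finally have "- (s * t l * (a l \<bullet> ?y - a l \<bullet> v)) <= \<bar>th\<bar>" using 2 by linarith
    moreover have "- (s * t l * (a l \<bullet> ?y - a l \<bullet> v)) = \<bar>s * t l * (a l \<bullet> ?y - a l \<bullet> v)\<bar>" using 1[OF True] by simp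
    ultimately have "\<bar>t l\<bar> * \<bar>a l \<bullet> ?y - a l \<bullet> v\<bar> <= \<bar>th\<bar>" using s(2) by (simp add: abs_mult)
    then have "\<bar>a l \<bullet> ?y - a l \<bullet> v\<bar> <= et l" using True by (simp add: et_def J_def pos_le_divide_eq mult.commute)
    then show ?thesis using True by (simp add: be_def lam_def inner_diff_right algebra_simps)
   next
    case False
    have zl: "b l < a l \<bullet> (I z - I p)" "a l \<bullet> (I z - I p) < b l + lam l (q l)" using zOm l False by (auto simp: Om_def)
    have "(a l \<bullet> (I z - I p) - (b l + lam l 0)) * (a l \<bullet> ?y - (b l + lam l 0)) > 0"
     by (rule same[OF x flag_Hs[OF f l] lat_0]) (use r1 in simp)
    then have "b l < a l \<bullet> ?y" using zl by (auto simp: lam_0 zero_less_mult_iff)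
    moreover have "(a l \<bullet> (I z - I p) - (b l + lam l (q l))) * (a l \<bullet> ?y - (b l + lam l (q l))) > 0"
     by (rule same[OF x flag_Hs[OF f l] qG[OF l] q(2)[OF l]])
    then have "a l \<bullet> ?y < b l + lam l (q l)" using zl by (auto simp: zero_less_mult_iff)
    ultimately show ?thesis using False by (simp add: be_def et_def lam_def inner_diff_right)
   qed
   then show ?thesis using x(1) by (simp add: Box_def Gw_def)
  qed
  obtain R1 where R1: "R1 >= 1" "\<And>R'. R' >= R1 ==> cnt R' Box <= CB * (\<Prod>l\<in>f. et l) * R' ^ d"
   using CB(2)[of et Box be] et rh(2) by (auto simp: Box_def)
  obtain vn where vn: "((\<lambda>R'. cnt R' (acc (CS * R) (I z)) / cnt R' Win) \<longlongrightarrow> vn) at_top" "cP / (CS * R) ^ d <= vn"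
   using rP[OF RrP zG] by blast
  have "vn <= CB * (\<Prod>l\<in>f. et l) / cW"
  proof (rule tendsto_upperbound[OF vn(1)])
   show "\<forall>\<^sub>F R' in at_top. cnt R' (acc (CS * R) (I z)) / cnt R' Win <= CB * (\<Prod>l\<in>f. et l) / cW"
    using eventually_ge_at_top[of R1] eventually_ge_at_top[of RW]
   proof eventually_elim
    case (elim R')
    have Rd: "R' ^ d > 0" using elim R1 by simp
    have "pts R' (acc (CS * R) (I z)) \<subseteq> pts R' Box" using box by (auto simp: pts_def acc_def Gw_def)
    moreover have "bounded Box" by (rule bounded_subset[OF Win_bdd]) (auto simp: Box_def)
    ultimately have "cnt R' (acc (CS * R) (I z)) <= cnt R' Box" unfolding cnt_def by (intro of_nat_mono card_mono pts_finite)
    also have "\<dots> <= CB * (\<Prod>l\<in>f. et l) * R' ^ d" by (rule R1(2)[OF elim(1)])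
    finally have up: "cnt R' (acc (CS * R) (I z)) <= CB * (\<Prod>l\<in>f. et l) * R' ^ d" .
    have lo: "cW * R' ^ d <= cnt R' Win" by (rule cW(3)[OF elim(2)])
    have "cnt R' (acc (CS * R) (I z)) / cnt R' Win <= (CB * (\<Prod>l\<in>f. et l) * R' ^ d) / (cW * R' ^ d)"
     using up lo cW(1) Rd cnt_nonneg by (intro frac_le) (auto intro: mult_pos_pos order_trans)
    also have "\<dots> = CB * (\<Prod>l\<in>f. et l) / cW" by (rule mult_divide_mult_cancel_right[OF Rd[THEN less_imp_neq, THEN not_sym]])
    finally show ?case .
   qed
  qed simp
  then have "cP / (CS * R) ^ d <= CB * (\<Prod>l\<in>f. et l) / cW" using vn(2) by linarith
  then have "cP / (CS * (K + 1)) ^ d / r ^ d <= CB * (\<Prod>l\<in>f. et l) / cW" by (simp add: R_def power_mult_distrib mult_ac)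
  moreover have "cW / CB * r ^ d >= 0" using cW(1) CB(1) r1 by simp
  ultimately have "cP / (CS * (K + 1)) ^ d / r ^ d * (cW / CB * r ^ d) <= CB * (\<Prod>l\<in>f. et l) / cW * (cW / CB * r ^ d)"
   by (rule mult_right_mono)
  moreover have "r ~= 0" using r1 by simp
  ultimately have 1: "cP * cW / (CB * (CS * (K + 1)) ^ d) <= (\<Prod>l\<in>f. et l) * r ^ d"
   using cW(1) CB(1) by (simp add: mult_ac)
  have "(\<Prod>l\<in>f. et l) = (\<Prod>l\<in>J. et l) * (\<Prod>l\<in>f - J. et l)" using prod.subset_diff[OF fJ(2) ff, of et] by (simp add: mult.commute)
  moreover have "r ^ d = (\<Prod>l\<in>J. r ^ dlt l) * (\<Prod>l\<in>f - J. r ^ dlt l)"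
   using sum_dlt[OF assms(2) f] prod.subset_diff[OF fJ(2) ff, of "\<lambda>l. r ^ dlt l"] by (simp add: mult.commute flip: power_sum)
  ultimately have "(\<Prod>l\<in>f. et l) * r ^ d = (\<Prod>l\<in>J. et l * r ^ dlt l) * (\<Prod>l\<in>f - J. et l * r ^ dlt l)"
   by (simp add: prod.distrib mult_ac)
  also have "\<dots> <= (\<Prod>l\<in>J. et l * r ^ dlt l) * (\<Prod>l\<in>f - J. fst (CD l))"
  proof (rule mult_left_mono)
   show "(\<Prod>l\<in>f - J. et l * r ^ dlt l) <= (\<Prod>l\<in>f - J. fst (CD l))"
   proof (rule prod_mono)
    fix l assume l: "l \<in> f - J"
    have "et l <= fst (CD l) / r ^ dlt l" using q(4)[of l] l by (simp add: et_def)
    then show "0 <= et l * r ^ dlt l \<and> et l * r ^ dlt l <= fst (CD l)" using et l r1 by (auto simp: pos_le_divide_eq less_imp_le)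
   qed
   show "0 <= (\<Prod>l\<in>J. et l * r ^ dlt l)" by (rule prod_nonneg) (use et fJ r1 in \<open>auto simp: less_imp_le\<close>)
  qed
  also have "(\<Prod>l\<in>J. et l * r ^ dlt l) = (\<Prod>l\<in>J. 1 / \<bar>t l\<bar> * (\<bar>th\<bar> * r ^ dlt h))"
   by (rule prod.cong) (auto simp: et_def dJ)
  also have "\<dots> = (\<Prod>l\<in>J. 1 / \<bar>t l\<bar>) * (\<bar>th\<bar> * r ^ dlt h) ^ card J" by (simp only: prod.distrib prod_constant power_mult_distrib)
  finally have 2: "(\<Prod>l\<in>f. et l) * r ^ d <= (\<Prod>l\<in>J. 1 / \<bar>t l\<bar>) * (\<bar>th\<bar> * r ^ dlt h) ^ card J * (\<Prod>l\<in>f - J. fst (CD l))" .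
  have sm: "\<bar>th\<bar> * r ^ dlt h < c7" using small rd by (simp add: pos_less_divide_eq)
  \<comment> \<open>The base is below 1 and \<open>card J\<close> is at least 1.\<close>
  have "(\<bar>th\<bar> * r ^ dlt h) ^ card J <= (\<bar>th\<bar> * r ^ dlt h) ^ 1"
   using cJ sm rd by (intro power_decreasing) (auto simp: c7_def)
  then have "(\<bar>th\<bar> * r ^ dlt h) ^ card J < c6" using sm by (simp add: c7_def)
  then have "(\<Prod>j\<in>J. 1 / \<bar>t j\<bar>) * (\<bar>th\<bar> * r ^ dlt h) ^ card J * (\<Prod>l\<in>f - J. fst (CD l)) < (\<Prod>j\<in>J. 1 / \<bar>t j\<bar>) * c6 * (\<Prod>l\<in>f - J. fst (CD l))"
   using prodt prodC by (intro mult_strict_right_mono mult_strict_left_mono) auto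
  also have "\<dots> = cP * cW / (CB * (CS * (K + 1)) ^ d)" unfolding c6_def using prodt prodC by simp
  finally show False using 1 2 by linarith
 qed
 have "gap f h (c7 / r2 ^ dlt h)"
  unfolding gap_def
 proof (intro allI impI)
  fix r :: real and ga ga' v assume r: "1 <= r" and g: "\<forall>l\<in>f. ga l \<in> Ga \<and> norm (ga l) <= r" and g': "ga' \<in> Ga" "norm ga' <= r"
   and v: "v \<in> range I" "\<forall>l\<in>f. a l \<bullet> v = b l + lam l (ga l)" and th: "a h \<bullet> v - (b h + lam h ga') ~= 0"
  \<comment> \<open>Radii below \<open>r2\<close> are treated by applying the estimate at
    \<open>max r r2\<close>, which is at most \<open>r * r2\<close>.\<close>
  have mx: "max r r2 <= r * r2" using r r2(1) mult_left_mono[OF r2(1), of r] mult_right_mono[OF r, of r2] by simp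
  have "c7 / r2 ^ dlt h / r ^ dlt h = c7 / (r * r2) ^ dlt h" by (simp add: power_mult_distrib)
  also have "\<dots> <= c7 / (max r r2) ^ dlt h" using mx c7 r r2(1) by (intro divide_left_mono power_mono mult_pos_pos zero_less_power) auto
  also have "\<dots> <= \<bar>a h \<bullet> v - (b h + lam h ga')\<bar>"
   by (rule main[OF _ _ g'(1) _ v refl th]) (use g g'(2) in \<open>auto simp: le_max_iff_disj\<close>)
  finally show "c7 / r2 ^ dlt h / r ^ dlt h <= \<bar>a h \<bullet> v - (b h + lam h ga')\<bar>" .
 qed
 moreover have "c7 / r2 ^ dlt h > 0" using c7 r2(1) by simp
 ultimately show "\<exists>c>0. gap f h c" by blast
qed

end

text \<open>The hypothesis says that no hyperplane of \<open>K\<close> contains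
  \<open>x + V\<close>. Inductively, a step along a direction transversal to the new hyperplane
  escapes it, and only finitely many step lengths hit one of the hyperplanes.\<close>

lemma avoid_hyperplanes:
 fixes V :: "'a::euclidean_space set"
 assumes "finite K" and V: "subspace V" and "\<forall>kp\<in>K. (\<exists>v\<in>V. fst kp \<bullet> v ~= 0) \<or> fst kp \<bullet> x ~= snd kp" and e: "e > 0"
 shows "\<exists>v\<in>V. norm v < e \<and> (\<forall>kp\<in>K. fst kp \<bullet> (x + v) ~= (snd kp :: real))"
 using assms(1,3)
proof (induction K rule: finite_induct)
 case empty then show ?case using V e by (intro bexI[of _ 0]) (auto simp: subspace_0)
next
 case (insert kp K)
 then obtain v where v: "v \<in> V" "norm v < e" "\<forall>kp\<in>K. fst kp \<bullet> (x + v) ~= snd kp" by auto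
 show ?case
 proof (cases "fst kp \<bullet> (x + v) = snd kp")
  case False then show ?thesis using v by blast
 next
  case True
  then obtain u where u: "u \<in> V" "fst kp \<bullet> u ~= 0" using insert.prems v(1) by (force simp: inner_add_right)
  then have nu: "norm u > 0" by auto
  define s where "s = (e - norm v) / norm u"
  have "s > 0" using v(2) nu by (simp add: s_def)
  moreover have "finite ((\<lambda>kp. (snd kp - fst kp \<bullet> (x + v)) / (fst kp \<bullet> u)) ` insert kp K)" using insert.hyps by blast
  ultimately have "infinite ({0<..<s} - (\<lambda>kp. (snd kp - fst kp \<bullet> (x + v)) / (fst kp \<bullet> u)) ` insert kp K)"
   by (intro Diff_infinite_finite) auto
  from infinite_imp_nonempty[OF this]
  obtain t where "t \<in> {0<..<s} - (\<lambda>kp. (snd kp - fst kp \<bullet> (x + v)) / (fst kp \<bullet> u)) ` insert kp K" by blast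
  then have t: "0 < t" "t < s" "t \<notin> (\<lambda>kp. (snd kp - fst kp \<bullet> (x + v)) / (fst kp \<bullet> u)) ` insert kp K" by auto
  have "norm (v + t *\<^sub>R u) <= norm v + t * norm u" using norm_triangle_ineq[of v "t *\<^sub>R u"] t by simp
  also have "\<dots> < e" using t(2) nu by (simp add: s_def field_simps)
  finally have "norm (v + t *\<^sub>R u) < e" .
  moreover have "fst kp' \<bullet> (x + (v + t *\<^sub>R u)) ~= snd kp'" if k: "kp' \<in> insert kp K" for kp'
  proof (cases "fst kp' \<bullet> u = 0")
   case True then show ?thesis using v(3) u(2) k by (auto simp: inner_add_right)
  next
   case False
   have "t ~= (snd kp' - fst kp' \<bullet> (x + v)) / (fst kp' \<bullet> u)" using t(3) k by blast
   then show ?thesis using False by (auto simp: inner_add_right field_simps)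
  qed
  ultimately show ?thesis using v(1) u(1) V by (intro bexI[of _ "v + t *\<^sub>R u"]) (auto intro: subspace_add subspace_scale)
 qed
qed

context cut_window begin

subsection \<open>Diophantine flags imply linear repetitivity\<close>

lemma DS_uniform:
 assumes DS
 shows "\<exists>c>0. \<forall>f h. flag f --> h \<in> Hs --> gap f h c"
proof -
 let ?X = "{f. flag f} \<times> Hs"
 have "\<forall>x\<in>?X. \<exists>c. c > 0 \<and> gap (fst x) (snd x) c" using assms unfolding DS_def by auto
 from bchoice[OF this] obtain c where c: "\<forall>x\<in>?X. c x > 0 \<and> gap (fst x) (snd x) (c x)" by blast
 have "{f. flag f} \<subseteq> Pow Hs" by (auto simp: flag_def)
 then have fin: "finite ?X" using finH by (meson finite_Pow_iff finite_SigmaI finite_subset)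
 have "finite (c ` ?X)" "\<And>y. y \<in> c ` ?X ==> y > 0" using fin c by auto
 from finite_pos_lower[OF this zero_less_one] obtain e where e: "e > 0" "\<forall>y\<in>c ` ?X. e < y" by blast
 have "gap f h e" if "flag f" "h \<in> Hs" for f h
 proof (rule gap_mono)
  have x: "(f, h) \<in> ?X" using that by simp
  then show "e <= c (f, h)" using e(2) by (auto intro: less_imp_le)
  show "gap f h (c (f, h))" using bspec[OF c x] by simp
 qed
 then show ?thesis using e(1) by blast
qed

text \<open>Shifting all walls of the flag by the same \<open>g\<close> moves its vertex to height
  \<open>lam j g\<close> over the unshifted wall \<open>j\<close>. So the heights of lattice vectors
  are badly approximable, the converse bound to \<open>axg_dirichlet\<close>.\<close>

lemma DS_homogeneous:
 assumes DS and f: "flag f" and j: "j \<in> f"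
 shows "\<exists>c>0. \<forall>r\<ge>1. \<forall>g\<in>Ga. norm g <= r --> lam j g ~= 0 --> c / r ^ dlt j <= \<bar>lam j g\<bar>"
proof -
 obtain u where "dual f u" using flag_dual[OF f] by blast
 note u = dualD[OF this]
 obtain c where c: "c > 0" and cb: "gap f j c"
  using assms(1) f flag_Hs[OF f j] unfolding DS_def by blast
 have "c / r ^ dlt j <= \<bar>lam j g\<bar>" if r: "r >= 1" and g: "g \<in> Ga" "norm g <= r" "lam j g ~= 0" for r g
 proof -
  define v where "v = (\<Sum>l\<in>f. (b l + lam l g) *\<^sub>R u l)"
  have vI: "v \<in> range I" unfolding v_def by (intro subspace_sum[OF subspace_I] subspace_scale[OF subspace_I] u)
  have v: "\<forall>l\<in>f. a l \<bullet> v = b l + lam l g"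
  proof
   fix l assume l: "l \<in> f"
   show "a l \<bullet> v = b l + lam l g" unfolding v_def by (rule dual_coord[OF f u(2) l])
  qed
  have "a j \<bullet> v - (b j + lam j 0) = lam j g" using v j by (simp add: lam_0)
  then show ?thesis using gapD[OF cb r, of "\<lambda>_. g" 0 v] r g lat_0 vI v by simp
 qed
 then show ?thesis using c by blast
qed

text \<open>An Ostrowski-type greedy expansion along best approximations at dyadic scales.\<close>

lemma axg_covering:
 assumes RC and DS and f: "flag f" and j: "j \<in> f"
 shows "\<exists>C>0. \<exists>r1\<ge>1. \<forall>r\<ge>r1. \<forall>s. \<bar>s\<bar> <= S -->
  (\<exists>g\<in>axg f j. norm g <= C * r \<and> s - 1 / r ^ dlt j <= lam j g \<and> lam j g <= s)"
proof -
 let ?dt = "dlt j"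
 have dt: "?dt >= 1" by (rule dlt_ge_1[OF flag_Hs[OF f j]])
 obtain C r0 where C: "C > 0" "r0 >= 1" "\<And>r. r >= r0 ==> \<exists>g\<in>axg f j. norm g <= r \<and> 0 < lam j g \<and> lam j g <= C / r ^ ?dt"
  using axg_dirichlet[OF assms(1) f j] by metis
 obtain kp where kp: "kp > 0" "\<And>r g. r >= 1 ==> g \<in> Ga ==> norm g <= r ==> lam j g ~= 0 ==> kp / r ^ ?dt <= \<bar>lam j g\<bar>"
  using DS_homogeneous[OF assms(2) f j] by blast
 have sc: "r0 * 2 ^ m >= r0" "r0 * 2 ^ m >= 1" for m :: nat
 proof -
  have "r0 * 1 <= r0 * 2 ^ m" using C(2) by (intro mult_left_mono) auto
  then show "r0 * 2 ^ m >= r0" "r0 * 2 ^ m >= 1" using C(2) by linarith+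
 qed
 have "\<forall>m. \<exists>g. g \<in> axg f j \<and> norm g <= r0 * 2 ^ m \<and> 0 < lam j g \<and> lam j g <= C / (r0 * 2 ^ m) ^ ?dt"
  using C(3)[OF sc(1)] by blast
 from choice[OF this] obtain q where q: "\<And>m. q m \<in> axg f j" "\<And>m. norm (q m) <= r0 * 2 ^ m" "\<And>m. 0 < lam j (q m)"
  "\<And>m. lam j (q m) <= C / (r0 * 2 ^ m) ^ ?dt" by blast
 have ql: "kp / (r0 * 2 ^ m) ^ ?dt <= lam j (q m)" for m
 proof -
  have "q m \<in> Ga" "lam j (q m) ~= 0" using q(1)[of m] q(3)[of m] axg_sub(2) by auto
  from kp(2)[OF sc(2) this(1) q(2) this(2)] show ?thesis using q(3)[of m] by simp
 qed
 have scp: "(r0 * 2 ^ m) ^ ?dt > 0" for m using less_le_trans[OF zero_less_one sc(2)[of m]] by (rule zero_less_power)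
 \<comment> \<open>The height of \<open>q m\<close> is pinned between \<open>kp\<close> and
   \<open>C\<close> times the same power of its scale, so consecutive heights have bounded ratio;
   this bounds the digits of the expansion.\<close>
 define Q where "Q = C * 2 ^ ?dt / kp"
 have Q: "Q > 0" using C kp by (simp add: Q_def)
 have ratio: "lam j (q m) / lam j (q (Suc m)) <= Q" for m
 proof -
  have "lam j (q m) / lam j (q (Suc m)) <= (C / (r0 * 2 ^ m) ^ ?dt) / (kp / (r0 * 2 ^ Suc m) ^ ?dt)"
   by (rule frac_le[OF less_imp_le[OF divide_pos_pos[OF C(1) scp]] q(4) divide_pos_pos[OF kp(1) scp] ql])
  also have "\<dots> = Q * ((r0 * 2 ^ m) ^ ?dt / (r0 * 2 ^ m) ^ ?dt)" by (simp add: Q_def power_mult_distrib)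
  also have "\<dots> = Q" using sc(2)[of m] by (metis div_self mult.right_neutral not_one_le_zero power_eq_0_iff)
  finally show ?thesis .
 qed
 \<comment> \<open>The first term pays for the initial digit, the second for one digit at the next
   scale; the sum of norms then doubles at most with each scale.\<close>
 define B where "B = max ((\<bar>S\<bar> / lam j (q 0) + 1) * r0) (2 * Q * r0)"
 have B: "B > 0" using Q C(2) by (auto simp: B_def less_max_iff_disj intro!: mult_pos_pos)
 have greedy: "\<exists>g\<in>axg f j. norm g <= B * 2 ^ m \<and> lam j g <= s \<and> s - lam j g <= lam j (q m)" if s: "\<bar>s\<bar> <= S" for s m
 proof (induction m)
  case 0
  let ?z = "\<lfloor>s / lam j (q 0)\<rfloor>"
  let ?g = "real_of_int ?z *\<^sub>R q 0"
  have l0: "lam j (q 0) > 0" by (rule q(3))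
  have z: "real_of_int ?z <= s / lam j (q 0)" "s / lam j (q 0) < real_of_int ?z + 1" by linarith+
  then have 1: "real_of_int ?z * lam j (q 0) <= s" "s < (real_of_int ?z + 1) * lam j (q 0)"
   using floor_divide_lower[OF l0] floor_divide_upper[OF l0] by blast+
  have "\<bar>real_of_int ?z\<bar> <= \<bar>s / lam j (q 0)\<bar> + 1" using z by linarith
  also have "\<bar>s / lam j (q 0)\<bar> <= \<bar>S\<bar> / lam j (q 0)" using s l0 by (simp add: abs_divide divide_right_mono)
  finally have "\<bar>real_of_int ?z\<bar> * norm (q 0) <= (\<bar>S\<bar> / lam j (q 0) + 1) * r0"
   using q(2)[of 0] l0 by (intro mult_mono) auto
  then have "norm ?g <= B * 2 ^ 0" by (simp add: B_def)
  moreover have "?g \<in> axg f j" by (rule zmod.subspace_scale[OF axg_sub(1) q(1)])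
  moreover have "lam j ?g <= s" "s - lam j ?g <= lam j (q 0)" using 1 by (simp_all add: lam_scale algebra_simps)
  ultimately show ?case by blast
 next
  case (Suc m)
  then obtain g where g: "g \<in> axg f j" "norm g <= B * 2 ^ m" "lam j g <= s" "s - lam j g <= lam j (q m)" by blast
  let ?l = "lam j (q (Suc m))"
  let ?z = "\<lfloor>(s - lam j g) / ?l\<rfloor>"
  let ?g = "g + real_of_int ?z *\<^sub>R q (Suc m)"
  have l0: "?l > 0" by (rule q(3))
  have z: "real_of_int ?z <= (s - lam j g) / ?l" "(s - lam j g) / ?l < real_of_int ?z + 1" by linarith+
  then have 1: "real_of_int ?z * ?l <= s - lam j g" "s - lam j g < (real_of_int ?z + 1) * ?l"
   using floor_divide_lower[OF l0] floor_divide_upper[OF l0] by blast+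
  have z0: "?z >= 0" using g(3) l0 by simp
  have "(s - lam j g) / ?l <= lam j (q m) / ?l" using g(4) l0 by (intro divide_right_mono) auto
  then have "real_of_int ?z <= Q" using z(1) ratio[of m] by linarith
  then have "\<bar>real_of_int ?z\<bar> * norm (q (Suc m)) <= Q * (r0 * 2 ^ Suc m)" using q(2)[of "Suc m"] z0 Q by (intro mult_mono) auto
  also have "\<dots> = (2 * Q * r0) * 2 ^ m" by simp
  also have "\<dots> <= B * 2 ^ m" by (intro mult_right_mono) (auto simp: B_def)
  finally have "norm (real_of_int ?z *\<^sub>R q (Suc m)) <= B * 2 ^ m" by simp
  then have "norm ?g <= B * 2 ^ Suc m" using g(2) norm_triangle_ineq[of g "real_of_int ?z *\<^sub>R q (Suc m)"] by simp
  moreover have "?g \<in> axg f j" by (rule zmod.subspace_add[OF axg_sub(1) g(1) zmod.subspace_scale[OF axg_sub(1) q(1)]])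
  moreover have "lam j ?g <= s" "s - lam j ?g <= ?l" using 1 by (simp_all add: lam_add lam_scale algebra_simps)
  ultimately show ?case by blast
 qed
 \<comment> \<open>Absorbs the Dirichlet constant \<open>C\<close> into the scale, which is possible
   because the exponent is at least 1.\<close>
 define E where "E = max 1 C"
 have E: "E >= 1" "E ^ ?dt >= C"
 proof -
  show E1: "E >= 1" by (simp add: E_def)
  have "C <= E" by (simp add: E_def)
  also have "E <= E ^ ?dt" using E1 dt by (simp add: self_le_power)
  finally show "E ^ ?dt >= C" .
 qed
 have "\<exists>g\<in>axg f j. norm g <= (B * (2 * E) / r0) * r \<and> s - 1 / r ^ ?dt <= lam j g \<and> lam j g <= s"
  if r: "r >= r0" and s: "\<bar>s\<bar> <= S" for r s
 proof -
  have r1: "r >= 1" using r C(2) by linarith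
  have "\<exists>m::nat. E * r <= r0 * 2 ^ m"
  proof -
   obtain m where "E * r / r0 < 2 ^ m" using real_arch_pow[of 2 "E * r / r0"] by auto
   then have "E * r <= r0 * 2 ^ m" using C(2) by (simp add: pos_divide_less_eq mult.commute less_imp_le)
   then show ?thesis ..
  qed
  \<comment> \<open>The least suitable scale overshoots \<open>E r\<close> at most by a factor 2,
    which keeps the cost linear in \<open>r\<close>.\<close>
  then obtain m where m: "E * r <= r0 * 2 ^ m" "\<And>m'. E * r <= r0 * 2 ^ m' ==> m <= m'"
   using LeastI_ex[of "\<lambda>m. E * r <= r0 * 2 ^ m"] Least_le[of "\<lambda>m. E * r <= r0 * 2 ^ m"] by blast
  have m2: "r0 * 2 ^ m <= 2 * (E * r)"
  proof (cases m)
   case 0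
   have "1 * r <= E * r" using E r1 by (intro mult_right_mono) auto
   moreover have "r0 * 2 ^ m = r0" using 0 by simp
   ultimately show ?thesis using r r1 by linarith
  next
   case (Suc m')
   then have "\<not> E * r <= r0 * 2 ^ m'" using m(2)[of m'] by auto
   then show ?thesis using Suc by simp
  qed
  obtain g where g: "g \<in> axg f j" "norm g <= B * 2 ^ m" "lam j g <= s" "s - lam j g <= lam j (q m)" using greedy[OF s] by blast
  have "C / (r0 * 2 ^ m) ^ ?dt <= C / (E * r) ^ ?dt"
   using m(1) C(1,2) E r1 by (intro divide_left_mono power_mono mult_pos_pos zero_less_power) auto
  also have "\<dots> <= (E ^ ?dt) / (E * r) ^ ?dt" using E r1 by (intro divide_right_mono) auto
  also have "\<dots> = 1 / r ^ ?dt" using E by (simp add: power_mult_distrib)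
  finally have "s - 1 / r ^ ?dt <= lam j g" using q(4)[of m] g(4) by linarith
  moreover have "norm g <= (B * (2 * E) / r0) * r"
  proof -
   have "B * (r0 * 2 ^ m) <= B * (2 * (E * r))" using m2 B by (intro mult_left_mono) auto
   then have "B * 2 ^ m <= (B * (2 * E) / r0) * r" using C(2) by (simp add: field_simps)
   then show ?thesis using g(2) by linarith
  qed
  ultimately show ?thesis using g by blast
 qed
 moreover have "B * (2 * E) / r0 > 0" using B E C(2) by (intro divide_pos_pos mult_pos_pos) auto
 ultimately show ?thesis using C(2) by blast
qed

section \<open>Cells of the wall arrangement: vertices and inscribed boxes\<close>

lemma flag_subset:
 assumes S: "S \<subseteq> Hs" "\<And>y. y \<in> range I ==> (\<And>l. l \<in> S ==> a l \<bullet> y = 0) ==> y = 0"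
 shows "\<exists>f\<subseteq>S. flag f"
proof -
 obtain B where B: "B \<subseteq> a ` S" "independent B" "a ` S \<subseteq> span B" using maximal_independent_subset by metis
 have aI: "a ` S \<subseteq> range I" using a_I S(1) by auto
 have "range I \<subseteq> span (a ` S)" by (rule span_range_I[OF aI]) (use S(2) in blast)
 also have "\<dots> \<subseteq> span B" using B(3) by (simp add: span_minimal)
 finally have sp: "range I \<subseteq> span B" .
 have "card B = n" by (rule dim_unique[symmetric, OF order_trans[OF B(1) aI] sp B(2) refl])
 have "\<forall>v\<in>B. \<exists>l. l \<in> S \<and> a l = v" using B(1) by blast
 from bchoice[OF this] obtain q where q: "\<And>v. v \<in> B ==> q v \<in> S" "\<And>v. v \<in> B ==> a (q v) = v" by blast
 have "inj_on q B" using q(2) by (metis inj_onI)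
 then have "card (q ` B) = n" using \<open>card B = n\<close> by (simp add: card_image)
 moreover have "y = 0" if y: "y \<in> range I" "\<forall>h\<in>q ` B. a h \<bullet> y = 0" for y
 proof -
  have "orthogonal y v" if "v \<in> B" for v using y(2) q(2)[OF that] that by (auto simp: orthogonal_def inner_commute)
  then have "orthogonal y y" using orthogonal_to_span[of y B] sp y(1) by blast
  then show ?thesis by (simp add: orthogonal_self)
 qed
 ultimately have "flag (q ` B)" unfolding flag_def using q(1) S(1) by auto
 then show ?thesis using q(1) by blast
qed

lemma flag_exists: "\<exists>f. flag f"
 using flag_subset[of Hs] spanning by blast

text \<open>Linear programming: among the maximisers of \<open>fi\<close> in the compact cell one
  with the most active walls is taken. If the active normals did not determine the point, it could
  be moved until another wall becomes active; so they contain a flag.\<close>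

lemma cell_vertex:
 fixes p q :: "'h \<Rightarrow> real"
 defines "Pol \<equiv> {y\<in>range I. \<forall>h\<in>Hs. p h <= a h \<bullet> y \<and> a h \<bullet> y <= q h}"
 assumes ne: "Pol ~= {}"
 shows "\<exists>x\<in>Pol. (\<forall>y\<in>Pol. fi \<bullet> y <= fi \<bullet> x) \<and> (\<exists>f. flag f \<and> (\<forall>l\<in>f. a l \<bullet> x = p l \<or> a l \<bullet> x = q l))"
proof -
 obtain f0 where f0: "flag f0" using flag_exists by blast
 obtain u where "dual f0 u" using flag_dual[OF f0] by blast
 note u = dualD[OF this]
 have bd: "bounded Pol"
 proof (rule boundedI)
  fix y assume y: "y \<in> Pol"
  have "norm y = norm (\<Sum>h\<in>f0. (a h \<bullet> y) *\<^sub>R u h)" using flag_expand[OF f0 u, of y] y by (simp add: Pol_def)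
  also have "\<dots> <= (\<Sum>h\<in>f0. (\<bar>p h\<bar> + \<bar>q h\<bar>) * norm (u h))"
  proof (rule sum_norm_le)
   fix h assume h: "h \<in> f0"
   have "\<bar>a h \<bullet> y\<bar> <= \<bar>p h\<bar> + \<bar>q h\<bar>" using y flag_Hs[OF f0 h] by (fastforce simp: Pol_def)
   then show "norm ((a h \<bullet> y) *\<^sub>R u h) <= (\<bar>p h\<bar> + \<bar>q h\<bar>) * norm (u h)" by (simp add: mult_right_mono)
  qed
  finally show "norm y <= (\<Sum>h\<in>f0. (\<bar>p h\<bar> + \<bar>q h\<bar>) * norm (u h))" .
 qed
 have "Pol = range I \<inter> (\<Inter>h\<in>Hs. {y. p h <= a h \<bullet> y} \<inter> {y. a h \<bullet> y <= q h})" by (auto simp: Pol_def)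
 moreover have "closed \<dots>"
  by (intro closed_Int closed_INT ballI closed_Collect_le continuous_intros closed_subspace[OF subspace_I])
 ultimately have "closed Pol" by simp
 then have cpt: "compact Pol" using bd by (simp add: compact_eq_bounded_closed)
 have cont: "continuous_on Pol (\<lambda>y. fi \<bullet> y)" by (intro continuous_intros)
 obtain x0 where x0: "x0 \<in> Pol" "\<And>y. y \<in> Pol ==> fi \<bullet> y <= fi \<bullet> x0" using continuous_attains_sup[OF cpt ne cont] by blast
 define Act where "Act x = {l\<in>Hs. a l \<bullet> x = p l \<or> a l \<bullet> x = q l}" for x
 let ?F = "\<lambda>x. x \<in> Pol \<and> fi \<bullet> x = fi \<bullet> x0"
 have bdA: "\<forall>x. ?F x --> card (Act x) < Suc (card Hs)"
  using finH by (auto simp: Act_def less_Suc_eq_le intro!: card_mono)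
 obtain x where x: "?F x" "\<And>y. ?F y ==> card (Act y) <= card (Act x)"
  using ex_has_greatest_nat[of ?F x0 "\<lambda>x. card (Act x)" "Suc (card Hs)"] x0(1) bdA by blast
 \<comment> \<open>Moving along \<open>v\<close> keeps the active walls active until a new one becomes active.\<close>
 have move: "\<exists>t>0. x + t *\<^sub>R v \<in> Pol \<and> card (Act x) < card (Act (x + t *\<^sub>R v))"
  if v: "v \<in> range I" "\<And>l. l \<in> Act x ==> a l \<bullet> v = 0" "v ~= 0" for v
 proof -
  define M where "M = {l\<in>Hs. a l \<bullet> v ~= 0}"
  have M: "finite M" "M ~= {}" using finH spanning[OF v(1)] v(3) by (auto simp: M_def)
  \<comment> \<open>The ratio test: the parameter at which the moving point reaches the wall
    \<open>l\<close>.\<close>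
  define ta where "ta l = (if a l \<bullet> v > 0 then (q l - a l \<bullet> x) / (a l \<bullet> v) else (p l - a l \<bullet> x) / (a l \<bullet> v))" for l
  have ta: "ta l > 0" if l: "l \<in> M" for l
  proof -
   have "l \<notin> Act x" using v(2) l by (auto simp: M_def)
   moreover have "p l <= a l \<bullet> x" "a l \<bullet> x <= q l" using x(1) l by (auto simp: Pol_def M_def)
   ultimately have "p l < a l \<bullet> x" "a l \<bullet> x < q l" using l by (auto simp: Act_def M_def)
   then show ?thesis using l by (auto simp: ta_def M_def zero_less_divide_iff)
  qed
  define t where "t = Min (ta ` M)"
  have tM: "t \<in> ta ` M" unfolding t_def using M by (intro Min_in) auto
  then obtain l0 where l0: "l0 \<in> M" "t = ta l0" by auto
  have t0: "t > 0" using ta[OF l0(1)] l0(2) by simp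
  have tle: "t <= ta l" if "l \<in> M" for l unfolding t_def using M that by (intro Min_le) auto
  have inP: "p l <= a l \<bullet> (x + t *\<^sub>R v) \<and> a l \<bullet> (x + t *\<^sub>R v) <= q l" if l: "l \<in> Hs" for l
  proof -
   have pq: "p l <= a l \<bullet> x" "a l \<bullet> x <= q l" using x(1) l by (auto simp: Pol_def)
   consider "a l \<bullet> v = 0" | "a l \<bullet> v > 0" | "a l \<bullet> v < 0" by linarith
   then show ?thesis
   proof cases
    case 1 then show ?thesis using pq by (simp add: inner_add_right)
   next
    case 2
    then have "t <= (q l - a l \<bullet> x) / (a l \<bullet> v)" using tle[of l] l by (simp add: M_def ta_def)
    then have "t * (a l \<bullet> v) <= q l - a l \<bullet> x" using 2 by (simp add: pos_le_divide_eq)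
    moreover have "t * (a l \<bullet> v) >= 0" using t0 2 by simp
    ultimately show ?thesis using pq by (simp add: inner_add_right)
   next
    case 3
    then have "t <= (p l - a l \<bullet> x) / (a l \<bullet> v)" using tle[of l] l by (simp add: M_def ta_def)
    then have "p l - a l \<bullet> x <= t * (a l \<bullet> v)" using 3 by (simp add: neg_le_divide_eq)
    moreover have "t * (a l \<bullet> v) <= 0" using t0 3 by (simp add: mult_le_0_iff)
    ultimately show ?thesis using pq by (simp add: inner_add_right)
   qed
  qed
  have "x + t *\<^sub>R v \<in> range I" using x(1) v(1) subspace_I by (auto simp: Pol_def intro!: subspace_add subspace_scale)
  then have P: "x + t *\<^sub>R v \<in> Pol" using inP by (simp add: Pol_def)
  have "l0 \<in> Act (x + t *\<^sub>R v)"
  proof -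
   have "a l0 \<bullet> v ~= 0" "l0 \<in> Hs" using l0 by (auto simp: M_def)
   then show ?thesis unfolding Act_def l0(2) by (auto simp: ta_def inner_add_right)
  qed
  moreover have "l0 \<notin> Act x" using v(2) l0(1) by (auto simp: M_def)
  moreover have "Act x \<subseteq> Act (x + t *\<^sub>R v)"
  proof
   fix l assume l: "l \<in> Act x"
   then show "l \<in> Act (x + t *\<^sub>R v)" using v(2)[OF l] by (simp add: Act_def inner_add_right)
  qed
  ultimately have "Act x \<subset> Act (x + t *\<^sub>R v)" by blast
  then have "card (Act x) < card (Act (x + t *\<^sub>R v))" using finH by (intro psubset_card_mono) (auto simp: Act_def)
  then show ?thesis using P t0 by blast
 qed
 \<comment> \<open>Moving in both directions stays in the cell for a while, so the objective is
   constant along \<open>v\<close> and the moved point is again a maximiser.\<close>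
 have ker: "v = 0" if v: "v \<in> range I" "\<And>l. l \<in> Act x ==> a l \<bullet> v = 0" for v
 proof (rule ccontr)
  assume nz: "v ~= 0"
  have "- v \<in> range I" using v(1) subspace_I by (simp add: subspace_neg)
  then obtain t' where t': "t' > 0" "x + t' *\<^sub>R (- v) \<in> Pol" using move[of "- v"] v(2) nz by auto
  obtain t where t: "t > 0" "x + t *\<^sub>R v \<in> Pol" "card (Act x) < card (Act (x + t *\<^sub>R v))" using move[OF v nz] by blast
  have "fi \<bullet> (x + t *\<^sub>R v) <= fi \<bullet> x0" "fi \<bullet> (x + t' *\<^sub>R (- v)) <= fi \<bullet> x0" using x0(2) t t' by auto
  then have "t * (fi \<bullet> v) <= 0" "t' * (fi \<bullet> v) >= 0" using x(1) by (auto simp: inner_add_right inner_diff_right)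
  then have "fi \<bullet> v = 0" using t(1) t'(1) by (simp add: mult_le_0_iff zero_le_mult_iff)
  then have "?F (x + t *\<^sub>R v)" using t(2) x(1) by (simp add: inner_add_right)
  then show False using x(2) t(3) by fastforce
 qed
 have "Act x \<subseteq> Hs" by (auto simp: Act_def)
 then obtain f where "f \<subseteq> Act x" "flag f" using flag_subset ker by blast
 then show ?thesis using x(1) x0(2) by (intro bexI[of _ x]) (auto simp: Act_def)
qed

text \<open>For every wall, maximising and minimising its height over the closed cell gives two
  vertices that keep the distance \<open>c / r ^ dlt h\<close> from its lower and upper bound. The
  average of all these vertices keeps a fixed fraction of that distance from every wall at
  once.\<close>

lemma cell_box:
 assumes RC and DS and f: "flag f"
 shows "\<exists>ep>0. \<exists>r0\<ge>1. \<forall>r\<ge>r0. \<forall>z\<in>range I. norm z <= rh -->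
  (\<forall>h\<in>Hs. \<forall>ga\<in>Ga. norm ga <= r --> a h \<bullet> z ~= b h + lam h ga) -->
  (\<exists>x\<in>range I. \<forall>y\<in>range I. (\<forall>j\<in>f. \<bar>a j \<bullet> (y - x)\<bar> <= ep / r ^ dlt j) -->
   (\<forall>h\<in>Hs. \<forall>ga\<in>Ga. norm ga <= r --> (a h \<bullet> y - (b h + lam h ga)) * (a h \<bullet> z - (b h + lam h ga)) > 0))"
proof (cases "Hs = {}")
 case True
 have "0 \<in> range I" by (rule subspace_0[OF subspace_I])
 then show ?thesis using True by (intro exI[of _ "1::real"]) (auto intro!: exI[of _ "1::real"])
next
 case False
 have ff: "finite f" by (rule flag_finite[OF f])
 obtain u where "dual f u" using flag_dual[OF f] by blast
 note u = dualD[OF this]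
 obtain c where c: "c > 0" and cb: "\<And>f h. flag f ==> h \<in> Hs ==> gap f h c"
  using DS_uniform[OF assms(2)] by blast
 define m where "m = real (card Hs)"
 have m: "m >= 1" using False finH by (simp add: m_def Suc_le_eq card_gt_0_iff)
 \<comment> \<open>For large \<open>r\<close> the shifts by \<open>g h\<close> and
   \<open>- g h\<close> put walls on both sides of every admissible \<open>z\<close>, so that the
   cell is bounded by \<open>p\<close> and \<open>q\<close> in all directions.\<close>
 have "\<forall>h\<in>Hs. \<exists>g. g \<in> Ga \<and> \<bar>b h\<bar> + norm (a h) * rh + 1 < lam h g"
 proof
  fix h assume h: "h \<in> Hs"
  obtain f' where f': "flag f'" "h \<in> f'" using flag_extend[OF h] by blast
  obtain C r0 where "\<And>r. r >= r0 ==> \<exists>g\<in>axg f' h. norm g <= r \<and> 0 < lam h g \<and> lam h g <= C / r ^ dlt h"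
   using axg_dirichlet[OF assms(1) f'] by blast
  then obtain g where g: "g \<in> axg f' h" "0 < lam h g" by blast
  obtain M :: nat where M: "\<bar>b h\<bar> + norm (a h) * rh + 1 < real M * lam h g" using reals_Archimedean3[OF g(2)] by blast
  have "real_of_int (int M) *\<^sub>R g \<in> Ga" using g(1) axg_sub(2) by (intro lat_scale) auto
  then show "\<exists>g. g \<in> Ga \<and> \<bar>b h\<bar> + norm (a h) * rh + 1 < lam h g" using M by (intro exI[of _ "real_of_int (int M) *\<^sub>R g"]) (simp add: lam_scale)
 qed
 from bchoice[OF this] obtain g where g: "\<And>h. h \<in> Hs ==> g h \<in> Ga" "\<And>h. h \<in> Hs ==> \<bar>b h\<bar> + norm (a h) * rh + 1 < lam h (g h)" by blast
 define r0 where "r0 = (\<Sum>h\<in>Hs. norm (g h)) + 1"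
 have r0: "r0 >= 1" by (simp add: r0_def sum_nonneg)
 have gr0: "norm (g h) <= r0" if "h \<in> Hs" for h
 proof -
  have "norm (g h) <= (\<Sum>h\<in>Hs. norm (g h))" by (rule member_le_sum[OF that]) (use finH in auto)
  then show ?thesis by (simp add: r0_def)
 qed
 define T where "T = (\<Sum>h\<in>Hs. \<Sum>j\<in>f. \<bar>a h \<bullet> u j\<bar>) + 1"
 have T: "T >= 1" unfolding T_def by (simp add: sum_nonneg)
 have Th: "(\<Sum>j\<in>f. \<bar>a h \<bullet> u j\<bar>) <= T" if "h \<in> Hs" for h
 proof -
  have "(\<Sum>j\<in>f. \<bar>a h \<bullet> u j\<bar>) <= (\<Sum>h\<in>Hs. \<Sum>j\<in>f. \<bar>a h \<bullet> u j\<bar>)" by (rule member_le_sum[OF that]) (use finH in \<open>auto simp: sum_nonneg\<close>)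
  then show ?thesis by (simp add: T_def)
 qed
 \<comment> \<open>\<open>T\<close> bounds the effect of a unit box in dual coordinates on any
   height; the result stays below the \<open>c / (2 m)\<close> which averaging over
   \<open>2 m\<close> vertices preserves.\<close>
 define ep where "ep = c / (4 * m * T)"
 have ep: "ep > 0" using c m T by (simp add: ep_def)
 have epT: "ep * T < c / (2 * m)"
 proof -
  have "ep * T = c / (4 * m)" using T by (simp add: ep_def)
  also have "\<dots> < c / (2 * m)" using c m by (intro divide_strict_left_mono) auto
  finally show ?thesis .
 qed
 have "\<exists>x\<in>range I. \<forall>y\<in>range I. (\<forall>j\<in>f. \<bar>a j \<bullet> (y - x)\<bar> <= ep / r ^ dlt j) -->
   (\<forall>h\<in>Hs. \<forall>ga\<in>Ga. norm ga <= r --> (a h \<bullet> y - (b h + lam h ga)) * (a h \<bullet> z - (b h + lam h ga)) > 0)"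
  if r: "r >= r0" and z: "z \<in> range I" "norm z <= rh" and nz: "\<forall>h\<in>Hs. \<forall>ga\<in>Ga. norm ga <= r --> a h \<bullet> z ~= b h + lam h ga" for r z
 proof -
  have r1: "r >= 1" using r r0 by linarith
  define Q where "Q h = (\<lambda>ga. b h + lam h ga) ` {ga\<in>Ga. norm ga <= r}" for h
  have finQ: "finite (Q h)" for h unfolding Q_def by (intro finite_imageI lattice_finite)
  define p where "p h = Max {v\<in>Q h. v < a h \<bullet> z}" for h
  define q where "q h = Min {v\<in>Q h. v > a h \<bullet> z}" for h
  have az: "\<bar>a h \<bullet> z\<bar> <= norm (a h) * rh" for h
   using Cauchy_Schwarz_ineq2[of "a h" z] mult_left_mono[OF z(2) norm_ge_zero[of "a h"]] by linarith
  have p: "p h \<in> Q h" "p h < a h \<bullet> z" "\<And>v. v \<in> Q h ==> v < a h \<bullet> z ==> v <= p h" if h: "h \<in> Hs" for h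
  proof -
   have "- g h \<in> Ga" using g(1)[OF h] by (rule lat_neg)
   then have "b h + lam h (- g h) \<in> Q h" using gr0[OF h] r by (auto simp: Q_def)
   moreover have "b h + lam h (- g h) < a h \<bullet> z" using g(2)[OF h] az[of h] by (simp add: lam_neg abs_le_iff) linarith
   ultimately have ne: "{v\<in>Q h. v < a h \<bullet> z} ~= {}" by blast
   have "p h \<in> {v\<in>Q h. v < a h \<bullet> z}" unfolding p_def by (rule Max_in) (use finQ ne in auto)
   then show "p h \<in> Q h" "p h < a h \<bullet> z" by auto
   show "\<And>v. v \<in> Q h ==> v < a h \<bullet> z ==> v <= p h" unfolding p_def by (rule Max_ge) (use finQ in auto)
  qed
  have q: "q h \<in> Q h" "q h > a h \<bullet> z" "\<And>v. v \<in> Q h ==> v > a h \<bullet> z ==> q h <= v" if h: "h \<in> Hs" for h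
  proof -
   have "b h + lam h (g h) \<in> Q h" using g(1)[OF h] gr0[OF h] r by (auto simp: Q_def)
   moreover have "b h + lam h (g h) > a h \<bullet> z" using g(2)[OF h] az[of h] by linarith
   ultimately have ne: "{v\<in>Q h. v > a h \<bullet> z} ~= {}" by blast
   have "q h \<in> {v\<in>Q h. v > a h \<bullet> z}" unfolding q_def by (rule Min_in) (use finQ ne in auto)
   then show "q h \<in> Q h" "q h > a h \<bullet> z" by auto
   show "\<And>v. v \<in> Q h ==> v > a h \<bullet> z ==> q h <= v" unfolding q_def by (rule Min_le) (use finQ in auto)
  qed
  let ?Pol = "{y\<in>range I. \<forall>h\<in>Hs. p h <= a h \<bullet> y \<and> a h \<bullet> y <= q h}"
  have zP: "z \<in> ?Pol" using z(1) p(2) q(2) by (auto simp: less_imp_le)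
  then have neP: "?Pol ~= {}" by blast
  have vert: "c / r ^ dlt h <= \<bar>a h \<bullet> x - s\<bar>"
   if h: "h \<in> Hs" and x: "x \<in> range I" and f': "flag f'" "\<forall>l\<in>f'. a l \<bullet> x = p l \<or> a l \<bullet> x = q l"
    and s: "s \<in> Q h" "a h \<bullet> x ~= s" for h x f' s
  proof -
   have "\<forall>l\<in>f'. \<exists>ga. ga \<in> Ga \<and> norm ga <= r \<and> a l \<bullet> x = b l + lam l ga"
    using f' p(1) q(1) flag_Hs[OF f'(1)] by (fastforce simp: Q_def)
   from bchoice[OF this] obtain ga where ga: "\<And>l. l \<in> f' ==> ga l \<in> Ga \<and> norm (ga l) <= r \<and> a l \<bullet> x = b l + lam l (ga l)" by blast
   obtain ga' where ga': "ga' \<in> Ga" "norm ga' <= r" "s = b h + lam h ga'" using s(1) by (auto simp: Q_def)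
   show ?thesis unfolding ga'(3)
    by (rule gapD[OF cb[OF f'(1) h] r1 _ ga'(1,2) x, of ga]) (use ga s(2) ga'(3) in auto)
  qed
  have "\<forall>h\<in>Hs. \<exists>x. x \<in> ?Pol \<and> c / r ^ dlt h <= a h \<bullet> x - p h"
  proof
   fix h assume h: "h \<in> Hs"
   obtain x f' where x: "x \<in> ?Pol" "\<And>y. y \<in> ?Pol ==> a h \<bullet> y <= a h \<bullet> x" "flag f'" "\<forall>l\<in>f'. a l \<bullet> x = p l \<or> a l \<bullet> x = q l"
    using cell_vertex[OF neP, of "a h"] by blast
   have gt: "a h \<bullet> x > p h" using x(2)[OF zP] p(2)[OF h] by linarith
   then have "c / r ^ dlt h <= \<bar>a h \<bullet> x - p h\<bar>" using x(1) by (intro vert[OF h _ x(3,4) p(1)[OF h]]) auto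
   then show "\<exists>x. x \<in> ?Pol \<and> c / r ^ dlt h <= a h \<bullet> x - p h" using x(1) gt by (intro exI[of _ x]) linarith
  qed
  from bchoice[OF this] obtain xp where xp: "\<And>h. h \<in> Hs ==> xp h \<in> ?Pol" "\<And>h. h \<in> Hs ==> c / r ^ dlt h <= a h \<bullet> xp h - p h" by blast
  have "\<forall>h\<in>Hs. \<exists>x. x \<in> ?Pol \<and> c / r ^ dlt h <= q h - a h \<bullet> x"
  proof
   fix h assume h: "h \<in> Hs"
   obtain x f' where x: "x \<in> ?Pol" "\<And>y. y \<in> ?Pol ==> (- a h) \<bullet> y <= (- a h) \<bullet> x" "flag f'" "\<forall>l\<in>f'. a l \<bullet> x = p l \<or> a l \<bullet> x = q l"
    using cell_vertex[OF neP, of "- a h"] by blast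
   have gt: "a h \<bullet> x < q h" using x(2)[OF zP] q(2)[OF h] by simp
   then have "c / r ^ dlt h <= \<bar>a h \<bullet> x - q h\<bar>" using x(1) by (intro vert[OF h _ x(3,4) q(1)[OF h]]) auto
   then show "\<exists>x. x \<in> ?Pol \<and> c / r ^ dlt h <= q h - a h \<bullet> x" using x(1) gt by (intro exI[of _ x]) linarith
  qed
  from bchoice[OF this] obtain xq where xq: "\<And>h. h \<in> Hs ==> xq h \<in> ?Pol" "\<And>h. h \<in> Hs ==> c / r ^ dlt h <= q h - a h \<bullet> xq h" by blast
  \<comment> \<open>Each of the \<open>2 m\<close> vertices has nonnegative slack at every wall, and
    at the wall it was chosen for its slack is large.\<close>
  define x where "x = (1 / (2 * m)) *\<^sub>R (\<Sum>h\<in>Hs. xp h + xq h)"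
  have xI: "x \<in> range I" unfolding x_def
   by (intro subspace_scale[OF subspace_I] subspace_sum[OF subspace_I] subspace_add[OF subspace_I]) (use xp(1) xq(1) in blast)+
  have ax: "a h \<bullet> x = (1 / (2 * m)) * (\<Sum>l\<in>Hs. a h \<bullet> xp l + a h \<bullet> xq l)" for h
   by (simp add: x_def inner_sum_right inner_add_right)
  have slp: "c / (2 * m) / r ^ dlt h <= a h \<bullet> x - p h" and slq: "c / (2 * m) / r ^ dlt h <= q h - a h \<bullet> x" if h: "h \<in> Hs" for h
  proof -
   have ph: "p h = (1 / (2 * m)) * (\<Sum>l\<in>Hs. p h + p h)" and qh: "q h = (1 / (2 * m)) * (\<Sum>l\<in>Hs. q h + q h)"
    using m by (simp_all add: m_def)
   have Pp: "0 <= a h \<bullet> xp l - p h" "0 <= a h \<bullet> xq l - p h" "0 <= q h - a h \<bullet> xp l" "0 <= q h - a h \<bullet> xq l" if "l \<in> Hs" for l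
    using xp(1)[OF that] xq(1)[OF that] h by auto
   have "c / r ^ dlt h <= (a h \<bullet> xp h - p h) + (a h \<bullet> xq h - p h)" using xp(2)[OF h] Pp[OF h] by linarith
   also have "\<dots> <= (\<Sum>l\<in>Hs. (a h \<bullet> xp l - p h) + (a h \<bullet> xq l - p h))"
    by (rule member_le_sum[OF h]) (use finH add_nonneg_nonneg[OF Pp(1,2)] in blast)+
   finally have "(1 / (2 * m)) * (c / r ^ dlt h) <= (1 / (2 * m)) * (\<Sum>l\<in>Hs. (a h \<bullet> xp l - p h) + (a h \<bullet> xq l - p h))"
    using m by (intro mult_left_mono) auto
   also have "\<dots> = a h \<bullet> x - p h" unfolding ax by (subst (2) ph) (simp add: sum.distrib sum_subtractf algebra_simps)
   finally show "c / (2 * m) / r ^ dlt h <= a h \<bullet> x - p h" by simp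
   have "c / r ^ dlt h <= (q h - a h \<bullet> xp h) + (q h - a h \<bullet> xq h)" using xq(2)[OF h] Pp[OF h] by linarith
   also have "\<dots> <= (\<Sum>l\<in>Hs. (q h - a h \<bullet> xp l) + (q h - a h \<bullet> xq l))"
    by (rule member_le_sum[OF h]) (use finH add_nonneg_nonneg[OF Pp(3,4)] in blast)+
   finally have "(1 / (2 * m)) * (c / r ^ dlt h) <= (1 / (2 * m)) * (\<Sum>l\<in>Hs. (q h - a h \<bullet> xp l) + (q h - a h \<bullet> xq l))"
    using m by (intro mult_left_mono) auto
   also have "\<dots> = q h - a h \<bullet> x" unfolding ax by (subst (2) qh) (simp add: sum.distrib sum_subtractf algebra_simps)
   finally show "c / (2 * m) / r ^ dlt h <= q h - a h \<bullet> x" by simp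
  qed
  have "(a h \<bullet> y - (b h + lam h ga)) * (a h \<bullet> z - (b h + lam h ga)) > 0"
   if y: "y \<in> range I" "\<forall>j\<in>f. \<bar>a j \<bullet> (y - x)\<bar> <= ep / r ^ dlt j" and h: "h \<in> Hs" and ga: "ga \<in> Ga" "norm ga <= r" for y h ga
  proof -
   have rd: "r ^ dlt h > 0" using r1 by simp
   have yx: "y - x \<in> range I" using y(1) xI subspace_I by (intro subspace_diff)
   have "a h \<bullet> (y - x) = a h \<bullet> (\<Sum>j\<in>f. (a j \<bullet> (y - x)) *\<^sub>R u j)" using flag_expand[OF f u yx] by simp
   also have "\<dots> = (\<Sum>j\<in>f. (a j \<bullet> (y - x)) * (a h \<bullet> u j))" by (simp add: inner_sum_right)
   finally have "\<bar>a h \<bullet> (y - x)\<bar> <= (\<Sum>j\<in>f. \<bar>(a j \<bullet> (y - x)) * (a h \<bullet> u j)\<bar>)" using sum_abs by metis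
   also have "\<dots> <= (\<Sum>j\<in>f. ep / r ^ dlt h * \<bar>a h \<bullet> u j\<bar>)"
   proof (rule sum_mono)
    fix j assume j: "j \<in> f"
    show "\<bar>(a j \<bullet> (y - x)) * (a h \<bullet> u j)\<bar> <= ep / r ^ dlt h * \<bar>a h \<bullet> u j\<bar>"
    proof (cases "a h \<bullet> u j = 0")
     case True then show ?thesis by simp
    next
     case False
     \<comment> \<open>A side of the box scales with the exponent of its own axis; the exchange
       lemma identifies it with that of \<open>h\<close> whenever the axis affects
       \<open>h\<close>.\<close>
     have "dlt h = dlt j" using cdim_exchange[OF assms(1) f u h j False] by (simp add: dlt_def)
     then have "\<bar>a j \<bullet> (y - x)\<bar> <= ep / r ^ dlt h" using y(2) j by simp
     then show ?thesis unfolding abs_mult by (intro mult_right_mono) auto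
    qed
   qed
   also have "\<dots> = ep / r ^ dlt h * (\<Sum>j\<in>f. \<bar>a h \<bullet> u j\<bar>)" by (rule sum_distrib_left[symmetric])
   also have "\<dots> <= ep / r ^ dlt h * T" using Th[OF h] ep rd by (intro mult_left_mono) auto
   also have "\<dots> = (ep * T) / r ^ dlt h" by simp
   also have "\<dots> < c / (2 * m) / r ^ dlt h" using epT rd by (intro divide_strict_right_mono)
   finally have cl: "\<bar>a h \<bullet> y - a h \<bullet> x\<bar> < c / (2 * m) / r ^ dlt h" by (simp add: inner_diff_right)
   have pq: "p h < a h \<bullet> y" "a h \<bullet> y < q h" using cl slp[OF h] slq[OF h] by linarith+
   have vQ: "b h + lam h ga \<in> Q h" using ga by (auto simp: Q_def)
   have "a h \<bullet> z ~= b h + lam h ga" using nz h ga by blast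
   then consider "b h + lam h ga < a h \<bullet> z" | "b h + lam h ga > a h \<bullet> z" by linarith
   then show ?thesis
   proof cases
    case 1
    then have "b h + lam h ga < a h \<bullet> y" using p(3)[OF h vQ] pq by linarith
    then show ?thesis using 1 by (intro mult_pos_pos) auto
   next
    case 2
    then have "b h + lam h ga > a h \<bullet> y" using q(3)[OF h vQ] pq by linarith
    then show ?thesis using 2 by (intro mult_neg_neg) auto
   qed
  qed
  then show ?thesis using xI by blast
 qed
 then show ?thesis using ep r0 by blast
qed

text \<open>The cell belonging to the patch at \<open>y\<close> contains a box with sides of order
  \<open>1 / r ^ dlt j\<close>. From any \<open>x\<close>, \<open>axg_covering\<close> provides on
  each axis a lattice vector of norm \<open>O(r)\<close> that corrects the coordinate within that
  tolerance; their sum leads from \<open>x\<close> into the box.\<close>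

theorem DS_imp_LR:
 assumes RC and DS
 shows LR
proof -
 obtain f where f: "flag f" using flag_exists by blast
 have ff: "finite f" by (rule flag_finite[OF f])
 obtain rh where rh: "rh > 0" "\<forall>x\<in>Win. norm x <= rh" using Win_bound by blast
 obtain ep r0 where e: "ep > 0" "r0 >= 1" and box: "\<And>r z. r >= r0 ==> z \<in> range I ==> norm z <= rh ==>
  (\<forall>h\<in>Hs. \<forall>ga\<in>Ga. norm ga <= r --> a h \<bullet> z ~= b h + lam h ga) ==>
  (\<exists>x\<in>range I. \<forall>y\<in>range I. (\<forall>j\<in>f. \<bar>a j \<bullet> (y - x)\<bar> <= ep / r ^ dlt j) -->
   (\<forall>h\<in>Hs. \<forall>ga\<in>Ga. norm ga <= r --> (a h \<bullet> y - (b h + lam h ga)) * (a h \<bullet> z - (b h + lam h ga)) > 0))"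
  using cell_box[OF assms f, of rh] by blast
 define Sa where "Sa = (\<Sum>h\<in>f. norm (a h))"
 have aSa: "norm (a l) <= Sa" if "l \<in> f" for l unfolding Sa_def by (rule member_le_sum[OF that]) (use ff in auto)
 have Sa0: "Sa >= 0" by (simp add: Sa_def sum_nonneg)
 define S where "S = Sa * (2 * rh)"
 have "\<forall>j\<in>f. \<exists>Cr. fst Cr > 0 \<and> snd Cr >= 1 \<and> (\<forall>r\<ge>snd Cr. \<forall>s. \<bar>s\<bar> <= S -->
  (\<exists>g\<in>axg f j. norm g <= fst Cr * r \<and> s - 1 / r ^ dlt j <= lam j g \<and> lam j g <= s))"
  using axg_covering[OF assms f, of _ S] by (metis fst_conv snd_conv)
 from bchoice[OF this] obtain CC where CC: "\<And>j. j \<in> f ==> fst (CC j) > 0" "\<And>j. j \<in> f ==> snd (CC j) >= 1"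
  "\<And>j r s. j \<in> f ==> r >= snd (CC j) ==> \<bar>s\<bar> <= S ==> \<exists>g\<in>axg f j. norm g <= fst (CC j) * r \<and> s - 1 / r ^ dlt j <= lam j g \<and> lam j g <= s" by blast
 obtain kp where kp: "kp > 0" "\<And>x. norm x <= kp * N (P x) + norm (I x)" using norm_le_N by metis
 obtain KN where KN: "KN > 0" "\<And>x. N (P x) <= KN * norm x" using N_le by metis
 \<comment> \<open>Converts the physical radius \<open>r\<close> into a norm in the total space for
   all translations that a patch can involve.\<close>
 define Kw where "Kw = kp + 2 * rh + 1"
 have Kw: "Kw >= 1" using kp rh by (simp add: Kw_def)
 \<comment> \<open>Covering has tolerance \<open>1 / r ^ dlt j\<close>, the box tolerance
   \<open>ep\<close> times that at its scale; enlarging the radius by \<open>E\<close> makes up for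
   \<open>ep\<close>.\<close>
 define E where "E = max 1 (1 / ep)"
 have E1: "E >= 1" by (simp add: E_def)
 have Ee: "1 / E ^ dlt j <= ep" if j: "j \<in> f" for j
 proof -
  have "1 / ep <= E" by (simp add: E_def)
  also have "E <= E ^ dlt j" using E1 dlt_ge_1[OF flag_Hs[OF f j]] by (simp add: self_le_power)
  finally show ?thesis using e(1) E1 by (simp add: field_simps)
 qed
 define SC where "SC = (\<Sum>j\<in>f. fst (CC j)) + 1"
 have SC: "SC > 0" unfolding SC_def using CC(1) by (simp add: add_nonneg_pos sum_nonneg less_imp_le)
 define rr where "rr = (\<Sum>j\<in>f. snd (CC j)) + r0 + 1"
 have rrj: "snd (CC j) <= rr" if "j \<in> f" for j
 proof -
  have "snd (CC j) <= (\<Sum>j\<in>f. snd (CC j))" by (rule member_le_sum[OF that]) (use ff CC(2) in \<open>auto intro: order_trans[OF zero_le_one]\<close>)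
  then show ?thesis using e(2) by (simp add: rr_def)
 qed
 have rr0: "r0 <= rr" "1 <= rr"
 proof -
  have "(\<Sum>j\<in>f. snd (CC j)) >= 0" by (rule sum_nonneg) (use CC(2) in \<open>auto intro: order_trans[OF zero_le_one]\<close>)
  then show "r0 <= rr" "1 <= rr" using e(2) by (simp_all add: rr_def)
 qed
 have main: "\<exists>z\<in>Gw. pat r (I z) = pat r (I y) \<and> N (P (z - x)) <= (KN * SC * (E * Kw)) * r"
  if r: "r >= rr" and x: "x \<in> Gw" and y: "y \<in> Gw" for r x y
 proof -
  have r1: "r >= 1" using r rr0 by linarith
  let ?R = "Kw * r"
  have Rr: "r <= ?R" using mult_right_mono[OF Kw, of r] r1 by simp
  let ?F = "pts r (cball 0 (2 * rh))"
  have finF: "finite (?F \<times> L)" using pts_finite[OF bounded_cball] finL by blast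
  have "\<forall>t\<in>?F \<times> L. \<exists>e'. e' > 0 \<and> (\<forall>v\<in>range I. norm (v - I (y + fst t)) < e' --> (v \<in> W (snd t) \<longleftrightarrow> I (y + fst t) \<in> W (snd t)))"
  proof
   fix t assume t: "t \<in> ?F \<times> L"
   then have "y + fst t \<in> Ga" using y by (auto simp: Gw_def pts_def intro: lat_add)
   then show "\<exists>e'. e' > 0 \<and> (\<forall>v\<in>range I. norm (v - I (y + fst t)) < e' --> (v \<in> W (snd t) \<longleftrightarrow> I (y + fst t) \<in> W (snd t)))"
    using nonsing[of "y + fst t" "snd t"] t by auto
  qed
  from bchoice[OF this] obtain ee where ee0: "\<forall>t\<in>?F \<times> L. ee t > 0 \<and> (\<forall>v\<in>range I. norm (v - I (y + fst t)) < ee t --> (v \<in> W (snd t) \<longleftrightarrow> I (y + fst t) \<in> W (snd t)))"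
   by (rule exE)
  note ee = conjunct1[OF bspec[OF ee0]] conjunct2[OF bspec[OF ee0], THEN bspec, THEN mp]
  have "finite (ee ` (?F \<times> L))" "\<And>v. v \<in> ee ` (?F \<times> L) ==> v > 0" using finF ee(1) by auto
  from finite_pos_lower[OF this zero_less_one] obtain e0 where e0: "e0 > 0" "\<forall>v\<in>ee ` (?F \<times> L). e0 < v" by blast
  \<comment> \<open>Nonsingularity keeps \<open>I y\<close> off the boundaries of pieces, but a wall
    extended beyond the boundary may pass through it. A small perturbation \<open>z0\<close> avoids
    all these walls and keeps the patch.\<close>
  define K where "K = (\<lambda>(h, ga). (a h, b h + lam h ga)) ` (Hs \<times> {ga\<in>Ga. norm ga <= ?R})"
  have "finite K" unfolding K_def using finH lattice_finite by blast
  moreover have "\<forall>kp\<in>K. (\<exists>v\<in>range I. fst kp \<bullet> v ~= 0) \<or> fst kp \<bullet> I y ~= snd kp"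
  proof
   fix kp assume "kp \<in> K"
   then have "fst kp \<in> range I" "fst kp \<bullet> fst kp ~= 0" using a_I a_nz by (auto simp: K_def)
   then show "(\<exists>v\<in>range I. fst kp \<bullet> v ~= 0) \<or> fst kp \<bullet> I y ~= snd kp" by blast
  qed
  ultimately obtain v where v: "v \<in> range I" "norm v < e0" "\<forall>kp\<in>K. fst kp \<bullet> (I y + v) ~= snd kp"
   using avoid_hyperplanes[OF _ subspace_I _ e0(1)] by blast
  define z0 where "z0 = I y + v"
  have z0: "z0 \<in> range I" "norm (z0 - I y) < e0" "\<forall>kp\<in>K. fst kp \<bullet> z0 ~= snd kp"
   using v subspace_add[OF subspace_I] by (simp_all add: z0_def)
  have iff0: "z0 + I g \<in> W i \<longleftrightarrow> I y + I g \<in> W i" if g: "g \<in> ?F" "i \<in> L" for g i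
  proof -
   have t: "(g, i) \<in> ?F \<times> L" using g by simp
   have "z0 + I g \<in> range I" using z0(1) subspace_I by (intro subspace_add) auto
   moreover have "norm (z0 + I g - I (y + g)) < ee (g, i)" using z0(2) e0(2) t by (simp add: I_add) (metis image_eqI less_trans)
   ultimately show ?thesis using ee(2)[OF t] by (simp add: I_add)
  qed
  have zF: "0 \<in> ?F" using r1 rh(1) by (simp add: pts_def lat_0 P_0 N_0 I_0)
  obtain i0 where i0: "i0 \<in> L" "I y \<in> W i0" using y by (auto simp: Gw_def Win_def)
  have z0i: "z0 \<in> W i0" using iff0[OF zF i0(1)] i0(2) by (simp add: I_0)
  then have z0W: "z0 \<in> Win" using i0(1) by (auto simp: Win_def)
  have yW: "I y \<in> Win" using y by (simp add: Gw_def)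
  have patF: "(g, i) \<in> pat r v ==> g \<in> ?F \<and> i \<in> L \<and> v + I g \<in> W i" if "v \<in> Win" for v g i
   using pat_range[OF that _ rh(2)] by (auto simp: pts_def)
  have Fpat: "(g, i) \<in> pat r v" if "g \<in> ?F" "i \<in> L" "v + I g \<in> W i" for v g i
   using that by (auto simp: pts_def pat_def)
  have pat_sub: "pat r v \<subseteq> pat r v'"
   if vW: "v \<in> Win" and imp: "\<And>g i. g \<in> ?F ==> i \<in> L ==> v + I g \<in> W i ==> v' + I g \<in> W i" for v v'
  proof
   fix t assume "t \<in> pat r v"
   moreover obtain g i where t: "t = (g, i)" by (cases t)
   ultimately have "g \<in> ?F \<and> i \<in> L \<and> v + I g \<in> W i" using patF[OF vW] by simp
   then show "t \<in> pat r v'" unfolding t using imp[of g i] by (intro Fpat) simp_all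
  qed
  have pat0: "pat r z0 = pat r (I y)"
   by (rule subset_antisym) (use pat_sub[OF z0W] pat_sub[OF yW] iff0 in simp_all)
  have "norm z0 <= rh" using z0W rh(2) by blast
  moreover have "\<forall>h\<in>Hs. \<forall>ga\<in>Ga. norm ga <= ?R --> a h \<bullet> z0 ~= b h + lam h ga" using z0(3) by (force simp: K_def)
  moreover have "?R >= r0" using Rr r rr0 by linarith
  ultimately obtain xb where xb: "xb \<in> range I" "\<And>v h ga. v \<in> range I ==> (\<forall>j\<in>f. \<bar>a j \<bullet> (v - xb)\<bar> <= ep / ?R ^ dlt j) ==> h \<in> Hs ==>
   ga \<in> Ga ==> norm ga <= ?R ==> (a h \<bullet> v - (b h + lam h ga)) * (a h \<bullet> z0 - (b h + lam h ga)) > 0"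
   using box[of ?R z0] z0(1) by blast
  have Fn: "norm (- g) <= ?R" if "g \<in> ?F" for g
  proof -
   have "norm g <= kp * N (P g) + norm (I g)" by (rule kp)
   also have "\<dots> <= kp * r + 2 * rh" using that kp(1) by (intro add_mono mult_left_mono) (auto simp: pts_def)
   also have "2 * rh * 1 <= 2 * rh * r" using r1 rh(1) by (intro mult_left_mono) auto
   then have "kp * r + 2 * rh <= ?R" using r1 by (simp add: Kw_def distrib_right)
   finally show ?thesis by simp
  qed
  have cell: "v \<in> Win \<and> pat r v = pat r (I y)" if v: "v \<in> range I" "\<forall>j\<in>f. \<bar>a j \<bullet> (v - xb)\<bar> <= ep / ?R ^ dlt j" for v
  proof -
   have iff: "v + I g \<in> W i \<longleftrightarrow> z0 + I g \<in> W i" if g: "g \<in> ?F" "i \<in> L" for g i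
   proof (rule ccontr)
    assume "\<not> ?thesis"
    moreover have gG: "g \<in> Ga" using g(1) by (simp add: pts_def)
    ultimately have "\<exists>h\<in>Hs. (a h \<bullet> v - (b h - lam h g)) * (a h \<bullet> z0 - (b h - lam h g)) <= 0"
     using cut_transl[OF g(2) v(1) z0(1) gG] cut_transl[OF g(2) z0(1) v(1) gG] by (auto simp: mult.commute)
    then obtain h where h: "h \<in> Hs" "(a h \<bullet> v - (b h - lam h g)) * (a h \<bullet> z0 - (b h - lam h g)) <= 0" by blast
    have "(a h \<bullet> v - (b h + lam h (- g))) * (a h \<bullet> z0 - (b h + lam h (- g))) > 0"
     by (rule xb(2)[OF v h(1) lat_neg[OF gG] Fn[OF g(1)]])
    then show False using h(2) by (simp add: lam_neg)
   qed
   have "v \<in> W i0" using iff[OF zF i0(1)] z0i by (simp add: I_0)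
   then have vW: "v \<in> Win" using i0(1) by (auto simp: Win_def)
   have "pat r v = pat r z0"
    by (rule subset_antisym) (use pat_sub[OF z0W] pat_sub[OF vW] iff in simp_all)
   then show ?thesis using vW pat0 by simp
  qed
  have "xb \<in> Win" using cell[OF xb(1)] e(1) Kw r1 by simp
  \<comment> \<open>The coordinate that still has to be gained on the axis \<open>j\<close> to get
    from \<open>x\<close> to the centre of the box.\<close>
  define s where "s j = a j \<bullet> xb - lam j x" for j
  have sS: "\<bar>s j\<bar> <= S" if j: "j \<in> f" for j
  proof -
   have "s j = a j \<bullet> (xb - I x)" by (simp add: s_def lam_def inner_diff_right)
   then have "\<bar>s j\<bar> <= norm (a j) * norm (xb - I x)" using Cauchy_Schwarz_ineq2 by metis
   also have "\<dots> <= Sa * (2 * rh)"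
   proof (rule mult_mono[OF aSa[OF j]])
    have "norm xb <= rh" "norm (I x) <= rh" using \<open>xb \<in> Win\<close> x rh(2) by (auto simp: Gw_def)
    then show "norm (xb - I x) <= 2 * rh" using norm_triangle_ineq4[of xb "I x"] by linarith
   qed (use Sa0 in auto)
   finally show ?thesis by (simp add: S_def)
  qed
  let ?R' = "E * Kw * r"
  have R'R: "?R <= ?R'" using mult_right_mono[OF E1, of ?R] Kw r1 by (simp add: mult.assoc)
  have "\<forall>j\<in>f. \<exists>g. g \<in> axg f j \<and> norm g <= fst (CC j) * ?R' \<and> s j - 1 / ?R' ^ dlt j <= lam j g \<and> lam j g <= s j"
  proof
   fix j assume j: "j \<in> f"
   have "snd (CC j) <= ?R'" using rrj[OF j] r Rr R'R by linarith
   then show "\<exists>g. g \<in> axg f j \<and> norm g <= fst (CC j) * ?R' \<and> s j - 1 / ?R' ^ dlt j <= lam j g \<and> lam j g <= s j"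
    using CC(3)[OF j _ sS[OF j]] by blast
  qed
  from bchoice[OF this] obtain g where g: "\<And>j. j \<in> f ==> g j \<in> axg f j" "\<And>j. j \<in> f ==> norm (g j) <= fst (CC j) * ?R'"
   "\<And>j. j \<in> f ==> s j - 1 / ?R' ^ dlt j <= lam j (g j)" "\<And>j. j \<in> f ==> lam j (g j) <= s j" by blast
  define G where "G = (\<Sum>j\<in>f. g j)"
  have GG: "G \<in> Ga" unfolding G_def by (rule lat_sum) (use g(1) axg_sub(2) in blast)
  have lG: "lam l G = lam l (g l)" if l: "l \<in> f" for l
  proof -
   have "lam l G = (\<Sum>j\<in>f. lam l (g j))" by (simp add: G_def lam_sum)
   also have "\<dots> = (\<Sum>j\<in>f. if j = l then lam l (g l) else 0)" by (rule sum.cong) (use g(1) l in \<open>auto simp: axg_def\<close>)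
   finally show ?thesis using l ff by simp
  qed
  define z where "z = x + G"
  have "\<forall>j\<in>f. \<bar>a j \<bullet> (I z - xb)\<bar> <= ep / ?R ^ dlt j"
  proof
   fix j assume j: "j \<in> f"
   have "a j \<bullet> (I z - xb) = lam j (g j) - s j" using lG[OF j] by (simp add: z_def s_def lam_def inner_diff_right inner_add_right I_add)
   then have "\<bar>a j \<bullet> (I z - xb)\<bar> <= 1 / ?R' ^ dlt j" using g(3,4)[OF j] by (simp add: abs_le_iff)
   also have "\<dots> = 1 / E ^ dlt j / ?R ^ dlt j" by (simp add: power_mult_distrib)
   also have "\<dots> <= ep / ?R ^ dlt j" using Ee[OF j] Kw r1 by (intro divide_right_mono) auto
   finally show "\<bar>a j \<bullet> (I z - xb)\<bar> <= ep / ?R ^ dlt j" .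
  qed
  then have zc: "I z \<in> Win" "pat r (I z) = pat r (I y)" using cell[OF rangeI] by blast+
  have "z \<in> Ga" unfolding z_def using x GG by (auto simp: Gw_def intro: lat_add)
  then have "z \<in> Gw" using zc by (simp add: Gw_def)
  moreover have "N (P (z - x)) <= (KN * SC * (E * Kw)) * r"
  proof -
   have "norm G <= (\<Sum>j\<in>f. fst (CC j) * ?R')" unfolding G_def by (rule sum_norm_le) (rule g(2))
   also have "\<dots> = (SC - 1) * ?R'" by (simp add: SC_def sum_distrib_right)
   also have "\<dots> <= SC * ?R'" using E1 Kw r1 by (intro mult_right_mono) auto
   finally have "KN * norm G <= KN * (SC * ?R')" using KN(1) by (intro mult_left_mono) auto
   moreover have "N (P (z - x)) <= KN * norm G" using KN(2)[of G] by (simp add: z_def)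
   ultimately show ?thesis by (simp add: mult.assoc)
  qed
  ultimately show ?thesis using zc(2) by blast
 qed
 have "KN * SC * (E * Kw) > 0" using KN SC E1 Kw by (intro mult_pos_pos) auto
 then show ?thesis unfolding LR_def eventually_at_top_linorder using main by blast
qed

theorem LR_iff_PW: "LR \<longleftrightarrow> PW"
 using LR_imp_PW PW_imp_RC PW_imp_DS DS_imp_LR by blast

end

section \<open>The scheme of a window\<close>

lemma proj_eqI:
 assumes "subspace A" "subspace B" "A \<inter> B = {0}" "u \<in> A" "x - u \<in> B"
 shows "proj A B x = u"
 unfolding proj_def
proof (rule the_equality)
 fix v assume v: "v \<in> A \<and> x - v \<in> B"
 have "v - u \<in> A" "(x - u) - (x - v) \<in> B" using v assms(4,5) subspace_diff[OF assms(1)] subspace_diff[OF assms(2)] by blast+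
 then have "v - u \<in> A \<inter> B" by simp
 then show "v = u" using assms(3) by simp
qed (use assms in simp)

lemma proj_mem:
 assumes "subspace A" "subspace B" "A \<inter> B = {0}" "x \<in> A + B"
 shows "proj A B x \<in> A" "x - proj A B x \<in> B"
proof -
 obtain u v where "u \<in> A" "v \<in> B" "x = u + v" using assms(4) by (rule set_plus_elim)
 then show "proj A B x \<in> A" "x - proj A B x \<in> B" using proj_eqI[OF assms(1-3), of u x] by auto
qed

lemma supporting_data:
 assumes "properly_supporting E W H"
 shows "\<exists>a b w e. a \<in> E \<and> a ~= 0 \<and> H = {x \<in> E. a \<bullet> x = b} \<and> w \<in> E \<and> a \<bullet> w = b \<and> e > 0 \<and>
  (\<forall>y\<in>E. norm (y - w) < e --> (y \<in> W \<longleftrightarrow> a \<bullet> y <= b))"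
proof -
 obtain a b w U where ab: "a \<in> E" "a ~= 0" "H = {x \<in> E. a \<bullet> x = b}" and w: "w \<in> H"
  and U: "openin (top_of_set E) U" "w \<in> U" "W \<inter> U = {x \<in> E. a \<bullet> x <= b} \<inter> U"
  using assms[unfolded properly_supporting_def] by (elim exE conjE bexE) (rule that)
 obtain e where e: "e > 0" "ball w e \<inter> E \<subseteq> U" using U(1,2) by (metis openin_contains_ball)
 have "y \<in> W \<longleftrightarrow> a \<bullet> y <= b" if "y \<in> E" "norm (y - w) < e" for y
 proof -
  have "y \<in> U" using e(2) that by (auto simp: dist_norm norm_minus_commute)
  then show ?thesis using U(3) that(1) by blast
 qed
 then show ?thesis using w ab e(1) by (intro exI[of _ a] exI[of _ b] exI[of _ w] exI[of _ e]) simp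
qed

text \<open>A segment from a point of \<open>W\<close> to a point outside is connected, so it meets
  the frontier.\<close>

lemma polytopal_crossing:
 assumes E: "subspace E" and W: "polytopal E W" "y \<in> W" and y': "y' \<in> E" "y' \<notin> W"
 obtains H x where "properly_supporting E W H" "x \<in> closed_segment y y'" "x \<in> H"
proof -
 obtain HH where HH: "\<forall>H\<in>HH. properly_supporting E W H" "top_of_set E frontier_of W \<subseteq> \<Union>HH" "W \<subseteq> E"
  using W(1) unfolding polytopal_def by metis
 have "closed_segment y y' \<subseteq> E"
  using E W(2) HH(3) y'(1) by (intro closed_segment_subset subspace_imp_convex) auto
 then have "connectedin (top_of_set E) (closed_segment y y')" by (simp add: connectedin_subtopology)
 from connectedin_Int_frontier_of[OF this] have "closed_segment y y' \<inter> top_of_set E frontier_of W ~= {}"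
  using W(2) y'(2) by blast
 then show ?thesis using HH that by blast
qed

text \<open>A properly supporting hyperplane outside the given finite family would contain, near its
  supporting point, a point of \<open>W\<close> on none of the members. That point would be interior
  to \<open>W\<close>, although crossing the hyperplane there leaves \<open>W\<close>.\<close>

lemma finite_supporting:
 assumes E: "subspace E" and W: "polytopal E W"
 shows "finite {H. properly_supporting E W H}"
proof -
 obtain HH where HH: "finite HH" "\<forall>H\<in>HH. properly_supporting E W H" "top_of_set E frontier_of W \<subseteq> \<Union>HH"
  using W unfolding polytopal_def by metis
 have clW: "W \<subseteq> E" "closed W" using W by (auto simp: polytopal_def compact_imp_closed)
 have "\<forall>H\<in>HH. \<exists>ab. fst ab \<in> E \<and> fst ab ~= 0 \<and> H = {x \<in> E. fst ab \<bullet> x = snd ab}"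
 proof
  fix H assume "H \<in> HH"
  then obtain a b where "a \<in> E" "a ~= 0" "H = {x \<in> E. a \<bullet> x = b}" using supporting_data[of E W H] HH(2) by blast
  then show "\<exists>ab. fst ab \<in> E \<and> fst ab ~= 0 \<and> H = {x \<in> E. fst ab \<bullet> x = snd ab}" by (intro exI[of _ "(a, b)"]) simp
 qed
 from bchoice[OF this] obtain ab where ab: "\<forall>H\<in>HH. fst (ab H) \<in> E \<and> fst (ab H) ~= 0 \<and> H = {x \<in> E. fst (ab H) \<bullet> x = snd (ab H)}" by (rule exE)
 have "H \<in> HH" if H: "properly_supporting E W H" for H
 proof (rule ccontr)
  assume nH: "H \<notin> HH"
  obtain a b w e where a: "a \<in> E" "a ~= 0" "H = {x \<in> E. a \<bullet> x = b}" and w: "w \<in> E" "a \<bullet> w = b" "e > 0"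
   and loc: "\<forall>y\<in>E. norm (y - w) < e --> (y \<in> W \<longleftrightarrow> a \<bullet> y <= b)" using supporting_data[OF H] by blast
  define V where "V = {x \<in> E. a \<bullet> x = 0}"
  have V: "subspace V" unfolding V_def
   using E by (auto simp: subspace_def inner_add_right)
  have aa: "a \<bullet> a > 0" using a(2) by simp
  \<comment> \<open>A member of the family that contains \<open>w + V\<close> has a normal
    proportional to \<open>a\<close> and passes through \<open>w\<close>, hence equals
    \<open>H\<close>.\<close>
  have "(\<exists>v\<in>V. fst kp \<bullet> v ~= 0) \<or> fst kp \<bullet> w ~= snd kp" if k: "kp \<in> ab ` HH" for kp
  proof (rule ccontr)
   assume "\<not> ?thesis"
   then have c: "\<And>v. v \<in> V ==> fst kp \<bullet> v = 0" "fst kp \<bullet> w = snd kp" by auto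
   obtain H' where H': "H' \<in> HH" "kp = ab H'" using k by blast
   have k1: "fst kp \<in> E" "fst kp ~= 0" "H' = {x \<in> E. fst kp \<bullet> x = snd kp}" using ab H' by auto
   define t where "t = (fst kp \<bullet> a) / (a \<bullet> a)"
   define z where "z = fst kp - t *\<^sub>R a"
   have az: "a \<bullet> z = 0" using aa by (simp add: z_def t_def inner_diff_right inner_commute)
   then have "z \<in> V" using k1 a(1) E by (auto simp: V_def z_def intro: subspace_diff subspace_scale)
   then have "fst kp \<bullet> z = 0" by (rule c)
   moreover have "z \<bullet> z = fst kp \<bullet> z - t * (a \<bullet> z)" by (subst (1) z_def) (simp add: inner_diff_left)
   ultimately have "z = 0" using az by simp
   then have k2: "fst kp = t *\<^sub>R a" by (simp add: z_def)
   then have "t ~= 0" "snd kp = t * b" using k1(2) c(2) w(2) by auto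
   then have "H' = H" unfolding k1(3) a(3) k2 by simp
   then show False using H'(1) nH by simp
  qed
  then obtain v where v: "v \<in> V" "norm v < e" "\<forall>kp\<in>ab ` HH. fst kp \<bullet> (w + v) ~= snd kp"
   using avoid_hyperplanes[OF finite_imageI[OF HH(1)] V _ w(3)] by blast
  define y where "y = w + v"
  have y: "y \<in> E" "norm (y - w) < e" "a \<bullet> y = b"
   using v w E by (auto simp: y_def V_def inner_add_right intro: subspace_add)
  have "y \<notin> \<Union>HH" using v(3) ab by (auto simp: y_def)
  moreover have "y \<in> W" using loc y by simp
  then have "y \<in> top_of_set E closure_of W" using closure_of_subset[of W "top_of_set E"] clW(1) by auto
  ultimately have "y \<in> top_of_set E interior_of W" using HH(3) by (auto simp: frontier_of_def)
  then obtain T where T: "openin (top_of_set E) T" "y \<in> T" "T \<subseteq> W" unfolding interior_of_def by blast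
  then obtain e' where e': "e' > 0" "ball y e' \<inter> E \<subseteq> T" by (metis openin_contains_ball)
  define s where "s = min e' (e - norm (y - w)) / (2 * norm a)"
  have s: "s > 0" using e' y(2) a(2) by (simp add: s_def)
  have ns: "s * norm a < e'" "s * norm a < e - norm (y - w)" using e' y(2) a(2) by (auto simp: s_def min_def)
  have 1: "y + s *\<^sub>R a \<in> E" using y(1) a(1) E by (intro subspace_add subspace_scale)
  have "y + s *\<^sub>R a \<in> ball y e'" using ns s by (simp add: dist_norm)
  then have "y + s *\<^sub>R a \<in> W" using e' T(3) 1 by blast
  moreover have "norm (y + s *\<^sub>R a - w) <= norm (y - w) + s * norm a"
   using norm_triangle_ineq[of "y - w" "s *\<^sub>R a"] s by (simp add: algebra_simps)
  then have "norm (y + s *\<^sub>R a - w) < e" using ns by linarith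
  ultimately have "a \<bullet> (y + s *\<^sub>R a) <= b" using bspec[OF loc 1] by simp
  then show False using y(3) mult_pos_pos[OF s aa] by (simp add: inner_add_right)
 qed
 then have "{H. properly_supporting E W H} \<subseteq> HH" by blast
 then show ?thesis using HH(1) finite_subset by blast
qed

section \<open>The scheme as an instance of the abstract window\<close>

context
 fixes S :: "('e::euclidean_space, 'l) cp_scheme"
 assumes S: "polytopal_scheme S"
begin

lemma scheme_spaces:
 shows "subspace (physical S)" "subspace (internal S)" "physical S \<inter> internal S = {0}" "physical S + internal S = UNIV"
 using S by (simp_all add: polytopal_scheme_def)

lemma to_phys_eqI: "u \<in> physical S ==> x - u \<in> internal S ==> to_phys S x = u"
 unfolding to_phys_def by (rule proj_eqI[OF scheme_spaces(1-3)])

lemma to_int_eqI: "u \<in> internal S ==> x - u \<in> physical S ==> to_int S x = u"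
 unfolding to_int_def using scheme_spaces by (intro proj_eqI) (simp_all add: Int_commute)

lemma to_phys_mem: "to_phys S x \<in> physical S" "x - to_phys S x \<in> internal S"
 unfolding to_phys_def using proj_mem[OF scheme_spaces(1-3), of x] scheme_spaces(4) by simp_all

lemma to_int_eq: "to_int S x = x - to_phys S x"
 by (rule to_int_eqI) (simp_all add: to_phys_mem)

lemma linear_to_phys: "linear (to_phys S)"
proof (rule linearI)
 fix x y :: 'e and c :: real
 show "to_phys S (x + y) = to_phys S x + to_phys S y"
 proof (rule to_phys_eqI)
  have "x + y - (to_phys S x + to_phys S y) = (x - to_phys S x) + (y - to_phys S y)" by simp
  then show "x + y - (to_phys S x + to_phys S y) \<in> internal S"
   by (simp only:) (intro subspace_add scheme_spaces to_phys_mem)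
 qed (intro subspace_add scheme_spaces to_phys_mem)
 show "to_phys S (c *\<^sub>R x) = c *\<^sub>R to_phys S x"
 proof (rule to_phys_eqI)
  show "c *\<^sub>R x - c *\<^sub>R to_phys S x \<in> internal S"
   unfolding scaleR_diff_right[symmetric] by (intro subspace_scale scheme_spaces to_phys_mem)
 qed (intro subspace_scale scheme_spaces to_phys_mem)
qed

lemma linear_to_int: "linear (to_int S)"
proof -
 have "to_int S = (\<lambda>x. x - to_phys S x)" using to_int_eq by blast
 then show ?thesis by (simp add: linear_compose_sub[OF linear_ident linear_to_phys])
qed

lemma to_phys_idem: "x \<in> physical S ==> to_phys S x = x"
 by (rule to_phys_eqI) (simp_all add: subspace_0[OF scheme_spaces(2)])

lemma to_int_idem: "x \<in> internal S ==> to_int S x = x"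
 by (rule to_int_eqI) (simp_all add: subspace_0[OF scheme_spaces(1)])

lemma to_int_mem: "to_int S x \<in> internal S"
 unfolding to_int_eq by (rule to_phys_mem)

lemma range_to_phys: "range (to_phys S) = physical S"
 using to_phys_mem(1) to_phys_idem by (metis image_subsetI rangeI subsetI subset_antisym)

lemma range_to_int: "range (to_int S) = internal S"
 using to_int_mem to_int_idem by (metis image_subsetI rangeI subsetI subset_antisym)

lemma piece_polytopal: "i \<in> labels S ==> polytopal (internal S) (piece S i)"
 using S unfolding polytopal_scheme_def by (elim conjE) blast

lemma finite_hyperplanes: "finite (hyperplanes S)"
proof -
 have "finite (labels S)" using S unfolding polytopal_scheme_def by (elim conjE)
 then show ?thesis unfolding hyperplanes_def
  using finite_supporting[OF scheme_spaces(2) piece_polytopal] by blast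
qed

lemma hyperplane_data:
 "\<exists>a b w. \<forall>H\<in>hyperplanes S. a H \<in> internal S \<and> a H ~= 0 \<and> H = {x \<in> internal S. a H \<bullet> x = b H} \<and>
  w H \<in> internal S \<and> a H \<bullet> w H = b H \<and>
  (\<exists>i\<in>labels S. \<exists>e>0. \<forall>y\<in>internal S. norm (y - w H) < e --> (y \<in> piece S i \<longleftrightarrow> a H \<bullet> y <= b H))"
proof -
 have "\<forall>H\<in>hyperplanes S. \<exists>t. fst t \<in> internal S \<and> fst t ~= 0 \<and> H = {x \<in> internal S. fst t \<bullet> x = fst (snd t)} \<and>
  snd (snd t) \<in> internal S \<and> fst t \<bullet> snd (snd t) = fst (snd t) \<and>
  (\<exists>i\<in>labels S. \<exists>e>0. \<forall>y\<in>internal S. norm (y - snd (snd t)) < e --> (y \<in> piece S i \<longleftrightarrow> fst t \<bullet> y <= fst (snd t)))"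
 proof
  fix H assume "H \<in> hyperplanes S"
  then obtain i where i: "i \<in> labels S" "properly_supporting (internal S) (piece S i) H" unfolding hyperplanes_def by blast
  obtain a b w e where "a \<in> internal S" "a ~= 0" "H = {x \<in> internal S. a \<bullet> x = b}" "w \<in> internal S" "a \<bullet> w = b" "e > 0"
   "\<forall>y\<in>internal S. norm (y - w) < e --> (y \<in> piece S i \<longleftrightarrow> a \<bullet> y <= b)" using supporting_data[OF i(2)] by blast
  then show "\<exists>t. fst t \<in> internal S \<and> fst t ~= 0 \<and> H = {x \<in> internal S. fst t \<bullet> x = fst (snd t)} \<and>
  snd (snd t) \<in> internal S \<and> fst t \<bullet> snd (snd t) = fst (snd t) \<and>
  (\<exists>i\<in>labels S. \<exists>e>0. \<forall>y\<in>internal S. norm (y - snd (snd t)) < e --> (y \<in> piece S i \<longleftrightarrow> fst t \<bullet> y <= fst (snd t)))"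
   using i(1) by (intro exI[of _ "(a, b, w)"]) auto
 qed
 from bchoice[OF this] show ?thesis by (elim exE) (intro exI, assumption)
qed

lemma piece_cut:
 assumes i: "i \<in> labels S" and y: "y \<in> piece S i" "y' \<in> internal S" "y' \<notin> piece S i"
  and ab: "\<forall>H\<in>hyperplanes S. H = {x \<in> internal S. a H \<bullet> x = b H}"
 shows "\<exists>H\<in>hyperplanes S. (a H \<bullet> y - b H) * (a H \<bullet> y' - b H) <= (0::real)"
proof -
 obtain H x where H: "properly_supporting (internal S) (piece S i) H" "x \<in> closed_segment y y'" "x \<in> H"
  by (rule polytopal_crossing[OF scheme_spaces(2) piece_polytopal[OF i] y])
 have HS: "H \<in> hyperplanes S" using H(1) i by (auto simp: hyperplanes_def)
 then have ax: "a H \<bullet> x = b H" using ab H(3) by blast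
 obtain t where t: "0 <= t" "t <= 1" "x = (1 - t) *\<^sub>R y + t *\<^sub>R y'" using H(2) by (auto simp: closed_segment_def)
 let ?p = "a H \<bullet> y - b H" and ?q = "a H \<bullet> y' - b H"
 \<comment> \<open>A convex combination of the two values vanishes where the segment crosses
   \<open>H\<close>, so they cannot have the same strict sign.\<close>
 have e: "(1 - t) * ?p + t * ?q = 0" using ax unfolding t(3) inner_add_right inner_scaleR_right by (simp add: algebra_simps)
 have "?p * ?q <= 0"
 proof (rule ccontr)
  assume "\<not> ?p * ?q <= 0"
  then have pq: "?p * ?q > 0" by simp
  have "?p * ((1 - t) * ?p + t * ?q) = (1 - t) * (?p * ?p) + t * (?p * ?q)" by (simp add: algebra_simps)
  then have s: "(1 - t) * (?p * ?p) + t * (?p * ?q) = 0" using e by simp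
  have "(1 - t) * (?p * ?p) >= 0" "t * (?p * ?q) >= 0" using t(1,2) pq by simp_all
  then have "t * (?p * ?q) = 0" "(1 - t) * (?p * ?p) = 0" using s by linarith+
  then show False using pq by auto
 qed
 then show ?thesis using HS by blast
qed

lemma piece_closed: "i \<in> labels S ==> piece S i \<subseteq> internal S" "i \<in> labels S ==> closed (piece S i)"
 "i \<in> labels S ==> bounded (piece S i)"
 using piece_polytopal by (auto simp: polytopal_def compact_imp_closed compact_imp_bounded)

lemma piece_nonsingular:
 assumes i: "i \<in> labels S" and g: "ga \<in> lattice S"
 shows "\<exists>e>0. \<forall>y\<in>internal S. norm (y - to_int S ga) < e --> (y \<in> piece S i \<longleftrightarrow> to_int S ga \<in> piece S i)"
proof (cases "to_int S ga \<in> piece S i")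
 case True
 have "to_int S ga \<notin> top_of_set (internal S) frontier_of piece S i"
  using S i g by (simp add: polytopal_scheme_def)
 moreover have "to_int S ga \<in> top_of_set (internal S) closure_of piece S i"
  using closure_of_subset[of "piece S i" "top_of_set (internal S)"] True piece_closed(1)[OF i] by auto
 ultimately obtain T where T: "openin (top_of_set (internal S)) T" "to_int S ga \<in> T" "T \<subseteq> piece S i"
  unfolding frontier_of_def interior_of_def by blast
 then obtain e where e: "e > 0" "ball (to_int S ga) e \<inter> internal S \<subseteq> T" by (metis openin_contains_ball)
 have "y \<in> piece S i" if "y \<in> internal S" "norm (y - to_int S ga) < e" for y
 proof -
  have "y \<in> ball (to_int S ga) e" using that(2) by (simp add: dist_norm norm_minus_commute)
  then show ?thesis using e(2) T(3) that(1) by blast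
 qed
 then show ?thesis using e(1) True by blast
next
 case False
 then obtain e where e: "e > 0" "\<forall>y\<in>piece S i. \<not> dist y (to_int S ga) < e"
  using piece_closed(2)[OF i] closed_approachable by metis
 then show ?thesis using False by (intro exI[of _ e]) (auto simp: dist_norm)
qed

lemma piece_regular:
 assumes i: "i \<in> labels S" and z: "z \<in> piece S i" and e: "e > 0"
 shows "\<exists>c\<in>internal S. norm (c - z) < e \<and> (\<exists>r>0. \<forall>y\<in>internal S. norm (y - c) < r --> y \<in> piece S i)"
proof -
 have "piece S i = closure (top_of_set (internal S) interior_of piece S i)"
  using piece_polytopal[OF i] unfolding polytopal_def by (elim conjE)
 then have "z \<in> closure (top_of_set (internal S) interior_of piece S i)" using z by blast
 then obtain c where c: "c \<in> top_of_set (internal S) interior_of piece S i" "dist c z < e"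
  using e by (auto simp: closure_approachable)
 then obtain T where T: "openin (top_of_set (internal S)) T" "c \<in> T" "T \<subseteq> piece S i"
  unfolding interior_of_def by blast
 then obtain r where r: "r > 0" "ball c r \<inter> internal S \<subseteq> T" by (metis openin_contains_ball)
 have "y \<in> piece S i" if "y \<in> internal S" "norm (y - c) < r" for y
 proof -
  have "y \<in> ball c r" using that(2) by (simp add: dist_norm norm_minus_commute)
  then show ?thesis using r(2) T(3) that(1) by blast
 qed
 moreover have "c \<in> internal S" using T(2,3) piece_closed(1)[OF i] by blast
 ultimately show ?thesis using r(1) c(2) by (auto simp: dist_norm)
qed

text \<open>Starting from a point of a piece that lies on no wall, moving along \<open>y\<close>
  changes no height. So no wall is met, although the bounded piece is eventually left.\<close>

lemma normals_spanning:
 assumes ab: "\<forall>H\<in>hyperplanes S. a H \<in> internal S \<and> a H ~= 0 \<and> H = {x \<in> internal S. a H \<bullet> x = b H}"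
  and y: "y \<in> internal S" "\<And>H. H \<in> hyperplanes S ==> a H \<bullet> y = 0"
 shows "y = 0"
proof (rule ccontr)
 assume y0: "y ~= 0"
 have "window S ~= {}" using S unfolding polytopal_scheme_def by (elim conjE)
 then obtain i z where i: "i \<in> labels S" "z \<in> piece S i" unfolding window_def by blast
 from piece_regular[OF this zero_less_one] obtain c r where c: "c \<in> internal S" and r: "r > 0"
  "\<And>y. y \<in> internal S ==> norm (y - c) < r ==> y \<in> piece S i" by blast
 have "\<forall>kp\<in>(\<lambda>H. (a H, b H)) ` hyperplanes S. (\<exists>v\<in>internal S. fst kp \<bullet> v ~= 0) \<or> fst kp \<bullet> c ~= snd kp"
 proof
  fix kp assume "kp \<in> (\<lambda>H. (a H, b H)) ` hyperplanes S"
  then obtain H where "H \<in> hyperplanes S" "kp = (a H, b H)" by blast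
  then have "fst kp \<in> internal S" "fst kp \<bullet> fst kp ~= 0" using ab by auto
  then show "(\<exists>v\<in>internal S. fst kp \<bullet> v ~= 0) \<or> fst kp \<bullet> c ~= snd kp" by blast
 qed
 from avoid_hyperplanes[OF finite_imageI[OF finite_hyperplanes] scheme_spaces(2) this r(1)]
 obtain v where v: "v \<in> internal S" "norm v < r" "\<forall>H\<in>hyperplanes S. a H \<bullet> (c + v) ~= b H" by auto
 have x: "c + v \<in> piece S i" using r(2)[of "c + v"] v c subspace_add[OF scheme_spaces(2)] by simp
 obtain B where B: "\<And>x. x \<in> piece S i ==> norm x <= B" using piece_closed(3)[OF i(1)] bounded_iff by metis
 define t where "t = (\<bar>B\<bar> + norm (c + v) + 1) / norm y"
 have "t * norm y = \<bar>B\<bar> + norm (c + v) + 1" using y0 by (simp add: t_def)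
 moreover have "t >= 0" by (simp add: t_def)
 ultimately have "norm (t *\<^sub>R y) = \<bar>B\<bar> + norm (c + v) + 1" by simp
 then have "norm (c + v + t *\<^sub>R y) > B" using norm_triangle_ineq4[of "c + v + t *\<^sub>R y" "c + v"] by simp
 then have "c + v + t *\<^sub>R y \<notin> piece S i" using B by force
 moreover have "c + v + t *\<^sub>R y \<in> internal S"
  using c v(1) y(1) scheme_spaces(2) by (intro subspace_add subspace_scale)
 ultimately obtain H where H: "H \<in> hyperplanes S" "(a H \<bullet> (c + v) - b H) * (a H \<bullet> (c + v + t *\<^sub>R y) - b H) <= 0"
  using piece_cut[OF i(1) x, of _ a b] ab by blast
 have "a H \<bullet> (c + v + t *\<^sub>R y) = a H \<bullet> (c + v)" using y(2)[OF H(1)] by (simp add: inner_add_right)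
 then have "(a H \<bullet> (c + v) - b H) * (a H \<bullet> (c + v) - b H) <= 0" using H(2) by simp
 moreover have "(a H \<bullet> (c + v) - b H) * (a H \<bullet> (c + v) - b H) > 0" using v(3) H(1) by (auto simp: zero_less_mult_iff)
 ultimately show False by linarith
qed

lemma scheme_cut_window:
 assumes N: "norm_on (physical S) N"
 shows "\<exists>a b w. cut_window (lattice S) (to_phys S) (to_int S) N (labels S) (piece S) (hyperplanes S) a b w \<and>
  (\<forall>H\<in>hyperplanes S. H = {x \<in> internal S. a H \<bullet> x = b H})"
proof -
 obtain a b w where D: "\<forall>H\<in>hyperplanes S. a H \<in> internal S \<and> a H ~= 0 \<and> H = {x \<in> internal S. a H \<bullet> x = b H} \<and>
  w H \<in> internal S \<and> a H \<bullet> w H = b H \<and>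
  (\<exists>i\<in>labels S. \<exists>e>0. \<forall>y\<in>internal S. norm (y - w H) < e --> (y \<in> piece S i \<longleftrightarrow> a H \<bullet> y <= b H))"
  using hyperplane_data by blast
 have lat: "is_lattice (lattice S)" and dp: "1 <= dim (physical S)" and fl: "finite (labels S)" and w0: "window S ~= {}"
  and ip: "inj_on (to_phys S) (lattice S)" and ii: "inj_on (to_int S) (lattice S)"
  and de: "closure (to_int S ` lattice S) = internal S"
  using S by (simp_all add: polytopal_scheme_def)
 have l0: "0 \<in> lattice S" using lat unfolding is_lattice_def by (metis zmod.span_zero)
 have p0: "to_phys S 0 = 0" "to_int S 0 = 0" using linear_0[OF linear_to_phys] linear_0[OF linear_to_int] by auto
 have "cut_lattice (lattice S) (to_phys S) (to_int S) N"
 proof (rule cut_lattice.intro)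
  show "linear (to_phys S)" "linear (to_int S)" by (rule linear_to_phys linear_to_int)+
  show "to_phys S x + to_int S x = x" for x by (simp add: to_int_eq)
  show "to_phys S (to_phys S x) = to_phys S x" for x by (rule to_phys_idem[OF to_phys_mem(1)])
  show "to_int S (to_int S x) = to_int S x" for x by (rule to_int_idem[OF to_int_mem])
 next
  show "ga \<in> lattice S ==> to_phys S ga = 0 ==> ga = 0" for ga using inj_onD[OF ip, of ga 0] l0 p0 by simp
  show "ga \<in> lattice S ==> to_int S ga = 0 ==> ga = 0" for ga using inj_onD[OF ii, of ga 0] l0 p0 by simp
  fix x and e :: real assume "x \<in> range (to_int S)" "e > 0"
  then have "x \<in> closure (to_int S ` lattice S)" using de range_to_int by simp
  then show "\<exists>ga\<in>lattice S. norm (to_int S ga - x) < e" using \<open>e > 0\<close> by (auto simp: closure_approachable dist_norm)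
 qed (simp_all add: lat N range_to_phys)
 moreover have "cut_window_axioms (lattice S) (to_phys S) (to_int S) (labels S) (piece S) (hyperplanes S) a b w"
  unfolding cut_window_axioms_def range_to_phys range_to_int
 proof (intro conjI allI impI)
  show "1 <= dim (physical S)" "finite (labels S)" "finite (hyperplanes S)" by (fact dp fl finite_hyperplanes)+
  show "(\<Union>i\<in>labels S. piece S i) ~= {}" using w0 by (simp add: window_def)
  fix z and e :: real assume "z \<in> (\<Union>i\<in>labels S. piece S i)" "e > 0"
  then obtain i where i: "i \<in> labels S" "z \<in> piece S i" by blast
  from piece_regular[OF this \<open>e > 0\<close>] obtain c r where "c \<in> internal S" "norm (c - z) < e" "r > 0"
   "\<forall>y\<in>internal S. norm (y - c) < r --> y \<in> piece S i" by blast
  then show "\<exists>c\<in>internal S. norm (c - z) < e \<and> (\<exists>r>0. \<forall>y\<in>internal S. norm (y - c) < r --> y \<in> (\<Union>i\<in>labels S. piece S i))"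
   using i(1) by (intro bexI[of _ c] conjI exI[of _ r]) auto
 next
  fix i y y' assume "i \<in> labels S" "y \<in> piece S i" "y' \<in> internal S" "y' \<notin> piece S i"
  then show "\<exists>h\<in>hyperplanes S. (a h \<bullet> y - b h) * (a h \<bullet> y' - b h) <= 0" by (rule piece_cut) (use D in blast)
 next
  fix y assume "y \<in> internal S" "\<forall>h. h \<in> hyperplanes S --> a h \<bullet> y = 0"
  then show "y = 0" by (intro normals_spanning[of a b]) (use D in blast)+
 qed (use D piece_closed piece_nonsingular in blast)+
 ultimately have "cut_window (lattice S) (to_phys S) (to_int S) N (labels S) (piece S) (hyperplanes S) a b w"
  by (simp add: cut_window_def)
 then show ?thesis using D by blast
qed

end

locale window_scheme = cut_window "lattice S" "to_phys S" "to_int S" N "labels S" "piece S" "hyperplanes S" a b w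
 for S :: "('e::euclidean_space, 'l) cp_scheme" and N a b w +
 assumes scheme: "polytopal_scheme S"
  and wall: "H \<in> hyperplanes S ==> H = {x \<in> internal S. a H \<bullet> x = b H}"
begin

abbreviation I :: "'e \<Rightarrow> 'e" where "I \<equiv> to_int S"
abbreviation P :: "'e \<Rightarrow> 'e" where "P \<equiv> to_phys S"
abbreviation Ga :: "'e set" where "Ga \<equiv> lattice S"
abbreviation Hs :: "'e set set" where "Hs \<equiv> hyperplanes S"

section \<open>Patches, repetitivity and weights in terms of lattice vectors\<close>

lemma inj_P: "inj_on P Ga"
 using scheme by (simp add: polytopal_scheme_def)

lemma star_P: "ga \<in> Ga ==> star S (P ga) = I ga"
 by (simp add: star_def the_inv_into_f_f[OF inj_P])

lemma window_Win: "window S = Win" by (simp add: window_def Win_def)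

lemma cps_eq: "cps S = P ` Gw"
 by (auto simp: cps_def Gw_def window_Win star_P)

lemma cps_ball_eq: "cps_ball S N r (P x) = P ` {y \<in> Gw. N (P (y - x)) <= r}"
 by (auto simp: cps_ball_def cps_eq P_diff)

lemma patch_eq:
 assumes x: "x \<in> Ga"
 shows "patch S N r (P x) = (\<lambda>(g, i). (P g, i)) ` pat r (I x)"
proof (rule set_eqI, rule iffI)
 fix t assume "t \<in> patch S N r (P x)"
 then obtain y i where y: "y \<in> Gw" "N (P (y - x)) <= r" "i \<in> labels S" "star S (P y) \<in> piece S i" and t: "t = (P y - P x, i)"
  unfolding patch_def cps_ball_eq by blast
 then have yG: "y \<in> Ga" by (simp add: Gw_def)
 then have "(y - x, i) \<in> pat r (I x)" using y x by (simp add: pat_def star_P lat_diff I_diff)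
 then show "t \<in> (\<lambda>(g, i). (P g, i)) ` pat r (I x)" unfolding t P_diff[symmetric] by (rule rev_image_eqI) simp
next
 fix t assume "t \<in> (\<lambda>(g, i). (P g, i)) ` pat r (I x)"
 then obtain g i where g: "g \<in> Ga" "N (P g) <= r" "i \<in> labels S" "I x + I g \<in> piece S i" and t: "t = (P g, i)"
  by (auto simp: pat_def)
 have xg: "x + g \<in> Ga" using x g(1) by (rule lat_add)
 then have 1: "x + g \<in> Gw" using g by (auto simp: Gw_def Win_def I_add)
 then have 2: "P (x + g) \<in> cps_ball S N r (P x)" unfolding cps_ball_eq using g(2) by simp
 have "star S (P (x + g)) \<in> piece S i" using star_P[OF xg] g(4) by (simp add: I_add)
 moreover have "t = (P (x + g) - P x, i)" by (simp add: t P_add)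
 ultimately show "t \<in> patch S N r (P x)" unfolding patch_def using 2 g(3) by blast
qed

lemma patch_eq_iff:
 assumes "x \<in> Ga" "y \<in> Ga"
 shows "patch S N r (P x) = patch S N r (P y) \<longleftrightarrow> pat r (I x) = pat r (I y)"
proof -
 have "inj_on (\<lambda>(g, i). (P g, i)) (Ga \<times> UNIV)" using inj_P by (auto simp: inj_on_def)
 then show ?thesis unfolding patch_eq[OF assms(1)] patch_eq[OF assms(2)]
  by (rule inj_on_image_eq_iff) (auto simp: pat_def)
qed

lemma Gw_lattice: "x \<in> Gw ==> x \<in> Ga" by (simp add: Gw_def)

lemma linearly_repetitive_iff: "linearly_repetitive S N \<longleftrightarrow> LR"
proof
 assume "linearly_repetitive S N"
 then obtain C where C: "C > 0" "\<forall>\<^sub>F r in at_top. \<forall>x\<in>cps S. \<forall>y\<in>cps S.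
    \<exists>z\<in>cps S. patch S N r z = patch S N r y \<and> cps_ball S N r z \<subseteq> cps_ball S N (C * r) x"
  unfolding linearly_repetitive_def by blast
 have "\<forall>\<^sub>F r in at_top. \<forall>x\<in>Gw. \<forall>y\<in>Gw. \<exists>z\<in>Gw. pat r (I z) = pat r (I y) \<and> N (P (z - x)) <= C * r"
  using C(2) eventually_ge_at_top[of 0]
 proof eventually_elim
  case (elim r)
  show ?case
  proof (intro ballI)
   fix x y assume xy: "x \<in> Gw" "y \<in> Gw"
   then have "P x \<in> cps S" "P y \<in> cps S" by (simp_all add: cps_eq)
   then obtain z' where z': "z' \<in> cps S" "patch S N r z' = patch S N r (P y)" "cps_ball S N r z' \<subseteq> cps_ball S N (C * r) (P x)"
    using elim(1) by blast
   then obtain z where z: "z \<in> Gw" "z' = P z" by (auto simp: cps_eq)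
   have "P z \<in> cps_ball S N r z'" using z'(1) z(2) elim(2) N_0 by (simp add: cps_ball_def)
   then have "N (P z - P x) <= C * r" using z'(3) unfolding cps_ball_def by blast
   moreover have "pat r (I z) = pat r (I y)" using z'(2) patch_eq_iff[of z y r] z xy by (simp add: Gw_lattice)
   ultimately show "\<exists>z\<in>Gw. pat r (I z) = pat r (I y) \<and> N (P (z - x)) <= C * r" using z(1) by (auto simp: P_diff)
  qed
 qed
 then show LR unfolding LR_def using C(1) by blast
next
 assume LR
 then obtain C where C: "C > 0" "\<forall>\<^sub>F r in at_top. \<forall>x\<in>Gw. \<forall>y\<in>Gw. \<exists>z\<in>Gw. pat r (I z) = pat r (I y) \<and> N (P (z - x)) <= C * r"
  unfolding LR_def by blast
 have "\<forall>\<^sub>F r in at_top. \<forall>x\<in>cps S. \<forall>y\<in>cps S.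
    \<exists>z\<in>cps S. patch S N r z = patch S N r y \<and> cps_ball S N r z \<subseteq> cps_ball S N ((C + 1) * r) x"
  using C(2)
 proof eventually_elim
  case (elim r)
  show ?case
  proof (intro ballI)
   fix x' y' assume "x' \<in> cps S" "y' \<in> cps S"
   then obtain x y where xy: "x \<in> Gw" "y \<in> Gw" "x' = P x" "y' = P y" by (auto simp: cps_eq)
   then obtain z where z: "z \<in> Gw" "pat r (I z) = pat r (I y)" "N (P (z - x)) <= C * r" using elim by blast
   \<comment> \<open>The whole patch, not only its centre, has to lie in the larger ball; the
     triangle inequality costs another \<open>r\<close>.\<close>
   have "N (P (v - x)) <= (C + 1) * r" if "N (P (v - z)) <= r" for v
   proof -
    have "N (P ((v - z) + (z - x))) <= N (P (v - z)) + N (P (z - x))" by (rule N_triangle')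
    then show ?thesis using that z(3) by (simp add: algebra_simps)
   qed
   then have "cps_ball S N r (P z) \<subseteq> cps_ball S N ((C + 1) * r) (P x)" unfolding cps_ball_eq by blast
   moreover have "patch S N r (P z) = patch S N r (P y)" using z xy patch_eq_iff[of z y r] by (simp add: Gw_lattice)
   moreover have "P z \<in> cps S" using z(1) by (simp add: cps_eq)
   ultimately show "\<exists>z\<in>cps S. patch S N r z = patch S N r y' \<and> cps_ball S N r z \<subseteq> cps_ball S N ((C + 1) * r) x'"
    unfolding xy by blast
  qed
 qed
 then show "linearly_repetitive S N" unfolding linearly_repetitive_def using C(1) by (intro exI[of _ "C + 1"]) simp
qed

lemma card_P_pts: "real (card (P ` pts R A)) = cnt R A"
proof -
 have "inj_on P (pts R A)" by (rule inj_on_subset[OF inj_P]) (auto simp: pts_def)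
 then show ?thesis by (simp add: cnt_def card_image)
qed

lemma has_frequency_iff:
 assumes y: "y \<in> Gw"
 shows "has_frequency S N r (patch S N r (P y)) vn \<longleftrightarrow> ((\<lambda>R. cnt R (acc r (I y)) / cnt R Win) \<longlongrightarrow> vn) at_top"
proof -
 have 0: "cps_ball S N R 0 = P ` pts R Win" for R
  using cps_ball_eq[of R 0] by (simp add: P_0 pts_def Gw_def) (metis (lifting) conj_commute conj_assoc)
 have "{x \<in> cps_ball S N R 0. patch S N r x = patch S N r (P y)} = P ` pts R (acc r (I y))" for R
  unfolding 0
 proof (rule set_eqI, rule iffI)
  fix t assume "t \<in> {x \<in> P ` pts R Win. patch S N r x = patch S N r (P y)}"
  then obtain x where x: "x \<in> pts R Win" "t = P x" "patch S N r (P x) = patch S N r (P y)" by blast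
  then have "pat r (I x) = pat r (I y)" using patch_eq_iff[of x y r] Gw_lattice[OF y] by (simp add: pts_def)
  then show "t \<in> P ` pts R (acc r (I y))" using x by (auto simp: pts_def acc_def)
 next
  fix t assume "t \<in> P ` pts R (acc r (I y))"
  then obtain x where x: "x \<in> Ga" "N (P x) <= R" "I x \<in> Win" "pat r (I x) = pat r (I y)" "t = P x" by (auto simp: pts_def acc_def)
  then show "t \<in> {x \<in> P ` pts R Win. patch S N r x = patch S N r (P y)}"
   using patch_eq_iff[OF x(1) Gw_lattice[OF y], of r] by (simp add: pts_def)
 qed
 then show ?thesis unfolding has_frequency_def 0 by (simp add: card_P_pts)
qed

lemma dim_spaces: "d = dim (physical S)" "n = dim (internal S)" "range I = internal S" "range P = physical S"
 using range_to_phys[OF scheme] range_to_int[OF scheme] by simp_all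

lemma positivity_of_weights_iff: "positivity_of_weights S N \<longleftrightarrow> PW"
proof -
 have "(\<forall>Q \<in> patch S N r ` cps S. \<exists>vn. has_frequency S N r Q vn \<and> c / r ^ dim (physical S) <= vn) \<longleftrightarrow>
  (\<forall>y\<in>Gw. \<exists>vn. ((\<lambda>R. cnt R (acc r (I y)) / cnt R Win) \<longlongrightarrow> vn) at_top \<and> c / r ^ d <= vn)" for c r
  by (simp add: cps_eq image_image has_frequency_iff dim_spaces(4))
 then show ?thesis unfolding positivity_of_weights_def PW_def by presburger
qed

lemma PW_imp_property_C:
 assumes PW shows "property_C S N"
proof -
 obtain C where C: "C > 0" "\<forall>\<^sub>F r in at_top. finite ((\<lambda>y. pat r (I y)) ` Gw) \<and> real (card ((\<lambda>y. pat r (I y)) ` Gw)) <= C * r ^ d"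
  using PW_patches[OF assms] by blast
 have "\<forall>\<^sub>F r in at_top. real (complexity S N r) <= C * r ^ dim (physical S)"
  using C(2)
 proof eventually_elim
  case (elim r)
  have "patch S N r ` cps S = (image (\<lambda>(g, i). (P g, i))) ` (\<lambda>y. pat r (I y)) ` Gw"
   unfolding cps_eq image_image by (rule image_cong) (simp_all add: patch_eq Gw_lattice)
  then have "card (patch S N r ` cps S) <= card ((\<lambda>y. pat r (I y)) ` Gw)" using card_image_le elim by metis
  then show ?case using elim by (simp add: complexity_def dim_spaces(4))
 qed
 then show ?thesis unfolding property_C_def using C(1) by blast
qed

subsection \<open>Flags and their vertex groups\<close>

lemma n_pos: "1 <= n"
 using scheme dim_spaces(2) by (simp add: polytopal_scheme_def)

lemma flag_ext:
 assumes "flag f" "x \<in> range I" "y \<in> range I" "\<And>h. h \<in> f ==> a h \<bullet> x = a h \<bullet> y"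
 shows "x = y"
proof -
 have "x - y \<in> range I" "\<forall>h\<in>f. a h \<bullet> (x - y) = 0"
  using assms subspace_diff[OF subspace_I] by (simp_all add: inner_diff_right)
 then have "x - y = 0" using assms(1) unfolding flag_def by blast
 then show ?thesis by simp
qed

lemma I_ext:
 assumes "x \<in> range I" "y \<in> range I" "\<And>h. h \<in> Hs ==> a h \<bullet> x = a h \<bullet> y"
 shows "x = y"
proof -
 have "x - y \<in> range I" using assms subspace_diff[OF subspace_I] by blast
 then have "x - y = 0" by (rule spanning) (simp add: assms(3) inner_diff_right)
 then show ?thesis by simp
qed

lemma flag_point:
 assumes "flag f" shows "\<exists>v\<in>range I. \<forall>h\<in>f. a h \<bullet> v = t h"
proof -
 obtain u where "dual f u" using flag_dual[OF assms] by blast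
 note u = dualD[OF this]
 have "(\<Sum>h\<in>f. t h *\<^sub>R u h) \<in> range I" using u(1) by (intro subspace_sum[OF subspace_I] subspace_scale[OF subspace_I])
 then show ?thesis using dual_coord[OF assms u(2)] by blast
qed

lemma Inter_walls:
 assumes "f \<subseteq> Hs" "f ~= {}" shows "\<Inter>f = {x \<in> range I. \<forall>h\<in>f. a h \<bullet> x = b h}"
proof -
 have "x \<in> h \<longleftrightarrow> x \<in> range I \<and> a h \<bullet> x = b h" if "h \<in> f" for x h
  using wall[of h] that assms(1) unfolding dim_spaces(3) by blast
 then show ?thesis using assms(2) by blast
qed

lemma flag_ne: "flag f ==> f ~= {}" using n_pos by (auto simp: flag_def)

lemma flags_eq: "flags S = {f. flag f}"
proof -
 have "f \<subseteq> Hs \<and> card f = n \<and> (\<exists>v. \<Inter>f = {v}) \<longleftrightarrow> flag f" for f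
 proof
  assume f: "f \<subseteq> Hs \<and> card f = n \<and> (\<exists>v. \<Inter>f = {v})"
  then obtain v where v: "\<Inter>f = {v}" by blast
  \<comment> \<open>The intersection of the empty family is the whole type, so it is essential that
    the internal space has positive dimension.\<close>
  have "card f ~= 0" using f n_pos by linarith
  then have "f ~= {}" by force
  then have If: "\<Inter>f = {x \<in> range I. \<forall>h\<in>f. a h \<bullet> x = b h}" using Inter_walls f by blast
  have "y = 0" if y: "y \<in> range I" "\<forall>h\<in>f. a h \<bullet> y = 0" for y
  proof -
   have "v \<in> range I" "\<forall>h\<in>f. a h \<bullet> v = b h" using v If by blast+
   then have "v + y \<in> \<Inter>f" unfolding If using y subspace_add[OF subspace_I] by (simp add: inner_add_right)
   then show ?thesis using v by simp
  qed
  then show "flag f" using f by (simp add: flag_def)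
 next
  assume f: "flag f"
  then obtain v where v: "v \<in> range I" "\<forall>h\<in>f. a h \<bullet> v = b h" using flag_point by blast
  have "f \<subseteq> Hs" "card f = n" using f by (auto simp: flag_def)
  moreover have "\<Inter>f = {v}" unfolding Inter_walls[OF \<open>f \<subseteq> Hs\<close> flag_ne[OF f]]
  proof (intro subset_antisym subsetI)
   fix x assume "x \<in> {x \<in> range I. \<forall>h\<in>f. a h \<bullet> x = b h}"
   then have "x = v" using v by (intro flag_ext[OF f]) auto
   then show "x \<in> {v}" by simp
  qed (use v in blast)
  ultimately show "f \<subseteq> Hs \<and> card f = n \<and> (\<exists>v. \<Inter>f = {v})" by blast
 qed
 then show ?thesis unfolding flags_def dim_spaces(2) by blast
qed

lemma flag_vertex:
 assumes f: "flag f" shows "flag_vertex f \<in> range I" "h \<in> f ==> a h \<bullet> flag_vertex f = b h"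
proof -
 have "f \<subseteq> Hs" "\<exists>v. \<Inter>f = {v}" using f flags_eq unfolding flags_def by blast+
 then obtain v where v: "\<Inter>f = {v}" by blast
 then have "flag_vertex f = v" by (simp add: flag_vertex_def)
 then have "flag_vertex f \<in> \<Inter>f" using v by simp
 then show "flag_vertex f \<in> range I" "h \<in> f ==> a h \<bullet> flag_vertex f = b h"
  unfolding Inter_walls[OF \<open>f \<subseteq> Hs\<close> flag_ne[OF f]] by simp_all
qed

lemma Ver_eq:
 assumes f: "flag f"
 shows "Ver S f = {v \<in> range I. \<exists>ga. (\<forall>h\<in>f. ga h \<in> Ga) \<and> (\<forall>h\<in>f. a h \<bullet> v = b h + lam h (ga h))}"
proof -
 have fH: "f \<subseteq> Hs" using f by (simp add: flag_def)
 have mem: "x \<in> I g +o h \<longleftrightarrow> x \<in> range I \<and> a h \<bullet> x = b h + lam h g" if h: "h \<in> f" for x g h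
 proof -
  have "x \<in> I g +o h \<longleftrightarrow> x - I g \<in> h" unfolding elt_set_plus_def by force
  also have "\<dots> \<longleftrightarrow> x - I g \<in> range I \<and> a h \<bullet> (x - I g) = b h" using wall[of h] h fH unfolding dim_spaces(3) by blast
  also have "x - I g \<in> range I \<longleftrightarrow> x \<in> range I"
   using subspace_diff[OF subspace_I, of x "I g"] subspace_add[OF subspace_I, of "x - I g" "I g"] by auto
  finally show ?thesis by (auto simp: inner_diff_right lam_def)
 qed
 have "{v} = (\<Inter>h\<in>f. I (ga h) +o h) \<longleftrightarrow> (\<forall>h\<in>f. a h \<bullet> v = b h + lam h (ga h))" if v: "v \<in> range I" for v ga
 proof
  assume "{v} = (\<Inter>h\<in>f. I (ga h) +o h)"
  then show "\<forall>h\<in>f. a h \<bullet> v = b h + lam h (ga h)" using mem by blast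
 next
  assume e: "\<forall>h\<in>f. a h \<bullet> v = b h + lam h (ga h)"
  have "x = v" if "x \<in> (\<Inter>h\<in>f. I (ga h) +o h)" for x
  proof -
   have "\<And>h. h \<in> f ==> a h \<bullet> x = b h + lam h (ga h)" "x \<in> range I" using that mem flag_ne[OF f] by blast+
   then show ?thesis using e v by (intro flag_ext[OF f]) auto
  qed
  moreover have "v \<in> (\<Inter>h\<in>f. I (ga h) +o h)" using e v mem by blast
  ultimately show "{v} = (\<Inter>h\<in>f. I (ga h) +o h)" by blast
 qed
 then show ?thesis unfolding Ver_def dim_spaces(3)[symmetric] by blast
qed

text \<open>Every element has a coset representative in a fixed ball.\<close>

lemma finite_exponent:
 assumes A: "zsubgroup A" "A \<subseteq> Ga" "span A = UNIV"
 shows "\<exists>M::nat. 1 <= M \<and> (\<forall>ga\<in>Ga. real M *\<^sub>R ga \<in> A)"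
proof -
 obtain C where C: "C > 0" "\<And>x. \<exists>y\<in>A. norm (x - y) <= C" using cocompact[OF A(1)] A(3) by auto
 define R where "R = {ga\<in>Ga. norm ga <= C}"
 have fR: "finite R" unfolding R_def by (rule lattice_finite)
 have Asc: "real m *\<^sub>R x \<in> A" if "x \<in> A" for m x using zmod.subspace_scale[OF A(1) that, of "int m"] by simp
 have Gsc: "real m *\<^sub>R x \<in> Ga" if "x \<in> Ga" for m x using lat_scale[OF that, of "int m"] by simp
 have "\<exists>m::nat. 1 <= m \<and> real m *\<^sub>R ga \<in> A" if g: "ga \<in> Ga" for ga
 proof -
  have "\<forall>m::nat. \<exists>y\<in>A. norm (real m *\<^sub>R ga - y) <= C" using C(2) by blast
  from choice[OF this[unfolded Bex_def]] obtain y where y: "\<And>m. y m \<in> A" "\<And>m. norm (real m *\<^sub>R ga - y m) <= C" by blast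
  have "range (\<lambda>m. real m *\<^sub>R ga - y m) \<subseteq> R"
   unfolding R_def by (intro image_subsetI CollectI conjI lat_diff Gsc[OF g] y(2) subsetD[OF A(2) y(1)])
  then have "\<not> inj (\<lambda>m. real m *\<^sub>R ga - y m)" using fR finite_subset range_inj_infinite by blast
  then have "\<exists>p q. p < q \<and> real p *\<^sub>R ga - y p = real q *\<^sub>R ga - y q" unfolding inj_def by (metis linorder_neqE_nat)
  then obtain p q where pq: "p < q" "real p *\<^sub>R ga - y p = real q *\<^sub>R ga - y q" by blast
  then have "real (q - p) *\<^sub>R ga = y q - y p" by (simp add: of_nat_diff algebra_simps)
  then show ?thesis using pq(1) zsubgroup_diff[OF A(1) y(1) y(1)] by (intro exI[of _ "q - p"]) simp
 qed
 then have "\<forall>ga\<in>Ga. \<exists>m::nat. 1 <= m \<and> real m *\<^sub>R ga \<in> A" by blast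
 from bchoice[OF this] obtain m :: "'e \<Rightarrow> nat" where m: "\<And>ga. ga \<in> Ga ==> 1 <= m ga" "\<And>ga. ga \<in> Ga ==> real (m ga) *\<^sub>R ga \<in> A" by blast
 \<comment> \<open>A common multiple of the exponents of the finitely many representatives; it
   serves every lattice vector, since a vector differs from its representative by an element of
   \<open>A\<close>.\<close>
 define M where "M = (\<Prod>ga\<in>R. m ga)"
 have "M > 0" unfolding M_def using m(1) by (intro prod_pos) (auto simp: R_def Suc_le_eq)
 moreover have "real M *\<^sub>R ga \<in> A" if g: "ga \<in> Ga" for ga
 proof -
  obtain y where y: "y \<in> A" "norm (ga - y) <= C" using C(2) by blast
  then have R: "ga - y \<in> R" "ga - y \<in> Ga" using g A(2) lat_diff by (auto simp: R_def)
  have "m (ga - y) dvd M" unfolding M_def by (rule dvd_prodI[OF fR R(1)])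
  then obtain k where k: "M = m (ga - y) * k" by (rule dvdE)
  have "real M *\<^sub>R ga = real k *\<^sub>R (real (m (ga - y)) *\<^sub>R (ga - y)) + real M *\<^sub>R y"
   by (simp add: k scaleR_diff_right mult.commute)
  then show ?thesis using Asc[OF m(2)[OF R(2)], of k] Asc[OF y(1), of M] zmod.subspace_add[OF A(1)] by simp
 qed
 ultimately show ?thesis by (intro exI[of _ M]) simp
qed

text \<open>The real projections of the total space onto the spans of the axes of \<open>f\<close>.
  They map the lattice into the axes only up to the denominator \<open>M\<close>, and these
  fractions are what makes \<open>flag_group\<close> larger than the lattice.\<close>

definition fproj :: "'e set set \<Rightarrow> ('e set \<Rightarrow> 'e \<Rightarrow> 'e) \<Rightarrow> nat \<Rightarrow> bool" where
 "fproj f pj M \<longleftrightarrow> 1 <= M \<and> (\<forall>l\<in>f. linear (pj l)) \<and> (\<forall>l\<in>f. \<forall>ga\<in>Ga. real M *\<^sub>R pj l ga \<in> axg f l) \<and>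
  (\<forall>x. (\<Sum>l\<in>f. pj l x) = x)"

text \<open>By the rank condition the integer bases of the axes combine to a real basis. They
  generate a sublattice of full rank, and its finite exponent is the denominator.\<close>

lemma fproj_exists:
 assumes RC and f: "flag f" shows "\<exists>pj M. fproj f pj M"
proof -
 have ff: "finite f" by (rule flag_finite[OF f])
 have "\<forall>l. \<exists>B. zbasis B (axg f l) \<and> independent B"
  using sublattice_zbasis_exists[OF sublatticeI[OF axg_sub(1) axg_sub(2)]] by blast
 from choice[OF this] obtain B where B: "\<And>l. zbasis (B l) (axg f l)" "\<And>l. independent (B l)" by blast
 define BB where "BB = (\<Union>l\<in>f. B l)"
 have fB: "finite (B l)" and zB: "zspan (B l) = axg f l" for l using B(1) by (auto simp: zbasis_def)
 have fBB: "finite BB" unfolding BB_def using ff fB by blast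
 have "(\<Union>l\<in>f. axg f l) \<subseteq> span BB"
 proof (rule UN_least)
  fix l assume "l \<in> f"
  then have "span (B l) \<subseteq> span BB" unfolding BB_def by (intro span_mono) blast
  then show "axg f l \<subseteq> span BB" using zspan_sub_span[of "B l"] zB[of l] by blast
 qed
 then have sBB: "span BB = UNIV" using axg_rank(2)[OF assms] by (metis span_minimal subspace_span top.extremum_uniqueI)
 have cB: "card (B l) = cdim l" if "l \<in> f" for l
  using axg_rank(1)[OF assms that] zB[of l] B(2)[of l] by (metis dim_eq_card_independent dim_span span_zspan)
 have "(\<Sum>l\<in>f. card (B l)) = DIM('e)" using cB assms by (simp add: RC_def)
 then have le: "card BB <= DIM('e)" unfolding BB_def using card_UN_le[OF ff, of B] by simp
 have iBB: "independent BB"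
  by (rule card_le_dim_spanning[of BB UNIV]) (use sBB fBB le in \<open>simp_all\<close>)
 have "card BB = DIM('e)" using iBB sBB dim_eq_card_independent dim_span by (metis dim_UNIV)
 have dj: "B l \<inter> B l' = {}" if l: "l \<in> f" "l' \<in> f" "l ~= l'" for l l'
 proof (rule ccontr)
  assume "B l \<inter> B l' ~= {}"
  then obtain e where e: "e \<in> B l" "e \<in> B l'" by blast
  have "e \<in> axg f l" "e \<in> axg f l'" using e zB zmod.span_base by metis+
  then have "\<forall>h\<in>f. lam h e = 0" "e \<in> Ga" using l unfolding axg_def by blast+
  then have "e = 0" using flag_lam_0[OF f, of e] by blast
  then show False using e(1) B(2)[of l] dependent_zero by blast
 qed
 have "\<forall>l. \<exists>g. linear g \<and> (\<forall>x\<in>BB. g x = (if x \<in> B l then x else 0))"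
  by (rule allI, rule linear_independent_extend[OF iBB])
 from choice[OF this] obtain pj where p: "\<And>l. linear (pj l)" "\<And>l x. x \<in> BB ==> pj l x = (if x \<in> B l then x else 0)" by blast
 have sum1: "(\<Sum>l\<in>f. pj l x) = x" for x
 proof -
  have "(\<Sum>l\<in>f. pj l e) = id e" if e: "e \<in> BB" for e
  proof -
   obtain l where l: "l \<in> f" "e \<in> B l" using e unfolding BB_def by blast
   have "(\<Sum>l'\<in>f. pj l' e) = (\<Sum>l'\<in>f. if l' = l then e else 0)"
    by (rule sum.cong) (use p(2)[OF e] l dj in auto)
   then show ?thesis using l ff by simp
  qed
  moreover have "linear (\<lambda>x. \<Sum>l\<in>f. pj l x)" by (rule linear_compose_sum) (simp add: p(1))
  ultimately show ?thesis using linear_eq_on_span[of "\<lambda>x. \<Sum>l\<in>f. pj l x" id BB x] sBB linear_id by auto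
 qed
 have axB: "pj l x \<in> axg f l" if l: "l \<in> f" and x: "x \<in> zspan BB" for l x
 proof -
  obtain m where m: "x = (\<Sum>e\<in>BB. real_of_int (m e) *\<^sub>R e)" using x zmod.span_finite[OF fBB] by auto
  have "pj l x = (\<Sum>e\<in>BB. real_of_int (m e) *\<^sub>R pj l e)" by (simp add: m linear_sum[OF p(1)] linear_scale[OF p(1)])
  moreover have "pj l e \<in> axg f l" if "e \<in> BB" for e
   using p(2)[OF that] zmod.span_base[of e "B l"] zB[of l] zmod.subspace_0[OF axg_sub(1)] by auto
  ultimately show ?thesis
   using zmod.subspace_sum[OF axg_sub(1)] zmod.subspace_scale[OF axg_sub(1)] by (metis (no_types, lifting))
 qed
 have "zspan BB \<subseteq> Ga"
  by (rule zmod.span_minimal[OF _ zsubgroup_lattice]) (use zB axg_sub(2) zmod.span_superset in \<open>unfold BB_def; blast\<close>)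
 then obtain M :: nat where M: "1 <= M" "\<forall>ga\<in>Ga. real M *\<^sub>R ga \<in> zspan BB"
  using finite_exponent[OF zmod.subspace_span, of BB] sBB span_zspan[of BB] by auto
 have "real M *\<^sub>R pj l ga \<in> axg f l" if "l \<in> f" "ga \<in> Ga" for l ga
  using axB[OF that(1) bspec[OF M(2) that(2)]] by (simp add: linear_scale[OF p(1)])
 then show ?thesis unfolding fproj_def using M(1) p(1) sum1 by blast
qed

text \<open>Vanishing of the other heights is checked on lattice vectors, where a multiple of the
  projection lies in the axis, and extends to the span of the lattice.\<close>

lemma fproj_lam:
 assumes "fproj f pj M" "flag f" "h \<in> f" "l \<in> f"
 shows "lam h (pj l x) = (if h = l then lam l x else 0)"
proof -
 have lp: "linear (pj l)" if "l \<in> f" for l using assms that by (simp add: fproj_def)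
 have off: "lam h (pj l x) = 0" if "h \<in> f" "l \<in> f" "h ~= l" for h l x
 proof -
  have "linear (\<lambda>x. lam h (pj l x))" using linear_compose[OF lp[OF that(2)] lam_linear] by (simp add: o_def)
  then have "subspace {x. lam h (pj l x) = 0}" by (rule linear_subspace_kernel)
  moreover have "Ga \<subseteq> {x. lam h (pj l x) = 0}"
  proof
   fix g assume "g \<in> Ga"
   then have "real M *\<^sub>R pj l g \<in> axg f l" "M ~= 0" using assms(1) that by (auto simp: fproj_def)
   then have "lam h (real M *\<^sub>R pj l g) = 0" "M ~= 0" using that by (auto simp: axg_def)
   then show "g \<in> {x. lam h (pj l x) = 0}" by (simp add: lam_scale)
  qed
  ultimately have "span Ga \<subseteq> {x. lam h (pj l x) = 0}" by (rule span_minimal[rotated])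
  then show ?thesis using lattice_span by blast
 qed
 have "lam l x = lam l (\<Sum>j\<in>f. pj j x)" using assms by (simp add: fproj_def)
 also have "\<dots> = (\<Sum>j\<in>f. if j = l then lam l (pj l x) else 0)"
  unfolding lam_sum by (rule sum.cong) (use off assms(4) in auto)
 also have "\<dots> = lam l (pj l x)" using assms(4) flag_finite[OF assms(2)] by simp
 finally show ?thesis using off assms by auto
qed

lemma fproj_lam_sum:
 assumes "fproj f pj M" "flag f" "h \<in> f"
 shows "lam h (\<Sum>l\<in>f. pj l (ga l)) = lam h (ga h)"
proof -
 have "lam h (\<Sum>l\<in>f. pj l (ga l)) = (\<Sum>l\<in>f. if l = h then lam h (ga h) else 0)"
  unfolding lam_sum by (rule sum.cong) (use fproj_lam[OF assms] in auto)
 then show ?thesis using assms flag_finite by simp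
qed

lemma fproj_zero: "fproj f pj M ==> l \<in> f ==> pj l 0 = 0"
 unfolding fproj_def using linear_0 by blast

text \<open>When each wall \<open>l\<close> is shifted by its own vector \<open>ga l\<close>, only
  the component of that vector on the axis of \<open>l\<close> moves the vertex.\<close>

lemma fproj_vertex:
 assumes "fproj f pj M" "flag f" "v \<in> range I" "\<And>l. l \<in> f ==> a l \<bullet> v = b l + lam l (ga l)"
 shows "v = flag_vertex f + I (\<Sum>l\<in>f. pj l (ga l))"
proof (rule flag_ext[OF assms(2,3)])
 show "flag_vertex f + I (\<Sum>l\<in>f. pj l (ga l)) \<in> range I"
  using subspace_add[OF subspace_I] flag_vertex(1)[OF assms(2)] by blast
 fix h assume h: "h \<in> f"
 have "a h \<bullet> I (\<Sum>l\<in>f. pj l (ga l)) = lam h (ga h)" using fproj_lam_sum[OF assms(1,2) h] by (simp add: lam_def)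
 then show "a h \<bullet> v = a h \<bullet> (flag_vertex f + I (\<Sum>l\<in>f. pj l (ga l)))"
  using assms(4)[OF h] flag_vertex(2)[OF assms(2) h] by (simp add: inner_add_right)
qed

lemma scaled_inj:
 assumes "x \<in> (\<lambda>ga. (1 / real M) *\<^sub>R ga) ` Ga" "y \<in> (\<lambda>ga. (1 / real M') *\<^sub>R ga) ` Ga" "M >= 1" "M' >= 1" "I x = I y"
 shows "x = y"
proof -
 obtain p q where p: "p \<in> Ga" "x = (1 / real M) *\<^sub>R p" and q: "q \<in> Ga" "y = (1 / real M') *\<^sub>R q" using assms(1,2) by blast
 have g: "real_of_int (int M') *\<^sub>R p - real_of_int (int M) *\<^sub>R q \<in> Ga"
  by (intro lat_diff lat_scale p(1) q(1))
 have "real_of_int (int M') *\<^sub>R p - real_of_int (int M) *\<^sub>R q = (real M * real M') *\<^sub>R (x - y)"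
  using assms(3,4) by (simp add: p(2) q(2) scaleR_diff_right)
 moreover have "I ((real M * real M') *\<^sub>R (x - y)) = 0" using assms(5) by (simp add: I_scale I_diff)
 ultimately have "(real M * real M') *\<^sub>R (x - y) = 0" using injI[OF g] by simp
 then show ?thesis using assms(3,4) by simp
qed

text \<open>Shifted vertices are sums of axis projections by \<open>fproj_vertex\<close>, so the
  sums satisfy the description of the flag group; \<open>scaled_inj\<close> makes the group with
  this description unique.\<close>

lemma flag_group_eq:
 assumes p: "fproj f pj M" and f: "flag f"
 shows "flag_group S f = {\<Sum>l\<in>f. pj l (ga l) | ga. \<forall>l\<in>f. ga l \<in> Ga}" (is "_ = ?G")
  and "zsubgroup (flag_group S f)" and "g \<in> flag_group S f ==> real M *\<^sub>R g \<in> Ga"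
proof -
 have lp: "linear (pj l)" if "l \<in> f" for l using p that by (simp add: fproj_def)
 have M: "M >= 1" using p by (simp add: fproj_def)
 have zG: "zsubgroup ?G" unfolding zsubgroup_iff
 proof (intro conjI ballI allI)
  show "0 \<in> ?G" using fproj_zero[OF p] lat_0 by (intro CollectI exI[of _ "\<lambda>_. 0"]) simp
  fix x y assume "x \<in> ?G" "y \<in> ?G"
  then obtain ga ga' where "x = (\<Sum>l\<in>f. pj l (ga l))" "\<forall>l\<in>f. ga l \<in> Ga" "y = (\<Sum>l\<in>f. pj l (ga' l))" "\<forall>l\<in>f. ga' l \<in> Ga" by blast
  then show "x + y \<in> ?G" by (intro CollectI exI[of _ "\<lambda>l. ga l + ga' l"]) (simp add: linear_add[OF lp] sum.distrib lat_add)
 next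
  fix m x assume "x \<in> ?G"
  then obtain ga where "x = (\<Sum>l\<in>f. pj l (ga l))" "\<forall>l\<in>f. ga l \<in> Ga" by blast
  then show "real_of_int m *\<^sub>R x \<in> ?G"
   by (intro CollectI exI[of _ "\<lambda>l. real_of_int m *\<^sub>R ga l"]) (simp add: linear_scale[OF lp] scaleR_right.sum lat_scale)
 qed
 have MG: "real M *\<^sub>R g \<in> Ga" if gG: "g \<in> ?G" for g
 proof -
  obtain ga where g: "g = (\<Sum>l\<in>f. pj l (ga l))" "\<forall>l\<in>f. ga l \<in> Ga" using gG by blast
  have "real M *\<^sub>R pj l (ga l) \<in> Ga" if "l \<in> f" for l using p g(2) that axg_sub(2) unfolding fproj_def by blast
  then show ?thesis unfolding g(1) scaleR_right.sum by (rule lat_sum)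
 qed
 have sub: "?G \<subseteq> (\<lambda>ga. (1 / real M) *\<^sub>R ga) ` Ga"
 proof
  fix g assume "g \<in> ?G"
  then have "g = (1 / real M) *\<^sub>R (real M *\<^sub>R g)" "real M *\<^sub>R g \<in> Ga" using M MG by simp_all
  then show "g \<in> (\<lambda>ga. (1 / real M) *\<^sub>R ga) ` Ga" by blast
 qed
 have img: "I ` ?G = (\<lambda>v. v - flag_vertex f) ` Ver S f"
 proof (rule set_eqI, rule iffI)
  fix x assume "x \<in> I ` ?G"
  then obtain ga where x: "x = I (\<Sum>l\<in>f. pj l (ga l))" "\<forall>l\<in>f. ga l \<in> Ga" by blast
  have "flag_vertex f + x \<in> range I" unfolding x using subspace_add[OF subspace_I] flag_vertex(1)[OF f] by blast
  moreover have "\<forall>h\<in>f. a h \<bullet> (flag_vertex f + x) = b h + lam h (ga h)"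
   using fproj_lam_sum[OF p f] flag_vertex(2)[OF f] by (simp add: x inner_add_right lam_def)
  ultimately have "flag_vertex f + x \<in> Ver S f" unfolding Ver_eq[OF f] using x(2) by blast
  then show "x \<in> (\<lambda>v. v - flag_vertex f) ` Ver S f" by (rule rev_image_eqI) simp
 next
  fix x assume "x \<in> (\<lambda>v. v - flag_vertex f) ` Ver S f"
  then obtain v ga where v: "x = v - flag_vertex f" "v \<in> range I" "\<forall>h\<in>f. ga h \<in> Ga" "\<forall>h\<in>f. a h \<bullet> v = b h + lam h (ga h)"
   unfolding Ver_eq[OF f] by blast
  have "x = I (\<Sum>l\<in>f. pj l (ga l))" using fproj_vertex[OF p f v(2), of ga] v(1,4) by simp
  then show "x \<in> I ` ?G" using v(3) by blast
 qed
 show e: "flag_group S f = ?G" unfolding flag_group_def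
 proof (rule the_equality)
  show "zsubgroup ?G \<and> (\<exists>M\<ge>1. ?G \<subseteq> (\<lambda>ga. (1 / real M) *\<^sub>R ga) ` Ga) \<and> I ` ?G = (\<lambda>v. v - flag_vertex f) ` Ver S f"
   using zG M sub img by blast
  fix G assume G: "zsubgroup G \<and> (\<exists>M\<ge>1. G \<subseteq> (\<lambda>ga. (1 / real M) *\<^sub>R ga) ` Ga) \<and> I ` G = (\<lambda>v. v - flag_vertex f) ` Ver S f"
  then obtain M' :: nat where M': "M' >= 1" "G \<subseteq> (\<lambda>ga. (1 / real M') *\<^sub>R ga) ` Ga" by blast
  have eq: "x = y" if "x \<in> G" "y \<in> ?G" "I x = I y" for x y
   by (rule scaled_inj[OF _ _ M'(1) M that(3)]) (use that M'(2) sub in blast)+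
  have iG: "I ` G = I ` ?G" using G img by simp
  show "G = ?G"
  proof (rule subset_antisym; rule subsetI)
   fix x assume x: "x \<in> G"
   then obtain y where "y \<in> ?G" "I x = I y" using iG by blast
   then show "x \<in> ?G" using eq[OF x] by blast
  next
   fix y assume y: "y \<in> ?G"
   then obtain x where "x \<in> G" "I y = I x" using iG by blast
   then show "y \<in> G" using eq[OF _ y] by metis
  qed
 qed
 show "zsubgroup (flag_group S f)" "g \<in> flag_group S f ==> real M *\<^sub>R g \<in> Ga"
  using zG MG unfolding e by blast+
qed

end

subsection \<open>Decompositions of constant stabiliser rank\<close>

locale csr_scheme = window_scheme S N a b w
 for S :: "('e::euclidean_space, 'l) cp_scheme" and N a b w +
 fixes Q :: "'e set set set"
 assumes csr: "CSR_decomposition S Q"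
begin

text \<open>The direction space of a wall is missing from exactly one member of \<open>Q\<close>:
  the wall cuts the summand of that part and its direction space contains all other
  summands.\<close>

definition tp :: "'e set \<Rightarrow> 'e set set" where "tp h = (THE T. T \<in> Q \<and> differences h h \<notin> T)"

lemma differences_wall: assumes h: "h \<in> Hs" shows "differences h h = {x \<in> range I. a h \<bullet> x = 0}"
proof -
 have e: "x \<in> h \<longleftrightarrow> x \<in> range I \<and> a h \<bullet> x = b h" for x using wall[OF h] unfolding dim_spaces(3) by blast
 show ?thesis
 proof (rule set_eqI, rule iffI)
  fix x assume "x \<in> differences h h"
  then obtain y z where "x = y - z" "y \<in> h" "z \<in> h" unfolding differences_def by blast
  then show "x \<in> {x \<in> range I. a h \<bullet> x = 0}" using e subspace_diff[OF subspace_I] by (simp add: inner_diff_right)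
 next
  fix x assume x: "x \<in> {x \<in> range I. a h \<bullet> x = 0}"
  then have "w h + x \<in> h" "w h \<in> h" using e w_I[OF h] w_wall[OF h] subspace_add[OF subspace_I] by (simp_all add: inner_add_right)
  then show "x \<in> differences h h" unfolding differences_def by (intro CollectI exI[of _ "w h + x"] exI[of _ "w h"]) simp
 qed
qed

lemma decomp: "T \<in> Q ==> T \<subset> hyperplanes0 S" "V \<in> hyperplanes0 S ==> \<exists>!T. T \<in> Q \<and> V \<notin> T"
 "internal S = (\<Sum>T\<in>Q. X_space S T)"
 using csr unfolding CSR_decomposition_def decomposition_def by blast+

lemma tp: assumes "h \<in> Hs" shows "tp h \<in> Q" "differences h h \<notin> tp h" "T \<in> Q ==> differences h h \<notin> T \<longleftrightarrow> T = tp h"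
proof -
 have e: "\<exists>!T. T \<in> Q \<and> differences h h \<notin> T" using decomp(2) assms by (simp add: hyperplanes0_def)
 from theI'[OF e] show 1: "tp h \<in> Q" "differences h h \<notin> tp h" by (simp_all add: tp_def)
 show "T \<in> Q ==> differences h h \<notin> T \<longleftrightarrow> T = tp h" using e 1 by blast
qed

lemma tp_surj: assumes "T \<in> Q" shows "\<exists>h\<in>Hs. tp h = T"
proof -
 obtain h where "h \<in> Hs" "differences h h \<notin> T" using decomp(1)[OF assms] unfolding hyperplanes0_def by blast
 then show ?thesis using tp(3)[OF _ assms] by blast
qed

lemma finite_Q: "finite Q"
 by (rule finite_subset[OF _ finite_imageI[OF finH, of tp]]) (use tp_surj in blast)

lemma X_eq: assumes T: "T \<in> Q" shows "X_space S T = {x \<in> range I. \<forall>h\<in>Hs. tp h ~= T --> a h \<bullet> x = 0}"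
proof -
 have "(\<forall>V\<in>T. x \<in> V) \<longleftrightarrow> (\<forall>h\<in>Hs. tp h ~= T --> a h \<bullet> x = 0)" if x: "x \<in> range I" for x
 proof -
  have "(\<forall>V\<in>T. x \<in> V) \<longleftrightarrow> (\<forall>h\<in>Hs. differences h h \<in> T --> x \<in> differences h h)"
   using decomp(1)[OF T] unfolding hyperplanes0_def by blast
  also have "\<dots> \<longleftrightarrow> (\<forall>h\<in>Hs. tp h ~= T --> a h \<bullet> x = 0)"
   using tp(3)[OF _ T] differences_wall x by blast
  finally show ?thesis .
 qed
 then show ?thesis unfolding X_space_def dim_spaces(3)[symmetric] by blast
qed

lemma subspace_walls: "subspace {x \<in> range I. \<forall>h\<in>Hs. R h --> a h \<bullet> x = 0}"
 by (rule subspaceI) (use subspace_0[OF subspace_I] subspace_add[OF subspace_I] subspace_scale[OF subspace_I] in \<open>simp_all add: inner_add_right\<close>)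

lemma subspace_X: assumes T: "T \<in> Q" shows "subspace (X_space S T)"
 unfolding X_eq[OF T] by (rule subspace_walls)

lemma decompose:
 assumes x: "x \<in> range I"
 shows "\<exists>c. (\<forall>T\<in>Q. c T \<in> X_space S T) \<and> x = (\<Sum>T\<in>Q. c T) \<and> (\<forall>T\<in>Q. \<forall>h\<in>Hs. a h \<bullet> c T = (if tp h = T then a h \<bullet> x else 0))"
proof -
 have "x \<in> (\<Sum>T\<in>Q. X_space S T)" using x decomp(3) dim_spaces(3) by simp
 then obtain c where c: "x = (\<Sum>T\<in>Q. c T)" "\<forall>T\<in>Q. c T \<in> X_space S T" unfolding set_sum_alt[OF finite_Q] by blast
 have "a h \<bullet> c T = (if tp h = T then a h \<bullet> x else 0)" if T: "T \<in> Q" and h: "h \<in> Hs" for T h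
 proof -
  have z: "a h \<bullet> c T' = 0" if "T' \<in> Q" "tp h ~= T'" for T' using c(2) X_eq[OF that(1)] that h by blast
  have "a h \<bullet> x = (\<Sum>T'\<in>Q. if T' = tp h then a h \<bullet> c (tp h) else 0)"
   unfolding c(1) inner_sum_right by (rule sum.cong) (use z in auto)
  also have "\<dots> = a h \<bullet> c (tp h)" using finite_Q tp(1)[OF h] by simp
  finally show ?thesis using z[OF T] by auto
 qed
 then show ?thesis using c by blast
qed

text \<open>The sum of the other summands is identified with the set of points having height 0 over
  all walls of type \<open>T\<close>. Thus a component is determined by its heights, the form in
  which it is used later.\<close>

lemma component:
 assumes T: "T \<in> Q" and x: "x \<in> range I"
 shows "component S Q T x \<in> range I" "h \<in> Hs ==> a h \<bullet> component S Q T x = (if tp h = T then a h \<bullet> x else 0)"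
proof -
 define Y where "Y = {x \<in> range I. \<forall>h\<in>Hs. tp h = T --> a h \<bullet> x = 0}"
 have fQT: "finite (Q - {T})" using finite_Q by blast
 have Y: "(\<Sum>T'\<in>Q - {T}. X_space S T') = Y"
 proof (rule subset_antisym; rule subsetI)
  fix y assume "y \<in> (\<Sum>T'\<in>Q - {T}. X_space S T')"
  then obtain c where c: "y = (\<Sum>T'\<in>Q - {T}. c T')" "\<forall>T'\<in>Q - {T}. c T' \<in> X_space S T'" unfolding set_sum_alt[OF fQT] by blast
  have cI: "c T' \<in> range I \<and> (\<forall>h\<in>Hs. tp h ~= T' --> a h \<bullet> c T' = 0)" if "T' \<in> Q - {T}" for T' using c(2) X_eq that by blast
  have "y \<in> range I" unfolding c(1) by (rule subspace_sum[OF subspace_I]) (use cI in blast)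
  moreover have "a h \<bullet> y = 0" if "h \<in> Hs" "tp h = T" for h
   unfolding c(1) inner_sum_right by (rule sum.neutral) (use cI that in blast)
  ultimately show "y \<in> Y" by (simp add: Y_def)
 next
  fix y assume y: "y \<in> Y"
  then have yI: "y \<in> range I" by (simp add: Y_def)
  from decompose[OF this] obtain c where c: "\<forall>T\<in>Q. c T \<in> X_space S T" "y = (\<Sum>T\<in>Q. c T)"
   "\<forall>T\<in>Q. \<forall>h\<in>Hs. a h \<bullet> c T = (if tp h = T then a h \<bullet> y else 0)" by blast
  have "c T = 0"
  proof (rule spanning)
   show "c T \<in> range I" using c(1) X_eq[OF T] T by blast
   show "\<And>h. h \<in> Hs ==> a h \<bullet> c T = 0" using c(3) T y by (simp add: Y_def)
  qed
  then have "y = (\<Sum>T'\<in>Q - {T}. c T')" unfolding c(2) using sum.remove[OF finite_Q T, of c] by simp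
  then show "y \<in> (\<Sum>T'\<in>Q - {T}. X_space S T')" unfolding set_sum_alt[OF fQT] using c(1) by blast
 qed
 have sY: "subspace Y" unfolding Y_def by (rule subspace_walls)
 have XY: "X_space S T \<inter> Y = {0}"
 proof -
  have "y = 0" if "y \<in> X_space S T \<inter> Y" for y
   by (rule spanning) (use that X_eq[OF T] in \<open>auto simp: Y_def\<close>)
  then show ?thesis using subspace_0[OF sY] subspace_0[OF subspace_X[OF T]] by blast
 qed
 obtain c where c: "\<forall>T\<in>Q. c T \<in> X_space S T" "\<forall>T\<in>Q. \<forall>h\<in>Hs. a h \<bullet> c T = (if tp h = T then a h \<bullet> x else 0)"
  using decompose[OF x] by blast
 have cT: "c T \<in> range I" using c(1) X_eq[OF T] T by blast
 have "component S Q T x = c T" unfolding component_def Y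
 proof (rule proj_eqI[OF subspace_X[OF T] sY XY])
  show "c T \<in> X_space S T" using c(1) T by blast
  show "x - c T \<in> Y" using c(2) T x cT subspace_diff[OF subspace_I] by (simp add: Y_def inner_diff_right)
 qed
 then show "component S Q T x \<in> range I" "h \<in> Hs ==> a h \<bullet> component S Q T x = (if tp h = T then a h \<bullet> x else 0)"
  using cT c(2) T by auto
qed

text \<open>\<open>u j\<close> and its component of type \<open>tp j\<close> have the same heights
  over the walls of the flag, hence coincide.\<close>

lemma dual_type:
 assumes f: "flag f" and u: "\<And>h. h \<in> f ==> u h \<in> range I"
  "\<And>h l. h \<in> f ==> l \<in> f ==> a l \<bullet> u h = (if l = h then 1 else 0)" and j: "j \<in> f"
 shows "u j \<in> X_space S (tp j)"
proof -
 have jH: "j \<in> Hs" by (rule flag_Hs[OF f j])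
 let ?c = "component S Q (tp j) (u j)"
 note c = component[OF tp(1)[OF jH] u(1)[OF j]]
 have "a h \<bullet> u j = a h \<bullet> ?c" if h: "h \<in> f" for h
  using c(2)[OF flag_Hs[OF f h]] u(2)[OF j h] by (auto split: if_splits)
 then have "u j = ?c" by (rule flag_ext[OF f u(1)[OF j] c(1)])
 then have "a h \<bullet> u j = 0" if "h \<in> Hs" "tp h ~= tp j" for h using c(2)[OF that(1)] that(2) by (simp split: if_splits)
 then show ?thesis unfolding X_eq[OF tp(1)[OF jH]] using u(1)[OF j] by blast
qed

text \<open>The dual basis is sorted by type: the vectors \<open>u h\<close> with
  \<open>tp h = T\<close> form a basis of the summand of \<open>T\<close>.\<close>

lemma dim_X:
 assumes f: "flag f" and T: "T \<in> Q" shows "dim (X_space S T) = card {h \<in> f. tp h = T}"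
proof -
 obtain u where "dual f u" using flag_dual[OF f] by blast
 note u = dualD[OF this]
 have ff: "finite f" by (rule flag_finite[OF f])
 let ?F = "{h \<in> f. tp h = T}"
 have inj: "inj_on u f"
 proof (rule inj_onI)
  fix h l assume hl: "h \<in> f" "l \<in> f" "u h = u l"
  then have "a h \<bullet> u l = 1" using u(2)[of h h] by simp
  then show "h = l" using u(2)[OF hl(2,1)] by (auto split: if_splits)
 qed
 have ind: "independent (u ` ?F)"
 proof
  assume "dependent (u ` ?F)"
  then obtain t v where t: "v \<in> u ` ?F" "t v ~= 0" "(\<Sum>x\<in>u ` ?F. t x *\<^sub>R x) = 0" using ff by (auto simp: dependent_finite)
  then obtain h where h: "h \<in> f" "v = u h" by blast
  have "(\<Sum>x\<in>?F. t (u x) *\<^sub>R u x) = 0" using t(3) sum.reindex[of u ?F "\<lambda>x. t x *\<^sub>R x"] inj_on_subset[OF inj, of ?F] by auto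
  then have "(\<Sum>x\<in>f. (if tp x = T then t (u x) else 0) *\<^sub>R u x) = 0"
   using ff by (simp add: sum.inter_filter if_distrib[of "\<lambda>c. c *\<^sub>R _"] cong: if_cong)
  then have "(if tp h = T then t (u h) else 0) = 0" using dual_coord[OF f u(2) h(1), of "\<lambda>x. if tp x = T then t (u x) else 0"] by simp
  moreover have "tp h = T" using t(1) h inj by (auto dest: inj_onD)
  ultimately show False using t(2) h(2) by simp
 qed
 have "span (u ` ?F) = X_space S T"
 proof
  show "span (u ` ?F) \<subseteq> X_space S T" by (rule span_minimal[OF _ subspace_X[OF T]]) (use dual_type[OF f u] in blast)
  show "X_space S T \<subseteq> span (u ` ?F)"
  proof
   fix x assume x: "x \<in> X_space S T"
   have "x = (\<Sum>h\<in>f. (a h \<bullet> x) *\<^sub>R u h)" by (rule flag_expand[OF f u]) (use x X_eq[OF T] in blast)+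
   also have "\<dots> \<in> span (u ` ?F)"
   proof (rule span_sum)
    fix h assume h: "h \<in> f"
    show "(a h \<bullet> x) *\<^sub>R u h \<in> span (u ` ?F)"
    proof (cases "tp h = T")
     case True then show ?thesis using h by (intro span_scale span_base) blast
    next
     case False
     then have "a h \<bullet> x = 0" using x X_eq[OF T] flag_Hs[OF f h] by blast
     then show ?thesis by (simp add: span_zero)
    qed
   qed
   finally show "x \<in> span (u ` ?F)" .
  qed
 qed
 then have "dim (X_space S T) = card (u ` ?F)" using ind by (metis dim_eq_card_independent dim_span)
 then show ?thesis using card_image[OF inj_on_subset[OF inj, of ?F]] by auto
qed

section \<open>Ranks of the stabilisers in a CSR decomposition\<close>

abbreviation st :: "'e set set \<Rightarrow> 'e set" where "st \<equiv> stabiliser S"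

lemma st_eq: assumes T: "T \<in> Q" shows "st T = {ga \<in> Ga. \<forall>h\<in>Hs. tp h ~= T --> lam h ga = 0}"
proof -
 have "st T = {ga \<in> Ga. I ga \<in> X_space S T}" using range_to_int[OF scheme] by (auto simp: stabiliser_def X_space_def)
 then show ?thesis unfolding X_eq[OF T] lam_def by blast
qed

lemma st_sub: assumes T: "T \<in> Q" shows "zsubgroup (st T)" "st T \<subseteq> Ga" "zrank (st T) = dim (st T)"
proof -
 show z: "zsubgroup (st T)" "st T \<subseteq> Ga"
  unfolding zsubgroup_iff st_eq[OF T] by (auto simp: lat_0 lat_add lat_scale lam_add lam_scale lam_0)
 show "zrank (st T) = dim (st T)" by (rule zrank_sublattice[OF sublatticeI[OF z]])
qed

text \<open>Finite index, by the pigeonhole principle for the cosets of the multiples of a lattice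
  vector, puts a nonzero multiple of it into the sum of the stabilisers.\<close>

lemma span_st: "span (\<Union>T\<in>Q. st T) = UNIV"
proof -
 let ?A = "\<Sum>T\<in>Q. st T"
 have A: "x \<in> ?A ==> x \<in> span (\<Union>T\<in>Q. st T)" for x
  unfolding set_sum_alt[OF finite_Q] by (auto intro!: span_sum intro: span_base)
 have fin: "finite ((\<lambda>g. g +o ?A) ` Ga)" using csr by (simp add: CSR_decomposition_def finite_index_def)
 have A0: "0 \<in> ?A" unfolding set_sum_alt[OF finite_Q]
  using zmod.subspace_0[OF st_sub(1)] by (intro CollectI exI[of _ "\<lambda>_. 0"]) simp
 have "ga \<in> span (\<Union>T\<in>Q. st T)" if g: "ga \<in> Ga" for ga
 proof -
  have "range (\<lambda>m::nat. (real m *\<^sub>R ga) +o ?A) \<subseteq> (\<lambda>g. g +o ?A) ` Ga"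
   using lat_scale[OF g, of "int _"] by auto
  then have "\<not> inj (\<lambda>m::nat. (real m *\<^sub>R ga) +o ?A)" using fin finite_subset range_inj_infinite by blast
  then obtain p q :: nat where pq: "p ~= q" "(real p *\<^sub>R ga) +o ?A = (real q *\<^sub>R ga) +o ?A" unfolding inj_def by blast
  have "real p *\<^sub>R ga \<in> (real p *\<^sub>R ga) +o ?A" using A0 by (force simp: elt_set_plus_def)
  then have "real p *\<^sub>R ga \<in> (real q *\<^sub>R ga) +o ?A" unfolding pq(2) .
  then obtain x where "x \<in> ?A" "real p *\<^sub>R ga = real q *\<^sub>R ga + x" unfolding elt_set_plus_def by blast
  then have "(real p - real q) *\<^sub>R ga \<in> span (\<Union>T\<in>Q. st T)" using A by (simp add: algebra_simps)
  then have "(1 / (real p - real q)) *\<^sub>R (real p - real q) *\<^sub>R ga \<in> span (\<Union>T\<in>Q. st T)" by (rule span_scale)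
  then show ?thesis using pq(1) by simp
 qed
 then have "span Ga \<subseteq> span (\<Union>T\<in>Q. st T)" by (intro span_minimal) auto
 then show ?thesis using lattice_span by blast
qed

text \<open>The stabilisers are independent: those of other parts have height 0 over all walls of
  type \<open>T\<close>, and a vector of \<open>st T\<close> with that property has all heights
  0.\<close>

lemma sum_dim_st: "(\<Sum>T\<in>Q. dim (st T)) = DIM('e)"
proof -
 have "(\<Sum>T\<in>F. dim (st T)) = dim (\<Union>T\<in>F. st T)" if "F \<subseteq> Q" for F
  using finite_subset[OF that finite_Q] that
 proof (induction F rule: finite_induct)
  case empty then show ?case by simp
 next
  case (insert T F)
  then have T: "T \<in> Q" by simp
  define A where "A = {ga \<in> Ga. \<forall>h\<in>Hs. tp h = T --> lam h ga = 0}"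
  have A: "zsubgroup A" "A \<subseteq> Ga"
   unfolding zsubgroup_iff A_def by (auto simp: lat_0 lat_add lat_scale lam_add lam_scale lam_0)
  have "ga = 0" if "ga \<in> A \<inter> st T" for ga
  proof -
   have "ga \<in> Ga" "\<forall>h\<in>Hs. lam h ga = 0" using that unfolding A_def st_eq[OF T] by blast+
   moreover from this have "I ga = 0" by (intro spanning) (auto simp: lam_def)
   ultimately show ?thesis using injI by blast
  qed
  then have "span (A \<inter> st T) \<subseteq> span {0}" by (intro span_mono) blast
  then have tr: "span A \<inter> span (st T) \<subseteq> {0}" using span_Int_sublattice[OF A st_sub(1,2)[OF T]] by simp
  have "(\<Union>T\<in>F. st T) \<subseteq> A"
  proof
   fix g assume "g \<in> (\<Union>T\<in>F. st T)"
   then obtain T' where "T' \<in> F" "g \<in> st T'" by blast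
   moreover have "T' ~= T" "T' \<in> Q" using insert \<open>T' \<in> F\<close> by auto
   ultimately show "g \<in> A" unfolding A_def st_eq[OF \<open>T' \<in> Q\<close>] by auto
  qed
  then have "span (\<Union>T\<in>F. st T) \<inter> span (st T) \<subseteq> {0}" using tr span_mono by blast
  then have "dim (span (\<Union>T\<in>F. st T) \<inter> span (st T)) = 0" by simp
  moreover have "dim {x + y |x y. x \<in> span (\<Union>T\<in>F. st T) \<and> y \<in> span (st T)} = dim (\<Union>T\<in>insert T F. st T)"
   using span_Un[of "\<Union>T\<in>F. st T" "st T"] by (metis UN_insert Un_commute dim_span)
  moreover note dim_sums_Int[OF subspace_span subspace_span, of "\<Union>T\<in>F. st T" "st T"]
  ultimately have "dim (\<Union>T\<in>insert T F. st T) = dim (\<Union>T\<in>F. st T) + dim (st T)" unfolding dim_span by linarith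
  then show ?case using insert by simp
 qed
 from this[OF order_refl] show ?thesis using span_st by (metis dim_UNIV dim_span)
qed

text \<open>The stabilisers of the other parts lie in \<open>U h\<close>, so the codimension of
  \<open>U h\<close> can be computed inside the span of \<open>st (tp h)\<close>, where the rank in
  the CSR condition bounds it. Equality follows by counting in \<open>dlt_delta\<close>.\<close>

lemma cdim_le: assumes h: "h \<in> Hs" shows "real (cdim h) <= delta S (tp h) + 1"
proof -
 let ?T = "tp h"
 have T: "?T \<in> Q" by (rule tp(1)[OF h])
 let ?K = "st {differences h h} \<inter> st ?T"
 have K: "?K = {ga \<in> st ?T. lam h ga = 0}"
  using st_sub(2)[OF T] by (auto simp: stabiliser_def differences_wall[OF h] lam_def)
 have "sublattice ?K" unfolding K
  by (rule sublatticeI) (use st_sub(1,2)[OF T] in \<open>auto simp: zsubgroup_iff lam_0 lam_add lam_scale\<close>)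
 then have zK: "zrank ?K = dim ?K" by (rule zrank_sublattice)
 have "differences h h \<in> hyperplanes0 S - ?T" using tp(2)[OF h] h by (simp add: hyperplanes0_def)
 then have rk: "real (dim ?K) = real (dim (st ?T)) - delta S ?T - 1"
  using csr T zK st_sub(3)[OF T] unfolding CSR_decomposition_def by force
 have "?K \<subseteq> stab h" unfolding K using st_sub(2)[OF T] by (auto simp: stab_def)
 then have "span ?K \<subseteq> U h \<inter> span (st ?T)" unfolding U_def using span_mono[of ?K] by (simp add: span_mono)
 then have d1: "dim ?K <= dim (U h \<inter> span (st ?T))" by (metis dim_span dim_subset)
 have "st T' \<subseteq> U h \<union> st ?T" if "T' \<in> Q" for T'
 proof (cases "T' = ?T")
  case False
  then have "st T' \<subseteq> stab h" unfolding st_eq[OF that] using h by (auto simp: stab_def)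
  then show ?thesis unfolding U_def using span_superset[of "stab h"] by blast
 qed simp
 then have "span (\<Union>T\<in>Q. st T) \<subseteq> span (U h \<union> st ?T)" by (intro span_mono) blast
 then have "{x + y |x y. x \<in> U h \<and> y \<in> span (st ?T)} = UNIV"
  using span_st span_Un[of "U h" "st ?T"] span_eq_iff[THEN iffD2, OF subspace_U, of h] by auto
 then have "dim {x + y |x y. x \<in> U h \<and> y \<in> span (st ?T)} = DIM('e)" by (metis dim_UNIV)
 then have "DIM('e) + dim (U h \<inter> span (st ?T)) = dim (U h) + dim (st ?T)"
  using dim_sums_Int[OF subspace_U subspace_span, of h "st ?T"] by simp
 then have "real (cdim h) = real (dim (st ?T)) - real (dim (U h \<inter> span (st ?T)))"
  using dim_U(2)[of h] by (simp add: cdim_def of_nat_diff)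
 then show ?thesis using d1 rk by linarith
qed

text \<open>A part of dimension \<open>n_i\<close> contributes \<open>n_i\<close> walls to the flag
  and hence \<open>n_i (\<delta>_i + 1) = k_i\<close>; the ranks \<open>k_i\<close> add up to the
  full rank.\<close>

lemma sum_delta: assumes f: "flag f" shows "(\<Sum>h\<in>f. delta S (tp h) + 1) = DIM('e)"
proof -
 have ff: "finite f" by (rule flag_finite[OF f])
 have nz: "dim (X_space S T) ~= 0" if T: "T \<in> Q" for T
 proof -
  obtain h where "h \<in> Hs" "tp h = T" using tp_surj[OF T] by blast
  moreover then obtain f' where "flag f'" "h \<in> f'" using flag_extend by blast
  ultimately show ?thesis using dim_X[OF _ T, of f'] flag_finite[of f'] by auto
 qed
 have "(\<Sum>h\<in>f. delta S (tp h) + 1) = (\<Sum>T\<in>Q. \<Sum>h\<in>{h\<in>f. tp h = T}. delta S (tp h) + 1)"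
  by (rule sum.group[symmetric, OF ff finite_Q]) (use tp(1) flag_Hs[OF f] in blast)
 also have "\<dots> = (\<Sum>T\<in>Q. real (dim (st T)))"
 proof (rule sum.cong[OF refl])
  fix T assume T: "T \<in> Q"
  have "(\<Sum>h\<in>{h\<in>f. tp h = T}. delta S (tp h) + 1) = real (dim (X_space S T)) * (delta S T + 1)"
   by (simp add: dim_X[OF f T])
  also have "\<dots> = real (dim (st T))" using nz[OF T] st_sub(3)[OF T] by (simp add: delta_def field_simps)
  finally show "(\<Sum>h\<in>{h\<in>f. tp h = T}. delta S (tp h) + 1) = real (dim (st T))" .
 qed
 finally show ?thesis using sum_dim_st by (metis of_nat_sum)
qed

lemma csr_RC: RC
proof -
 have "(\<Sum>h\<in>f. cdim h) = DIM('e)" if f: "flag f" for f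
 proof -
  have "(\<Sum>h\<in>f. real (cdim h)) <= (\<Sum>h\<in>f. delta S (tp h) + 1)"
   by (rule sum_mono) (use cdim_le flag_Hs[OF f] in blast)
  then have "real (\<Sum>h\<in>f. cdim h) <= real (DIM('e))" using sum_delta[OF f] by simp
  then have "(\<Sum>h\<in>f. cdim h) <= DIM('e)" by (simp only: of_nat_le_iff)
  then show ?thesis using sum_cdim_ge[OF f] by simp
 qed
 then show ?thesis by (simp add: RC_def)
qed

text \<open>Both sides have the same sum over a flag and are ordered termwise, so they agree
  termwise.\<close>

lemma dlt_delta: assumes h: "h \<in> Hs" shows "real (dlt h) = delta S (tp h)"
proof -
 obtain f where f: "flag f" "h \<in> f" using flag_extend[OF h] by blast
 have "(\<Sum>h\<in>f. delta S (tp h) + 1 - real (cdim h)) = 0"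
  using sum_delta[OF f(1)] csr_RC f(1) by (simp add: sum_subtractf RC_def flip: of_nat_sum)
 moreover have "\<And>l. l \<in> f ==> 0 <= delta S (tp l) + 1 - real (cdim l)" using cdim_le flag_Hs[OF f(1)] by force
 ultimately have "delta S (tp h) + 1 - real (cdim h) = 0"
  using sum_nonneg_eq_0_iff[OF flag_finite[OF f(1)], of "\<lambda>l. delta S (tp l) + 1 - real (cdim l)"] f(2) by blast
 then show ?thesis using Suc_dlt[OF h] by linarith
qed

end

subsection \<open>The Diophantine condition\<close>

lemma zspan_image:
 assumes f: "linear f" shows "zspan (f ` B) = f ` zspan B"
proof (rule subset_antisym)
 have "zsubgroup (f ` zspan B)"
  using zmod.subspace_span[of B] unfolding zsubgroup_iff
  by (auto simp: linear_0[OF f, symmetric] linear_add[OF f, symmetric] linear_scale[OF f, symmetric] simp del: of_int_mult)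
 then show "zspan (f ` B) \<subseteq> f ` zspan B" by (intro zmod.span_minimal) (auto intro: zmod.span_base)
 have "zsubgroup {x. f x \<in> zspan (f ` B)}"
  using zmod.subspace_span[of "f ` B"] unfolding zsubgroup_iff by (simp add: linear_0[OF f] linear_add[OF f] linear_scale[OF f])
 then have "zspan B \<subseteq> {x. f x \<in> zspan (f ` B)}" by (intro zmod.span_minimal) (auto intro: zmod.span_base)
 then show "f ` zspan B \<subseteq> zspan (f ` B)" by blast
qed

text \<open>Used for \<open>I\<close> on groups whose rank exceeds the internal dimension:
  \<open>I\<close> is injective on the group but not on its real span, so independence can be
  transferred over the integers only.\<close>

lemma zbasis_image:
 assumes f: "linear f" and G: "zsubgroup G" and inj: "inj_on f G" and BG: "B \<subseteq> G"
 shows "zbasis (f ` B) (f ` G) \<longleftrightarrow> zbasis B G"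
proof -
 have injB: "inj_on f B" by (rule inj_on_subset[OF inj BG])
 have "zspan (f ` B) = f ` G \<longleftrightarrow> zspan B = G"
  unfolding zspan_image[OF f] by (rule inj_on_image_eq_iff[OF inj zmod.span_minimal[OF BG G] order_refl])
 moreover have "zdependent (f ` B) \<longleftrightarrow> zdependent B" if fB: "finite B"
 proof
  assume "zdependent B"
  then obtain u v where u: "v \<in> B" "u v ~= (0::int)" "(\<Sum>v\<in>B. real_of_int (u v) *\<^sub>R v) = 0"
   using fB by (auto simp: zmod.dependent_finite)
  have "(\<Sum>x\<in>f ` B. real_of_int (u (inv_into B f x)) *\<^sub>R x) = (\<Sum>v\<in>B. real_of_int (u v) *\<^sub>R f v)"
   using injB by (simp add: sum.reindex)
  also have "\<dots> = f (\<Sum>v\<in>B. real_of_int (u v) *\<^sub>R v)" by (simp add: linear_sum[OF f] linear_scale[OF f])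
  finally have "(\<Sum>x\<in>f ` B. real_of_int (u (inv_into B f x)) *\<^sub>R x) = 0" using u(3) linear_0[OF f] by simp
  moreover have "u (inv_into B f (f v)) ~= 0" using u(1,2) injB by simp
  ultimately show "zdependent (f ` B)" using u(1) fB
   by (simp add: zmod.dependent_finite) (intro exI[of _ "\<lambda>x. u (inv_into B f x)"] conjI bexI[of _ v]; assumption)
 next
  assume "zdependent (f ` B)"
  then obtain u v where u: "v \<in> B" "u (f v) ~= (0::int)" "(\<Sum>x\<in>f ` B. real_of_int (u x) *\<^sub>R x) = 0"
   using fB by (auto simp: zmod.dependent_finite)
  have "f (\<Sum>v\<in>B. real_of_int (u (f v)) *\<^sub>R v) = (\<Sum>x\<in>f ` B. real_of_int (u x) *\<^sub>R x)"
   using injB by (simp add: sum.reindex linear_sum[OF f] linear_scale[OF f])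
  then have "f (\<Sum>v\<in>B. real_of_int (u (f v)) *\<^sub>R v) = f 0" using u(3) linear_0[OF f] by simp
  moreover have "(\<Sum>v\<in>B. real_of_int (u (f v)) *\<^sub>R v) \<in> G"
   by (rule zmod.subspace_sum[OF G], rule zmod.subspace_scale[OF G]) (use BG in blast)
  ultimately have "(\<Sum>v\<in>B. real_of_int (u (f v)) *\<^sub>R v) = 0" using inj zmod.subspace_0[OF G] by (auto dest: inj_onD)
  then show "zdependent B" using u(1,2) fB
   by (simp add: zmod.dependent_finite) (intro exI[of _ "\<lambda>x. u (f x)"] conjI bexI[of _ v]; assumption)
 qed
 moreover have "finite (f ` B) \<longleftrightarrow> finite B" by (rule finite_image_iff[OF injB])
 ultimately show ?thesis unfolding zbasis_def by blast
qed

lemma eta_coeffs: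
 assumes f: "linear f" and G: "zsubgroup G" and inj: "inj_on f G" and BG: "B \<subseteq> G"
  and z: "zbasis (f ` B) (f ` G)" and g: "g \<in> G" "g ~= 0"
 shows "\<exists>m. g = (\<Sum>e\<in>B. real_of_int (m e) *\<^sub>R e) \<and> (\<forall>e\<in>B. \<bar>m e\<bar> <= eta (f ` B) (f g)) \<and> (\<exists>e\<in>B. \<bar>m e\<bar> = eta (f ` B) (f g)) \<and> 1 <= eta (f ` B) (f g)"
proof -
 have injB: "inj_on f B" by (rule inj_on_subset[OF inj BG])
 have fB: "finite B" using z finite_image_iff[OF injB] by (simp add: zbasis_def)
 define m where "m e = zrepresentation (f ` B) (f g) (f e)" for e
 have "f g = (\<Sum>x\<in>f ` B. real_of_int (zrepresentation (f ` B) (f g) x) *\<^sub>R x)"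
  using z g(1) fB unfolding zbasis_def by (intro zmod.sum_representation_eq[symmetric]) auto
 also have "\<dots> = f (\<Sum>e\<in>B. real_of_int (m e) *\<^sub>R e)"
  using injB by (simp add: sum.reindex m_def linear_sum[OF f] linear_scale[OF f])
 finally have "f g = f (\<Sum>e\<in>B. real_of_int (m e) *\<^sub>R e)" .
 moreover have "(\<Sum>e\<in>B. real_of_int (m e) *\<^sub>R e) \<in> G"
  by (rule zmod.subspace_sum[OF G], rule zmod.subspace_scale[OF G]) (use BG in blast)
 ultimately have gm: "g = (\<Sum>e\<in>B. real_of_int (m e) *\<^sub>R e)" using inj_onD[OF inj] g(1) by blast
 have "\<exists>e\<in>B. m e ~= 0" using g(2) unfolding gm by (metis (mono_tags, lifting) of_int_0 scale_eq_0_iff sum.neutral)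
 then obtain e0 where e0: "e0 \<in> B" "m e0 ~= 0" by blast
 have im: "(\<lambda>b. \<bar>zrepresentation (f ` B) (f g) b\<bar>) ` f ` B = (\<lambda>e. \<bar>m e\<bar>) ` B" by (simp add: image_image m_def)
 have fin: "finite ((\<lambda>e. \<bar>m e\<bar>) ` B)" and ne: "(\<lambda>e. \<bar>m e\<bar>) ` B ~= {}" using fB e0(1) by auto
 have le: "\<bar>m e\<bar> <= eta (f ` B) (f g)" if "e \<in> B" for e unfolding eta_def im using Max_ge[OF fin] that by blast
 moreover have "\<exists>e\<in>B. \<bar>m e\<bar> = eta (f ` B) (f g)" unfolding eta_def im using Max_in[OF fin ne] by force
 moreover have "1 <= eta (f ` B) (f g)" using le[OF e0(1)] e0(2) by linarith
 ultimately show ?thesis using gm by blast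
qed

text \<open>The coefficients are read off upstairs, where the basis is independent over the reals;
  the norm on the right is therefore that of \<open>g\<close> and not of its image.\<close>

lemma eta_le:
 fixes B :: "'a::euclidean_space set"
 assumes f: "linear f" and G: "zsubgroup G" and inj: "inj_on f G" and BG: "B \<subseteq> G"
  and z: "zbasis (f ` B) (f ` G)" and B: "independent B"
 shows "\<exists>C>0. \<forall>g\<in>G. g ~= 0 --> real_of_int (eta (f ` B) (f g)) <= C * norm g"
proof -
 obtain C where C: "C > 0" "\<And>u b. b \<in> B ==> \<bar>u b\<bar> <= C * norm (\<Sum>v\<in>B. u v *\<^sub>R v)" using coordinate_bound[OF B] by blast
 have "real_of_int (eta (f ` B) (f g)) <= C * norm g" if g: "g \<in> G" "g ~= 0" for g
 proof -
  obtain m e where m: "g = (\<Sum>e\<in>B. real_of_int (m e) *\<^sub>R e)" "e \<in> B" "\<bar>m e\<bar> = eta (f ` B) (f g)"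
   using eta_coeffs[OF f G inj BG z g] by blast
  show ?thesis using C(2)[OF m(2), of "\<lambda>e. real_of_int (m e)"] unfolding m(1)[symmetric] m(3)[symmetric] by simp
 qed
 then show ?thesis using C(1) by blast
qed

context csr_scheme begin

lemma fproj_type:
 assumes p: "fproj f pj M" and f: "flag f" and l: "l \<in> f" and h: "h \<in> Hs" "tp h ~= tp l"
 shows "lam h (pj l x) = 0"
proof -
 obtain u where "dual f u" using flag_dual[OF f] by blast
 note u = dualD[OF this]
 have "I (pj l x) = lam l x *\<^sub>R u l"
 proof (rule flag_ext[OF f])
  show "lam l x *\<^sub>R u l \<in> range I" by (intro subspace_scale[OF subspace_I] u(1) l)
  fix j assume j: "j \<in> f"
  show "a j \<bullet> I (pj l x) = a j \<bullet> (lam l x *\<^sub>R u l)" using fproj_lam[OF p f j l, of x] u(2)[OF l j] by (simp add: lam_def)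
 qed simp
 moreover have "a h \<bullet> u l = 0" using dual_type[OF f u l] X_eq[OF tp(1)[OF flag_Hs[OF f l]]] h by blast
 ultimately show ?thesis by (simp add: lam_def)
qed

text \<open>Dropping the axes of all other types amounts to projecting to the part \<open>T\<close>,
  since each axis has heights only over walls of its own type.\<close>

lemma lam_truncate:
 assumes p: "fproj f pj M" and f: "flag f" and h: "h \<in> Hs"
 shows "lam h (\<Sum>l\<in>f. pj l (if tp l = T then ga l else 0)) = (if tp h = T then lam h (\<Sum>l\<in>f. pj l (ga l)) else 0)"
proof -
 have "lam h (pj l (if tp l = T then ga l else 0)) = (if tp h = T then lam h (pj l (ga l)) else 0)" if l: "l \<in> f" for l
  using fproj_type[OF p f l h, of "ga l"] fproj_zero[OF p l] lam_0 by auto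
 then show ?thesis by (simp add: lam_sum)
qed

lemma fproj_bound:
 assumes p: "fproj f pj M" and f: "flag f"
 shows "\<exists>K>0. \<forall>ga r. (\<forall>l\<in>f. norm (ga l) <= r) --> norm (\<Sum>l\<in>f. pj l (ga l)) <= K * r"
proof -
 have "\<forall>l\<in>f. \<exists>k. k > 0 \<and> (\<forall>x. norm (pj l x) <= k * norm x)"
  using p unfolding fproj_def by (meson linear_bounded_pos)
 from bchoice[OF this] obtain k where k: "\<And>l. l \<in> f ==> k l > 0" "\<And>l x. l \<in> f ==> norm (pj l x) <= k l * norm x" by blast
 have "norm (\<Sum>l\<in>f. pj l (ga l)) <= (\<Sum>l\<in>f. k l) * r" if "\<forall>l\<in>f. norm (ga l) <= r" for ga r
  unfolding sum_distrib_right
 proof (rule sum_norm_le)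
  fix l assume l: "l \<in> f"
  have "k l * norm (ga l) <= k l * r" using that l k(1)[OF l] by (intro mult_left_mono) auto
  then show "norm (pj l (ga l)) <= k l * r" using k(2)[OF l, of "ga l"] by linarith
 qed
 moreover have "(\<Sum>l\<in>f. k l) > 0" using k(1) flag_ne[OF f] flag_finite[OF f] by (intro sum_pos) auto
 ultimately show ?thesis by blast
qed

text \<open>The group lies between \<open>st T\<close> and its real span, because the product of the
  two denominators carries it into \<open>st T\<close>. So it has the rank, and hence the
  Diophantine exponent, of the part \<open>T\<close>.\<close>

lemma flag_group2:
 assumes p: "fproj f pj M" and f: "flag f" and p': "fproj f' pj' M'" and f': "flag f'" and T: "T \<in> Q"
 defines "G \<equiv> flag_group2_in S T f f'"
 shows "g \<in> G \<longleftrightarrow> (\<exists>ga ga'. (\<forall>l\<in>f. ga l \<in> Ga) \<and> (\<forall>l\<in>f'. ga' l \<in> Ga) \<and> g = (\<Sum>l\<in>f. pj l (ga l)) - (\<Sum>l\<in>f'. pj' l (ga' l))) \<and>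
   (\<forall>h\<in>Hs. tp h ~= T --> lam h g = 0)"
  and "sublattice G" "inj_on I G" "dim G = dim (st T)"
proof -
 note g1 = flag_group_eq[OF p f] and g2 = flag_group_eq[OF p' f']
 have M: "M >= 1" "M' >= 1" using p p' by (simp_all add: fproj_def)
 have X: "I g \<in> X_space S T \<longleftrightarrow> (\<forall>h\<in>Hs. tp h ~= T --> lam h g = 0)" for g by (simp add: X_eq[OF T] lam_def)
 have mem: "g \<in> G \<longleftrightarrow> (\<exists>x\<in>flag_group S f. \<exists>y\<in>flag_group S f'. g = x - y) \<and> (\<forall>h\<in>Hs. tp h ~= T --> lam h g = 0)" for g
  unfolding G_def flag_group2_in_def flag_group2_def differences_def X[symmetric] by blast
 show "g \<in> G \<longleftrightarrow> (\<exists>ga ga'. (\<forall>l\<in>f. ga l \<in> Ga) \<and> (\<forall>l\<in>f'. ga' l \<in> Ga) \<and> g = (\<Sum>l\<in>f. pj l (ga l)) - (\<Sum>l\<in>f'. pj' l (ga' l))) \<and>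
   (\<forall>h\<in>Hs. tp h ~= T --> lam h g = 0)"
  unfolding mem g1(1) g2(1) by blast
 have zG: "zsubgroup G" unfolding zsubgroup_iff
 proof (intro conjI ballI allI)
  show "0 \<in> G" unfolding mem using zmod.subspace_0[OF g1(2)] zmod.subspace_0[OF g2(2)] by (auto simp: lam_0)
  fix x y assume "x \<in> G" "y \<in> G"
  then obtain s t s' t' where "x = s - t" "y = s' - t'" "s \<in> flag_group S f" "s' \<in> flag_group S f" "t \<in> flag_group S f'" "t' \<in> flag_group S f'"
   and l: "\<forall>h\<in>Hs. tp h ~= T --> lam h x = 0" "\<forall>h\<in>Hs. tp h ~= T --> lam h y = 0" unfolding mem by blast
  then have "s + s' \<in> flag_group S f" "t + t' \<in> flag_group S f'" "x + y = (s + s') - (t + t')"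
   using zmod.subspace_add[OF g1(2)] zmod.subspace_add[OF g2(2)] by auto
  moreover have "\<forall>h\<in>Hs. tp h ~= T --> lam h (x + y) = 0" using l by (simp add: lam_add)
  ultimately show "x + y \<in> G" unfolding mem by blast
 next
  fix m x assume "x \<in> G"
  then obtain s t where "x = s - t" "s \<in> flag_group S f" "t \<in> flag_group S f'" and l: "\<forall>h\<in>Hs. tp h ~= T --> lam h x = 0"
   unfolding mem by blast
  then have "real_of_int m *\<^sub>R s \<in> flag_group S f" "real_of_int m *\<^sub>R t \<in> flag_group S f'"
   "real_of_int m *\<^sub>R x = real_of_int m *\<^sub>R s - real_of_int m *\<^sub>R t"
   using zmod.subspace_scale[OF g1(2)] zmod.subspace_scale[OF g2(2)] by (auto simp: scaleR_diff_right)
  moreover have "\<forall>h\<in>Hs. tp h ~= T --> lam h (real_of_int m *\<^sub>R x) = 0" using l by (simp add: lam_scale)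
  ultimately show "real_of_int m *\<^sub>R x \<in> G" unfolding mem by blast
 qed
 let ?c = "1 / real (M * M')"
 have MG: "real (M * M') *\<^sub>R g \<in> Ga" if gG: "g \<in> G" for g
 proof -
  obtain s t where st: "g = s - t" "s \<in> flag_group S f" "t \<in> flag_group S f'" using gG unfolding mem by blast
  have "real (M * M') *\<^sub>R g = real_of_int (int M') *\<^sub>R (real M *\<^sub>R s) - real_of_int (int M) *\<^sub>R (real M' *\<^sub>R t)"
   by (simp add: st(1) scaleR_diff_right mult.commute)
  then show ?thesis using lat_diff[OF lat_scale[OF g1(3)[OF st(2)]] lat_scale[OF g2(3)[OF st(3)]]] by metis
 qed
 have sub: "G \<subseteq> (\<lambda>ga. ?c *\<^sub>R ga) ` Ga"
 proof
  fix g assume "g \<in> G"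
  moreover have "g = ?c *\<^sub>R (real (M * M') *\<^sub>R g)" using M by simp
  ultimately show "g \<in> (\<lambda>ga. ?c *\<^sub>R ga) ` Ga" using MG by blast
 qed
 show "inj_on I G"
  by (rule inj_onI, rule scaled_inj[of _ "M * M'" _ "M * M'"]) (use sub M in \<open>auto simp: Suc_le_eq\<close>)
 obtain B0 where B0: "independent B0" "zspan B0 = Ga" using lattice unfolding is_lattice_def by blast
 have lc: "linear (\<lambda>x::'e. ?c *\<^sub>R x)" by (rule linear_scale_self)
 have ic: "inj_on (\<lambda>x::'e. ?c *\<^sub>R x) A" for A using M by (auto simp: inj_on_def)
 have "independent ((\<lambda>x. ?c *\<^sub>R x) ` B0)" by (rule linear_independent_injective_image[OF lc B0(1) ic])
 then show "sublattice G" unfolding sublattice_def using zG sub zspan_image[OF lc, of B0] B0(2) by auto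
 have "st T \<subseteq> G"
 proof
  fix g assume g: "g \<in> st T"
  then have g0: "g \<in> Ga" "\<forall>h\<in>Hs. tp h ~= T --> lam h g = 0" unfolding st_eq[OF T] by blast+
  have "g = (\<Sum>l\<in>f. pj l g)" using p by (simp add: fproj_def)
  then have "g \<in> flag_group S f" unfolding g1(1) using g0(1) by (intro CollectI exI[of _ "\<lambda>_. g"]) simp
  moreover have "g = g - 0" by simp
  ultimately show "g \<in> G" unfolding mem using zmod.subspace_0[OF g2(2)] g0(2) by blast
 qed
 moreover have "G \<subseteq> span (st T)"
 proof
  fix g assume g: "g \<in> G"
  have "real (M * M') *\<^sub>R g \<in> st T" using MG[OF g] g unfolding st_eq[OF T] mem by (simp add: lam_scale)
  then have "?c *\<^sub>R (real (M * M') *\<^sub>R g) \<in> span (st T)" by (intro span_scale span_base)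
  then show "g \<in> span (st T)" using M by simp
 qed
 ultimately show "dim G = dim (st T)" by (metis dim_span dim_subset le_antisym)
qed

lemma exponent:
 assumes h: "h \<in> Hs" and "card B = dim (st (tp h))"
 shows "(real (card B) - real (dim (X_space S (tp h)))) / real (dim (X_space S (tp h))) = real (dlt h)"
 using dlt_delta[OF h] st_sub(3)[OF tp(1)[OF h]] assms(2) by (simp add: delta_def)

lemma vertex_difference:
 assumes f: "flag f" and f': "flag f'" and T: "T \<in> Q"
 defines "ah \<equiv> component S Q T (flag_vertex f') - component S Q T (flag_vertex f)"
 shows "ah \<in> range I" "h \<in> Hs ==> a h \<bullet> ah = (if tp h = T then a h \<bullet> (flag_vertex f' - flag_vertex f) else 0)"
proof -
 note c = component[OF T flag_vertex(1)[OF f]] and c' = component[OF T flag_vertex(1)[OF f']]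
 show "ah \<in> range I" unfolding ah_def using c(1) c'(1) subspace_diff[OF subspace_I] by blast
 show "h \<in> Hs ==> a h \<bullet> ah = (if tp h = T then a h \<bullet> (flag_vertex f' - flag_vertex f) else 0)"
  unfolding ah_def inner_diff_right using c(2) c'(2) by simp
qed

text \<open>An element \<open>g\<close> of the group encodes a shift of the walls of
  \<open>f\<close> and one of those of \<open>f'\<close>. The height of \<open>I g - ah\<close> over
  a wall \<open>h\<close> of \<open>f'\<close> is the height of the shifted vertex of
  \<open>f\<close> over the shifted \<open>h\<close>, to which \<open>gap\<close> applies with a
  radius proportional to \<open>eta\<close>.\<close>

lemma DS_imp_diophantine:
 assumes DS and Ni: "norm_on (internal S) Ni"
 shows "flags_diophantine S Ni Q"
 unfolding flags_diophantine_def flags_eq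
proof (intro ballI)
 fix f f' T assume "f \<in> {f. flag f}" "f' \<in> {f. flag f}" and T: "T \<in> Q"
 then have f: "flag f" and f': "flag f'" by simp_all
 obtain h0 where h0: "h0 \<in> Hs" "tp h0 = T" using tp_surj[OF T] by blast
 obtain pj M pj' M' where p: "fproj f pj M" and p': "fproj f' pj' M'" using fproj_exists[OF csr_RC] f f' by metis
 define G where "G = flag_group2_in S T f f'"
 define ah where "ah = component S Q T (flag_vertex f') - component S Q T (flag_vertex f)"
 note G = flag_group2[OF p f p' f' T, folded G_def] and ah = vertex_difference[OF f f' T, folded ah_def]
 have zG: "zsubgroup G" using G(2) by (simp add: sublattice_def)
 obtain B where B: "zbasis B G" "independent B" using sublattice_zbasis_exists[OF G(2)] by blast
 have fB: "finite B" and BG: "B \<subseteq> G" using B(1) zmod.span_superset by (auto simp: zbasis_def)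
 have z: "zbasis (I ` B) (I ` G)" using zbasis_image[OF linI zG G(3) BG] B(1) by simp
 have "card (I ` B) = dim (st (tp h0))"
  using card_image[OF inj_on_subset[OF G(3) BG]] zbasis_card[OF G(2) B(1)] G(4) h0(2) by simp
 from exponent[OF h0(1) this] have ex: "(real (card (I ` B)) - real (dim (X_space S T))) / real (dim (X_space S T)) = real (dlt h0)"
  using h0(2) by simp
 have dl: "dlt h = dlt h0" if "h \<in> Hs" "tp h = T" for h using dlt_delta[OF that(1)] dlt_delta[OF h0(1)] that(2) h0(2) by simp
 \<comment> \<open>Shifts are fixed once for the basis elements and combined linearly, so the shifts
   for \<open>g\<close> are bounded by a constant times \<open>eta\<close>.\<close>
 have "\<forall>e\<in>B. \<exists>s. (\<forall>l\<in>f. fst s l \<in> Ga) \<and> (\<forall>l\<in>f'. snd s l \<in> Ga) \<and> e = (\<Sum>l\<in>f. pj l (fst s l)) - (\<Sum>l\<in>f'. pj' l (snd s l))"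
 proof
  fix e assume "e \<in> B"
  then obtain ga ga' where "\<forall>l\<in>f. ga l \<in> Ga" "\<forall>l\<in>f'. ga' l \<in> Ga" "e = (\<Sum>l\<in>f. pj l (ga l)) - (\<Sum>l\<in>f'. pj' l (ga' l))"
   using BG G(1) by blast
  then show "\<exists>s. (\<forall>l\<in>f. fst s l \<in> Ga) \<and> (\<forall>l\<in>f'. snd s l \<in> Ga) \<and> e = (\<Sum>l\<in>f. pj l (fst s l)) - (\<Sum>l\<in>f'. pj' l (snd s l))"
   by (intro exI[of _ "(ga, ga')"]) simp
 qed
 from bchoice[OF this] obtain s where s: "\<And>e l. e \<in> B ==> l \<in> f ==> fst (s e) l \<in> Ga" "\<And>e l. e \<in> B ==> l \<in> f' ==> snd (s e) l \<in> Ga"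
  "\<And>e. e \<in> B ==> e = (\<Sum>l\<in>f. pj l (fst (s e) l)) - (\<Sum>l\<in>f'. pj' l (snd (s e) l))" by blast
 define K where "K = (\<Sum>e\<in>B. (\<Sum>l\<in>f. norm (fst (s e) l)) + (\<Sum>l\<in>f'. norm (snd (s e) l))) + 1"
 have K1: "K >= 1" unfolding K_def by (simp add: sum_nonneg add_nonneg_nonneg)
 have part: "(\<Sum>e\<in>B. norm (fst (s e) l)) <= K" if "l \<in> f" for l
 proof -
  have "(\<Sum>e\<in>B. norm (fst (s e) l)) <= (\<Sum>e\<in>B. (\<Sum>l\<in>f. norm (fst (s e) l)) + (\<Sum>l\<in>f'. norm (snd (s e) l)))"
   using member_le_sum[OF that, of "\<lambda>l. norm (fst (s _) l)"] flag_finite[OF f] by (intro sum_mono add_increasing2 sum_nonneg) auto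
  then show ?thesis by (simp add: K_def)
 qed
 have part': "(\<Sum>e\<in>B. norm (snd (s e) l)) <= K" if "l \<in> f'" for l
 proof -
  have "(\<Sum>e\<in>B. norm (snd (s e) l)) <= (\<Sum>e\<in>B. (\<Sum>l\<in>f. norm (fst (s e) l)) + (\<Sum>l\<in>f'. norm (snd (s e) l)))"
   using member_le_sum[OF that, of "\<lambda>l. norm (snd (s _) l)"] flag_finite[OF f'] by (intro sum_mono add_increasing sum_nonneg) auto
  then show ?thesis by (simp add: K_def)
 qed
 have comb: "norm (\<Sum>e\<in>B. real_of_int (m e) *\<^sub>R t e) <= K * et"
  if "\<forall>e\<in>B. \<bar>real_of_int (m e)\<bar> <= et" "(\<Sum>e\<in>B. norm (t e)) <= K" "et >= 0" for m :: "'e \<Rightarrow> int" and t :: "'e \<Rightarrow> 'e" and et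
 proof -
  have "norm (\<Sum>e\<in>B. real_of_int (m e) *\<^sub>R t e) <= (\<Sum>e\<in>B. et * norm (t e))"
   by (rule sum_norm_le) (use that(1) in \<open>auto intro: mult_right_mono\<close>)
  also have "\<dots> = et * (\<Sum>e\<in>B. norm (t e))" by (simp add: sum_distrib_left)
  also have "\<dots> <= et * K" using that(2,3) by (rule mult_left_mono)
  finally show ?thesis by (simp add: mult.commute)
 qed
 obtain c where c: "c > 0" and ds: "\<And>f h. flag f ==> h \<in> Hs ==> gap f h c"
  using DS_uniform[OF assms(1)] by blast
 obtain cN where cN: "cN > 0" "\<And>x. x \<in> range I ==> cN * norm x <= Ni x"
  using norm_on_equiv[OF subspace_I, of Ni] Ni unfolding dim_spaces(3) by blast
 define A where "A = (\<Sum>h\<in>f'. norm (a h)) + 1"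
 have A: "A > 0" unfolding A_def by (simp add: add_nonneg_pos sum_nonneg)
 have main: "cN * c / (A * K ^ dlt h0) * real_of_int (eta (I ` B) (I g)) powr (- real (dlt h0)) <= Ni (I g - ah)"
  if g: "g \<in> G" "I g ~= 0" "I g ~= ah" for g
 proof -
  have g0: "g ~= 0" using g(2) I_0 by auto
  define et where "et = real_of_int (eta (I ` B) (I g))"
  obtain m where m: "g = (\<Sum>e\<in>B. real_of_int (m e) *\<^sub>R e)" "\<forall>e\<in>B. \<bar>m e\<bar> <= eta (I ` B) (I g)" "1 <= eta (I ` B) (I g)"
   using eta_coeffs[OF linI zG G(3) BG z g(1) g0] by blast
  have et: "et >= 1" "\<forall>e\<in>B. \<bar>real_of_int (m e)\<bar> <= et" using m(2,3) unfolding et_def by (simp_all flip: of_int_abs)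
  define ga where "ga l = (\<Sum>e\<in>B. real_of_int (m e) *\<^sub>R fst (s e) l)" for l
  define ga' where "ga' l = (\<Sum>e\<in>B. real_of_int (m e) *\<^sub>R snd (s e) l)" for l
  have ga: "ga l \<in> Ga \<and> norm (ga l) <= K * et" if "l \<in> f" for l
   unfolding ga_def using comb[OF et(2) part[OF that]] et(1) s(1)[OF _ that] by (intro conjI lat_sum lat_scale) auto
  have ga': "ga' l \<in> Ga \<and> norm (ga' l) <= K * et" if "l \<in> f'" for l
   unfolding ga'_def using comb[OF et(2) part'[OF that]] et(1) s(2)[OF _ that] by (intro conjI lat_sum lat_scale) auto
  have lp: "\<And>l. l \<in> f ==> linear (pj l)" "\<And>l. l \<in> f' ==> linear (pj' l)" using p p' by (simp_all add: fproj_def)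
  have "(\<Sum>l\<in>f. pj l (ga l)) = (\<Sum>l\<in>f. \<Sum>e\<in>B. real_of_int (m e) *\<^sub>R pj l (fst (s e) l))"
   by (rule sum.cong[OF refl]) (simp add: ga_def linear_sum[OF lp(1)] linear_scale[OF lp(1)])
  then have s1: "(\<Sum>l\<in>f. pj l (ga l)) = (\<Sum>e\<in>B. real_of_int (m e) *\<^sub>R (\<Sum>l\<in>f. pj l (fst (s e) l)))"
   unfolding scaleR_right.sum by (rule trans[OF _ sum.swap])
  have "(\<Sum>l\<in>f'. pj' l (ga' l)) = (\<Sum>l\<in>f'. \<Sum>e\<in>B. real_of_int (m e) *\<^sub>R pj' l (snd (s e) l))"
   by (rule sum.cong[OF refl]) (simp add: ga'_def linear_sum[OF lp(2)] linear_scale[OF lp(2)])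
  then have s2: "(\<Sum>l\<in>f'. pj' l (ga' l)) = (\<Sum>e\<in>B. real_of_int (m e) *\<^sub>R (\<Sum>l\<in>f'. pj' l (snd (s e) l)))"
   unfolding scaleR_right.sum by (rule trans[OF _ sum.swap])
  have gs: "g = (\<Sum>l\<in>f. pj l (ga l)) - (\<Sum>l\<in>f'. pj' l (ga' l))"
   unfolding s1 s2 sum_subtractf[symmetric] scaleR_diff_right[symmetric] m(1) by (rule sum.cong) (use s(3) in auto)
  define v where "v = flag_vertex f + I (\<Sum>l\<in>f. pj l (ga l))"
  have vI: "v \<in> range I" unfolding v_def using subspace_add[OF subspace_I] flag_vertex(1)[OF f] by blast
  have av: "a l \<bullet> v = b l + lam l (ga l)" if "l \<in> f" for l
   using fproj_lam_sum[OF p f that] flag_vertex(2)[OF f that] by (simp add: v_def inner_add_right lam_def)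
  have Iga: "I g - ah \<in> range I" using ah(1) subspace_diff[OF subspace_I] by blast
  \<comment> \<open>A nonzero internal vector has nonzero height over some wall of the flag
    \<open>f'\<close>; that wall is of type \<open>T\<close>, since both terms have height 0 over
    all others.\<close>
  have "\<not> (\<forall>h\<in>f'. a h \<bullet> (I g - ah) = 0)"
   using f' g(3) Iga unfolding flag_def by (metis eq_iff_diff_eq_0)
  then obtain h where h: "h \<in> f'" "a h \<bullet> (I g - ah) ~= 0" by blast
  have hH: "h \<in> Hs" by (rule flag_Hs[OF f' h(1)])
  have hT: "tp h = T"
  proof (rule ccontr)
   assume n: "tp h ~= T"
   then have "a h \<bullet> I g = 0" using G(1) g(1) hH by (simp add: lam_def)
   then show False using h(2) ah(2)[OF hH] n by (simp add: inner_diff_right)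
  qed
  have e: "a h \<bullet> (I g - ah) = a h \<bullet> v - (b h + lam h (ga' h))"
  proof -
   have "a h \<bullet> I g = lam h (\<Sum>l\<in>f. pj l (ga l)) - lam h (ga' h)"
    using fproj_lam_sum[OF p' f' h(1)] by (simp add: gs lam_diff flip: lam_def)
   then show ?thesis using ah(2)[OF hH] hT flag_vertex(2)[OF f' h(1)] by (simp add: v_def inner_diff_right inner_add_right lam_def)
  qed
  have Ket: "K * et >= 1" using mult_mono[OF K1 et(1)] K1 by simp
  have "c / (K * et) ^ dlt h <= \<bar>a h \<bullet> v - (b h + lam h (ga' h))\<bar>"
   by (rule gapD[OF ds[OF f hH] Ket ga _ _ vI av]) (use ga'[OF h(1)] h(2) e in auto)
  also have "\<dots> <= norm (a h) * norm (I g - ah)" unfolding e[symmetric] by (rule Cauchy_Schwarz_ineq2)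
  also have "\<dots> <= A * norm (I g - ah)"
   using member_le_sum[OF h(1), of "\<lambda>h. norm (a h)"] flag_finite[OF f'] by (intro mult_right_mono) (auto simp: A_def)
  finally have "c / (K ^ dlt h0 * et ^ dlt h0) <= A * norm (I g - ah)" by (simp add: dl[OF hH hT] power_mult_distrib)
  then have "cN / A * (c / (K ^ dlt h0 * et ^ dlt h0)) <= cN / A * (A * norm (I g - ah))"
   using cN(1) A by (intro mult_left_mono) auto
  also have "\<dots> = cN * norm (I g - ah)" using A by simp
  also have "\<dots> <= Ni (I g - ah)" by (rule cN(2)[OF Iga])
  finally show ?thesis using et(1) by (simp add: et_def[symmetric] powr_minus powr_realpow divide_inverse mult_ac)
 qed
 have "cN * c / (A * K ^ dlt h0) > 0" using cN(1) c A K1 by simp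
 then show "diophantine Ni (X_space S T) (I ` flag_group2_in S T f f')
   {component S Q T (flag_vertex f') - component S Q T (flag_vertex f)}"
  unfolding diophantine_def G_def[symmetric] ah_def[symmetric]
  using z main unfolding ex[symmetric] by blast
qed

text \<open>The wall \<open>h\<close> is exchanged into the flag for some \<open>j\<close>. Sliding
  the vertex \<open>v\<close> along the dual vector \<open>u j\<close> until it meets the shifted
  \<open>h\<close> gives a vertex \<open>v'\<close> of the new flag, and \<open>v - v'\<close> lies
  in the summand of \<open>h\<close>. There it equals \<open>I g - ah\<close> for a group element of
  size \<open>O(r)\<close>, so the Diophantine bound limits how short the slide can be.\<close>

lemma diophantine_imp_DS:
 assumes D: "flags_diophantine S Ni Q" and Ni: "norm_on (internal S) Ni"
 shows DS
 unfolding DS_def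
proof (intro allI impI)
 fix f h assume f: "flag f" and h: "h \<in> Hs"
 obtain u where "dual f u" using flag_dual[OF f] by blast
 note u = dualD[OF this]
 have "\<exists>j\<in>f. a h \<bullet> u j ~= 0"
 proof (rule ccontr)
  assume "\<not> ?thesis"
  then have "a h \<bullet> (\<Sum>l\<in>f. (a l \<bullet> a h) *\<^sub>R u l) = 0" by (simp add: inner_sum_right)
  then show False using flag_expand[OF f u a_I[OF h]] a_nz[OF h] by simp
 qed
 then obtain j where j: "j \<in> f" "a h \<bullet> u j ~= 0" by blast
 define f' where "f' = insert h (f - {j})"
 note ex' = flag_exchange[OF f u h j, folded f'_def]
 have f': "flag f'" by (rule ex'(1))
 define T where "T = tp h"
 have T: "T \<in> Q" unfolding T_def by (rule tp(1)[OF h])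
 have jH: "j \<in> Hs" by (rule flag_Hs[OF f j(1)])
 have uX: "u j \<in> X_space S (tp j)" by (rule dual_type[OF f u j(1)])
 have Tj: "tp j = T" using uX j(2) h unfolding X_eq[OF tp(1)[OF jH]] T_def by auto
 obtain pj M pj' M' where p: "fproj f pj M" and p': "fproj f' pj' M'" using fproj_exists[OF csr_RC] f f' by metis
 define G where "G = flag_group2_in S T f f'"
 define ah where "ah = component S Q T (flag_vertex f') - component S Q T (flag_vertex f)"
 note G = flag_group2[OF p f p' f' T, folded G_def] and ah = vertex_difference[OF f f' T, folded ah_def]
 have zG: "zsubgroup G" using G(2) by (simp add: sublattice_def)
 have "diophantine Ni (X_space S T) (I ` G) {ah}"
  using D f f' T unfolding flags_diophantine_def flags_eq G_def ah_def by blast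
 then obtain B' c0 where B': "zbasis B' (I ` G)" and c0: "c0 > 0" and dio: "\<forall>x\<in>I ` G. x ~= 0 \<and> x ~= ah -->
   Ni (x - ah) >= c0 * real_of_int (eta B' x) powr (- ((real (card B') - real (dim (X_space S T))) / real (dim (X_space S T))))"
  unfolding diophantine_def by blast
 have "B' \<subseteq> I ` G" using B' zmod.span_superset by (auto simp: zbasis_def)
 then obtain B where B: "B \<subseteq> G" "B' = I ` B" using subset_image_iff[of B' I G] by blast
 have zB: "zbasis B G" using zbasis_image[OF linI zG G(3) B(1)] B' B(2) by simp
 have iB: "independent B" by (rule sublattice_zbasis_independent[OF G(2) zB])
 have "card B' = dim (st (tp h))"
  using card_image[OF inj_on_subset[OF G(3) B(1)]] zbasis_card[OF G(2) zB] G(4) B(2) by (simp add: T_def)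
 note ex = exponent[OF h this, folded T_def]
 obtain Ce where Ce: "Ce > 0" "\<And>g. g \<in> G ==> g ~= 0 ==> real_of_int (eta B' (I g)) <= Ce * norm g"
  using eta_le[OF linI zG G(3) B(1) _ iB] B' B(2) by auto
 obtain K where K: "K > 0" "\<And>ga r. \<forall>l\<in>f. norm (ga l) <= r ==> norm (\<Sum>l\<in>f. pj l (ga l)) <= K * r" using fproj_bound[OF p f] by blast
 obtain K' where K': "K' > 0" "\<And>ga r. \<forall>l\<in>f'. norm (ga l) <= r ==> norm (\<Sum>l\<in>f'. pj' l (ga l)) <= K' * r" using fproj_bound[OF p' f'] by blast
 obtain CN where CN: "CN > 0" "\<And>x. x \<in> range I ==> Ni x <= CN * norm x"
  using norm_on_equiv[OF subspace_I, of Ni] Ni unfolding dim_spaces(3) by blast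
 define q where "q = CN * norm (u j) / \<bar>a h \<bullet> u j\<bar>"
 have "u j ~= 0" using j(2) by auto
 then have q: "q > 0" using CN(1) j(2) by (simp add: q_def)
 define E where "E = Ce * (K + K')"
 have E: "E > 0" using Ce(1) K(1) K'(1) by (simp add: E_def)
 \<comment> \<open>The Diophantine condition excludes \<open>g = 0\<close>; in that case the slide
   is \<open>- ah\<close>, of a fixed positive length, which gives the first entry. For
   \<open>ah = 0\<close> that case cannot occur, and 1 is a dummy value.\<close>
 define c where "c = min (if ah = 0 then 1 else Ni ah / q) (c0 / (q * E ^ dlt h))"
 have Na: "Ni (- ah) = Ni ah" "ah ~= 0 ==> Ni ah > 0"
 proof -
  have "ah \<in> internal S" using ah(1) dim_spaces(3) by simp
  then have "Ni ((-1) *\<^sub>R ah) = \<bar>-1\<bar> * Ni ah" "0 <= Ni ah" "Ni ah = 0 \<longleftrightarrow> ah = 0" using Ni unfolding norm_on_def by blast+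
  then show "Ni (- ah) = Ni ah" "ah ~= 0 ==> Ni ah > 0" by auto
 qed
 have c: "c > 0" using Na(2) q c0 E by (simp add: c_def)
 have main: "c / r ^ dlt h <= \<bar>a h \<bullet> v - (b h + lam h ga')\<bar>"
  if r: "r >= 1" and ga: "\<forall>l\<in>f. ga l \<in> Ga \<and> norm (ga l) <= r" and ga': "ga' \<in> Ga" "norm ga' <= r" and v: "v \<in> range I"
   "\<forall>l\<in>f. a l \<bullet> v = b l + lam l (ga l)" and nz: "a h \<bullet> v - (b h + lam h ga') ~= 0" for r ga ga' v
 proof -
  define th where "th = a h \<bullet> v - (b h + lam h ga')"
  define t where "t = th / (a h \<bullet> u j)"
  have t: "t ~= 0" "t * (a h \<bullet> u j) = th" using nz j(2) by (simp_all add: t_def th_def)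
  define v' where "v' = v - t *\<^sub>R u j"
  have v'I: "v' \<in> range I" unfolding v'_def by (intro subspace_diff[OF subspace_I] subspace_scale[OF subspace_I] v(1) u(1) j(1))
  define ga2 where "ga2 l = (if l = h then ga' else ga l)" for l
  have ga2: "ga2 l \<in> Ga" "norm (ga2 l) <= r" if "l \<in> f'" for l using that ga ga' by (auto simp: ga2_def f'_def)
  have av': "a l \<bullet> v' = b l + lam l (ga2 l)" if l: "l \<in> f'" for l
  proof (cases "l = h")
   case True then show ?thesis using t(2) by (simp add: v'_def ga2_def inner_diff_right th_def)
  next
   case False
   then have "l \<in> f" "l ~= j" using l by (auto simp: f'_def)
   then show ?thesis using v(2) u(2)[OF j(1), of l] False by (simp add: v'_def ga2_def inner_diff_right)
  qed
  \<comment> \<open>Shifts of walls of other types are discarded. They move \<open>v\<close> and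
    \<open>v'\<close> alike, because the two flags differ only in walls of type
    \<open>T\<close>.\<close>
  define g1 where "g1 = (\<Sum>l\<in>f. pj l (if tp l = T then ga l else 0))"
  define g2 where "g2 = (\<Sum>l\<in>f'. pj' l (if tp l = T then ga2 l else 0))"
  note l1 = lam_truncate[OF p f, of _ T ga, folded g1_def] and l2 = lam_truncate[OF p' f', of _ T ga2, folded g2_def]
  have e1: "v = flag_vertex f + I (\<Sum>l\<in>f. pj l (ga l))" by (rule fproj_vertex[OF p f v(1)]) (use v(2) in blast)
  have e2: "v' = flag_vertex f' + I (\<Sum>l\<in>f'. pj' l (ga2 l))" by (rule fproj_vertex[OF p' f' v'I]) (rule av')
  define g where "g = g1 - g2"
  have gG: "g \<in> G" unfolding G(1)
  proof (intro conjI exI ballI impI)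
   show "g = (\<Sum>l\<in>f. pj l (if tp l = T then ga l else 0)) - (\<Sum>l\<in>f'. pj' l (if tp l = T then ga2 l else 0))"
    by (simp add: g_def g1_def g2_def)
  qed (use ga ga2 lat_0 l1 l2 in \<open>auto simp: g_def lam_diff\<close>)
  have vd: "v - v' = I g - ah"
  proof (rule I_ext)
   show "v - v' \<in> range I" "I g - ah \<in> range I" using v(1) v'I ah(1) subspace_diff[OF subspace_I] by blast+
   fix l assume l: "l \<in> Hs"
   show "a l \<bullet> (v - v') = a l \<bullet> (I g - ah)"
   proof (cases "tp l = T")
    case True
    then have "a l \<bullet> I g = lam l (\<Sum>l\<in>f. pj l (ga l)) - lam l (\<Sum>l\<in>f'. pj' l (ga2 l))"
     using l1[OF l] l2[OF l] by (simp add: g_def lam_diff flip: lam_def)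
    then show ?thesis using ah(2)[OF l] True unfolding e1 e2 by (simp add: inner_diff_right inner_add_right lam_def)
   next
    case False
    then have "a l \<bullet> u j = 0" using uX l unfolding X_eq[OF tp(1)[OF jH]] by (simp add: Tj)
    moreover have "a l \<bullet> I g = 0" using G(1) gG l False by (simp add: lam_def)
    ultimately show ?thesis using ah(2)[OF l] False by (simp add: v'_def inner_diff_right)
   qed
  qed
  have "I g - ah = t *\<^sub>R u j" using vd by (simp add: v'_def)
  then have Iga: "norm (I g - ah) = \<bar>t\<bar> * norm (u j)" "I g ~= ah" using t(1) \<open>u j ~= 0\<close> by auto
  have "I g - ah \<in> range I" using ah(1) subspace_diff[OF subspace_I] by blast
  then have up: "Ni (I g - ah) <= q * \<bar>th\<bar>" using CN(2)[of "I g - ah"] Iga(1) by (simp add: q_def t_def abs_divide mult_ac)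
  show ?thesis
  proof (cases "I g = 0")
   case True
   then have "ah ~= 0" "Ni ah <= q * \<bar>th\<bar>" using up Iga(2) Na(1) by auto
   then have "Ni ah / q <= \<bar>th\<bar>" "c <= Ni ah / q" using q by (simp_all add: field_simps c_def)
   moreover have "c / r ^ dlt h <= c" using c r by (simp add: divide_le_eq mult_left_mono)
   ultimately show ?thesis unfolding th_def by linarith
  next
   case False
   then have g0: "g ~= 0" using I_0 by auto
   obtain m where "1 <= eta B' (I g)" using eta_coeffs[OF linI zG G(3) B(1) _ gG g0] B' B(2) by blast
   then have et1: "real_of_int (eta B' (I g)) >= 1" by simp
   have "norm g1 <= K * r" unfolding g1_def by (rule K(2)) (use ga r in auto)
   moreover have "norm g2 <= K' * r" unfolding g2_def by (rule K'(2)) (use ga2 r in auto)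
   ultimately have "norm g <= (K + K') * r" unfolding g_def using norm_triangle_ineq4[of g1 g2] by (simp add: distrib_right)
   then have "Ce * norm g <= Ce * ((K + K') * r)" using Ce(1) by (intro mult_left_mono) auto
   then have "real_of_int (eta B' (I g)) <= E * r" using Ce(2)[OF gG g0] by (simp add: E_def mult.assoc)
   then have "real_of_int (eta B' (I g)) ^ dlt h <= (E * r) ^ dlt h" using et1 by (intro power_mono) auto
   then have "c0 / (E * r) ^ dlt h <= c0 / real_of_int (eta B' (I g)) ^ dlt h" using c0 et1 E r by (intro divide_left_mono mult_pos_pos zero_less_power) auto
   also have "\<dots> = c0 * real_of_int (eta B' (I g)) powr (- real (dlt h))" using et1 by (simp add: powr_minus powr_realpow divide_inverse)
   also have "\<dots> <= Ni (I g - ah)" using dio[unfolded ex] gG False Iga(2) by blast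
   also note up
   finally have "c0 / (E * r) ^ dlt h <= q * \<bar>th\<bar>" .
   then have "c0 / (E * r) ^ dlt h / q <= q * \<bar>th\<bar> / q" using q by (intro divide_right_mono) auto
   then have "c0 / (E * r) ^ dlt h / q <= \<bar>th\<bar>" using q by simp
   then have "c0 / (q * E ^ dlt h) / r ^ dlt h <= \<bar>th\<bar>" by (simp add: power_mult_distrib mult_ac)
   moreover have "c / r ^ dlt h <= c0 / (q * E ^ dlt h) / r ^ dlt h" using r by (intro divide_right_mono) (simp_all add: c_def)
   ultimately show ?thesis unfolding th_def by linarith
  qed
 qed
 then have "gap f h c" unfolding gap_def by blast
 then show "\<exists>c>0. gap f h c" using c by blast
qed

end

theorem theorem4p12:
  fixes S :: "('e::euclidean_space, 'l) cp_scheme"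
    and N_phys N_int :: "'e \<Rightarrow> real"
  assumes "polytopal_scheme S"
    and "norm_on (physical S) N_phys"
    and "norm_on (internal S) N_int"
  shows "(linearly_repetitive S N_phys \<longleftrightarrow> positivity_of_weights S N_phys) \<and>
    (\<forall>Q. (property_C S N_phys \<longrightarrow> CSR_decomposition S Q) \<longrightarrow>
      (positivity_of_weights S N_phys \<longleftrightarrow>
        property_C S N_phys \<and> flags_diophantine S N_int Q))"
proof -
 obtain a b w where cw: "cut_window (lattice S) (to_phys S) (to_int S) N_phys (labels S) (piece S) (hyperplanes S) a b w"
  and wall: "\<forall>H\<in>hyperplanes S. H = {x \<in> internal S. a H \<bullet> x = b H}"
  using scheme_cut_window[OF assms(1,2)] by blast
 have ws: "window_scheme S N_phys a b w"
  using cw wall assms(1) unfolding window_scheme_def window_scheme_axioms_def by blast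
 interpret window_scheme S N_phys a b w by (rule ws)
 show ?thesis unfolding linearly_repetitive_iff positivity_of_weights_iff
 proof (intro conjI allI impI)
  show "LR \<longleftrightarrow> PW" by (rule LR_iff_PW)
  fix Q assume Q: "property_C S N_phys --> CSR_decomposition S Q"
  show "PW \<longleftrightarrow> property_C S N_phys \<and> flags_diophantine S N_int Q"
  proof
   assume pw: PW
   \<comment> \<open>The decomposition is available only under property C, so C is derived before
     anything that refers to the parts.\<close>
   then have C: "property_C S N_phys" by (rule PW_imp_property_C)
   then have "csr_scheme S N_phys a b w Q" using Q ws unfolding csr_scheme_def csr_scheme_axioms_def by blast
   then show "property_C S N_phys \<and> flags_diophantine S N_int Q"
    using csr_scheme.DS_imp_diophantine[OF _ PW_imp_DS[OF pw PW_imp_RC[OF pw]] assms(3)] C by blast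
  next
   assume C: "property_C S N_phys \<and> flags_diophantine S N_int Q"
   then have csr: "csr_scheme S N_phys a b w Q" using Q ws unfolding csr_scheme_def csr_scheme_axioms_def by blast
   then have DS using csr_scheme.diophantine_imp_DS[OF csr _ assms(3)] C by blast
   then show PW using DS_imp_LR[OF csr_scheme.csr_RC[OF csr]] LR_iff_PW by blast
  qed
 qed
qed

end
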